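(* Let $d\in\mathbb N$, let $\mathbf h=(h_1,\ldots,h_d)$ satisfy $h_1,\ldots,h_d\in(1/2,1)$ and $\sum_{\ell=1}^d h_\ell>d-\tfrac12$, and let $J\in\mathbb N$. The approximation process $\{X^{(d)}_{\mathbf h,J}(t)\}_{t\in\mathbb R_+}$ at scale $J$ of the generalized Hermite process can be expressed, for all $t\in\mathbb R_+$, as $$X_{\mathbf h,J}^{(d)}(t)=2^{-J(h_1+\cdots+h_d-d)}\sum_{\mathbf k\in\mathbb Z^d}\sigma^{(\mathbf h)}_{J,\mathbf k}\int_0^t\prod_{\ell=1}^d\Phi_\Delta^{(h_\ell-1/2)}(2^Ju-k_\ell)\,du$$ (equality of random variables, i.e. almost surely), where the series is almost surely uniformly convergent in $t$ on each compact interval of $\mathbb R_+$.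
   Context: Notation: $\mathbb N=\{1,2,\ldots\}$, $\mathbb N_0=\mathbb N\cup\{0\}$, $\mathbb R_+=[0,\infty)$; $y_+^\alpha=y^\alpha$ if $y>0$ and $y_+^\alpha=0$ otherwise. Fourier transform: $\widehat f(\xi)=(2\pi)^{-1/2}\int_{\mathbb R}e^{-i\xi x}f(x)\,dx$. Wavelets: $\phi,\psi$ are the (real-valued) univariate scaling function and mother wavelet of an orthonormal Meyer wavelet basis of $L^2(\mathbb R)$. That is: $\phi,\psi$ belong to the Schwartz class $\mathcal S(\mathbb R)$; $\operatorname{supp}\widehat\phi\subseteq[-\frac{4\pi}3,\frac{4\pi}3]$, $\operatorname{supp}\widehat\psi\subseteq[-\frac{8\pi}3,\frac{8\pi}3]\setminus(-\frac{2\pi}3,\frac{2\pi}3)$; denoting by $V_j^1$ the closed linear span of $\{\phi(2^j\cdot-k):k\in\mathbb Z\}$, $(V_j^1)_{j\in\mathbb Z}$ is a multiresolution analysis of $L^2(\mathbb R)$ (increasing, with intersection $\{0\}$ and dense union) and $\{\phi(\cdot-k)\}_{k\in\mathbb Z}$ is an orthonormal basis of $V_0^1$; $\{2^{j/2}\psi(2^j\cdot-k)\}_{k\in\mathbb Z}$ is an orthonormal basis of the orthogonal complement of $V_j^1$ in $V_{j+1}^1$. For $d\ge1$, $V_J^d=(V_J^1)^{\otimes d}\subset L^2(\mathbb R^d)$, with orthonormal basis $\{2^{Jd/2}\prod_{\ell=1}^d\phi(2^Jx_\ell-k_\ell):\mathbf k\in\mathbb Z^d\}$. Fractional scaling function: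 for $\delta\in\mathbb R$, $\Phi_\Delta^{(\delta)}\in\mathcal S(\mathbb R)$ is defined by $\widehat{\Phi}_\Delta^{(\delta)}(\xi)=\left(\frac{1-e^{-i\xi}}{i\xi}\right)^\delta\widehat\phi(\xi)$ for $\xi\ne0$ (extended by continuity at $0$; principal determination of the power). Processes: $\{B(x)\}_{x\in\mathbb R}$ is a standard Brownian motion and $\int_{\mathbb R^d}'$ denotes the $d$-fold multiple Wiener integral with respect to $B$ (diagonals excluded). The kernel is $$K^{(d)}_{\mathbf h}(t,x_1,\ldots,x_d)=\frac1{\prod_{\ell=1}^d\Gamma(h_\ell-1/2)}\int_0^t\prod_{\ell=1}^d(s-x_\ell)_+^{h_\ell-3/2}\,ds.$$ The generalized Hermite process is $X^{(d)}_{\mathbf h}(t)=\int_{\mathbb R^d}'K^{(d)}_{\mathbf h}(t,x_1,\ldots,x_d)\,dB(x_1)\cdots dB(x_d)$, $t\in\mathbb R_+$. For $J\in\mathbb N$, $K^{(d)}_{\mathbf h,J}(t,\cdot)$ is the orthogonal projection of $K^{(d)}_{\mathbf h}(t,\cdot)$ onto $V_J^d$ in $L^2(\mathbb R^d)$ and the approximation process at scale $J$ is $X^{(d)}_{\mathbf h,J}(t)=\int_{\mathbb R^d}'K^{(d)}_{\mathbf h,J}(t,x_1,\ldots,x_d)\,dB(x_1)\cdots dB(x_d)$. Generalized FARIMA sequence: for $\delta\in(-1/2,1/2)$, $\gamma_0^{(\delta)}=1$ and $\gamma_p^{(\delta)}=\frac{\delta\,\Gamma(p+\delta)}{\Gamma(p+1)\Gamma(\delta+1)}$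 for $p\ge1$. For $\mathbf k\in\mathbb Z^d$, $\mu_{J,\mathbf k}=2^{Jd/2}\int_{\mathbb R^d}'\phi(2^Jx_1-k_1)\cdots\phi(2^Jx_d-k_d)\,dB(x_1)\cdots dB(x_d)$ and $$\sigma^{(\mathbf h)}_{J,\mathbf k}=\sum_{\mathbf p\in\mathbb N_0^d}\Big(\prod_{\ell=1}^d\gamma_{p_\ell}^{(h_\ell-1/2)}\Big)\mu_{J,\mathbf k-\mathbf p},$$ the series being convergent almost surely and in $L^2(\Omega)$ (limit of the sums over $\mathbf p\in\{0,\ldots,n\}^d$ as $n\to\infty$). *)

theory Defs
  imports "HOL-Probability.Probability"
begin

section \<open>Real \<open>L\<^sup>2\<close> spaces\<close>

text \<open>
  Elements of \<open>L\<^sup>2\<close> are represented by functions, so all subspaces below are closed under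
  almost-everywhere equality, and statements such as ``intersection \<open>{0}\<close>'' are read almost everywhere.
\<close>

definition L2 :: "'a measure \<Rightarrow> ('a \<Rightarrow> real) set" where
  "L2 N = {f \<in> borel_measurable N. integrable N (\<lambda>x. (f x)\<^sup>2)}"

definition L2_inner :: "'a measure \<Rightarrow> ('a \<Rightarrow> real) \<Rightarrow> ('a \<Rightarrow> real) \<Rightarrow> real" where
  "L2_inner N f g = (LINT x|N. f x * g x)"

definition L2_dist :: "'a measure \<Rightarrow> ('a \<Rightarrow> real) \<Rightarrow> ('a \<Rightarrow> real) \<Rightarrow> real" where
  "L2_dist N f g = sqrt (LINT x|N. (f x - g x)\<^sup>2)"

definition fun_span :: "('a \<Rightarrow> real) set \<Rightarrow> ('a \<Rightarrow> real) set" where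
  "fun_span S = {\<lambda>x. \<Sum>s\<in>F. c s * s x | F c. finite F \<and> F \<subseteq> S}"

definition L2_closed_span :: "'a measure \<Rightarrow> ('a \<Rightarrow> real) set \<Rightarrow> ('a \<Rightarrow> real) set" where
  "L2_closed_span N S = {f \<in> L2 N. \<forall>\<epsilon>>0. \<exists>g \<in> fun_span S. L2_dist N f g < \<epsilon>}"

definition L2_orthonormal_basis ::
    "'a measure \<Rightarrow> ('i \<Rightarrow> 'a \<Rightarrow> real) \<Rightarrow> ('a \<Rightarrow> real) set \<Rightarrow> bool" where
  "L2_orthonormal_basis N e V \<longleftrightarrow>
     (\<forall>i. e i \<in> L2 N) \<and>
     (\<forall>i j. L2_inner N (e i) (e j) = (if i = j then 1 else 0)) \<and>
     L2_closed_span N (range e) = V"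

text \<open>A representative of the orthogonal projection of \<open>f\<close> onto the closed subspace \<open>V\<close>.\<close>

definition L2_projection :: "'a measure \<Rightarrow> ('a \<Rightarrow> real) set \<Rightarrow> ('a \<Rightarrow> real) \<Rightarrow> 'a \<Rightarrow> real" where
  "L2_projection N V f = (SOME g. g \<in> V \<and> (\<forall>v\<in>V. L2_inner N (\<lambda>x. f x - g x) v = 0))"


section \<open>Schwartz class and Fourier transform\<close>

definition schwartz :: "(real \<Rightarrow> 'a::real_normed_vector) \<Rightarrow> bool" where
  "schwartz f \<longleftrightarrow>
     (\<exists>D :: nat \<Rightarrow> real \<Rightarrow> 'a.
        D 0 = f \<and>
        (\<forall>n x. (D n has_vector_derivative D (Suc n) x) (at x)) \<and>
        (\<forall>m n. bounded (range (\<lambda>x. x ^ m *\<^sub>R D n x))))"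

definition fourier :: "(real \<Rightarrow> complex) \<Rightarrow> real \<Rightarrow> complex" where
  "fourier f \<xi> = (CLINT x|lborel. exp (- (\<i> * of_real \<xi> * of_real x)) * f x) / of_real (sqrt (2 * pi))"


section \<open>Meyer wavelets\<close>

definition V1 :: "(real \<Rightarrow> real) \<Rightarrow> int \<Rightarrow> (real \<Rightarrow> real) set" where
  "V1 \<phi> j = L2_closed_span lborel {\<lambda>x. \<phi> (2 powi j * x - of_int k) | k. True}"

definition meyer_wavelet :: "(real \<Rightarrow> real) \<Rightarrow> (real \<Rightarrow> real) \<Rightarrow> bool" where
  "meyer_wavelet \<phi> \<psi> \<longleftrightarrow>
     schwartz \<phi> \<and> schwartz \<psi> \<and>
     closure {\<xi>. fourier (\<lambda>x. of_real (\<phi> x)) \<xi> \<noteq> 0} \<subseteq> {- (4 * pi / 3) .. 4 * pi / 3} \<and>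
     closure {\<xi>. fourier (\<lambda>x. of_real (\<psi> x)) \<xi> \<noteq> 0} \<subseteq>
       {- (8 * pi / 3) .. 8 * pi / 3} - {- (2 * pi / 3) <..< 2 * pi / 3} \<and>
     (\<forall>j. V1 \<phi> j \<subseteq> V1 \<phi> (j + 1)) \<and>
     (\<forall>f. (\<forall>j. f \<in> V1 \<phi> j) \<longrightarrow> (AE x in lborel. f x = 0)) \<and>
     (\<forall>f \<in> L2 lborel. \<forall>\<epsilon>>0. \<exists>j. \<exists>g \<in> V1 \<phi> j. L2_dist lborel f g < \<epsilon>) \<and>
     L2_orthonormal_basis lborel (\<lambda>(k::int) x. \<phi> (x - of_int k)) (V1 \<phi> 0) \<and>
     (\<forall>j::int. L2_orthonormal_basis lborel
        (\<lambda>(k::int) x. 2 powr (of_int j / 2) * \<psi> (2 powi j * x - of_int k))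
        {f \<in> V1 \<phi> (j + 1). \<forall>g \<in> V1 \<phi> j. L2_inner lborel f g = 0})"

text \<open>The \<open>d\<close>-fold Hilbert space tensor power of \<open>V1 \<phi> j\<close>, inside \<open>L\<^sup>2(\<real>\<^sup>d)\<close>, where \<open>d = CARD('d)\<close>.\<close>

definition Vd :: "(real \<Rightarrow> real) \<Rightarrow> int \<Rightarrow> (real ^ 'd \<Rightarrow> real) set" where
  "Vd \<phi> j = L2_closed_span lborel
     {\<lambda>x. \<Prod>l\<in>UNIV. f l (x $ l) | f. \<forall>l::'d. f l \<in> V1 \<phi> j}"

text \<open>
  Since the Fourier transform of a Schwartz function is continuous and injective, prescribing it
  away from \<open>0\<close> determines the function. The complex \<open>powr\<close> is the principal determination.
\<close>

definition frac_scaling :: "(real \<Rightarrow> real) \<Rightarrow> real \<Rightarrow> real \<Rightarrow> complex" where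
  "frac_scaling \<phi> \<delta> = (THE \<Phi>. schwartz \<Phi> \<and>
     (\<forall>\<xi>. \<xi> \<noteq> 0 \<longrightarrow>
        fourier \<Phi> \<xi> =
          ((1 - exp (- (\<i> * of_real \<xi>))) / (\<i> * of_real \<xi>)) powr of_real \<delta>
            * fourier (\<lambda>x. of_real (\<phi> x)) \<xi>))"


section \<open>Brownian motion and multiple Wiener integrals\<close>

definition standard_brownian_motion :: "'w measure \<Rightarrow> (real \<Rightarrow> 'w \<Rightarrow> real) \<Rightarrow> bool" where
  "standard_brownian_motion M B \<longleftrightarrow>
     prob_space M \<and>
     (\<forall>x. B x \<in> borel_measurable M) \<and>
     (AE \<omega> in M. B 0 \<omega> = 0) \<and>
     (\<forall>(n::nat) t. strict_mono_on {..n} t \<longrightarrow>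
        prob_space.indep_vars M (\<lambda>_. borel) (\<lambda>i \<omega>. B (t (Suc i)) \<omega> - B (t i) \<omega>) {..<n}) \<and>
     (\<forall>x y. x < y \<longrightarrow>
        distributed M lborel (\<lambda>\<omega>. B y \<omega> - B x \<omega>) (normal_density 0 (sqrt (y - x)))) \<and>
     (AE \<omega> in M. continuous_on UNIV (\<lambda>x. B x \<omega>))"

definition off_diagonal :: "nat \<Rightarrow> ('d \<Rightarrow> nat) set" where
  "off_diagonal n = {i. inj i \<and> range i \<subseteq> {..<n}}"

definition step_kernel ::
    "nat \<Rightarrow> (nat \<Rightarrow> real) \<Rightarrow> (('d::finite \<Rightarrow> nat) \<Rightarrow> real) \<Rightarrow> real ^ 'd \<Rightarrow> real" where
  "step_kernel n t a x =
     (\<Sum>i\<in>off_diagonal n. a i * (\<Prod>l\<in>UNIV. indicator {t (i l) <.. t (Suc (i l))} (x $ l)))"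

definition step_integral ::
    "(real \<Rightarrow> 'w \<Rightarrow> real) \<Rightarrow> nat \<Rightarrow> (nat \<Rightarrow> real) \<Rightarrow> (('d::finite \<Rightarrow> nat) \<Rightarrow> real) \<Rightarrow> 'w \<Rightarrow> real" where
  "step_integral B n t a \<omega> =
     (\<Sum>i\<in>off_diagonal n. a i * (\<Prod>l\<in>UNIV. B (t (Suc (i l))) \<omega> - B (t (i l)) \<omega>))"

text \<open>
  The multiple Wiener integral is the continuous extension to \<open>L\<^sup>2(\<real>\<^sup>d)\<close> of the map taking a step
  kernel vanishing on the diagonals to its elementary integral: its graph is the closure
  of the graph of that map. For \<open>f\<close> in \<open>L\<^sup>2\<close> this determines the value up to
  almost sure equality; \<^term>\<open>wiener_integral\<close> below is a version of it.
\<close>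

definition is_wiener_integral ::
    "'w measure \<Rightarrow> (real \<Rightarrow> 'w \<Rightarrow> real) \<Rightarrow> (real ^ 'd \<Rightarrow> real) \<Rightarrow> ('w \<Rightarrow> real) \<Rightarrow> bool" where
  "is_wiener_integral M B f X \<longleftrightarrow>
     f \<in> L2 lborel \<and> X \<in> L2 M \<and>
     (\<forall>\<epsilon>>0. \<exists>n t a. strict_mono_on {..n} t \<and>
        L2_dist lborel f (step_kernel n t a) < \<epsilon> \<and>
        L2_dist M X (step_integral B n t a) < \<epsilon>)"

definition wiener_integral ::
    "'w measure \<Rightarrow> (real \<Rightarrow> 'w \<Rightarrow> real) \<Rightarrow> (real ^ 'd \<Rightarrow> real) \<Rightarrow> 'w \<Rightarrow> real" where
  "wiener_integral M B f = (SOME X. is_wiener_integral M B f X)"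


section \<open>The generalized Hermite process and its approximation\<close>

definition pos_power :: "real \<Rightarrow> real \<Rightarrow> real" where
  "pos_power y \<alpha> = (if y > 0 then y powr \<alpha> else 0)"

definition hermite_kernel :: "real ^ 'd \<Rightarrow> real \<Rightarrow> real ^ 'd \<Rightarrow> real" where
  "hermite_kernel h t x =
     1 / (\<Prod>l\<in>UNIV. Gamma (h $ l - 1/2)) *
     (LINT s:{0..t}|lborel. \<Prod>l\<in>UNIV. pos_power (s - x $ l) (h $ l - 3/2))"

definition hermite_process ::
    "'w measure \<Rightarrow> (real \<Rightarrow> 'w \<Rightarrow> real) \<Rightarrow> real ^ 'd \<Rightarrow> real \<Rightarrow> 'w \<Rightarrow> real" where
  "hermite_process M B h t = wiener_integral M B (hermite_kernel h t)"

definition hermite_approx_process ::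
    "'w measure \<Rightarrow> (real \<Rightarrow> 'w \<Rightarrow> real) \<Rightarrow> (real \<Rightarrow> real) \<Rightarrow> real ^ 'd \<Rightarrow> nat \<Rightarrow> real \<Rightarrow> 'w \<Rightarrow> real" where
  "hermite_approx_process M B \<phi> h J t =
     wiener_integral M B (L2_projection lborel (Vd \<phi> (int J)) (hermite_kernel h t))"


section \<open>Generalized FARIMA sequence\<close>

definition farima_coeff :: "real \<Rightarrow> nat \<Rightarrow> real" where
  "farima_coeff \<delta> p =
     (if p = 0 then 1 else \<delta> * Gamma (real p + \<delta>) / (Gamma (real p + 1) * Gamma (\<delta> + 1)))"

definition wiener_coeff ::
    "'w measure \<Rightarrow> (real \<Rightarrow> 'w \<Rightarrow> real) \<Rightarrow> (real \<Rightarrow> real) \<Rightarrow> nat \<Rightarrow> int ^ 'd \<Rightarrow> 'w \<Rightarrow> real" where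
  "wiener_coeff M B \<phi> J k \<omega> =
     2 powr (real J * real CARD('d) / 2) *
     wiener_integral M B (\<lambda>x. \<Prod>l\<in>UNIV. \<phi> (2 ^ J * x $ l - of_int (k $ l))) \<omega>"

text \<open>
  The series over \<open>\<nat>\<^sub>0\<^sup>d\<close> is the limit of its sums over the cubes \<open>{0..n}\<^sup>d\<close>. It is taken pointwise
  in \<open>\<omega>\<close>, hence is the almost sure limit; on the null set of divergence its value is irrelevant.
\<close>

definition farima ::
    "'w measure \<Rightarrow> (real \<Rightarrow> 'w \<Rightarrow> real) \<Rightarrow> (real \<Rightarrow> real) \<Rightarrow> real ^ 'd \<Rightarrow> nat \<Rightarrow> int ^ 'd \<Rightarrow> 'w \<Rightarrow> real" where
  "farima M B \<phi> h J k \<omega> =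
     lim (\<lambda>n::nat. \<Sum>p \<in> {p :: nat ^ 'd. \<forall>l. p $ l \<le> n}.
       (\<Prod>l\<in>UNIV. farima_coeff (h $ l - 1/2) (p $ l)) *
       wiener_coeff M B \<phi> J (\<chi> l. k $ l - int (p $ l)) \<omega>)"

end

theory Submission imports Defs "HOL-Complex_Analysis.Conformal_Mappings"
begin

text \<open>
The approximation process is the multiple Wiener integral of the projection of the Hermite kernel
  onto \<open>Vd\<close>. The Wiener integral is linear and continuous from \<open>L\<^sup>2(\<real>\<^sup>d)\<close> to \<open>L\<^sup>2\<close> of the probability space
  (\<open>is_wiener_integral_norm_le\<close>, \<open>is_wiener_integral_limit\<close>), so the theorem reduces to an expansion of that
  projection and to the almost sure behaviour of two series.

  The coefficients of the kernel in the orthonormal basis of dilated and translated products of \<open>\<phi>\<close> are, by Fubini's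
  theorem, integrals over time of products of fractional integrals of \<open>\<phi>\<close>. The key identity
  (\<open>fractional_integral_identity\<close>) expresses the fractional integral of order \<open>\<delta>\<close> of \<open>\<phi>\<close> as the sum of the translates
  \<open>\<Phi>(y - p)\<close> of the fractional scaling function with the FARIMA coefficients \<open>\<gamma> p\<close>. On the Fourier side
  it reads \<open>(\<i>\<xi>) powr (- \<delta>) = (1 - exp (- \<i>\<xi>)) powr (- \<delta>) * ((1 - exp (- \<i>\<xi>)) / \<i>\<xi>) powr \<delta>\<close>: the first factor
  on the right is the binomial series with coefficients \<open>\<gamma> p\<close>, the second is the multiplier that defines \<open>\<Phi>\<close>. The
  fractional kernel is not integrable at infinity and the binomial series is not absolutely convergent on the unit circle, so
  both sides are damped by \<open>exp (- eu)\<close> and \<open>e\<close> tends to \<open>0\<close>. The spectrum of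
  \<open>\<phi>\<close> stays within \<open>4\<pi>/3 < 2\<pi>\<close>, away from the zeros of the multiplier; hence \<open>\<Phi>\<close> is a Schwartz function and
  the powers have no singularity but the integrable one at \<open>0\<close>.

  So the coefficient at the basis function with index \<open>k\<close> is a convolution of the products of the \<open>\<gamma> p\<close> with the time integrals
  of the products of fractional scaling functions (\<open>hermite_kernel_coeff\<close>). Collecting the terms that belong to one
  time integral, with index \<open>m\<close>, leaves the combination of the basis functions with indices \<open>m - p\<close> that defines the FARIMA variable
  \<open>\<sigma> m\<close>. The projection is thus the sum over \<open>m\<close> of the time integrals times the kernels of the \<open>\<sigma> m\<close>
  (\<open>kernel_expansion\<close>).

  The variables \<open>\<sigma> m\<close> are defined by almost sure limits over cubes. The squared coefficients are summable because
  \<open>\<delta> < 1/2\<close>, and their sums over dyadic blocks decay geometrically, so dyadic chaining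
  (\<open>rademacher_menshov_dyadic\<close>) gives almost sure convergence, to the same limit as in \<open>L\<^sup>2\<close>
  (\<open>farima_wiener\<close>). Finally the time integrals are bounded, uniformly for bounded times, by a summable weight on the lattice,
  and the \<open>\<sigma> m\<close> have bounded first absolute moments. Almost surely the weighted sum of the \<open>\<bar>\<sigma> m\<bar>\<close> is finite
  (\<open>weighted_summable_AE\<close>), and the M-test gives uniform convergence.
\<close>

section \<open>The space of square integrable functions\<close>

definition L2_norm :: "'a measure \<Rightarrow> ('a \<Rightarrow> real) \<Rightarrow> real" where
  "L2_norm N f = sqrt (LINT x|N. (f x)\<^sup>2)"

lemma L2_dist_norm: "L2_dist N f g = L2_norm N (\<lambda>x. f x - g x)"
  by (simp add: L2_dist_def L2_norm_def)

lemma L2_norm_nonneg [simp]: "0 \<le> L2_norm N f"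
  by (simp add: L2_norm_def)

lemma L2_norm_sq: "(L2_norm N f)\<^sup>2 = (LINT x|N. (f x)\<^sup>2)"
  by (simp add: L2_norm_def)

lemma L2_dist_nonneg [simp]: "0 \<le> L2_dist N f g"
  by (simp add: L2_dist_norm)

lemma L2_measurable: "f \<in> L2 N \<Longrightarrow> f \<in> borel_measurable N"
  by (simp add: L2_def)

lemma L2_square_integrable: "f \<in> L2 N \<Longrightarrow> integrable N (\<lambda>x. (f x)\<^sup>2)"
  by (simp add: L2_def)

lemma L2_mult_integrable:
  assumes "f \<in> L2 N" "g \<in> L2 N"
  shows "integrable N (\<lambda>x. f x * g x)"
proof (rule Bochner_Integration.integrable_bound)
  show "integrable N (\<lambda>x. (f x)\<^sup>2 + (g x)\<^sup>2)"
    using assms by (simp add: L2_def)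
  show "(\<lambda>x. f x * g x) \<in> borel_measurable N"
    using assms[THEN L2_measurable] by simp
  show "AE x in N. norm (f x * g x) \<le> norm ((f x)\<^sup>2 + (g x)\<^sup>2)"
  proof (rule AE_I2)
    fix x
    define a where "a = \<bar>f x\<bar> * \<bar>g x\<bar>"
    have "0 \<le> a" "2 * a \<le> (f x)\<^sup>2 + (g x)\<^sup>2"
      using sum_squares_bound[of "\<bar>f x\<bar>" "\<bar>g x\<bar>"] by (simp_all add: a_def mult.assoc)
    then have "a \<le> (f x)\<^sup>2 + (g x)\<^sup>2" by linarith
    then show "norm (f x * g x) \<le> norm ((f x)\<^sup>2 + (g x)\<^sup>2)"
      by (simp add: abs_mult a_def)
  qed
qed

lemma L2_scale: "f \<in> L2 N \<Longrightarrow> (\<lambda>x. c * f x) \<in> L2 N"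
  by (auto simp: L2_def power_mult_distrib)

lemma L2_add:
  assumes "f \<in> L2 N" "g \<in> L2 N"
  shows "(\<lambda>x. f x + g x) \<in> L2 N"
  using assms L2_mult_integrable[OF assms] 
  by (auto simp: L2_def power2_sum mult.assoc)

lemma L2_diff:
  assumes "f \<in> L2 N" "g \<in> L2 N"
  shows "(\<lambda>x. f x - g x) \<in> L2 N"
  using L2_add[OF assms(1) L2_scale[OF assms(2), of "-1"]] by simp

lemma L2_zero: "(\<lambda>x. 0) \<in> L2 N"
  by (simp add: L2_def)

lemma L2_sum: "(\<And>i. i \<in> I \<Longrightarrow> f i \<in> L2 N) \<Longrightarrow> (\<lambda>x. \<Sum>i\<in>I. f i x) \<in> L2 N"
  by (induction I rule: infinite_finite_induct) (auto simp: L2_zero intro!: L2_add)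

lemma L2_lincomb: "(\<And>i. i \<in> I \<Longrightarrow> f i \<in> L2 N) \<Longrightarrow> (\<lambda>x. \<Sum>i\<in>I. c i * f i x) \<in> L2 N"
  by (intro L2_sum L2_scale)

lemma L2_norm_scale: "L2_norm N (\<lambda>x. c * f x) = \<bar>c\<bar> * L2_norm N f"
  by (simp add: L2_norm_def power_mult_distrib real_sqrt_mult)

lemma L2_dist_commute: "L2_dist N f g = L2_dist N g f"
  by (simp add: L2_dist_def power2_commute)

lemma L2_norm_zero_iff:
  assumes "f \<in> L2 N"
  shows "L2_norm N f = 0 \<longleftrightarrow> (AE x in N. f x = 0)"
  using integral_nonneg_eq_0_iff_AE[OF L2_square_integrable[OF assms]]
  by (simp add: L2_norm_def)

lemma L2_inner_CS:
  assumes f: "f \<in> L2 N" and g: "g \<in> L2 N"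
  shows "\<bar>L2_inner N f g\<bar> \<le> L2_norm N f * L2_norm N g"
proof -
  define A B C where "A = (LINT x|N. (f x)\<^sup>2)" and "B = (LINT x|N. (g x)\<^sup>2)"
    and "C = (LINT x|N. f x * g x)"
  have AB: "A \<ge> 0" "B \<ge> 0" by (simp_all add: A_def B_def)
  have "C\<^sup>2 \<le> A * B"
  proof (cases "B = 0")
    case True
    then have "AE x in N. g x = 0"
      using L2_norm_zero_iff[OF g] by (simp add: L2_norm_def B_def)
    then have "C = (LINT x|N. 0)"
      unfolding C_def using f[THEN L2_measurable] g[THEN L2_measurable]
      by (intro integral_cong_AE) auto
    then show ?thesis using True by simp
  next
    case False
    have "0 \<le> (LINT x|N. (B * f x - C * g x)\<^sup>2)" by simp
    also have "(\<lambda>x. (B * f x - C * g x)\<^sup>2) =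
        (\<lambda>x. B\<^sup>2 * (f x)\<^sup>2 + C\<^sup>2 * (g x)\<^sup>2 - 2 * B * C * (f x * g x))"
      by (simp add: power2_diff power_mult_distrib algebra_simps)
    also have "(LINT x|N. B\<^sup>2 * (f x)\<^sup>2 + C\<^sup>2 * (g x)\<^sup>2 - 2 * B * C * (f x * g x)) =
        B\<^sup>2 * A + C\<^sup>2 * B - 2 * B * C * C"
      using f g L2_mult_integrable[OF f g] by (simp add: L2_def A_def B_def C_def)
    also have "\<dots> = B * (A * B - C\<^sup>2)" by (simp add: power2_eq_square algebra_simps)
    finally show ?thesis using False AB by (simp add: zero_le_mult_iff)
  qed
  then have "sqrt (C\<^sup>2) \<le> sqrt (A * B)" by (rule real_sqrt_le_mono)
  then show ?thesis
    by (simp add: real_sqrt_mult L2_inner_def L2_norm_def A_def B_def C_def)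
qed

lemma L2_norm_add_sq:
  assumes f: "f \<in> L2 N" and g: "g \<in> L2 N"
  shows "(L2_norm N (\<lambda>x. f x + g x))\<^sup>2 = (L2_norm N f)\<^sup>2 + 2 * L2_inner N f g + (L2_norm N g)\<^sup>2"
  using f g L2_mult_integrable[OF f g]
  by (simp add: L2_norm_sq L2_inner_def power2_sum mult.assoc L2_def)

lemma L2_norm_triangle:
  assumes f: "f \<in> L2 N" and g: "g \<in> L2 N"
  shows "L2_norm N (\<lambda>x. f x + g x) \<le> L2_norm N f + L2_norm N g"
proof (rule power2_le_imp_le)
  show "(L2_norm N (\<lambda>x. f x + g x))\<^sup>2 \<le> (L2_norm N f + L2_norm N g)\<^sup>2"
    using L2_inner_CS[OF f g] unfolding L2_norm_add_sq[OF f g] power2_sum by simp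
qed simp

lemma L2_dist_triangle:
  assumes f: "f \<in> L2 N" and g: "g \<in> L2 N" and h: "h \<in> L2 N"
  shows "L2_dist N f h \<le> L2_dist N f g + L2_dist N g h"
  using L2_norm_triangle[OF L2_diff[OF f g] L2_diff[OF g h]] by (simp add: L2_dist_norm)

lemma L2_norm_sum_le:
  assumes "\<And>i. i \<in> I \<Longrightarrow> f i \<in> L2 N"
  shows "L2_norm N (\<lambda>x. \<Sum>i\<in>I. f i x) \<le> (\<Sum>i\<in>I. L2_norm N (f i))"
  using assms
proof (induction I rule: infinite_finite_induct)
  case (insert i I)
  have "L2_norm N (\<lambda>x. f i x + (\<Sum>i\<in>I. f i x)) \<le> L2_norm N (f i) + L2_norm N (\<lambda>x. \<Sum>i\<in>I. f i x)"
    using insert by (intro L2_norm_triangle L2_sum) auto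
  then show ?case using insert by auto
qed (auto simp: L2_norm_def)

lemma L2_norm_cong_AE:
  assumes "AE x in N. f x = g x" "f \<in> borel_measurable N" "g \<in> borel_measurable N"
  shows "L2_norm N f = L2_norm N g"
  unfolding L2_norm_def using assms by (intro arg_cong[of _ _ sqrt] integral_cong_AE) auto

lemma L2_inner_commute: "L2_inner N f g = L2_inner N g f"
  by (simp add: L2_inner_def mult.commute)

lemma L2_inner_scale_right: "L2_inner N r (\<lambda>x. c * f x) = c * L2_inner N r f"
proof -
  have "(\<lambda>x. r x * (c * f x)) = (\<lambda>x. c * (r x * f x))" by (simp add: fun_eq_iff)
  then show ?thesis by (simp add: L2_inner_def)
qed

lemma L2_inner_diff_left:
  assumes "f \<in> L2 N" "g \<in> L2 N" "v \<in> L2 N"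
  shows "L2_inner N (\<lambda>x. f x - g x) v = L2_inner N f v - L2_inner N g v"
  using assms by (simp add: L2_inner_def left_diff_distrib L2_mult_integrable)

lemma L2_inner_sum_left:
  assumes "\<And>i. i \<in> I \<Longrightarrow> f i \<in> L2 N" "v \<in> L2 N"
  shows "L2_inner N (\<lambda>x. \<Sum>i\<in>I. c i * f i x) v = (\<Sum>i\<in>I. c i * L2_inner N (f i) v)"
  using assms by (simp add: L2_inner_def sum_distrib_right mult.assoc L2_mult_integrable)

lemma L2_inner_tendsto:
  assumes "\<And>n. f n \<in> L2 N" "g \<in> L2 N" "v \<in> L2 N"
    and lim: "(\<lambda>n. L2_dist N (f n) g) \<longlonglongrightarrow> 0"
  shows "(\<lambda>n. L2_inner N (f n) v) \<longlonglongrightarrow> L2_inner N g v"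
proof (rule LIM_zero_cancel, rule Lim_null_comparison)
  show "\<forall>\<^sub>F n in sequentially. norm (L2_inner N (f n) v - L2_inner N g v) \<le>
      L2_dist N (f n) g * L2_norm N v"
    using assms(1-3) L2_inner_CS[OF L2_diff[OF assms(1,2)] assms(3)]
    by (auto simp: L2_inner_diff_left L2_dist_norm)
  show "(\<lambda>n. L2_dist N (f n) g * L2_norm N v) \<longlonglongrightarrow> 0"
    using tendsto_mult_left_zero[OF lim] by simp
qed

lemma L2_norm_tendsto:
  assumes "\<And>n. f n \<in> L2 N" "g \<in> L2 N"
    and lim: "(\<lambda>n. L2_dist N (f n) g) \<longlonglongrightarrow> 0"
  shows "(\<lambda>n. L2_norm N (f n)) \<longlonglongrightarrow> L2_norm N g"
proof (rule LIM_zero_cancel, rule Lim_null_comparison[OF _ lim], rule always_eventually, rule allI)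
  fix n
  have "L2_norm N (f n) \<le> L2_dist N (f n) g + L2_norm N g"
    using L2_norm_triangle[OF L2_diff[OF assms(1,2)] assms(2), of n] by (simp add: L2_dist_norm)
  moreover have "L2_norm N g \<le> L2_dist N (f n) g + L2_norm N (f n)"
    using L2_norm_triangle[OF L2_diff[OF assms(2,1)] assms(1), of n n]
    by (simp add: L2_dist_norm[symmetric] L2_dist_commute)
  ultimately show "norm (L2_norm N (f n) - L2_norm N g) \<le> L2_dist N (f n) g" by simp
qed

lemma L2_tendsto_AE_subseq:
  assumes "\<And>n. f n \<in> L2 N" "g \<in> L2 N"
    and lim: "(\<lambda>n. L2_dist N (f n) g) \<longlonglongrightarrow> 0"
  shows "\<exists>r::nat\<Rightarrow>nat. strict_mono r \<and> (AE x in N. (\<lambda>n. f (r n) x) \<longlonglongrightarrow> g x)"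
proof -
  have "(\<lambda>n. LINT x|N. norm ((f n x - g x)\<^sup>2)) \<longlonglongrightarrow> 0"
    using tendsto_power[OF lim, of 2] by (simp add: L2_dist_norm L2_norm_sq)
  then obtain r :: "nat \<Rightarrow> nat" where r: "strict_mono r" "AE x in N. (\<lambda>n. (f (r n) x - g x)\<^sup>2) \<longlonglongrightarrow> 0"
    using tendsto_L1_AE_subseq[of N "\<lambda>n x. (f n x - g x)\<^sup>2"] L2_square_integrable[OF L2_diff[OF assms(1,2)]]
    by blast
  have "(\<lambda>n. f (r n) x) \<longlonglongrightarrow> g x" if "(\<lambda>n. (f (r n) x - g x)\<^sup>2) \<longlonglongrightarrow> 0" for x
  proof -
    have "(\<lambda>n. sqrt ((f (r n) x - g x)\<^sup>2)) \<longlonglongrightarrow> 0"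
      using tendsto_real_sqrt[OF that] by simp
    then show ?thesis by (simp add: tendsto_rabs_zero_iff LIM_zero_iff)
  qed
  with r show ?thesis by (intro exI[of _ r]) auto
qed

text \<open>
  An \<open>L\<^sup>2\<close> limit and an almost everywhere limit of the same sequence agree, because the former is also an
  almost everywhere limit along a subsequence. This is what identifies random variables defined by
  almost sure limits with Wiener integrals, which are defined by \<open>L\<^sup>2\<close> limits.
\<close>

lemma L2_limit_AE_eq:
  assumes "\<And>n. f n \<in> L2 N" "g \<in> L2 N"
    and "(\<lambda>n. L2_dist N (f n) g) \<longlonglongrightarrow> 0"
    and "AE x in N. (\<lambda>n. f n x) \<longlonglongrightarrow> h x"
  shows "AE x in N. g x = h x"
proof -
  from L2_tendsto_AE_subseq[OF assms(1-3)]
  obtain r where r: "strict_mono r" "AE x in N. (\<lambda>n. f (r n) x) \<longlonglongrightarrow> g x" by blast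
  from r(2) assms(4) show ?thesis
  proof eventually_elim
    case (elim x)
    then show ?case
      using LIMSEQ_unique LIMSEQ_subseq_LIMSEQ[OF elim(2) r(1)] by (auto simp: o_def)
  qed
qed

lemma nn_integral_square:
  "f \<in> L2 N \<Longrightarrow> (\<integral>\<^sup>+x. ennreal ((f x)\<^sup>2) \<partial>N) = ennreal ((L2_norm N f)\<^sup>2)"
  by (simp add: L2_norm_sq nn_integral_eq_integral L2_square_integrable)

lemma L2_fatou:
  assumes f: "\<And>n. f n \<in> L2 N" and g: "g \<in> borel_measurable N"
    and lim: "AE x in N. (\<lambda>n. f n x) \<longlonglongrightarrow> g x"
    and bd: "\<forall>\<^sub>F n in sequentially. L2_norm N (f n) \<le> C"
  shows "g \<in> L2 N" "L2_norm N g \<le> C"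
proof -
  obtain m where "L2_norm N (f m) \<le> C" using eventually_happens[OF bd] by auto
  then have C: "0 \<le> C" by (meson L2_norm_nonneg order_trans)
  have "(\<integral>\<^sup>+x. ennreal ((g x)\<^sup>2) \<partial>N) = (\<integral>\<^sup>+x. liminf (\<lambda>n. ennreal ((f n x)\<^sup>2)) \<partial>N)"
  proof (rule nn_integral_cong_AE)
    show "AE x in N. ennreal ((g x)\<^sup>2) = liminf (\<lambda>n. ennreal ((f n x)\<^sup>2))"
      using lim
    proof eventually_elim
      case (elim x)
      have "(\<lambda>n. ennreal ((f n x)\<^sup>2)) \<longlonglongrightarrow> ennreal ((g x)\<^sup>2)"
        by (intro tendsto_ennrealI tendsto_power elim)
      then show ?case by (intro lim_imp_Liminf[symmetric]) auto
    qed
  qed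
  also have "\<dots> \<le> liminf (\<lambda>n. \<integral>\<^sup>+x. ennreal ((f n x)\<^sup>2) \<partial>N)"
    using L2_measurable[OF f] by (intro nn_integral_liminf) auto
  also have "\<dots> \<le> liminf (\<lambda>n. ennreal (C\<^sup>2))"
  proof (rule Liminf_mono)
    show "\<forall>\<^sub>F n in sequentially. (\<integral>\<^sup>+x. ennreal ((f n x)\<^sup>2) \<partial>N) \<le> ennreal (C\<^sup>2)"
      using bd by eventually_elim (simp add: nn_integral_square[OF f] ennreal_leI power_mono)
  qed
  also have "\<dots> = ennreal (C\<^sup>2)" by (simp add: Liminf_const)
  finally have le: "(\<integral>\<^sup>+x. ennreal ((g x)\<^sup>2) \<partial>N) \<le> ennreal (C\<^sup>2)" .
  then have "integrable N (\<lambda>x. (g x)\<^sup>2)"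
    using g by (intro integrableI_bounded) (auto simp: less_top[symmetric] top_unique)
  then show 1: "g \<in> L2 N" using g by (simp add: L2_def)
  have "(L2_norm N g)\<^sup>2 \<le> C\<^sup>2"
    using le nn_integral_square[OF 1] by (simp add: ennreal_le_iff)
  then show "L2_norm N g \<le> C" using C by (rule power2_le_imp_le)
qed

lemma L2_complete:
  assumes f: "\<And>n. f n \<in> L2 N"
    and Cauchy: "\<And>e. e > 0 \<Longrightarrow> \<exists>K. \<forall>m\<ge>K. \<forall>n\<ge>K. L2_dist N (f m) (f n) \<le> e"
  shows "\<exists>g\<in>L2 N. (\<lambda>n. L2_dist N (f n) g) \<longlonglongrightarrow> 0"
proof -
  (* The rate 4^(-j) leaves the integrals of 4^j * (D j)^2 summable, so that almost everywhere the
     increments D j along the subsequence are bounded by a multiple of 2^(-j). *)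
  have "\<exists>K. \<forall>j. (\<forall>m\<ge>K j. \<forall>n\<ge>K j. L2_dist N (f m) (f n) \<le> (1/4)^j) \<and> K j < K (Suc j)"
  proof (rule dependent_nat_choice)
    show "\<exists>K. \<forall>m\<ge>K. \<forall>n\<ge>K. L2_dist N (f m) (f n) \<le> (1/4)^0"
      using Cauchy[of 1] by simp
    fix K j
    obtain K' where "\<forall>m\<ge>K'. \<forall>n\<ge>K'. L2_dist N (f m) (f n) \<le> (1/4)^(Suc j)"
      using Cauchy[of "(1/4)^(Suc j)"] by auto
    then show "\<exists>K'. (\<forall>m\<ge>K'. \<forall>n\<ge>K'. L2_dist N (f m) (f n) \<le> (1/4)^(Suc j)) \<and> K < K'"
      by (intro exI[of _ "max K' (Suc K)"]) auto
  qed
  then obtain K where K: "\<And>j m n. m \<ge> K j \<Longrightarrow> n \<ge> K j \<Longrightarrow> L2_dist N (f m) (f n) \<le> (1/4)^j"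
    and KS: "\<And>j. K j < K (Suc j)" by blast
  have Kmono: "strict_mono K" using KS by (simp add: strict_mono_Suc_iff)
  define D where "D j x = f (K (Suc j)) x - f (K j) x" for j x
  have DL: "D j \<in> L2 N" for j unfolding D_def by (intro L2_diff f)
  have [measurable]: "f n \<in> borel_measurable N" "D j \<in> borel_measurable N" for n j
    using f DL by (auto dest: L2_measurable)
  have Dn: "L2_norm N (D j) \<le> (1/4)^j" for j
    using K[of j "K (Suc j)" "K j"] KS[of j] by (simp add: D_def[abs_def] L2_dist_norm)
  have "(\<integral>\<^sup>+x. (\<Sum>j. ennreal (4^j * (D j x)\<^sup>2)) \<partial>N) = (\<Sum>j. \<integral>\<^sup>+x. ennreal (4^j * (D j x)\<^sup>2) \<partial>N)"
    by (intro nn_integral_suminf) auto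
  also have "\<dots> \<le> (\<Sum>j. ennreal ((1/4)^j))"
  proof (intro suminf_le)
    fix j
    have "(\<integral>\<^sup>+x. ennreal (4^j * (D j x)\<^sup>2) \<partial>N) = ennreal (4^j) * ennreal ((L2_norm N (D j))\<^sup>2)"
      by (simp add: ennreal_mult nn_integral_cmult nn_integral_square[OF DL, symmetric])
    also have "\<dots> = ennreal (4^j * (L2_norm N (D j))\<^sup>2)" by (simp add: ennreal_mult)
    also have "\<dots> \<le> ennreal (4^j * ((1/4)^j)\<^sup>2)"
      using Dn[of j] by (intro ennreal_leI mult_left_mono power_mono) auto
    also have "(4::real)^j * ((1/4)^j)\<^sup>2 = (1/4)^j"
      by (simp add: power2_eq_square power_divide)
    finally show "(\<integral>\<^sup>+x. ennreal (4^j * (D j x)\<^sup>2) \<partial>N) \<le> ennreal ((1/4)^j)" .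
  qed auto
  also have "\<dots> < \<infinity>"
    by (subst suminf_ennreal2) (auto intro!: summable_geometric)
  finally have "(\<integral>\<^sup>+x. (\<Sum>j. ennreal (4^j * (D j x)\<^sup>2)) \<partial>N) \<noteq> \<infinity>" by simp
  then have "AE x in N. (\<Sum>j. ennreal (4^j * (D j x)\<^sup>2)) \<noteq> \<infinity>"
    by (intro nn_integral_noteq_infinite) auto
  then have conv: "AE x in N. convergent (\<lambda>j. f (K j) x)"
  proof eventually_elim
    case (elim x)
    then have "summable (\<lambda>j. 4^j * (D j x)\<^sup>2)"
      by (intro summable_suminf_not_top) auto
    then have "(\<lambda>j. 4^j * (D j x)\<^sup>2) \<longlonglongrightarrow> 0" by (rule summable_LIMSEQ_zero)
    then have "Bseq (\<lambda>j. 4^j * (D j x)\<^sup>2)" by (rule convergent_imp_Bseq[OF convergentI])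
    then obtain C where C: "C > 0" "\<And>j. 4^j * (D j x)\<^sup>2 \<le> C"
      by (auto simp: Bseq_def)
    have p4: "((2::real)^j)\<^sup>2 = 4^j" for j
      by (simp add: power2_eq_square flip: power_mult_distrib)
    have "norm (D j x) \<le> sqrt C * (1/2)^j" for j
    proof -
      have "(2^j * \<bar>D j x\<bar>)\<^sup>2 \<le> C"
        using C(2)[of j] p4[of j] by (simp add: power_mult_distrib)
      then have "2^j * \<bar>D j x\<bar> \<le> sqrt C" by (rule real_le_rsqrt)
      then show ?thesis by (simp add: power_divide field_simps)
    qed
    then have "summable (\<lambda>j. D j x)"
      by (intro summable_comparison_test'[of "\<lambda>j. sqrt C * (1/2)^j" 0 "\<lambda>j. D j x"] summable_mult summable_geometric) simp_all
    then have "summable (\<lambda>j. f (K (Suc j)) x - f (K j) x)" by (simp add: D_def)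
    then have "convergent (\<lambda>n. \<Sum>j<n. f (K (Suc j)) x - f (K j) x)"
      by (simp add: summable_iff_convergent)
    then have "convergent (\<lambda>n. f (K n) x - f (K 0) x)"
      by (simp add: sum_lessThan_telescope[where f="\<lambda>j. f (K j) x"])
    then have "convergent (\<lambda>n. (f (K n) x - f (K 0) x) + f (K 0) x)"
      by (intro convergent_add convergent_const)
    then show ?case by simp
  qed
  define g where "g x = lim (\<lambda>j. f (K j) x)" for x
  have [measurable]: "g \<in> borel_measurable N" unfolding g_def by measurable
  from conv have lim: "AE x in N. (\<lambda>j. f (K j) x) \<longlonglongrightarrow> g x"
    by eventually_elim (simp add: g_def convergent_LIMSEQ_iff)
  have main: "(\<lambda>x. f n x - g x) \<in> L2 N \<and> L2_dist N (f n) g \<le> (1/4)^j" if "n \<ge> K j" for n j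
  proof -
    have *: "AE x in N. (\<lambda>i. f n x - f (K i) x) \<longlonglongrightarrow> f n x - g x"
      using lim by eventually_elim (intro tendsto_intros)
    have bd: "\<forall>\<^sub>F i in sequentially. L2_norm N (\<lambda>x. f n x - f (K i) x) \<le> (1/4)^j"
      using eventually_ge_at_top[of j]
    proof eventually_elim
      case (elim i)
      then have "K i \<ge> K j" using Kmono by (simp add: strict_mono_less_eq)
      then show ?case using K[of j n "K i"] that by (simp add: L2_dist_norm)
    qed
    show ?thesis
      using L2_fatou[OF _ _ * bd] L2_diff[OF f f] by (auto simp: L2_dist_norm)
  qed
  have "(\<lambda>x. f (K 0) x - (f (K 0) x - g x)) \<in> L2 N"
    by (rule L2_diff[OF f]) (use main[of 0 "K 0"] in auto)
  then have gL: "g \<in> L2 N" by simp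
  have "(\<lambda>n. L2_dist N (f n) g) \<longlonglongrightarrow> 0"
  proof (rule LIMSEQ_I)
    fix e :: real assume "e > 0"
    then obtain j where j: "(1/4)^j < e" using real_arch_pow_inv[of e "1/4"] by auto
    show "\<exists>no. \<forall>n\<ge>no. norm (L2_dist N (f n) g - 0) < e"
      using main[of j] j by (intro exI[of _ "K j"]) (force intro: le_less_trans)
  qed
  with gL show ?thesis by blast
qed

section \<open>Product functions on \<open>\<real>\<^sup>d\<close>\<close>

lemma Basis_vec_eq: "(Basis :: (real^'d) set) = range (\<lambda>l. axis l 1)"
  by (auto simp: Basis_vec_def)

lemma inj_axis_1: "inj (\<lambda>l. axis l (1::real) :: real^'d)"
  by (auto simp: inj_on_def axis_eq_axis)

lemma prod_Basis_vec:
  "(\<Prod>b\<in>(Basis :: (real^'d) set). F (axis_index b) (x \<bullet> b)) = (\<Prod>l\<in>UNIV. F l (x $ l))"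
  by (simp add: Basis_vec_eq prod.reindex[OF inj_axis_1] inner_axis)

lemma prod_Basis_index:
  "(\<Prod>b\<in>(Basis :: (real^'d) set). F (axis_index b)) = (\<Prod>l\<in>UNIV. F l)"
  by (simp add: Basis_vec_eq prod.reindex[OF inj_axis_1])

lemma nn_integral_prod_vec:
  fixes f :: "'d::finite \<Rightarrow> real \<Rightarrow> ennreal"
  assumes "\<And>l. f l \<in> borel_measurable borel"
  shows "(\<integral>\<^sup>+x. (\<Prod>l\<in>UNIV. f l (x $ l)) \<partial>(lborel :: (real^'d) measure)) = (\<Prod>l\<in>UNIV. \<integral>\<^sup>+x. f l x \<partial>lborel)"
  using nn_integral_lborel_prod[where f="\<lambda>b::real^'d. f (axis_index b)"] assms
  by (simp add: prod_Basis_vec prod_Basis_index[of "\<lambda>l. integral\<^sup>N lborel (f l)"])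

lemma
  fixes f :: "'d::finite \<Rightarrow> real \<Rightarrow> 'b::{real_normed_field,banach,second_countable_topology}"
  assumes f: "\<And>l. integrable lborel (f l)"
  shows integrable_prod_vec: "integrable lborel (\<lambda>x::real^'d. \<Prod>l\<in>UNIV. f l (x $ l))"
    and integral_prod_vec: "(LINT x|(lborel :: (real^'d) measure). (\<Prod>l\<in>UNIV. f l (x $ l))) = (\<Prod>l\<in>UNIV. LINT x|lborel. f l x)"
proof -
  interpret product_sigma_finite "\<lambda>_::real^'d. lborel :: real measure" ..
  let ?P = "\<Pi>\<^sub>M b\<in>(Basis :: (real^'d) set). (lborel :: real measure)"
  have fm [measurable]: "f l \<in> borel_measurable borel" for l
    using borel_measurable_integrable[OF f[of l]] by simp
  have eq: "(\<Prod>l\<in>UNIV. f l ((\<Sum>b\<in>(Basis :: (real^'d) set). g b *\<^sub>R b) $ l)) = (\<Prod>b\<in>(Basis :: (real^'d) set). f (axis_index b) (g b))" for g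
  proof -
    have "(\<Sum>b\<in>(Basis :: (real^'d) set). g b *\<^sub>R b) $ l = g (axis l 1)" for l
    proof -
      have "(\<Sum>b\<in>(Basis :: (real^'d) set). g b *\<^sub>R b) \<bullet> axis l 1 = g (axis l 1)"
        by (intro inner_sum_left_Basis) (auto simp: Basis_vec_eq)
      then show ?thesis by (simp add: inner_axis)
    qed
    then show ?thesis by (simp add: Basis_vec_eq prod.reindex[OF inj_axis_1])
  qed
  have m1: "(\<lambda>g. \<Sum>b\<in>(Basis :: (real^'d) set). g b *\<^sub>R b) \<in> ?P \<rightarrow>\<^sub>M borel" by measurable
  have m2: "(\<lambda>x::real^'d. \<Prod>l\<in>UNIV. f l (x $ l)) \<in> borel_measurable borel" by measurable
  have 1: "integrable ?P (\<lambda>g. \<Prod>b\<in>(Basis :: (real^'d) set). f (axis_index b) (g b))"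
    by (intro product_integrable_prod f) auto
  show "integrable lborel (\<lambda>x::real^'d. \<Prod>l\<in>UNIV. f l (x $ l))"
    using 1 unfolding lborel_eq[where 'a="real^'d"] by (subst integrable_distr_eq[OF m1 m2]) (simp only: eq)
  have "(LINT x|(lborel :: (real^'d) measure). (\<Prod>l\<in>UNIV. f l (x $ l))) = (LINT g|(?P). (\<Prod>b\<in>(Basis :: (real^'d) set). f (axis_index b) (g b)))"
    unfolding lborel_eq[where 'a="real^'d"] by (subst integral_distr[OF m1 m2]) (simp only: eq)
  also have "\<dots> = (\<Prod>b\<in>(Basis :: (real^'d) set). LINT x|lborel. f (axis_index b) x)"
    by (intro product_integral_prod f) auto
  finally show "(LINT x|(lborel :: (real^'d) measure). (\<Prod>l\<in>UNIV. f l (x $ l))) = (\<Prod>l\<in>UNIV. LINT x|lborel. f l x)"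
    by (simp add: prod_Basis_index[of "\<lambda>l. LINT x|lborel. f l x"])
qed

lemma L2_prod_vec:
  fixes f :: "'d::finite \<Rightarrow> real \<Rightarrow> real"
  assumes "\<And>l. f l \<in> L2 lborel"
  shows "(\<lambda>x::real^'d. \<Prod>l\<in>UNIV. f l (x $ l)) \<in> L2 lborel"
proof -
  have [measurable]: "f l \<in> borel_measurable borel" for l
    using L2_measurable[OF assms[of l]] by simp
  show ?thesis
    using integrable_prod_vec[of "\<lambda>l x. (f l x)\<^sup>2"] L2_square_integrable[OF assms]
    by (simp add: L2_def prod_power_distrib)
qed

lemma L2_inner_prod_vec:
  fixes f g :: "'d::finite \<Rightarrow> real \<Rightarrow> real"
  assumes "\<And>l. f l \<in> L2 lborel" "\<And>l. g l \<in> L2 lborel"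
  shows "L2_inner lborel (\<lambda>x::real^'d. \<Prod>l\<in>UNIV. f l (x $ l)) (\<lambda>x. \<Prod>l\<in>UNIV. g l (x $ l)) =
    (\<Prod>l\<in>UNIV. L2_inner lborel (f l) (g l))"
  using integral_prod_vec[of "\<lambda>l x. f l x * g l x"] L2_mult_integrable[OF assms]
  by (simp add: L2_inner_def prod.distrib)

lemma L2_norm_prod_vec:
  fixes f :: "'d::finite \<Rightarrow> real \<Rightarrow> real"
  assumes "\<And>l. f l \<in> L2 lborel"
  shows "L2_norm lborel (\<lambda>x::real^'d. \<Prod>l\<in>UNIV. f l (x $ l)) = (\<Prod>l\<in>UNIV. L2_norm lborel (f l))"
proof -
  have "(LINT x|lborel. (\<Prod>l\<in>UNIV. f l ((x::real^'d) $ l))\<^sup>2) = (\<Prod>l\<in>UNIV. LINT x|lborel. (f l x)\<^sup>2)"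
    using L2_inner_prod_vec[OF assms assms] by (simp add: L2_inner_def power2_eq_square)
  moreover have "sqrt (\<Prod>l\<in>A. LINT x|lborel. (f l x)\<^sup>2) = (\<Prod>l\<in>A. sqrt (LINT x|lborel. (f l x)\<^sup>2))" for A
    by (induction A rule: infinite_finite_induct) (auto simp: real_sqrt_mult)
  ultimately show ?thesis by (simp add: L2_norm_def)
qed


section \<open>Step kernels and grid refinement\<close>

text \<open>
  The common form of step kernels and of their elementary integrals: \<open>W l b = 1\<close> or \<open>0\<close> according to
  \<open>x $ l \<le> b\<close> gives the value of the kernel at \<open>x\<close>, and \<open>W l b = B b \<omega>\<close> gives the integral. A statement
  that holds for all \<open>W\<close> therefore covers both at once.
\<close>

definition grid_sum ::
    "nat \<Rightarrow> (nat \<Rightarrow> real) \<Rightarrow> (('d::finite \<Rightarrow> nat) \<Rightarrow> real) \<Rightarrow> ('d \<Rightarrow> real \<Rightarrow> real) \<Rightarrow> real" where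
  "grid_sum n t a W = (\<Sum>i\<in>off_diagonal n. a i * (\<Prod>l\<in>UNIV. W l (t (Suc (i l))) - W l (t (i l))))"

lemma finite_off_diagonal [simp]: "finite (off_diagonal n :: ('d::finite \<Rightarrow> nat) set)"
proof (rule finite_subset)
  show "off_diagonal n \<subseteq> (PiE UNIV (\<lambda>_. {..<n}) :: ('d \<Rightarrow> nat) set)"
    by (auto simp: off_diagonal_def)
qed (auto intro!: finite_PiE)

lemma off_diagonal_less: "i \<in> off_diagonal n \<Longrightarrow> i l < n"
  by (auto simp: off_diagonal_def)

lemma grid_less: "strict_mono_on {..n} (t :: nat \<Rightarrow> real) \<Longrightarrow> i < n \<Longrightarrow> t i < t (Suc i)"
  by (rule strict_mono_onD) auto

lemma step_kernel_grid_sum: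
  assumes "strict_mono_on {..n} t"
  shows "step_kernel n t a x = grid_sum n t a (\<lambda>l b. if x $ l \<le> b then 1 else 0)"
  unfolding step_kernel_def grid_sum_def
proof (intro sum.cong refl arg_cong2[where f="(*)"] prod.cong)
  fix i :: "'a \<Rightarrow> nat" and l assume "i \<in> off_diagonal n"
  then show "indicator {t (i l)<..t (Suc (i l))} (x $ l) =
    (if x $ l \<le> t (Suc (i l)) then 1 else 0) - (if x $ l \<le> t (i l) then 1 else (0::real))"
    using grid_less[OF assms off_diagonal_less, of i l] by (auto simp: indicator_def)
qed

lemma step_integral_grid_sum: "step_integral B n t a \<omega> = grid_sum n t a (\<lambda>l b. B b \<omega>)"
  by (simp add: step_integral_def grid_sum_def)

text \<open>
  Every increment over a cell of the coarse grid is the sum of the increments over the fine cells that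
  it contains, and expanding the product distributes the coefficient over these fine cells. Distinct
  coarse cells contain disjoint sets of fine cells, so the refined sum again avoids the diagonals.
\<close>

lemma grid_refine:
  fixes a :: "('d::finite \<Rightarrow> nat) \<Rightarrow> real"
  assumes t: "strict_mono_on {..n} t" and s: "strict_mono_on {..m} s"
    and sub: "t ` {..n} \<subseteq> s ` {..m}"
  shows "\<exists>b. \<forall>W. grid_sum m s b W = grid_sum n t a W"
proof -
  have "\<forall>i\<in>{..n}. \<exists>r\<le>m. s r = t i" using sub by (metis atMost_iff imageE image_subset_iff)
  then obtain \<alpha> where \<alpha>: "\<And>i. i \<le> n \<Longrightarrow> \<alpha> i \<le> m" "\<And>i. i \<le> n \<Longrightarrow> s (\<alpha> i) = t i"
    by (metis atMost_iff)
  have mono: "\<alpha> i < \<alpha> j" if "i < j" "j \<le> n" for i j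
  proof -
    have "s (\<alpha> i) < s (\<alpha> j)" using that \<alpha>(2) strict_mono_onD[OF t, of i j] by simp
    then show ?thesis using strict_mono_on_less[OF s] \<alpha>(1)[of i] \<alpha>(1)[of j] that by auto
  qed
  have mono': "\<alpha> i \<le> \<alpha> j" if "i \<le> j" "j \<le> n" for i j
    using mono[of i j] that by (cases "i = j") auto
  (* The fine cells inside the coarse cell i. *)
  define C where "C i = {\<alpha> i..<\<alpha> (Suc i)}" for i
  have Cless: "r < m" if "r \<in> C i" "i < n" for r i
    using that \<alpha>(1)[of "Suc i"] by (auto simp: C_def)
  have Cdisj: "i = j" if "r \<in> C i" "r \<in> C j" "i < n" "j < n" for r i j
  proof (rule ccontr)
    assume "i \<noteq> j"
    then consider "i < j" | "j < i" by linarith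
    then show False
      using that mono'[of "Suc i" j] mono'[of "Suc j" i] by cases (auto simp: C_def)
  qed
  define P where "P i = PiE UNIV (\<lambda>l::'d. C (i l))" for i
  define b where "b j = (\<Sum>i\<in>off_diagonal n. if j \<in> P i then a i else 0)" for j
  have Psub: "P i \<subseteq> off_diagonal m" if i: "i \<in> off_diagonal n" for i
  proof
    fix j assume j: "j \<in> P i"
    then have jC: "j l \<in> C (i l)" for l by (auto simp: P_def)
    have "inj j"
    proof (rule injI)
      fix l l' assume "j l = j l'"
      then have "i l = i l'"
        using Cdisj[of "j l" "i l" "i l'"] jC[of l] jC[of l'] off_diagonal_less[OF i] by auto
      then show "l = l'" using i by (auto simp: off_diagonal_def inj_def)
    qed
    then show "j \<in> off_diagonal m"
      using Cless[OF jC off_diagonal_less[OF i]] by (auto simp: off_diagonal_def)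
  qed
  have "grid_sum m s b W = grid_sum n t a W" for W
  proof -
    define p where "p j = (\<Prod>l\<in>UNIV. W l (s (Suc (j l))) - W l (s (j l)))" for j
    have "(\<Prod>l\<in>UNIV. W l (t (Suc (i l))) - W l (t (i l))) = (\<Sum>j\<in>P i. p j)" if i: "i \<in> off_diagonal n" for i
    proof -
      have "W l (t (Suc (i l))) - W l (t (i l)) = (\<Sum>r\<in>C (i l). W l (s (Suc r)) - W l (s r))" for l
        using sum_Suc_diff'[OF mono'[of "i l" "Suc (i l)"], of "\<lambda>r. W l (s r)"] off_diagonal_less[OF i, of l]
        by (simp add: C_def \<alpha>(2))
      then show ?thesis by (simp add: p_def P_def prod_sum_PiE C_def)
    qed
    then have "grid_sum n t a W = (\<Sum>i\<in>off_diagonal n. a i * (\<Sum>j\<in>P i. p j))"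
      by (simp add: grid_sum_def)
    also have "\<dots> = (\<Sum>i\<in>off_diagonal n. \<Sum>j\<in>off_diagonal m. (if j \<in> P i then a i else 0) * p j)"
    proof (rule sum.cong[OF refl])
      fix i :: "'d \<Rightarrow> nat" assume i: "i \<in> off_diagonal n"
      have "(\<Sum>j\<in>off_diagonal m. (if j \<in> P i then a i else 0) * p j) = (\<Sum>j\<in>P i. (if j \<in> P i then a i else 0) * p j)"
        by (rule sum.mono_neutral_right) (use Psub[OF i] in auto)
      then show "a i * (\<Sum>j\<in>P i. p j) = (\<Sum>j\<in>off_diagonal m. (if j \<in> P i then a i else 0) * p j)"
        by (simp add: sum_distrib_left)
    qed
    also have "\<dots> = grid_sum m s b W"
      unfolding grid_sum_def b_def p_def[symmetric] by (subst sum.swap) (simp add: sum_distrib_right)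
    finally show ?thesis by simp
  qed
  then show ?thesis by blast
qed

lemma grid_of_finite_set:
  assumes "finite (P :: real set)" "P \<noteq> {}"
  shows "\<exists>m s. strict_mono_on {..m} s \<and> s ` {..m::nat} = P"
proof -
  obtain xs where xs: "sorted_wrt (<) xs" "set xs = P" "length xs = card P"
    using sorted_list_of_set.finite_set_strict_sorted[OF assms(1)] by blast
  have ne: "xs \<noteq> []" using xs(2) assms(2) by auto
  have "strict_mono_on {..length xs - 1} (\<lambda>i. xs ! i)"
  proof (rule strict_mono_onI)
    fix i j assume "i \<in> {..length xs - 1}" "j \<in> {..length xs - 1}" "i < j"
    moreover have "0 < length xs" using ne by simp
    ultimately have "i < j" "j < length xs" unfolding atMost_iff by linarith+
    then show "xs ! i < xs ! j" by (rule sorted_wrt_nth_less[OF xs(1)])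
  qed
  moreover have "(\<lambda>i. xs ! i) ` {..length xs - 1} = P"
  proof -
    have "{..length xs - 1} = {..<length xs}" using ne by (cases xs) auto
    then show ?thesis using xs(2) by (auto simp: set_conv_nth)
  qed
  ultimately show ?thesis by blast
qed

lemma grid_lincomb:
  fixes a b :: "('d::finite \<Rightarrow> nat) \<Rightarrow> real"
  assumes t: "strict_mono_on {..n} t" and s: "strict_mono_on {..m} s"
  shows "\<exists>k u e. strict_mono_on {..k} u \<and> (\<forall>W. grid_sum k u e W = x * grid_sum n t a W + y * grid_sum m s b W)"
proof -
  obtain k u where u: "strict_mono_on {..k} u" "u ` {..k::nat} = t ` {..n} \<union> s ` {..m}"
    using grid_of_finite_set[of "t ` {..n} \<union> s ` {..m}"] by auto
  obtain a' where a': "\<forall>W. grid_sum k u a' W = grid_sum n t a W"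
    using grid_refine[OF t u(1)] u(2) by blast
  obtain b' where b': "\<forall>W. grid_sum k u b' W = grid_sum m s b W"
    using grid_refine[OF s u(1)] u(2) by blast
  have "grid_sum k u (\<lambda>i. x * a' i + y * b' i) W = x * grid_sum k u a' W + y * grid_sum k u b' W" for W
    by (simp add: grid_sum_def sum_distrib_left sum.distrib algebra_simps)
  with a' b' u(1) show ?thesis
    by (intro exI[of _ k] exI[of _ u] exI[of _ "\<lambda>i. x * a' i + y * b' i"]) simp
qed

lemma step_kernel_eq:
  assumes t: "strict_mono_on {..n} t" and i: "\<And>l. i l < n" "\<And>l. t (i l) < x $ l" "\<And>l. x $ l \<le> t (Suc (i l))"
  shows "step_kernel n t a x = (if inj i then a i else 0)"
proof -
  have uniq: "j = i" if j: "j \<in> off_diagonal n" and "\<And>l. t (j l) < x $ l \<and> x $ l \<le> t (Suc (j l))" for j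
  proof
    fix l
    have jn: "j l < n" using j by (rule off_diagonal_less)
    have "t (i l) < t (Suc (j l))" "t (j l) < t (Suc (i l))" using i that by (meson le_less_trans less_le_trans)+
    then have "i l < Suc (j l)" "j l < Suc (i l)"
      using strict_mono_on_less[OF t] i(1)[of l] jn by auto
    then show "j l = i l" by simp
  qed
  have "(\<Prod>l\<in>UNIV. indicator {t (j l)<..t (Suc (j l))} (x $ l)) = (if j = i then 1 else (0::real))"
    if j: "j \<in> off_diagonal n" for j
  proof (cases "j = i")
    case False
    then obtain l where "\<not> (t (j l) < x $ l \<and> x $ l \<le> t (Suc (j l)))" using uniq[OF j] by blast
    then have "\<exists>l\<in>UNIV. indicator {t (j l)<..t (Suc (j l))} (x $ l) = (0::real)" by (auto simp: indicator_def)
    then show ?thesis using False by (subst prod_zero) auto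
  qed (use i in auto)
  then have "step_kernel n t a x = (\<Sum>j\<in>off_diagonal n. if j = i then a j else 0)"
    unfolding step_kernel_def by (intro sum.cong) auto
  also have "\<dots> = (if i \<in> off_diagonal n then a i else 0)" by (simp add: sum.delta)
  also have "i \<in> off_diagonal n \<longleftrightarrow> inj i" using i(1) by (auto simp: off_diagonal_def)
  finally show ?thesis .
qed

lemma step_kernel_eq_0:
  assumes "\<And>i. \<forall>l. i l < n \<and> t (i l) < x $ l \<and> x $ l \<le> t (Suc (i l)) \<Longrightarrow> False"
  shows "step_kernel n t a x = 0"
  unfolding step_kernel_def
proof (intro sum.neutral ballI)
  fix i :: "'a \<Rightarrow> nat" assume i: "i \<in> off_diagonal n"
  then obtain l where "\<not> (t (i l) < x $ l \<and> x $ l \<le> t (Suc (i l)))"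
    using assms[of i] off_diagonal_less[OF i] by blast
  then have "\<exists>l\<in>UNIV. indicator {t (i l)<..t (Suc (i l))} (x $ l) = (0::real)" by (auto simp: indicator_def)
  then show "a i * (\<Prod>l\<in>UNIV. indicator {t (i l)<..t (Suc (i l))} (x $ l)) = 0" by (subst prod_zero) auto
qed

text \<open>
  The boxes of a grid are disjoint, so the square of a step kernel has no mixed terms.
\<close>

lemma step_kernel_sq:
  assumes t: "strict_mono_on {..n} t"
  shows "(step_kernel n t a x)\<^sup>2 =
    (\<Sum>i\<in>off_diagonal n. (a i)\<^sup>2 * (\<Prod>l\<in>UNIV. indicator {t (i l)<..t (Suc (i l))} (x $ l)))"
proof -
  have "(step_kernel n t a x)\<^sup>2 = step_kernel n t (\<lambda>i. (a i)\<^sup>2) x"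
  proof (cases "\<exists>i. \<forall>l. i l < n \<and> t (i l) < x $ l \<and> x $ l \<le> t (Suc (i l))")
    case True
    then obtain i where i: "\<And>l. i l < n" "\<And>l. t (i l) < x $ l" "\<And>l. x $ l \<le> t (Suc (i l))" by blast
    show ?thesis by (simp add: step_kernel_eq[OF t i])
  next
    case False
    then have "step_kernel n t b x = 0" for b by (intro step_kernel_eq_0) blast
    then show ?thesis by simp
  qed
  then show ?thesis by (simp add: step_kernel_def)
qed

lemma
  fixes a :: "('d::finite \<Rightarrow> nat) \<Rightarrow> real"
  assumes t: "strict_mono_on {..n} t"
  shows step_kernel_L2: "step_kernel n t a \<in> L2 lborel"
    and step_kernel_norm: "(L2_norm lborel (step_kernel n t a))\<^sup>2 =
      (\<Sum>i\<in>off_diagonal n. (a i)\<^sup>2 * (\<Prod>l\<in>UNIV. t (Suc (i l)) - t (i l)))"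
proof -
  have m: "step_kernel n t a \<in> borel_measurable lborel"
    unfolding step_kernel_def[abs_def] by measurable
  have *: "integrable lborel (indicator {u<..v} :: real \<Rightarrow> real)" for u v :: real
    by (cases "u \<le> v") (auto intro!: integrable_real_indicator)
  have **: "integrable lborel (\<lambda>x::real^'d. \<Prod>l\<in>UNIV. indicator {t (i l)<..t (Suc (i l))} (x $ l) :: real)" for i :: "'d \<Rightarrow> nat"
    using integrable_prod_vec[of "\<lambda>l. indicator {t (i l)<..t (Suc (i l))} :: real \<Rightarrow> real"] * by simp
  show "step_kernel n t a \<in> L2 lborel"
    using m ** by (simp add: L2_def step_kernel_sq[OF t])
  show "(L2_norm lborel (step_kernel n t a))\<^sup>2 =
      (\<Sum>i\<in>off_diagonal n. (a i)\<^sup>2 * (\<Prod>l\<in>UNIV. t (Suc (i l)) - t (i l)))"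
  proof -
    have "(LINT x|lborel. (\<Prod>l\<in>UNIV. indicator {t (i l)<..t (Suc (i l))} ((x::real^'d) $ l) :: real)) =
        (\<Prod>l\<in>UNIV. t (Suc (i l)) - t (i l))" if "i \<in> off_diagonal n" for i
      using integral_prod_vec[of "\<lambda>l. indicator {t (i l)<..t (Suc (i l))} :: real \<Rightarrow> real"] *
        grid_less[OF t off_diagonal_less[OF that]]
      by (simp add: less_imp_le)
    then show ?thesis
      using ** by (simp add: L2_norm_sq step_kernel_sq[OF t])
  qed
qed

section \<open>The multiple Wiener integral\<close>

lemma card_same_range:
  fixes i :: "'d::finite \<Rightarrow> nat"
  assumes "inj i"
  shows "card {j\<in>(off_diagonal n :: ('d \<Rightarrow> nat) set). range j = range i} \<le> CARD('d) ^ CARD('d)"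
proof -
  have "card {j\<in>(off_diagonal n :: ('d \<Rightarrow> nat) set). range j = range i} \<le> card (PiE (UNIV :: 'd set) (\<lambda>_. range i))"
  proof (rule card_mono)
    show "finite (PiE (UNIV :: 'd set) (\<lambda>_. range i))" by (intro finite_PiE) auto
    show "{j\<in>(off_diagonal n :: ('d \<Rightarrow> nat) set). range j = range i} \<subseteq> PiE (UNIV :: 'd set) (\<lambda>_. range i)"
      by (auto simp: PiE_UNIV_domain)
  qed
  also have "\<dots> = CARD('d) ^ CARD('d)" using assms by (simp add: card_PiE card_image)
  finally show ?thesis .
qed

context
  fixes M :: "'w measure" and B :: "real \<Rightarrow> 'w \<Rightarrow> real"
  assumes bm: "standard_brownian_motion M B"
begin

lemma bm_prob_space: "prob_space M"
  using bm by (simp add: standard_brownian_motion_def)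

lemma bm_measurable: "B x \<in> borel_measurable M"
  using bm by (simp add: standard_brownian_motion_def)

lemma
  assumes "x < y"
  shows bm_increment_integrable: "integrable M (\<lambda>\<omega>. (B y \<omega> - B x \<omega>) ^ k)"
    and bm_increment_mean: "(LINT \<omega>|M. B y \<omega> - B x \<omega>) = 0"
    and bm_increment_variance: "(LINT \<omega>|M. (B y \<omega> - B x \<omega>)\<^sup>2) = y - x"
proof -
  interpret prob_space M by (rule bm_prob_space)
  have d: "distributed M lborel (\<lambda>\<omega>. B y \<omega> - B x \<omega>) (normal_density 0 (sqrt (y - x)))"
    using bm assms by (simp add: standard_brownian_motion_def)
  have s: "0 < sqrt (y - x)" using assms by simp
  show "integrable M (\<lambda>\<omega>. (B y \<omega> - B x \<omega>) ^ k)"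
    using distributed_integrable[OF d, of "\<lambda>x. x ^ k"] integrable_normal_moment[OF s, of 0 k] by simp
  show m: "(LINT \<omega>|M. B y \<omega> - B x \<omega>) = 0"
    by (rule normal_distributed_expectation[OF s d])
  show "(LINT \<omega>|M. (B y \<omega> - B x \<omega>)\<^sup>2) = y - x"
    using normal_distributed_variance[OF s d] assms m by simp
qed

text \<open>
  Collecting the factors by cell, the product of two products of increments is a product over all
  cells of a power \<open>0\<close>, \<open>1\<close> or \<open>2\<close> of the increment, and independence turns its expectation into a product. A cell
  that occurs in only one of the two products contributes the mean \<open>0\<close>.
\<close>

lemma
  fixes i j :: "'d::finite \<Rightarrow> nat"
  assumes t: "strict_mono_on {..n} t" and i: "i \<in> off_diagonal n" and j: "j \<in> off_diagonal n"
  defines "\<Delta> \<equiv> \<lambda>r \<omega>. B (t (Suc r)) \<omega> - B (t r) \<omega>"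
  shows increment_prod_integrable:
      "integrable M (\<lambda>\<omega>. (\<Prod>l\<in>UNIV. \<Delta> (i l) \<omega>) * (\<Prod>l\<in>UNIV. \<Delta> (j l) \<omega>))"
    and increment_prod_expectation:
      "(LINT \<omega>|M. (\<Prod>l\<in>UNIV. \<Delta> (i l) \<omega>) * (\<Prod>l\<in>UNIV. \<Delta> (j l) \<omega>)) =
        (if range i = range j then \<Prod>l\<in>UNIV. t (Suc (i l)) - t (i l) else 0)"
proof -
  interpret prob_space M by (rule bm_prob_space)
  define Y where "Y r x = (if r \<in> range i then x else 1) * (if r \<in> range j then x else (1::real))" for r :: nat and x
  have pr: "(\<Prod>l\<in>UNIV. F (k l)) = (\<Prod>r<n. if r \<in> range k then F r else 1)"
    if k: "k \<in> off_diagonal n" for k :: "'d \<Rightarrow> nat" and F :: "nat \<Rightarrow> real"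
  proof -
    have inj: "inj k" and sub: "range k \<subseteq> {..<n}" using k by (auto simp: off_diagonal_def)
    have "(\<Prod>l\<in>UNIV. F (k l)) = (\<Prod>r\<in>range k. F r)" using inj by (simp add: prod.reindex)
    also have "\<dots> = (\<Prod>r\<in>{..<n} \<inter> range k. F r)" using sub by (simp add: Int_absorb1)
    also have "\<dots> = (\<Prod>r<n. if r \<in> range k then F r else 1)" by (rule prod.inter_restrict) simp
    finally show ?thesis .
  qed
  have eq: "(\<Prod>l\<in>UNIV. \<Delta> (i l) \<omega>) * (\<Prod>l\<in>UNIV. \<Delta> (j l) \<omega>) = (\<Prod>r<n. Y r (\<Delta> r \<omega>))" for \<omega>
    using pr[OF i, of "\<lambda>r. \<Delta> r \<omega>"] pr[OF j, of "\<lambda>r. \<Delta> r \<omega>"] by (simp add: Y_def prod.distrib)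
  have ind0: "indep_vars (\<lambda>_. borel) \<Delta> {..<n}"
    using bm t unfolding standard_brownian_motion_def \<Delta>_def by blast
  have ind: "indep_vars (\<lambda>_. borel) (\<lambda>r \<omega>. Y r (\<Delta> r \<omega>)) {..<n}"
    by (rule indep_vars_compose2[OF ind0]) (auto simp: Y_def)
  have int: "integrable M (\<lambda>\<omega>. Y r (\<Delta> r \<omega>))" if "r < n" for r
    using bm_increment_integrable[OF grid_less[OF t that], of 1]
      bm_increment_integrable[OF grid_less[OF t that], of 2]
    by (cases "r \<in> range i"; cases "r \<in> range j") (simp_all add: Y_def \<Delta>_def power2_eq_square)
  show "integrable M (\<lambda>\<omega>. (\<Prod>l\<in>UNIV. \<Delta> (i l) \<omega>) * (\<Prod>l\<in>UNIV. \<Delta> (j l) \<omega>))"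
    unfolding eq by (intro indep_vars_integrable ind) (auto intro: int)
  have "(LINT \<omega>|M. (\<Prod>l\<in>UNIV. \<Delta> (i l) \<omega>) * (\<Prod>l\<in>UNIV. \<Delta> (j l) \<omega>)) = (\<Prod>r<n. LINT \<omega>|M. Y r (\<Delta> r \<omega>))"
    unfolding eq by (intro indep_vars_lebesgue_integral ind) (auto intro: int)
  also have "\<dots> = (if range i = range j then \<Prod>l\<in>UNIV. t (Suc (i l)) - t (i l) else 0)"
  proof (cases "range i = range j")
    case True
    have "(LINT \<omega>|M. Y r (\<Delta> r \<omega>)) = (if r \<in> range i then t (Suc r) - t r else 1)" if "r < n" for r
      using bm_increment_variance[OF grid_less[OF t that]] True prob_space
      by (auto simp: Y_def \<Delta>_def power2_eq_square)
    then show ?thesis using pr[OF i, of "\<lambda>r. t (Suc r) - t r"] True by simp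
  next
    case False
    then obtain r where r: "(r \<in> range i) \<noteq> (r \<in> range j)" by blast
    then have rn: "r < n" using i j by (auto simp: off_diagonal_def)
    have "(LINT \<omega>|M. Y r (\<Delta> r \<omega>)) = 0"
      using bm_increment_mean[OF grid_less[OF t rn]] r by (auto simp: Y_def \<Delta>_def)
    then have "(\<Prod>r<n. LINT \<omega>|M. Y r (\<Delta> r \<omega>)) = 0" using rn by (intro prod_zero) auto
    then show ?thesis using False by simp
  qed
  finally show "(LINT \<omega>|M. (\<Prod>l\<in>UNIV. \<Delta> (i l) \<omega>) * (\<Prod>l\<in>UNIV. \<Delta> (j l) \<omega>)) =
        (if range i = range j then \<Prod>l\<in>UNIV. t (Suc (i l)) - t (i l) else 0)" .
qed

text \<open>
  In the expansion of the second moment only pairs of multi-indices survive that use the same \<open>d\<close>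
  cells. Each multi-index has at most \<open>d^d\<close> such partners, which bounds the second moment by a
  constant times the squared norm of the kernel. For symmetric kernels the exact factor is \<open>d!\<close>; a
  bound is all that continuity of the integral requires.
\<close>

lemma
  fixes a :: "('d::finite \<Rightarrow> nat) \<Rightarrow> real"
  assumes t: "strict_mono_on {..n} t"
  shows step_integral_L2: "step_integral B n t a \<in> L2 M"
    and step_integral_bound: "(L2_norm M (step_integral B n t a))\<^sup>2 \<le>
      real (CARD('d) ^ CARD('d)) * (L2_norm lborel (step_kernel n t a))\<^sup>2"
proof -
  interpret prob_space M by (rule bm_prob_space)
  define p where "p i \<omega> = (\<Prod>l\<in>UNIV. B (t (Suc (i l))) \<omega> - B (t (i l)) \<omega>)" for i :: "'d \<Rightarrow> nat" and \<omega>
  define v where "v i = (\<Prod>l\<in>UNIV. t (Suc (i l)) - t (i l))" for i :: "'d \<Rightarrow> nat"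
  have v: "0 \<le> v i" if "i \<in> off_diagonal n" for i
    unfolding v_def using grid_less[OF t off_diagonal_less[OF that]] by (intro prod_nonneg) (auto intro: less_imp_le)
  have veq: "v i = v j" if "i \<in> off_diagonal n" "j \<in> off_diagonal n" "range i = range j" for i j
  proof -
    have "v k = (\<Prod>r\<in>range k. t (Suc r) - t r)" if "k \<in> off_diagonal n" for k
      using that by (simp add: v_def prod.reindex off_diagonal_def)
    then show ?thesis using that by simp
  qed
  have sq: "(step_integral B n t a \<omega>)\<^sup>2 =
      (\<Sum>i\<in>(off_diagonal n :: ('d \<Rightarrow> nat) set). \<Sum>j\<in>(off_diagonal n :: ('d \<Rightarrow> nat) set). a i * a j * (p i \<omega> * p j \<omega>))" for \<omega>
    by (simp add: step_integral_def p_def power2_eq_square sum_product ac_simps)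
  have int: "integrable M (\<lambda>\<omega>. p i \<omega> * p j \<omega>)" if "i \<in> off_diagonal n" "j \<in> off_diagonal n" for i j
    unfolding p_def by (rule increment_prod_integrable[OF t that])
  note bm_measurable [measurable]
  have "step_integral B n t a \<in> borel_measurable M"
    unfolding step_integral_def[abs_def] by measurable
  moreover have "integrable M (\<lambda>\<omega>. (step_integral B n t a \<omega>)\<^sup>2)"
    unfolding sq by (intro Bochner_Integration.integrable_sum integrable_mult_right int) auto
  ultimately show "step_integral B n t a \<in> L2 M" by (simp add: L2_def)
  have "(L2_norm M (step_integral B n t a))\<^sup>2 =
      (\<Sum>i\<in>(off_diagonal n :: ('d \<Rightarrow> nat) set). \<Sum>j\<in>(off_diagonal n :: ('d \<Rightarrow> nat) set). a i * a j * (LINT \<omega>|M. p i \<omega> * p j \<omega>))"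
    unfolding L2_norm_sq sq by (simp add: int)
  also have "\<dots> = (\<Sum>i\<in>(off_diagonal n :: ('d \<Rightarrow> nat) set). \<Sum>j\<in>(off_diagonal n :: ('d \<Rightarrow> nat) set). if range i = range j then a i * a j * v i else 0)"
    by (intro sum.cong refl) (simp add: increment_prod_expectation[OF t] p_def v_def)
  (* Multi-indices with the same cells have the same volume v, so 2 * a i * a j <= (a i)^2 + (a j)^2 applies. *)
  also have "\<dots> \<le> (\<Sum>i\<in>(off_diagonal n :: ('d \<Rightarrow> nat) set). \<Sum>j\<in>(off_diagonal n :: ('d \<Rightarrow> nat) set). if range i = range j then ((a i)\<^sup>2 * v i + (a j)\<^sup>2 * v j) / 2 else 0)"
  proof (intro sum_mono)
    fix i j :: "'d \<Rightarrow> nat" assume ij: "i \<in> off_diagonal n" "j \<in> off_diagonal n"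
    show "(if range i = range j then a i * a j * v i else 0) \<le>
      (if range i = range j then ((a i)\<^sup>2 * v i + (a j)\<^sup>2 * v j) / 2 else 0)"
    proof (cases "range i = range j")
      case True
      have "2 * (a i * a j) * v i \<le> ((a i)\<^sup>2 + (a j)\<^sup>2) * v i"
        using sum_squares_bound[of "a i" "a j"] v[OF ij(1)] by (intro mult_right_mono) auto
      then show ?thesis using True veq[OF ij True] by (simp add: field_simps)
    qed simp
  qed
  also have "\<dots> = (\<Sum>i\<in>(off_diagonal n :: ('d \<Rightarrow> nat) set). \<Sum>j\<in>(off_diagonal n :: ('d \<Rightarrow> nat) set). if range i = range j then (a i)\<^sup>2 * v i / 2 else 0) +
      (\<Sum>i\<in>(off_diagonal n :: ('d \<Rightarrow> nat) set). \<Sum>j\<in>(off_diagonal n :: ('d \<Rightarrow> nat) set). if range i = range j then (a j)\<^sup>2 * v j / 2 else 0)"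
    unfolding sum.distrib[symmetric] by (intro sum.cong refl) (auto simp: add_divide_distrib)
  also have "(\<Sum>i\<in>(off_diagonal n :: ('d \<Rightarrow> nat) set). \<Sum>j\<in>(off_diagonal n :: ('d \<Rightarrow> nat) set). if range i = range j then (a j)\<^sup>2 * v j / 2 else 0) =
      (\<Sum>i\<in>(off_diagonal n :: ('d \<Rightarrow> nat) set). \<Sum>j\<in>(off_diagonal n :: ('d \<Rightarrow> nat) set). if range i = range j then (a i)\<^sup>2 * v i / 2 else 0)"
    by (subst sum.swap) (simp add: eq_commute)
  also have "(\<Sum>i\<in>(off_diagonal n :: ('d \<Rightarrow> nat) set). \<Sum>j\<in>(off_diagonal n :: ('d \<Rightarrow> nat) set). if range i = range j then (a i)\<^sup>2 * v i / 2 else 0) +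
      (\<Sum>i\<in>(off_diagonal n :: ('d \<Rightarrow> nat) set). \<Sum>j\<in>(off_diagonal n :: ('d \<Rightarrow> nat) set). if range i = range j then (a i)\<^sup>2 * v i / 2 else 0) =
      (\<Sum>i\<in>(off_diagonal n :: ('d \<Rightarrow> nat) set). real (card {j\<in>(off_diagonal n :: ('d \<Rightarrow> nat) set). range j = range i}) * ((a i)\<^sup>2 * v i))"
  proof (subst sum.distrib[symmetric], rule sum.cong[OF refl])
    fix i :: "'d \<Rightarrow> nat"
    have "(\<Sum>j\<in>(off_diagonal n :: ('d \<Rightarrow> nat) set). if range i = range j then (a i)\<^sup>2 * v i / 2 else 0) =
        (\<Sum>j\<in>{j\<in>(off_diagonal n :: ('d \<Rightarrow> nat) set). range i = range j}. (a i)\<^sup>2 * v i / 2)"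
      by (rule sum.inter_filter[symmetric]) simp
    also have "{j\<in>(off_diagonal n :: ('d \<Rightarrow> nat) set). range i = range j} = {j\<in>off_diagonal n. range j = range i}"
      by auto
    finally have *: "(\<Sum>j\<in>(off_diagonal n :: ('d \<Rightarrow> nat) set). if range i = range j then (a i)\<^sup>2 * v i / 2 else 0) =
        real (card {j\<in>(off_diagonal n :: ('d \<Rightarrow> nat) set). range j = range i}) * ((a i)\<^sup>2 * v i / 2)"
      by simp
    show "(\<Sum>j\<in>(off_diagonal n :: ('d \<Rightarrow> nat) set). if range i = range j then (a i)\<^sup>2 * v i / 2 else 0) +
        (\<Sum>j\<in>(off_diagonal n :: ('d \<Rightarrow> nat) set). if range i = range j then (a i)\<^sup>2 * v i / 2 else 0) =
        real (card {j\<in>(off_diagonal n :: ('d \<Rightarrow> nat) set). range j = range i}) * ((a i)\<^sup>2 * v i)"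
      unfolding * by simp
  qed
  also have "\<dots> \<le> (\<Sum>i\<in>(off_diagonal n :: ('d \<Rightarrow> nat) set). real (CARD('d) ^ CARD('d)) * ((a i)\<^sup>2 * v i))"
    using v by (intro sum_mono mult_right_mono of_nat_mono card_same_range) (auto simp: off_diagonal_def)
  also have "\<dots> = real (CARD('d) ^ CARD('d)) * (L2_norm lborel (step_kernel n t a))\<^sup>2"
    by (simp add: step_kernel_norm[OF t] v_def sum_distrib_left)
  finally show "(L2_norm M (step_integral B n t a))\<^sup>2 \<le>
      real (CARD('d) ^ CARD('d)) * (L2_norm lborel (step_kernel n t a))\<^sup>2" .
qed

definition wiener_const :: "'d::finite itself \<Rightarrow> real" where
  "wiener_const _ = sqrt (real (CARD('d) ^ CARD('d)))"

lemma wiener_const_pos: "0 < wiener_const TYPE('d::finite)"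
  by (simp add: wiener_const_def)

lemma step_integral_norm_le:
  fixes a :: "('d::finite \<Rightarrow> nat) \<Rightarrow> real"
  assumes t: "strict_mono_on {..n} t"
  shows "L2_norm M (step_integral B n t a) \<le> wiener_const TYPE('d) * L2_norm lborel (step_kernel n t a)"
  using real_sqrt_le_mono[OF step_integral_bound[OF t, of a]]
  by (simp add: real_sqrt_mult wiener_const_def)

lemma step_lincomb:
  fixes a b :: "('d::finite \<Rightarrow> nat) \<Rightarrow> real"
  assumes t: "strict_mono_on {..n} t" and s: "strict_mono_on {..m} s"
  obtains k u e where "strict_mono_on {..k} u"
    "step_kernel k u e = (\<lambda>x. c * step_kernel n t a x + d * step_kernel m s b x)"
    "step_integral B k u e = (\<lambda>\<omega>. c * step_integral B n t a \<omega> + d * step_integral B m s b \<omega>)"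
proof -
  obtain k u e where u: "strict_mono_on {..k} u"
    and e: "\<And>W. grid_sum k u e W = c * grid_sum n t a W + d * grid_sum m s b W"
    using grid_lincomb[OF t s, of c a d b] by blast
  show ?thesis
    by (rule that[OF u, of e]) (simp_all add: fun_eq_iff step_kernel_grid_sum[OF t] step_kernel_grid_sum[OF s]
        step_kernel_grid_sum[OF u] step_integral_grid_sum e)
qed

lemma is_wiener_integral_L2:
  "is_wiener_integral M B f X \<Longrightarrow> f \<in> L2 lborel" "is_wiener_integral M B f X \<Longrightarrow> X \<in> L2 M"
  by (simp_all add: is_wiener_integral_def)

lemma L2_norm_lincomb_le:
  assumes "f \<in> L2 N" "g \<in> L2 N"
  shows "L2_norm N (\<lambda>x. c * f x + d * g x) \<le> \<bar>c\<bar> * L2_norm N f + \<bar>d\<bar> * L2_norm N g"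
  using L2_norm_triangle[OF L2_scale[OF assms(1)] L2_scale[OF assms(2)], of c d] by (simp add: L2_norm_scale)

lemma L2_dist_lincomb_le:
  assumes "f \<in> L2 N" "g \<in> L2 N" "f' \<in> L2 N" "g' \<in> L2 N"
  shows "L2_dist N (\<lambda>x. c * f x + d * g x) (\<lambda>x. c * f' x + d * g' x) \<le>
    \<bar>c\<bar> * L2_dist N f f' + \<bar>d\<bar> * L2_dist N g g'"
  using L2_norm_lincomb_le[OF L2_diff[OF assms(1,3)] L2_diff[OF assms(2,4)], of c d]
  by (simp add: L2_dist_norm algebra_simps)

lemma is_wiener_integral_lincomb:
  fixes f g :: "real ^ 'd \<Rightarrow> real"
  assumes f: "is_wiener_integral M B f X" and g: "is_wiener_integral M B g Y"
  shows "is_wiener_integral M B (\<lambda>x. c * f x + d * g x) (\<lambda>\<omega>. c * X \<omega> + d * Y \<omega>)"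
  unfolding is_wiener_integral_def
proof (intro conjI allI impI)
  note L = is_wiener_integral_L2[OF f] is_wiener_integral_L2[OF g]
  show "(\<lambda>x. c * f x + d * g x) \<in> L2 lborel" "(\<lambda>\<omega>. c * X \<omega> + d * Y \<omega>) \<in> L2 M"
    using L by (intro L2_add L2_scale; simp)+
  fix e :: real assume e: "e > 0"
  define e' where "e' = e / (\<bar>c\<bar> + \<bar>d\<bar> + 1)"
  have e': "e' > 0" using e by (auto simp: e'_def intro!: divide_pos_pos add_nonneg_pos)
  obtain n t a where t: "strict_mono_on {..n} t" and a: "L2_dist lborel f (step_kernel n t a) < e'"
     "L2_dist M X (step_integral B n t a) < e'"
    using f e' unfolding is_wiener_integral_def by blast
  obtain m s b where s: "strict_mono_on {..m} s" and b: "L2_dist lborel g (step_kernel m s b) < e'"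
     "L2_dist M Y (step_integral B m s b) < e'"
    using g e' unfolding is_wiener_integral_def by blast
  obtain k u q where u: "strict_mono_on {..k} u" and
    q: "step_kernel k u q = (\<lambda>x. c * step_kernel n t a x + d * step_kernel m s b x)"
    "step_integral B k u q = (\<lambda>\<omega>. c * step_integral B n t a \<omega> + d * step_integral B m s b \<omega>)"
    using step_lincomb[OF t s] by blast
  have *: "\<bar>c\<bar> * x + \<bar>d\<bar> * y < e" if "x < e'" "y < e'" for x y
  proof -
    have "\<bar>c\<bar> * x + \<bar>d\<bar> * y \<le> \<bar>c\<bar> * e' + \<bar>d\<bar> * e'" using that by (intro add_mono mult_left_mono) auto
    also have "\<dots> < (\<bar>c\<bar> + \<bar>d\<bar> + 1) * e'" using e' by (simp add: algebra_simps)
    also have "\<dots> = e" using e by (simp add: e'_def add_nonneg_eq_0_iff)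
    finally show ?thesis .
  qed
  have "L2_dist lborel (\<lambda>x. c * f x + d * g x) (step_kernel k u q) < e"
    unfolding q using L2_dist_lincomb_le[OF L(1) L(3) step_kernel_L2[OF t] step_kernel_L2[OF s], of c d a b] *[OF a(1) b(1)]
    by simp
  moreover have "L2_dist M (\<lambda>\<omega>. c * X \<omega> + d * Y \<omega>) (step_integral B k u q) < e"
    unfolding q using L2_dist_lincomb_le[OF L(2) L(4) step_integral_L2[OF t] step_integral_L2[OF s], of c d a b] *[OF a(2) b(2)]
    by simp
  ultimately show "\<exists>n t a. strict_mono_on {..n} t \<and> L2_dist lborel (\<lambda>x. c * f x + d * g x) (step_kernel n t a) < e \<and>
      L2_dist M (\<lambda>\<omega>. c * X \<omega> + d * Y \<omega>) (step_integral B n t a) < e"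
    using u by blast
qed

text \<open>
  The bound for step kernels passes to the closure of the graph. It gives uniqueness of the integral
  almost surely and makes it continuous.
\<close>

lemma is_wiener_integral_norm_le:
  fixes f :: "real ^ 'd \<Rightarrow> real"
  assumes f: "is_wiener_integral M B f X"
  shows "L2_norm M X \<le> wiener_const TYPE('d) * L2_norm lborel f"
proof (rule field_le_epsilon)
  fix e :: real assume e: "e > 0"
  note L = is_wiener_integral_L2[OF f]
  let ?K = "wiener_const TYPE('d)"
  have K: "0 < ?K" by (rule wiener_const_pos)
  define e' where "e' = e / (?K + 1)"
  have e': "e' > 0" using e K by (simp add: e'_def)
  obtain n t a where t: "strict_mono_on {..n} t" and a: "L2_dist lborel f (step_kernel n t a) < e'"
     "L2_dist M X (step_integral B n t a) < e'"
    using f e' unfolding is_wiener_integral_def by blast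
  have "L2_norm M X \<le> e' + L2_norm M (step_integral B n t a)"
    using L2_norm_triangle[OF L2_diff[OF L(2) step_integral_L2[OF t]] step_integral_L2[OF t], of a a] a(2)
    by (simp add: L2_dist_norm)
  also have "L2_norm M (step_integral B n t a) \<le> ?K * L2_norm lborel (step_kernel n t a)"
    by (rule step_integral_norm_le[OF t])
  also have "L2_norm lborel (step_kernel n t a) \<le> e' + L2_norm lborel f"
    using L2_norm_triangle[OF L2_diff[OF step_kernel_L2[OF t] L(1)] L(1), of a] a(1)
    by (simp add: L2_dist_norm[symmetric] L2_dist_commute)
  finally have "L2_norm M X \<le> e' + ?K * (e' + L2_norm lborel f)" using K by simp
  also have "\<dots> = ?K * L2_norm lborel f + (?K + 1) * e'" by (simp add: algebra_simps)
  also have "(?K + 1) * e' = e" using K by (simp add: e'_def)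
  finally show "L2_norm M X \<le> ?K * L2_norm lborel f + e" .
qed

lemma is_wiener_integral_unique:
  fixes f g :: "real ^ 'd \<Rightarrow> real"
  assumes f: "is_wiener_integral M B f X" and g: "is_wiener_integral M B g Y"
    and fg: "AE x in lborel. f x = g x"
  shows "AE \<omega> in M. X \<omega> = Y \<omega>"
proof -
  note L = is_wiener_integral_L2[OF f] is_wiener_integral_L2[OF g]
  have w: "is_wiener_integral M B (\<lambda>x. f x - g x) (\<lambda>\<omega>. X \<omega> - Y \<omega>)"
    using is_wiener_integral_lincomb[OF f g, of 1 "-1"] by simp
  have "L2_norm lborel (\<lambda>x. f x - g x) = 0"
    using fg L2_norm_zero_iff[OF L2_diff[OF L(1) L(3)]] by auto
  then have "L2_norm M (\<lambda>\<omega>. X \<omega> - Y \<omega>) = 0"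
    using is_wiener_integral_norm_le[OF w] L2_norm_nonneg[of M "\<lambda>\<omega>. X \<omega> - Y \<omega>"] by simp
  then show ?thesis using L2_norm_zero_iff[OF L2_diff[OF L(2) L(4)]] by simp
qed

text \<open>
  The graph of the integral is closed: integrals of a convergent sequence of kernels are Cauchy by
  the norm bound, and their limit is an integral of the limit kernel.
\<close>

lemma is_wiener_integral_limit:
  fixes f :: "nat \<Rightarrow> real ^ 'd \<Rightarrow> real"
  assumes f: "\<And>n. is_wiener_integral M B (f n) (X n)"
    and g: "g \<in> L2 lborel" "(\<lambda>n. L2_dist lborel (f n) g) \<longlonglongrightarrow> 0"
  shows "\<exists>Y. is_wiener_integral M B g Y \<and> (\<lambda>n. L2_dist M (X n) Y) \<longlonglongrightarrow> 0"
proof -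
  let ?K = "wiener_const TYPE('d)"
  have K: "0 < ?K" by (rule wiener_const_pos)
  note L = is_wiener_integral_L2[OF f]
  have dXX: "L2_dist M (X m) (X n) \<le> ?K * (L2_dist lborel (f m) g + L2_dist lborel (f n) g)" for m n
  proof -
    have w: "is_wiener_integral M B (\<lambda>x. f m x - f n x) (\<lambda>\<omega>. X m \<omega> - X n \<omega>)"
      using is_wiener_integral_lincomb[OF f f, of 1 m "-1" n] by simp
    have "L2_dist M (X m) (X n) \<le> ?K * L2_dist lborel (f m) (f n)"
      using is_wiener_integral_norm_le[OF w] by (simp add: L2_dist_norm)
    also have "\<dots> \<le> ?K * (L2_dist lborel (f m) g + L2_dist lborel g (f n))"
      using K L2_dist_triangle[OF L(1) g(1) L(1)] by (intro mult_left_mono) auto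
    finally show ?thesis by (simp add: L2_dist_commute)
  qed
  have "\<exists>Y\<in>L2 M. (\<lambda>n. L2_dist M (X n) Y) \<longlonglongrightarrow> 0"
  proof (rule L2_complete[OF L(2)])
    fix e :: real assume e: "e > 0"
    then have "e / (2 * ?K) > 0" using K by simp
    then obtain N where N: "\<And>n. n \<ge> N \<Longrightarrow> L2_dist lborel (f n) g < e / (2 * ?K)"
      using LIMSEQ_D[OF g(2)] by (auto simp: abs_less_iff)
    have "L2_dist M (X m) (X n) \<le> e" if "m \<ge> N" "n \<ge> N" for m n
    proof -
      have "L2_dist M (X m) (X n) \<le> ?K * (e / (2 * ?K) + e / (2 * ?K))"
        using dXX[of m n] N[OF that(1)] N[OF that(2)] K
        by (intro order_trans[OF dXX] mult_left_mono add_mono) auto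
      then show ?thesis using K by simp
    qed
    then show "\<exists>N. \<forall>m\<ge>N. \<forall>n\<ge>N. L2_dist M (X m) (X n) \<le> e" by blast
  qed
  then obtain Y where Y: "Y \<in> L2 M" "(\<lambda>n. L2_dist M (X n) Y) \<longlonglongrightarrow> 0" by blast
  have "is_wiener_integral M B g Y"
    unfolding is_wiener_integral_def
  proof (intro conjI allI impI g Y)
    fix e :: real assume e: "e > 0"
    then have "\<forall>\<^sub>F n in sequentially. L2_dist lborel (f n) g < e/2 \<and> L2_dist M (X n) Y < e/2"
      using order_tendstoD(2)[OF g(2), of "e/2"] order_tendstoD(2)[OF Y(2), of "e/2"]
      by (auto intro: eventually_conj)
    then obtain n where n: "L2_dist lborel (f n) g < e/2" "L2_dist M (X n) Y < e/2"
      using eventually_happens[of _ sequentially] by auto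
    obtain m t a where t: "strict_mono_on {..m} t" and a: "L2_dist lborel (f n) (step_kernel m t a) < e/2"
       "L2_dist M (X n) (step_integral B m t a) < e/2"
      using f[of n] e unfolding is_wiener_integral_def by (meson half_gt_zero)
    have "L2_dist lborel g (step_kernel m t a) < e"
      using L2_dist_triangle[OF g(1) L(1)[of n] step_kernel_L2[OF t, of a]] n a by (simp add: L2_dist_commute)
    moreover have "L2_dist M Y (step_integral B m t a) < e"
      using L2_dist_triangle[OF Y(1) L(2)[of n] step_integral_L2[OF t, of a]] n a by (simp add: L2_dist_commute)
    ultimately show "\<exists>n t a. strict_mono_on {..n} t \<and> L2_dist lborel g (step_kernel n t a) < e \<and>
      L2_dist M Y (step_integral B n t a) < e" using t by blast
  qed
  with Y show ?thesis by blast
qed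

lemma is_wiener_integral_step:
  "strict_mono_on {..n} t \<Longrightarrow> is_wiener_integral M B (step_kernel n t a) (step_integral B n t a)"
  unfolding is_wiener_integral_def
  by (auto simp: step_kernel_L2 step_integral_L2 L2_dist_def intro!: exI[of _ n] exI[of _ t] exI[of _ a])

end

section \<open>Rapidly decreasing functions and existence of the Wiener integral\<close>

lemma integrable_inverse_square: "integrable lborel (\<lambda>x::real. 1 / (1 + x\<^sup>2))"
  using integrable_inverse_1_plus_square by (simp add: set_integrable_def inverse_eq_divide)

lemma one_plus_sq_pos [simp]: "0 < 1 + (x::real)\<^sup>2"
  by (simp add: add_pos_nonneg)

lemma one_plus_sq_neq0 [simp]: "1 + (x::real)\<^sup>2 \<noteq> 0"
  using one_plus_sq_pos[of x] by linarith

text \<open>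
  Peetre's inequality: quadratic decay survives translation, at the cost of a constant that is quadratic
  in the shift.
\<close>

lemma peetre: "1 + (x::real)\<^sup>2 \<le> 2 * (1 + y\<^sup>2) * (1 + (x - y)\<^sup>2)"
proof -
  have "0 \<le> (x - 2 * y)\<^sup>2" by simp
  then have "x\<^sup>2 \<le> 2 * y\<^sup>2 + 2 * (x - y)\<^sup>2" by (simp add: power2_eq_square algebra_simps)
  moreover define p where "p = y\<^sup>2 * (x - y)\<^sup>2"
  moreover have "0 \<le> p" by (simp add: p_def)
  moreover have "2 * (1 + y\<^sup>2) * (1 + (x - y)\<^sup>2) = 2 + 2 * y\<^sup>2 + 2 * (x - y)\<^sup>2 + 2 * p"
    by (simp add: p_def algebra_simps)
  ultimately show ?thesis by linarith
qed

definition quadratic_decay :: "(real \<Rightarrow> 'a::real_normed_vector) \<Rightarrow> real \<Rightarrow> bool" where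
  "quadratic_decay f C \<longleftrightarrow> (\<forall>x. norm (f x) \<le> C / (1 + x\<^sup>2))"

lemma quadratic_decayD: "quadratic_decay f C \<Longrightarrow> norm (f x) \<le> C / (1 + x\<^sup>2)"
  by (simp add: quadratic_decay_def)

lemma quadratic_decay_nonneg: "quadratic_decay f C \<Longrightarrow> 0 \<le> C"
  using quadratic_decayD[of f C 0] order_trans[OF norm_ge_zero[of "f 0"]] by fastforce

lemma quadratic_decay_L2:
  fixes f :: "real \<Rightarrow> real"
  assumes "quadratic_decay f C" "f \<in> borel_measurable borel"
  shows "f \<in> L2 lborel"
proof -
  have "integrable lborel (\<lambda>x. (f x)\<^sup>2)"
  proof (rule Bochner_Integration.integrable_bound)
    show "integrable lborel (\<lambda>x::real. C\<^sup>2 * (1 / (1 + x\<^sup>2)))"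
      using integrable_inverse_square by (intro integrable_mult_right)
    show "(\<lambda>x. (f x)\<^sup>2) \<in> borel_measurable lborel" using assms(2) by measurable
    show "AE x in lborel. norm ((f x)\<^sup>2) \<le> norm (C\<^sup>2 * (1 / (1 + x\<^sup>2)))"
    proof (rule AE_I2)
      fix x :: real
      have "\<bar>f x\<bar>\<^sup>2 \<le> (C / (1 + x\<^sup>2))\<^sup>2"
        using quadratic_decayD[OF assms(1), of x] by (intro power_mono) auto
      also have "\<dots> = C\<^sup>2 * (1 / (1 + x\<^sup>2)) * (1 / (1 + x\<^sup>2))"
        by (simp add: power2_eq_square)
      also have "\<dots> \<le> C\<^sup>2 * (1 / (1 + x\<^sup>2)) * 1"
        by (intro mult_left_mono) (auto simp: divide_simps add_nonneg_eq_0_iff)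
      finally show "norm ((f x)\<^sup>2) \<le> norm (C\<^sup>2 * (1 / (1 + x\<^sup>2)))" by simp
    qed
  qed
  then show ?thesis using assms(2) by (simp add: L2_def)
qed

lemma quadratic_decay_integrable:
  fixes f :: "real \<Rightarrow> 'a::{banach, second_countable_topology}"
  assumes "quadratic_decay f C" "f \<in> borel_measurable borel"
  shows "integrable lborel f"
proof (rule Bochner_Integration.integrable_bound)
  show "integrable lborel (\<lambda>x::real. C * (1 / (1 + x\<^sup>2)))"
    using integrable_inverse_square by (intro integrable_mult_right)
  show "AE x in lborel. norm (f x) \<le> norm (C * (1 / (1 + x\<^sup>2)))"
  proof (rule AE_I2)
    fix x :: real
    have "norm (f x) \<le> C * (1 / (1 + x\<^sup>2))" using quadratic_decayD[OF assms(1), of x] by simp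
    also have "\<dots> \<le> norm (C * (1 / (1 + x\<^sup>2)))" by (simp only: real_norm_def abs_ge_self)
    finally show "norm (f x) \<le> norm (C * (1 / (1 + x\<^sup>2)))" .
  qed
qed (use assms in simp)

lemma quadratic_decay_uniform:
  fixes f :: "'d::finite \<Rightarrow> real \<Rightarrow> 'a::real_normed_vector"
  assumes "\<And>l. \<exists>C. quadratic_decay (f l) C"
  shows "\<exists>C. \<forall>l. quadratic_decay (f l) C"
proof -
  obtain C where C: "\<And>l. quadratic_decay (f l) (C l)" using assms by metis
  have "quadratic_decay (f l) (\<Sum>l\<in>UNIV. C l)" for l
  proof -
    have "C l \<le> (\<Sum>l\<in>UNIV. C l)" using quadratic_decay_nonneg[OF C] by (intro member_le_sum) auto
    then have "C l / (1 + x\<^sup>2) \<le> (\<Sum>l\<in>UNIV. C l) / (1 + x\<^sup>2)" for x :: real by (intro divide_right_mono) auto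
    then show ?thesis using quadratic_decayD[OF C[of l]] unfolding quadratic_decay_def by (meson order_trans)
  qed
  then show ?thesis by blast
qed

lemma schwartz_quadratic_decay:
  assumes "schwartz f"
  shows "\<exists>C. quadratic_decay f C"
proof -
  obtain D where D: "D 0 = f" "\<And>m n. bounded (range (\<lambda>x. x ^ m *\<^sub>R D n x))"
    using assms by (auto simp: schwartz_def)
  obtain a where a: "\<And>x. norm (x ^ 0 *\<^sub>R D 0 x) \<le> a" using D(2)[of 0 0] by (auto simp: bounded_iff)
  obtain b where b: "\<And>x. norm (x ^ 2 *\<^sub>R D 0 x) \<le> b" using D(2)[of 2 0] by (auto simp: bounded_iff)
  have "norm (f x) \<le> (a + b) / (1 + x\<^sup>2)" for x
    using a[of x] b[of x] by (simp add: D(1) pos_le_divide_eq algebra_simps)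
  then show ?thesis by (auto simp: quadratic_decay_def)
qed

lemma schwartz_continuous:
  assumes "schwartz f"
  shows "continuous_on UNIV f"
proof -
  obtain D where D: "D 0 = f" "\<And>n x. (D n has_vector_derivative D (Suc n) x) (at x)"
    using assms by (auto simp: schwartz_def)
  show ?thesis using D(2)[of 0] unfolding D(1)
    by (auto simp: continuous_on_eq_continuous_within intro!: has_vector_derivative_continuous)
qed

lemma quadratic_decay_affine:
  assumes "quadratic_decay f C" "1 \<le> c"
  shows "quadratic_decay (\<lambda>x. f (c * x - k)) (C * (2 * (1 + k\<^sup>2)))"
  unfolding quadratic_decay_def
proof
  fix x :: real
  have "1 * \<bar>x\<bar> \<le> c * \<bar>x\<bar>" using assms(2) by (intro mult_right_mono) auto
  then have "\<bar>x\<bar> \<le> \<bar>c * x\<bar>" using assms(2) by (simp add: abs_mult)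
  then have "x\<^sup>2 \<le> (c * x)\<^sup>2" by (simp only: abs_le_square_iff)
  then have *: "1 + x\<^sup>2 \<le> 2 * (1 + k\<^sup>2) * (1 + (c * x - k)\<^sup>2)"
    using peetre[of "c * x" k] by linarith
  have "norm (f (c * x - k)) \<le> C / (1 + (c * x - k)\<^sup>2)" by (rule quadratic_decayD[OF assms(1)])
  also have "\<dots> \<le> C * (2 * (1 + k\<^sup>2)) / (1 + x\<^sup>2)"
    using mult_left_mono[OF * quadratic_decay_nonneg[OF assms(1)]]
    by (simp add: divide_simps mult_ac)
  finally show "norm (f (c * x - k)) \<le> C * (2 * (1 + k\<^sup>2)) / (1 + x\<^sup>2)" .
qed

lemma AE_distinct_coordinates:
  "AE x in (lborel :: (real^'d) measure). \<forall>l l'. l \<noteq> l' \<longrightarrow> x $ l \<noteq> x $ l'"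
proof -
  have "AE x in (lborel :: (real^'d) measure). x $ l \<noteq> x $ l'" if "l \<noteq> l'" for l l' :: 'd
  proof -
    have ne: "axis l 1 - axis l' 1 \<noteq> (0 :: real^'d)" using that by (simp add: axis_eq_axis)
    have "negligible {x :: real^'d. (axis l 1 - axis l' 1) \<bullet> x = (0 :: real)}"
      by (intro negligible_hyperplane) (use ne in simp)
    moreover have "\<not> x $ l \<noteq> x $ l' \<Longrightarrow> (axis l 1 - axis l' 1) \<bullet> x = (0 :: real)" for x :: "real^'d"
      by (simp add: inner_diff_left inner_axis')
    ultimately have "AE x in (lebesgue :: (real^'d) measure). x $ l \<noteq> x $ l'"
      unfolding eventually_ae_filter_negligible by blast
    then show ?thesis by (simp add: AE_completion_iff)
  qed
  then show ?thesis by (simp add: AE_all_countable)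
qed

text \<open>
  The approximating step kernels sample the function at the left end points of the cells of a grid that
  becomes finer and wider. They vanish on cells that meet the diagonals, which is harmless in
  the limit since points with two equal coordinates form a null set. Quadratic decay, stable under shifts of size
  at most one, supplies a common square integrable majorant.
\<close>

lemma product_step_approx:
  fixes f :: "'d::finite \<Rightarrow> real \<Rightarrow> real"
  assumes cont: "\<And>l. continuous_on UNIV (f l)" and decay: "\<And>l. quadratic_decay (f l) C"
  defines "F \<equiv> \<lambda>x::real^'d. \<Prod>l\<in>UNIV. f l (x $ l)"
  shows "\<exists>n t a. (\<forall>N. strict_mono_on {..n N} (t N)) \<and>
     (\<lambda>N. L2_dist lborel F (step_kernel (n N) (t N) (a N))) \<longlonglongrightarrow> 0"
proof -
  define q where "q N = real (Suc N)" for N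
  have q: "q N \<ge> 1" for N by (simp add: q_def)
  (* The N-th grid has mesh 1 / q N and covers the interval from - q N to q N. *)
  define n where "n N = 2 * (Suc N)\<^sup>2" for N
  have nq: "real (n N) = 2 * (q N)\<^sup>2" for N by (simp add: n_def q_def)
  define t where "t N i = real i / q N - q N" for N i
  define a where "a N i = (\<Prod>l\<in>UNIV. f l (t N (i l)))" for N and i :: "'d \<Rightarrow> nat"
  have t: "strict_mono_on {..n N} (t N)" for N
    using q[of N] by (intro strict_mono_onI) (auto simp: t_def divide_simps)
  have [measurable]: "f l \<in> borel_measurable borel" for l
    using cont by (rule borel_measurable_continuous_onI)
  have C: "0 \<le> C" using quadratic_decay_nonneg[OF decay] .
  (* The index of the cell that contains x $ l; cells are open on the left, whence the ceiling. *)
  define cell where "cell N x l = nat (\<lceil>(x $ l + q N) * q N\<rceil> - 1)" for N and x :: "real^'d" and l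
  have cell: "cell N x l < n N" "t N (cell N x l) < x $ l" "x $ l \<le> t N (Suc (cell N x l))"
    if "\<bar>x $ l\<bar> < q N" for N x l
  proof -
    define y where "y = (x $ l + q N) * q N"
    have y: "0 < y" using that q[of N] unfolding y_def by (intro mult_pos_pos) auto
    have "y < (q N + q N) * q N" using that q[of N] unfolding y_def by (intro mult_strict_right_mono) auto
    then have y2: "y < real (n N)" by (simp add: nq power2_eq_square algebra_simps)
    have "1 \<le> \<lceil>y\<rceil>" using y by linarith
    then have r: "real (cell N x l) = of_int \<lceil>y\<rceil> - 1" by (simp add: cell_def y_def)
    show "cell N x l < n N" using y2 r by linarith
    have xy: "x $ l = y / q N - q N" using q[of N] by (simp add: y_def field_simps)
    show "t N (cell N x l) < x $ l"
      unfolding t_def xy r using q[of N] by (intro diff_strict_right_mono divide_strict_right_mono; linarith)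
    show "x $ l \<le> t N (Suc (cell N x l))"
      unfolding t_def xy of_nat_Suc r using q[of N] by (intro diff_right_mono divide_right_mono; linarith)
  qed
  have width: "t N (Suc i) - t N i = 1 / q N" for N i using q[of N] by (simp add: t_def field_simps)
  have invq: "1 / q N \<le> 1" for N using q[of N] by simp
  define G where "G N = step_kernel (n N) (t N) (a N)" for N
  (* A bound for all f l at any point within distance 1 of x; the mesh is at most 1. *)
  define g where "g x = 4 * C / (1 + x\<^sup>2)" for x :: real
  have gd: "quadratic_decay g (4 * C)" using C by (simp add: quadratic_decay_def g_def)
  have gm [measurable]: "g \<in> borel_measurable borel" unfolding g_def[abs_def] by measurable
  have gL: "(\<lambda>x::real^'d. \<Prod>l\<in>UNIV. g (x $ l)) \<in> L2 lborel"
    using quadratic_decay_L2[OF gd gm] by (intro L2_prod_vec) simp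
  have fL: "F \<in> L2 lborel"
    unfolding F_def by (intro L2_prod_vec quadratic_decay_L2[OF decay]) simp
  have GL: "G N \<in> L2 lborel" for N unfolding G_def by (rule step_kernel_L2[OF t])
  have g0: "0 \<le> g x" for x using C by (simp add: g_def)
  have fbd: "\<bar>f l u\<bar> \<le> g v" if "\<bar>v - u\<bar> \<le> 1" for l u v
  proof -
    have "(v - u)\<^sup>2 \<le> 1" using that by (simp add: abs_square_le_1)
    then have "2 * (1 + u\<^sup>2) * (1 + (v - u)\<^sup>2) \<le> 2 * (1 + u\<^sup>2) * 2"
      by (intro mult_left_mono) auto
    then have "1 + v\<^sup>2 \<le> 4 * (1 + u\<^sup>2)" using peetre[of v u] by simp
    then have "C * (1 + v\<^sup>2) \<le> C * (4 * (1 + u\<^sup>2))" using C by (rule mult_left_mono)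
    then have "C / (1 + u\<^sup>2) \<le> g v" by (simp add: g_def divide_simps mult_ac)
    then show ?thesis using quadratic_decayD[OF decay, of l u] by simp
  qed
  have Fbd: "\<bar>F x\<bar> \<le> (\<Prod>l\<in>UNIV. g (x $ l))" for x
    unfolding F_def abs_prod by (intro prod_mono) (auto intro!: fbd)
  have Gbd: "\<bar>G N x\<bar> \<le> (\<Prod>l\<in>UNIV. g (x $ l))" for N x
  proof (cases "\<exists>i. \<forall>l. i l < n N \<and> t N (i l) < x $ l \<and> x $ l \<le> t N (Suc (i l))")
    case True
    then obtain i where i: "\<And>l. i l < n N" "\<And>l. t N (i l) < x $ l" "\<And>l. x $ l \<le> t N (Suc (i l))" by blast
    have "\<bar>a N i\<bar> \<le> (\<Prod>l\<in>UNIV. g (x $ l))"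
      unfolding a_def abs_prod
    proof (intro prod_mono conjI)
      fix l show "\<bar>f l (t N (i l))\<bar> \<le> g (x $ l)"
        using i(2)[of l] i(3)[of l] width[of N "i l"] invq[of N] by (intro fbd) (simp add: abs_le_iff)
    qed auto
    then show ?thesis unfolding G_def step_kernel_eq[OF t i] by (auto intro!: prod_nonneg g0)
  next
    case False
    then have "G N x = 0" unfolding G_def by (intro step_kernel_eq_0) blast
    then show ?thesis by (auto intro!: prod_nonneg g0)
  qed
  have lim: "(\<lambda>N. G N x) \<longlonglongrightarrow> F x" if dist: "\<And>l l'. l \<noteq> l' \<Longrightarrow> x $ l \<noteq> x $ l'" for x
  proof -
    have qlim: "filterlim q at_top sequentially"
      unfolding q_def by (rule filterlim_compose[OF filterlim_real_sequentially filterlim_Suc])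
    have ilim: "(\<lambda>N. 1 / q N) \<longlonglongrightarrow> 0"
      using tendsto_inverse_0_at_top[OF qlim] by (simp add: inverse_eq_divide)
    have ev1: "\<forall>\<^sub>F N in sequentially. \<forall>l. \<bar>x $ l\<bar> < q N"
      unfolding eventually_all_finite
      using filterlim_at_top_dense[THEN iffD1, OF qlim] by (intro eventually_all_finite) blast
    have ev2: "\<forall>\<^sub>F N in sequentially. \<forall>l l'. l \<noteq> l' \<longrightarrow> 1 / q N < \<bar>x $ l - x $ l'\<bar>"
    proof (intro eventually_all_finite)
      fix l l' show "\<forall>\<^sub>F N in sequentially. l \<noteq> l' \<longrightarrow> 1 / q N < \<bar>x $ l - x $ l'\<bar>"
        using order_tendstoD(2)[OF ilim, of "\<bar>x $ l - x $ l'\<bar>"] dist[of l l'] by (cases "l = l'") auto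
    qed
    have tl: "(\<lambda>N. t N (cell N x l)) \<longlonglongrightarrow> x $ l" for l
    proof (rule LIM_zero_cancel, rule Lim_null_comparison[OF _ ilim])
      show "\<forall>\<^sub>F N in sequentially. norm (t N (cell N x l) - x $ l) \<le> 1 / q N"
        using ev1
      proof eventually_elim
        case (elim N)
        then show ?case using cell[of x l N] width[of N "cell N x l"] by auto
      qed
    qed
    have "(\<lambda>N. a N (cell N x)) \<longlonglongrightarrow> F x"
      unfolding a_def F_def
      by (intro tendsto_prod continuous_on_tendsto_compose[OF cont tl]) auto
    moreover have "\<forall>\<^sub>F N in sequentially. a N (cell N x) = G N x"
      using ev1 ev2
    proof eventually_elim
      case (elim N)
      have "inj (cell N x)"
      proof (rule injI, rule ccontr)
        fix l l' assume eq: "cell N x l = cell N x l'" and ne: "l \<noteq> l'"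
        have "\<bar>x $ l - x $ l'\<bar> \<le> 1 / q N"
          using cell[of x l N] cell[of x l' N] elim(1) width[of N "cell N x l"] eq by (auto simp: abs_le_iff)
        then show False using elim(2) ne by fastforce
      qed
      then show ?case
        unfolding G_def using step_kernel_eq[OF t, of "cell N x" N x "a N"] cell elim(1) by simp
    qed
    ultimately show ?thesis by (rule Lim_transform_eventually)
  qed
  have "(\<lambda>N. LINT x|lborel. (F x - G N x)\<^sup>2) \<longlonglongrightarrow> (LINT x|(lborel :: (real^'d) measure). 0)"
  proof (rule integral_dominated_convergence)
    show "(\<lambda>x::real^'d. 0::real) \<in> borel_measurable lborel" by simp
    show "(\<lambda>x. (F x - G N x)\<^sup>2) \<in> borel_measurable lborel" for N
      using L2_measurable[OF fL] L2_measurable[OF GL[of N]] by simp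
    show "integrable lborel (\<lambda>x::real^'d. 4 * (\<Prod>l\<in>UNIV. g (x $ l))\<^sup>2)"
      using L2_square_integrable[OF gL] by simp
    show "AE x in lborel. (\<lambda>N. (F x - G N x)\<^sup>2) \<longlonglongrightarrow> 0"
      using AE_distinct_coordinates
    proof eventually_elim
      case (elim x)
      have "(\<lambda>N. (F x - G N x)\<^sup>2) \<longlonglongrightarrow> (F x - F x)\<^sup>2"
        by (intro tendsto_intros lim) (use elim in blast)
      then show ?case by simp
    qed
    show "AE x in lborel. norm ((F x - G N x)\<^sup>2) \<le> 4 * (\<Prod>l\<in>UNIV. g (x $ l))\<^sup>2" for N
    proof (rule AE_I2)
      fix x :: "real^'d"
      have "\<bar>F x - G N x\<bar> \<le> 2 * (\<Prod>l\<in>UNIV. g (x $ l))" using Fbd[of x] Gbd[of N x] by simp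
      then have "\<bar>F x - G N x\<bar>\<^sup>2 \<le> (2 * (\<Prod>l\<in>UNIV. g (x $ l)))\<^sup>2" by (intro power_mono) auto
      then show "norm ((F x - G N x)\<^sup>2) \<le> 4 * (\<Prod>l\<in>UNIV. g (x $ l))\<^sup>2" by (simp add: power_mult_distrib)
    qed
  qed
  then have "(\<lambda>N. sqrt (LINT x|lborel. (F x - G N x)\<^sup>2)) \<longlonglongrightarrow> sqrt 0"
    by (intro tendsto_real_sqrt) simp
  then have "(\<lambda>N. L2_dist lborel F (G N)) \<longlonglongrightarrow> 0" by (simp add: L2_dist_def)
  then show ?thesis using t unfolding G_def by blast
qed

context
  fixes M :: "'w measure" and B :: "real \<Rightarrow> 'w \<Rightarrow> real"
  assumes bm: "standard_brownian_motion M B"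
begin

lemma is_wiener_integral_product:
  fixes f :: "'d::finite \<Rightarrow> real \<Rightarrow> real"
  assumes "\<And>l. continuous_on UNIV (f l)" and "\<And>l. quadratic_decay (f l) C"
  shows "\<exists>X. is_wiener_integral M B (\<lambda>x::real^'d. \<Prod>l\<in>UNIV. f l (x $ l)) X"
proof -
  obtain n t a where t: "\<And>N. strict_mono_on {..n N} (t N)" and
     lim: "(\<lambda>N. L2_dist lborel (\<lambda>x::real^'d. \<Prod>l\<in>UNIV. f l (x $ l)) (step_kernel (n N) (t N) (a N))) \<longlonglongrightarrow> 0"
    using product_step_approx[where f=f and C=C, OF assms] by blast
  have L: "(\<lambda>x::real^'d. \<Prod>l\<in>UNIV. f l (x $ l)) \<in> L2 lborel"
    using assms by (intro L2_prod_vec quadratic_decay_L2[OF assms(2)] borel_measurable_continuous_onI) simp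
  have w: "is_wiener_integral M B (step_kernel (n N) (t N) (a N)) (step_integral B (n N) (t N) (a N))" for N
    by (rule is_wiener_integral_step[OF bm t])
  have "(\<lambda>N. L2_dist lborel (step_kernel (n N) (t N) (a N)) (\<lambda>x::real^'d. \<Prod>l\<in>UNIV. f l (x $ l))) \<longlonglongrightarrow> 0"
    using lim by (subst L2_dist_commute)
  from is_wiener_integral_limit[OF bm w L this] show ?thesis by blast
qed

lemma is_wiener_integral_some:
  "\<exists>X. is_wiener_integral M B f X \<Longrightarrow> is_wiener_integral M B f (wiener_integral M B f)"
  unfolding wiener_integral_def by (erule someI_ex)

lemma is_wiener_integral_zero: "is_wiener_integral M B (\<lambda>x::real^'d. 0) (\<lambda>\<omega>. 0)"
proof -
  have "strict_mono_on {..0::nat} (\<lambda>_. 0 :: real)" by (auto intro!: strict_mono_onI)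
  from is_wiener_integral_step[OF bm this]
  have "is_wiener_integral M B (step_kernel 0 (\<lambda>_. 0) (\<lambda>_. 0) :: real^'d \<Rightarrow> real) (step_integral B 0 (\<lambda>_. 0) (\<lambda>_ :: 'd \<Rightarrow> nat. 0))" .
  then show ?thesis by (simp add: step_kernel_def[abs_def] step_integral_def[abs_def])
qed

lemma is_wiener_integral_sum:
  fixes f :: "'i \<Rightarrow> real^'d \<Rightarrow> real"
  assumes "\<And>i. i \<in> I \<Longrightarrow> is_wiener_integral M B (f i) (X i)"
  shows "is_wiener_integral M B (\<lambda>x. \<Sum>i\<in>I. c i * f i x) (\<lambda>\<omega>. \<Sum>i\<in>I. c i * X i \<omega>)"
  using assms
proof (induction I rule: infinite_finite_induct)
  case (insert i I)
  have "is_wiener_integral M B (\<lambda>x. c i * f i x + 1 * (\<Sum>i\<in>I. c i * f i x)) (\<lambda>\<omega>. c i * X i \<omega> + 1 * (\<Sum>i\<in>I. c i * X i \<omega>))"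
    using insert by (intro is_wiener_integral_lincomb bm) auto
  then show ?case using insert by simp
qed (auto simp: is_wiener_integral_zero)

end

section \<open>Fourier transform: inversion\<close>

lemma norm_exp_ii [simp]: "norm (exp (- (\<i> * complex_of_real a * complex_of_real b))) = 1"
  by (simp add: norm_exp_eq_Re)

lemma fourier_integrable:
  fixes f :: "real \<Rightarrow> complex"
  assumes "integrable lborel f"
  shows "integrable lborel (\<lambda>x. exp (- (\<i> * of_real \<xi> * of_real x)) * f x)"
proof (rule Bochner_Integration.integrable_bound[OF assms])
  note [measurable] = borel_measurable_integrable[OF assms]
  show "(\<lambda>x. exp (- (\<i> * of_real \<xi> * of_real x)) * f x) \<in> borel_measurable lborel" by measurable
qed (simp add: norm_mult)

lemma fourier_norm_le:
  assumes "integrable lborel f"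
  shows "norm (fourier f \<xi>) \<le> (LINT x|lborel. norm (f x)) / sqrt (2 * pi)"
proof -
  have "norm (CLINT x|lborel. exp (- (\<i> * of_real \<xi> * of_real x)) * f x) \<le> (LINT x|lborel. norm (f x))"
    by (rule order_trans[OF integral_norm_bound]) (simp add: norm_mult)
  then show ?thesis by (simp add: fourier_def norm_divide divide_right_mono)
qed

lemma fourier_diff:
  assumes "integrable lborel f" "integrable lborel g"
  shows "fourier (\<lambda>x. f x - g x) \<xi> = fourier f \<xi> - fourier g \<xi>"
  using assms by (simp add: fourier_def right_diff_distrib fourier_integrable diff_divide_distrib)

lemma fourier_exchange:
  fixes f g :: "real \<Rightarrow> complex"
  assumes f: "integrable lborel f" and g: "integrable lborel g"
  shows "(CLINT y|lborel. f y * fourier g y) = (CLINT y|lborel. fourier f y * g y)"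
proof -
  note [measurable] = borel_measurable_integrable[OF f] borel_measurable_integrable[OF g]
  define k where "k x y = f x * (exp (- (\<i> * of_real x * of_real y)) * g y)" for x y :: real
  have "integrable (lborel \<Otimes>\<^sub>M lborel) (\<lambda>(x, y). k x y)"
  proof (rule lborel_pair.Fubini_integrable)
    show "(\<lambda>(x, y). k x y) \<in> borel_measurable (lborel \<Otimes>\<^sub>M lborel)"
      unfolding k_def by measurable
    have "(\<lambda>x. LINT y|lborel. norm (k x y)) = (\<lambda>x. norm (f x) * (LINT y|lborel. norm (g y)))"
      by (simp add: k_def norm_mult)
    then show "integrable lborel (\<lambda>x. LINT y|lborel. norm (case (x, y) of (x, y) \<Rightarrow> k x y))"
      using f by simp
    show "AE x in lborel. integrable lborel (\<lambda>y. case (x, y) of (x, y) \<Rightarrow> k x y)"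
      unfolding k_def using fourier_integrable[OF g] by (intro AE_I2) simp
  qed
  then have "(CLINT y|lborel. CLINT x|lborel. k x y) = (CLINT x|lborel. CLINT y|lborel. k x y)"
    by (rule lborel_pair.Fubini_integral)
  moreover have "(CLINT y|lborel. k x y) = f x * (CLINT y|lborel. exp (- (\<i> * of_real x * of_real y)) * g y)" for x
    by (simp add: k_def)
  moreover have "(CLINT x|lborel. k x y) = (CLINT x|lborel. exp (- (\<i> * of_real y * of_real x)) * f x) * g y" for y
  proof -
    have "k x y = (exp (- (\<i> * of_real y * of_real x)) * f x) * g y" for x by (simp add: k_def mult_ac)
    then show ?thesis by simp
  qed
  ultimately show ?thesis by (simp add: fourier_def)
qed

lemma gaussian_fourier:
  "(CLINT z|lborel. exp (\<i> * of_real u * of_real z) * of_real (exp (- z\<^sup>2 / 2))) =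
     of_real (sqrt (2 * pi)) * of_real (exp (- u\<^sup>2 / 2))"
proof -
  have "of_real (exp (- u\<^sup>2 / 2)) = char std_normal_distribution u"
    by (simp add: char_std_normal_distribution)
  also have "\<dots> = (CLINT z|lborel. std_normal_density z *\<^sub>R exp (\<i> * of_real (u * z)))"
    unfolding char_def by (subst integral_density) (auto simp: normal_density_nonneg)
  also have "\<dots> = (CLINT z|lborel. exp (\<i> * of_real u * of_real z) * of_real (exp (- z\<^sup>2 / 2)) / of_real (sqrt (2 * pi)))"
    by (intro Bochner_Integration.integral_cong refl) (simp add: std_normal_density_def scaleR_conv_of_real mult_ac)
  also have "\<dots> = (CLINT z|lborel. exp (\<i> * of_real u * of_real z) * of_real (exp (- z\<^sup>2 / 2))) / of_real (sqrt (2 * pi))"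
    by (rule integral_divide_zero)
  finally show ?thesis by (simp add: field_simps)
qed

lemma gaussian_integrable: "integrable lborel (\<lambda>z::real. exp (- z\<^sup>2 / 2))"
proof -
  have "integrable lborel (\<lambda>z. sqrt (2 * pi) * std_normal_density z)"
    by (intro integrable_mult_right integrable_normal_density) simp
  then show ?thesis by (simp add: std_normal_density_def)
qed

lemma gaussian_integral: "(LINT z|lborel. exp (- z\<^sup>2 / 2)) = sqrt (2 * pi)"
proof -
  have "(LINT z|lborel. sqrt (2 * pi) * std_normal_density z) = sqrt (2 * pi)" by simp
  then show ?thesis by (simp add: std_normal_density_def)
qed

text \<open>
  The multiplication formula is applied to \<open>f\<close> and an exponential damped by a Gaussian of width
  \<open>1/s\<close>, whose transform is a Gaussian of width \<open>s\<close> centred at \<open>x\<close>. As \<open>s\<close> tends to \<open>0\<close>, one side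
  tends to \<open>f x\<close> by continuity and the other to the inverse transform.
\<close>

theorem fourier_inversion:
  fixes f :: "real \<Rightarrow> complex"
  assumes f: "integrable lborel f" and cont: "continuous_on UNIV f" and bdd: "\<And>x. norm (f x) \<le> K"
    and Ff: "integrable lborel (fourier f)"
  shows "fourier (fourier f) (- x) = f x"
proof -
  note [measurable] = borel_measurable_integrable[OF f] borel_measurable_integrable[OF Ff]
  define s where "s n = inverse (real (Suc n))" for n
  have s: "s n > 0" for n by (simp add: s_def)
  have slim: "s \<longlonglongrightarrow> 0" unfolding s_def by (rule LIMSEQ_inverse_real_of_nat)
  define g where "g n \<xi> = exp (- (\<i> * of_real (-x) * of_real \<xi>)) * of_real (exp (- (s n * \<xi>)\<^sup>2 / 2))" for n and \<xi> :: real
  have gi: "integrable lborel (g n)" for n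
  proof -
    have "integrable lborel (\<lambda>\<xi>. exp (- (0 + s n * \<xi>)\<^sup>2 / 2))"
      by (rule lborel_integrable_real_affine[OF gaussian_integrable]) (use s[of n] in simp)
    then have "integrable lborel (\<lambda>\<xi>. complex_of_real (exp (- (s n * \<xi>)\<^sup>2 / 2)))" by simp
    from fourier_integrable[OF this, of "-x"] show ?thesis by (simp add: g_def[abs_def])
  qed
  have Fg: "fourier (g n) y = of_real (exp (- ((x - y) / s n)\<^sup>2 / 2) / s n)" for n y
  proof -
    have "(CLINT \<xi>|lborel. exp (- (\<i> * of_real y * of_real \<xi>)) * g n \<xi>) =
        (CLINT \<xi>|lborel. exp (\<i> * of_real ((x - y) / s n) * of_real (0 + s n * \<xi>)) * of_real (exp (- (0 + s n * \<xi>)\<^sup>2 / 2)))"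
    proof (intro Bochner_Integration.integral_cong refl)
      fix \<xi> :: real
      have "\<i> * of_real ((x - y) / s n) * of_real (0 + s n * \<xi>) =
          - (\<i> * of_real y * of_real \<xi>) + - (\<i> * of_real (- x) * complex_of_real \<xi>)"
        using s[of n] by (simp add: field_simps)
      then have "exp (\<i> * of_real ((x - y) / s n) * of_real (0 + s n * \<xi>)) =
          exp (- (\<i> * of_real y * of_real \<xi>)) * exp (- (\<i> * of_real (- x) * complex_of_real \<xi>))"
        by (simp only: exp_add)
      then show "exp (- (\<i> * of_real y * of_real \<xi>)) * g n \<xi> =
          exp (\<i> * of_real ((x - y) / s n) * of_real (0 + s n * \<xi>)) * of_real (exp (- (0 + s n * \<xi>)\<^sup>2 / 2))"
        by (simp add: g_def)
    qed
    also have "\<dots> = (CLINT z|lborel. exp (\<i> * of_real ((x - y) / s n) * of_real z) * of_real (exp (- z\<^sup>2 / 2))) /\<^sub>R s n"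
      using s[of n] lborel_integral_real_affine[of "s n" "\<lambda>z. exp (\<i> * of_real ((x - y) / s n) * of_real z) * of_real (exp (- z\<^sup>2 / 2))" 0]
      by simp
    also have "\<dots> = of_real (sqrt (2 * pi)) * of_real (exp (- ((x - y) / s n)\<^sup>2 / 2)) /\<^sub>R s n"
      by (subst gaussian_fourier) simp
    finally show ?thesis by (simp add: fourier_def scaleR_conv_of_real field_simps)
  qed
  have "(CLINT y|lborel. fourier f y * g n y) = (CLINT z|lborel. f (x + s n * z) * of_real (exp (- z\<^sup>2 / 2)))" for n
  proof -
    have "(CLINT y|lborel. fourier f y * g n y) = (CLINT y|lborel. f y * fourier (g n) y)"
      by (rule fourier_exchange[OF f gi, symmetric])
    also have "\<dots> = \<bar>s n\<bar> *\<^sub>R (CLINT z|lborel. f (x + s n * z) * fourier (g n) (x + s n * z))"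
      by (rule lborel_integral_real_affine) (use s[of n] in simp)
    also have "\<dots> = (CLINT z|lborel. f (x + s n * z) * of_real (exp (- z\<^sup>2 / 2)))"
      using s[of n] by (simp add: Fg scaleR_conv_of_real)
    finally show ?thesis .
  qed
  moreover have "(\<lambda>n. CLINT z|lborel. f (x + s n * z) * of_real (exp (- z\<^sup>2 / 2))) \<longlonglongrightarrow>
      (CLINT z|lborel. f x * of_real (exp (- z\<^sup>2 / 2)))"
  proof (rule integral_dominated_convergence)
    show "integrable lborel (\<lambda>z. K * exp (- z\<^sup>2 / 2))" using gaussian_integrable by simp
    show "AE z in lborel. (\<lambda>n. f (x + s n * z) * of_real (exp (- z\<^sup>2 / 2))) \<longlonglongrightarrow> f x * of_real (exp (- z\<^sup>2 / 2))"
    proof (intro AE_I2 tendsto_mult tendsto_const)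
      fix z
      have "(\<lambda>n. x + s n * z) \<longlonglongrightarrow> x + 0 * z" by (intro tendsto_intros slim)
      then show "(\<lambda>n. f (x + s n * z)) \<longlonglongrightarrow> f x"
        using cont by (intro continuous_on_tendsto_compose[OF cont]) auto
    qed
    show "AE z in lborel. norm (f (x + s n * z) * of_real (exp (- z\<^sup>2 / 2))) \<le> K * exp (- z\<^sup>2 / 2)" for n
      using bdd by (intro AE_I2) (simp add: norm_mult mult_right_mono)
  qed auto
  ultimately have 1: "(\<lambda>n. CLINT y|lborel. fourier f y * g n y) \<longlonglongrightarrow> f x * of_real (sqrt (2 * pi))"
    using gaussian_integral by simp
  have 2: "(\<lambda>n. CLINT y|lborel. fourier f y * g n y) \<longlonglongrightarrow> (CLINT y|lborel. exp (- (\<i> * of_real (-x) * of_real y)) * fourier f y)"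
  proof (rule integral_dominated_convergence)
    show "integrable lborel (\<lambda>y. norm (fourier f y))" using Ff by simp
    show "(\<lambda>y. fourier f y * g n y) \<in> borel_measurable lborel" for n unfolding g_def by measurable
    show "(\<lambda>y. exp (- (\<i> * of_real (-x) * of_real y)) * fourier f y) \<in> borel_measurable lborel" by measurable
    show "AE y in lborel. (\<lambda>n. fourier f y * g n y) \<longlonglongrightarrow> exp (- (\<i> * of_real (-x) * of_real y)) * fourier f y"
    proof (rule AE_I2)
      fix y :: real
      have "(\<lambda>n. fourier f y * (exp (- (\<i> * of_real (-x) * of_real y)) * of_real (exp (- (s n * y)\<^sup>2 / 2)))) \<longlonglongrightarrow>
         fourier f y * (exp (- (\<i> * of_real (-x) * of_real y)) * of_real (exp (- (0 * y)\<^sup>2 / 2)))"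
        by (intro tendsto_intros slim) auto
      then show "(\<lambda>n. fourier f y * g n y) \<longlonglongrightarrow> exp (- (\<i> * of_real (-x) * of_real y)) * fourier f y"
        by (simp add: g_def mult.commute)
    qed
    show "AE y in lborel. norm (fourier f y * g n y) \<le> norm (fourier f y)" for n
    proof (rule AE_I2)
      fix y
      have "norm (g n y) \<le> 1"
        unfolding g_def norm_mult norm_exp_ii by simp
      then show "norm (fourier f y * g n y) \<le> norm (fourier f y)"
        using mult_left_mono[of "norm (g n y)" 1 "norm (fourier f y)"] by (simp add: norm_mult)
    qed
  qed
  have "(CLINT y|lborel. exp (- (\<i> * of_real (-x) * of_real y)) * fourier f y) = f x * of_real (sqrt (2 * pi))"
    by (rule LIMSEQ_unique[OF 2 1])
  then show ?thesis by (simp add: fourier_def)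
qed

lemma fourier_has_derivative:
  fixes f :: "real \<Rightarrow> complex"
  assumes f: "integrable lborel f" and xf: "integrable lborel (\<lambda>x. of_real x * f x)"
  shows "(fourier f has_vector_derivative fourier (\<lambda>x. - \<i> * of_real x * f x) \<xi>) (at \<xi>)"
proof -
  note [measurable] = borel_measurable_integrable[OF f]
  let ?c = "of_real (sqrt (2 * pi)) :: complex"
  have g: "integrable lborel (\<lambda>x. - \<i> * of_real x * f x)"
    using integrable_mult_right[OF xf, of "- \<i>"] by (simp add: mult.assoc)
  (* The quadratic bound on the remainder r gives pointwise convergence of the difference quotients,
     the linear bound gives the integrable majorant. *)
  define r where "r u = exp (\<i> * complex_of_real u) - (1 + \<i> * of_real u)" for u
  have r1: "norm (r u) \<le> u\<^sup>2 / 2" for u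
    using iexp_approx1[of u 1] by (simp add: r_def numeral_2_eq_2)
  have r2: "norm (r u) \<le> 2 * \<bar>u\<bar>" for u
    using iexp_approx2[of u 1] by (simp add: r_def)
  have eq: "fourier f (\<xi> + h) - fourier f \<xi> - h *\<^sub>R fourier (\<lambda>x. - \<i> * of_real x * f x) \<xi> =
     (CLINT x|lborel. r (- h * x) * (exp (- (\<i> * of_real \<xi> * of_real x)) * f x)) / ?c" for h
  proof -
    have *: "r (- h * x) * (exp (- (\<i> * of_real \<xi> * of_real x)) * f x) =
      exp (- (\<i> * of_real (\<xi> + h) * of_real x)) * f x - exp (- (\<i> * of_real \<xi> * of_real x)) * f x
       - of_real h * (exp (- (\<i> * of_real \<xi> * of_real x)) * (- \<i> * of_real x * f x))" for x
    proof -
      have "exp (- (\<i> * of_real (\<xi> + h) * of_real x)) = exp (\<i> * complex_of_real (- h * x)) * exp (- (\<i> * of_real \<xi> * of_real x))"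
        by (simp add: exp_add[symmetric] algebra_simps)
      then show ?thesis by (simp add: r_def algebra_simps)
    qed
    have lin: "(CLINT x|lborel. a x - b x - c * d x) = (CLINT x|lborel. a x) - (CLINT x|lborel. b x) - c * (CLINT x|lborel. d x)"
      if "integrable lborel a" "integrable lborel b" "integrable lborel d" for a b d :: "real \<Rightarrow> complex" and c
      using that by simp
    show ?thesis
      unfolding * lin[OF fourier_integrable[OF f] fourier_integrable[OF f] fourier_integrable[OF g]] fourier_def scaleR_conv_of_real
      by (simp only: diff_divide_distrib times_divide_eq_right)
  qed
  have "((\<lambda>h. norm (fourier f (\<xi> + h) - fourier f \<xi> - h *\<^sub>R fourier (\<lambda>x. - \<i> * of_real x * f x) \<xi>) / norm h) \<longlongrightarrow> 0) (at 0)"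
    unfolding tendsto_at_iff_sequentially
  proof (intro allI impI)
    fix X :: "nat \<Rightarrow> real" assume X: "\<forall>i. X i \<in> UNIV - {0}" and Xlim: "X \<longlonglongrightarrow> 0"
    have [measurable]: "r \<in> borel_measurable borel" unfolding r_def by measurable
    have "(\<lambda>n. LINT x|lborel. norm (r (- X n * x)) / \<bar>X n\<bar> * norm (f x)) \<longlonglongrightarrow> (LINT x|(lborel :: real measure). 0)"
    proof (rule integral_dominated_convergence)
      show "integrable lborel (\<lambda>x. 2 * norm (of_real x * f x))" using xf by (intro integrable_mult_right integrable_norm)
      show "AE x in lborel. (\<lambda>n. norm (r (- X n * x)) / \<bar>X n\<bar> * norm (f x)) \<longlonglongrightarrow> 0"
      proof (rule AE_I2)
        fix x :: real
        have "(\<lambda>n. \<bar>X n\<bar> * (x\<^sup>2 / 2) * norm (f x)) \<longlonglongrightarrow> \<bar>0\<bar> * (x\<^sup>2 / 2) * norm (f x)"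
          by (intro tendsto_intros Xlim)
        then have "(\<lambda>n. \<bar>X n\<bar> * (x\<^sup>2 / 2) * norm (f x)) \<longlonglongrightarrow> 0" by simp
        then show "(\<lambda>n. norm (r (- X n * x)) / \<bar>X n\<bar> * norm (f x)) \<longlonglongrightarrow> 0"
        proof (rule Lim_null_comparison[OF always_eventually, rotated], intro allI)
          fix n
          have "norm (r (- X n * x)) / \<bar>X n\<bar> \<le> (- X n * x)\<^sup>2 / 2 / \<bar>X n\<bar>"
            by (intro divide_right_mono r1) simp
          also have "\<dots> = \<bar>X n\<bar> * (x\<^sup>2 / 2)"
            using X[rule_format, of n] by (simp add: power_mult_distrib divide_simps) (simp add: power2_eq_square)
          finally have q: "norm (r (- X n * x)) / \<bar>X n\<bar> \<le> \<bar>X n\<bar> * (x\<^sup>2 / 2)" .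
          have "norm (norm (r (- X n * x)) / \<bar>X n\<bar> * norm (f x)) = norm (r (- X n * x)) / \<bar>X n\<bar> * norm (f x)" by simp
          also have "\<dots> \<le> \<bar>X n\<bar> * (x\<^sup>2 / 2) * norm (f x)" by (intro mult_right_mono q) simp
          finally show "norm (norm (r (- X n * x)) / \<bar>X n\<bar> * norm (f x)) \<le> \<bar>X n\<bar> * (x\<^sup>2 / 2) * norm (f x)" .
        qed
      qed
      show "AE x in lborel. norm (norm (r (- X n * x)) / \<bar>X n\<bar> * norm (f x)) \<le> 2 * norm (of_real x * f x)" for n
      proof (rule AE_I2)
        fix x :: real
        have "norm (r (- X n * x)) / \<bar>X n\<bar> \<le> 2 * \<bar>- X n * x\<bar> / \<bar>X n\<bar>"
          by (intro divide_right_mono r2) simp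
        also have "\<dots> = 2 * \<bar>x\<bar>" using X[rule_format, of n] by (simp add: abs_mult)
        finally have q: "norm (r (- X n * x)) / \<bar>X n\<bar> \<le> 2 * \<bar>x\<bar>" .
        have "norm (norm (r (- X n * x)) / \<bar>X n\<bar> * norm (f x)) = norm (r (- X n * x)) / \<bar>X n\<bar> * norm (f x)" by simp
        also have "\<dots> \<le> 2 * \<bar>x\<bar> * norm (f x)" by (intro mult_right_mono q) simp
        finally show "norm (norm (r (- X n * x)) / \<bar>X n\<bar> * norm (f x)) \<le> 2 * norm (of_real x * f x)"
          by (simp add: norm_mult)
      qed
    qed auto
    then have lim: "(\<lambda>n. LINT x|lborel. norm (r (- X n * x)) / \<bar>X n\<bar> * norm (f x)) \<longlonglongrightarrow> 0" by simp
    have lim': "(\<lambda>n. (LINT x|lborel. norm (r (- X n * x)) / \<bar>X n\<bar> * norm (f x)) / sqrt (2 * pi)) \<longlonglongrightarrow> 0"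
      using tendsto_divide[OF lim tendsto_const, of "sqrt (2 * pi)"] by simp
    show "((\<lambda>h. norm (fourier f (\<xi> + h) - fourier f \<xi> - h *\<^sub>R fourier (\<lambda>x. - \<i> * of_real x * f x) \<xi>) / norm h) \<circ> X) \<longlonglongrightarrow> 0"
      unfolding o_def
    proof (rule Lim_null_comparison[OF always_eventually lim'], intro allI)
      fix n
      have "norm (CLINT x|lborel. r (- X n * x) * (exp (- (\<i> * of_real \<xi> * of_real x)) * f x)) \<le>
          (LINT x|lborel. norm (r (- X n * x)) * norm (f x))"
        by (rule order_trans[OF integral_norm_bound]) (simp add: norm_mult)
      also have "\<dots> = (LINT x|lborel. norm (r (- X n * x)) / \<bar>X n\<bar> * norm (f x)) * \<bar>X n\<bar>"
        using X[rule_format, of n] by (subst integral_mult_left_zero[symmetric]) simp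
      finally show "norm (norm (fourier f (\<xi> + X n) - fourier f \<xi> - X n *\<^sub>R fourier (\<lambda>x. - \<i> * of_real x * f x) \<xi>) / norm (X n))
         \<le> (LINT x|lborel. norm (r (- X n * x)) / \<bar>X n\<bar> * norm (f x)) / sqrt (2 * pi)"
        unfolding eq using X[rule_format, of n]
        by (simp add: norm_divide divide_simps mult_ac)
    qed
  qed
  then show ?thesis
    unfolding has_vector_derivative_def has_derivative_at
    by (auto intro!: bounded_linear_scaleR_left)
qed

section \<open>Smoothness and decay under the Fourier transform\<close>

lemma has_vector_derivative_imp_continuous_on:
  "(\<And>x. x \<in> S \<Longrightarrow> (f has_vector_derivative f' x) (at x)) \<Longrightarrow> continuous_on S f"
  by (meson continuous_at_imp_continuous_on has_vector_derivative_continuous)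

primrec Ck :: "nat \<Rightarrow> real set \<Rightarrow> (real \<Rightarrow> complex) \<Rightarrow> bool" where
  "Ck 0 S f \<longleftrightarrow> continuous_on S f"
| "Ck (Suc n) S f \<longleftrightarrow> (\<exists>f'. (\<forall>x\<in>S. (f has_vector_derivative f' x) (at x)) \<and> Ck n S f')"

lemma Ck_continuous: "Ck n S f \<Longrightarrow> continuous_on S f"
  by (cases n) (auto intro: has_vector_derivative_imp_continuous_on)

lemma Ck_SucD: "Ck (Suc n) S f \<Longrightarrow> Ck n S f"
proof (induction n arbitrary: f)
  case 0
  then show ?case by (auto intro: has_vector_derivative_imp_continuous_on)
next
  case (Suc n)
  then obtain f' where f': "\<forall>x\<in>S. (f has_vector_derivative f' x) (at x)" "Ck (Suc n) S f'" by auto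
  from Suc.IH[OF f'(2)] f'(1) show ?case by auto
qed

lemma Ck_add: "Ck n S f \<Longrightarrow> Ck n S g \<Longrightarrow> Ck n S (\<lambda>x. f x + g x)"
proof (induction n arbitrary: f g)
  case 0
  then show ?case by (auto intro: continuous_on_add)
next
  case (Suc n)
  then obtain f' g' where "\<forall>x\<in>S. (f has_vector_derivative f' x) (at x)" "Ck n S f'"
    "\<forall>x\<in>S. (g has_vector_derivative g' x) (at x)" "Ck n S g'" by auto
  with Suc.IH[of f' g'] show ?case by (auto intro!: exI[of _ "\<lambda>x. f' x + g' x"] has_vector_derivative_add)
qed

lemma Ck_mult: "Ck n S f \<Longrightarrow> Ck n S g \<Longrightarrow> Ck n S (\<lambda>x. f x * g x)"
proof (induction n arbitrary: f g)
  case 0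
  then show ?case by (auto intro: continuous_on_mult)
next
  case (Suc n)
  then obtain f' g' where d: "\<forall>x\<in>S. (f has_vector_derivative f' x) (at x)" "Ck n S f'"
    "\<forall>x\<in>S. (g has_vector_derivative g' x) (at x)" "Ck n S g'" by auto
  have "Ck n S (\<lambda>x. f x * g' x + f' x * g x)"
    using Suc.IH Suc.prems[THEN Ck_SucD] d by (intro Ck_add) auto
  with d show ?case by (auto intro!: exI[of _ "\<lambda>x. f x * g' x + f' x * g x"] has_vector_derivative_mult)
qed

lemma Ck_holomorphic:
  assumes "h holomorphic_on U" "open U" "of_real ` S \<subseteq> U"
  shows "Ck n S (\<lambda>x. h (of_real x))"
  using assms(1)
proof (induction n arbitrary: h)
  case 0
  have "continuous_on (of_real ` S) h"
    using holomorphic_on_imp_continuous_on[OF 0] assms(3) by (rule continuous_on_subset)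
  then show ?case by (auto intro: continuous_on_compose2[of _ h S of_real] continuous_intros)
next
  case (Suc n)
  have "((\<lambda>x. h (of_real x)) has_vector_derivative deriv h (of_real x)) (at x)" if "x \<in> S" for x
  proof -
    have "(h has_field_derivative deriv h (of_real x)) (at (of_real x))"
      using holomorphic_derivI[OF Suc.prems assms(2)] assms(3) that by blast
    then show ?thesis by (rule has_vector_derivative_real_field)
  qed
  moreover have "Ck n S (\<lambda>x. deriv h (of_real x))"
    by (intro Suc.IH holomorphic_deriv Suc.prems assms(2))
  ultimately show ?case by (auto intro!: exI[of _ "\<lambda>x. deriv h (of_real x)"])
qed

lemma has_vector_derivative_zero_outside:
  assumes "closed K" "x \<notin> K" "\<And>y. y \<notin> K \<Longrightarrow> g y = 0"
  shows "(g has_vector_derivative 0) (at x)"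
proof (rule has_vector_derivative_transform_within_open[where S="- K" and f="\<lambda>_. 0"])
  show "((\<lambda>_. 0) has_vector_derivative 0) (at x)" by (rule has_vector_derivative_const)
qed (use assms in auto)

lemma vector_derivative_zero_outside:
  assumes "closed K" "x \<notin> K" "\<And>y. y \<notin> K \<Longrightarrow> g y = 0" "(g has_vector_derivative g') (at x)"
  shows "g' = 0"
  using vector_derivative_unique_at[OF assms(4) has_vector_derivative_zero_outside[OF assms(1-3)]] by simp

text \<open>
  Off \<open>K\<close> the function vanishes on an open set and so do its derivatives; on the open neighbourhood
  \<open>S\<close> of \<open>K\<close> smoothness is given. This is applied to functions that are holomorphic only near the
  support of a cut-off factor.
\<close>

lemma Ck_zero_extension:
  assumes "Ck n S g" "closed K" "K \<subseteq> S" "\<And>x. x \<notin> K \<Longrightarrow> g x = 0" "open S"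
  shows "Ck n UNIV g"
  using assms(1,4)
proof (induction n arbitrary: g)
  case 0
  have "continuous_on (S \<union> - K) g"
  proof (rule continuous_on_open_Un)
    show "continuous_on (- K) g" using 0 continuous_on_const[of "- K" 0] by (rule_tac continuous_on_eq) auto
  qed (use 0 assms in auto)
  moreover have "S \<union> - K = UNIV" using assms(3) by auto
  ultimately show ?case by simp
next
  case (Suc n)
  then obtain g' where g': "\<forall>x\<in>S. (g has_vector_derivative g' x) (at x)" "Ck n S g'" by auto
  define g'' where "g'' x = (if x \<in> S then g' x else 0)" for x
  have z: "g'' x = 0" if "x \<notin> K" for x
    using g'(1) vector_derivative_zero_outside[OF assms(2) that Suc.prems(2)] by (auto simp: g''_def)
  have d: "(g has_vector_derivative g'' x) (at x)" for x
  proof (cases "x \<in> K")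
    case True
    then show ?thesis using g'(1) assms(3) by (auto simp: g''_def)
  next
    case False
    then show ?thesis using has_vector_derivative_zero_outside[OF assms(2) False Suc.prems(2)] z by simp
  qed
  have "Ck n S g''"
  proof -
    have "Ck n S a \<Longrightarrow> (\<And>x. x \<in> S \<Longrightarrow> a x = b x) \<Longrightarrow> Ck n S b" for a b
    proof (induction n arbitrary: a b)
      case 0 then show ?case by (auto cong: continuous_on_cong)
    next
      case (Suc n)
      then obtain a' where a': "\<forall>x\<in>S. (a has_vector_derivative a' x) (at x)" "Ck n S a'" by auto
      have "\<forall>x\<in>S. (b has_vector_derivative a' x) (at x)"
        using a'(1) Suc.prems(2) assms(5) by (auto intro: has_vector_derivative_transform_within_open)
      then show ?case using a'(2) by auto
    qed
    from this[OF g'(2), of g''] show ?thesis by (simp add: g''_def)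
  qed
  from Suc.IH[OF this z] d show ?case by auto
qed

text \<open>
  The part of the Schwartz condition that survives multiplication by polynomials; the Fourier transform
  turns it into smoothness.
\<close>

definition rapid :: "(real \<Rightarrow> complex) \<Rightarrow> bool" where
  "rapid f \<longleftrightarrow> f \<in> borel_measurable borel \<and> (\<forall>m. \<exists>C. \<forall>x. norm (of_real x ^ m * f x) \<le> C)"

lemma rapid_mult_x:
  assumes "rapid f"
  shows "rapid (\<lambda>x. c * of_real x * f x)"
  unfolding rapid_def
proof (intro conjI allI)
  show "(\<lambda>x. c * of_real x * f x) \<in> borel_measurable borel" using assms by (auto simp: rapid_def)
  fix m
  obtain C where C: "\<And>x. norm (of_real x ^ Suc m * f x) \<le> C" using assms by (auto simp only: rapid_def)
  have "norm (of_real x ^ m * (c * of_real x * f x)) \<le> norm c * C" for x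
  proof -
    have "of_real x ^ m * (c * of_real x * f x) = c * (of_real x ^ Suc m * f x)" by simp
    then show ?thesis using C[of x] by (simp only: norm_mult[of c] mult_left_mono norm_ge_zero)
  qed
  then show "\<exists>C. \<forall>x. norm (of_real x ^ m * (c * of_real x * f x)) \<le> C" by blast
qed

lemma rapid_integrable:
  assumes "rapid f"
  shows "integrable lborel f"
proof -
  obtain a where a: "\<And>x. norm (of_real x ^ 0 * f x) \<le> a" using assms by (auto simp only: rapid_def)
  obtain b where b: "\<And>x. norm (of_real x ^ 2 * f x) \<le> b" using assms by (auto simp only: rapid_def)
  have "norm (f x) \<le> (a + b) / (1 + x\<^sup>2)" for x
    using a[of x] b[of x] by (simp add: pos_le_divide_eq algebra_simps norm_mult norm_power)
  then have "quadratic_decay f (a + b)" by (simp add: quadratic_decay_def)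
  then show ?thesis using assms by (intro quadratic_decay_integrable) (auto simp: rapid_def)
qed

lemma rapid_schwartz:
  assumes "schwartz f"
  shows "rapid f"
proof -
  obtain D where D: "D 0 = f" "\<And>m n. bounded (range (\<lambda>x. x ^ m *\<^sub>R D n x))"
    using assms by (auto simp: schwartz_def)
  have "\<exists>C. \<forall>x. norm (of_real x ^ m * f x) \<le> C" for m
    using D(2)[of m 0] by (auto simp: D(1) bounded_iff scaleR_conv_of_real)
  then show ?thesis
    using borel_measurable_continuous_onI[OF schwartz_continuous[OF assms]] by (simp add: rapid_def)
qed

lemma rapid_schwartz_real:
  assumes "schwartz (f :: real \<Rightarrow> real)"
  shows "rapid (\<lambda>x. of_real (f x))"
proof -
  obtain D where D: "D 0 = f" "\<And>m n. bounded (range (\<lambda>x. x ^ m *\<^sub>R D n x))"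
    using assms by (auto simp: schwartz_def)
  have "\<exists>C. \<forall>x. norm (of_real x ^ m * complex_of_real (f x)) \<le> C" for m
    using D(2)[of m 0] by (auto simp: D(1) bounded_iff norm_mult norm_power abs_mult power_abs)
  then show ?thesis
    using borel_measurable_continuous_onI[OF schwartz_continuous[OF assms]] by (simp add: rapid_def)
qed

lemma fourier_rapid_derivative:
  assumes "rapid f"
  shows "(fourier f has_vector_derivative fourier (\<lambda>x. - \<i> * of_real x * f x) \<xi>) (at \<xi>)"
  using fourier_has_derivative rapid_integrable[OF assms] rapid_integrable[OF rapid_mult_x[OF assms, of 1]]
  by simp

lemma Ck_fourier: "rapid f \<Longrightarrow> Ck n UNIV (fourier f)"
proof (induction n arbitrary: f)
  case 0
  then show ?case using has_vector_derivative_imp_continuous_on[OF fourier_rapid_derivative] by auto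
next
  case (Suc n)
  then show ?case
    using fourier_rapid_derivative[OF Suc.prems] Suc.IH[OF rapid_mult_x[OF Suc.prems, of "- \<i>"]] by auto
qed

lemma integrable_compact_support:
  fixes g :: "real \<Rightarrow> complex"
  assumes "continuous_on UNIV g" "\<And>x. x \<notin> {-R..R} \<Longrightarrow> g x = 0"
  shows "integrable lborel g"
proof -
  have "set_integrable lborel {-R..R} g"
    using assms(1) by (intro borel_integrable_atLeastAtMost') (rule continuous_on_subset, auto)
  moreover have "(\<lambda>x. indicator {-R..R} x *\<^sub>R g x) = g"
    using assms(2) by (auto simp: fun_eq_iff indicator_def)
  ultimately show ?thesis by (simp add: set_integrable_def)
qed

lemma rapid_compact_support:
  fixes g :: "real \<Rightarrow> complex"
  assumes "continuous_on UNIV g" "\<And>x. x \<notin> {-R..R} \<Longrightarrow> g x = 0"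
  shows "rapid g"
  unfolding rapid_def
proof (intro conjI allI)
  show "g \<in> borel_measurable borel" using assms(1) by (rule borel_measurable_continuous_onI)
  fix m
  have "compact ((\<lambda>x. of_real x ^ m * g x) ` {-R..R})"
    by (intro compact_continuous_image continuous_intros continuous_on_subset[OF assms(1)]) auto
  then obtain C where C: "\<And>x. x \<in> {-R..R} \<Longrightarrow> norm (of_real x ^ m * g x) \<le> C"
    by (meson bounded_iff compact_imp_bounded image_eqI)
  have "norm (of_real x ^ m * g x) \<le> max C 0" for x
    using C[of x] assms(2)[of x] by (cases "x \<in> {-R..R}") auto
  then show "\<exists>C. \<forall>x. norm (of_real x ^ m * g x) \<le> C" by blast
qed

lemma fourier_by_parts:
  fixes g :: "real \<Rightarrow> complex"
  assumes d: "\<And>x. (g has_vector_derivative g' x) (at x)" and c: "continuous_on UNIV g'"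
    and z: "\<And>x. x \<notin> {-R..R} \<Longrightarrow> g x = 0" "\<And>x. x \<notin> {-R..R} \<Longrightarrow> g' x = 0"
  shows "fourier g' \<xi> = \<i> * of_real \<xi> * fourier g \<xi>"
proof -
  let ?e = "\<lambda>x. exp (- (\<i> * of_real \<xi> * complex_of_real x))"
  (* Strictly outside the support, so that the boundary terms vanish. *)
  define R' where "R' = \<bar>R\<bar> + 1"
  have cg: "continuous_on UNIV g" by (rule has_vector_derivative_imp_continuous_on[OF d])
  have de: "((\<lambda>x. ?e x) has_vector_derivative - \<i> * of_real \<xi> * ?e x) (at x within S)" for x S
  proof -
    have "((\<lambda>z. exp (- (\<i> * of_real \<xi> * z))) has_field_derivative - \<i> * of_real \<xi> * ?e x) (at (of_real x))"
      by (rule derivative_eq_intros refl)+ simp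
    from has_vector_derivative_real_field[OF this] show ?thesis by (rule has_vector_derivative_at_within)
  qed
  have "(LINT x|lborel. indicator {-R'..R'} x *\<^sub>R (?e x * g' x + - \<i> * of_real \<xi> * ?e x * g x)) = ?e R' * g R' - ?e (-R') * g (-R')"
  proof (rule integral_FTC_Icc)
    show "-R' \<le> R'" by (simp add: R'_def)
    show "((\<lambda>x. ?e x * g x) has_vector_derivative ?e x * g' x + - \<i> * of_real \<xi> * ?e x * g x) (at x within {-R'..R'})" for x
      by (rule has_vector_derivative_mult[OF de has_vector_derivative_at_within[OF d]])
    show "continuous_on {-R'..R'} (\<lambda>x. ?e x * g' x + - \<i> * of_real \<xi> * ?e x * g x)"
      by (intro continuous_intros continuous_on_subset[OF c] continuous_on_subset[OF cg]) auto
  qed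
  also have "\<dots> = 0"
  proof -
    have "R' \<notin> {-R..R}" "- R' \<notin> {-R..R}" by (auto simp: R'_def)
    then have "g R' = 0" "g (- R') = 0" by (auto intro: z(1))
    then show ?thesis by simp
  qed
  also have "(LINT x|lborel. indicator {-R'..R'} x *\<^sub>R (?e x * g' x + - \<i> * of_real \<xi> * ?e x * g x)) =
      (LINT x|lborel. ?e x * g' x - \<i> * of_real \<xi> * (?e x * g x))"
  proof (intro Bochner_Integration.integral_cong refl)
    fix x show "indicator {-R'..R'} x *\<^sub>R (?e x * g' x + - \<i> * of_real \<xi> * ?e x * g x) = ?e x * g' x - \<i> * of_real \<xi> * (?e x * g x)"
    proof (cases "x \<in> {-R'..R'}")
      case False
      then have "x \<notin> {-R..R}" by (auto simp: R'_def)
      then show ?thesis using z[of x] False by simp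
    qed simp
  qed
  also have "\<dots> = (LINT x|lborel. ?e x * g' x) - \<i> * of_real \<xi> * (LINT x|lborel. ?e x * g x)"
    using fourier_integrable[OF integrable_compact_support[OF cg z(1)], of R \<xi>]
      fourier_integrable[OF integrable_compact_support[OF c z(2)], of R \<xi>] by simp
  finally show ?thesis by (simp add: fourier_def)
qed

lemma fourier_compact_decay:
  assumes "Ck k UNIV g" "\<And>x. x \<notin> {-R..R} \<Longrightarrow> g x = 0"
  shows "\<exists>C. \<forall>x. norm (of_real x ^ k * fourier g x) \<le> C"
  using assms
proof (induction k arbitrary: g)
  case 0
  then show ?case using fourier_norm_le[OF integrable_compact_support[of g R]] by auto
next
  case (Suc k)
  then obtain g' where g': "\<And>x. (g has_vector_derivative g' x) (at x)" "Ck k UNIV g'" by auto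
  have z: "g' x = 0" if "x \<notin> {-R..R}" for x
    by (rule vector_derivative_zero_outside[OF _ that Suc.prems(2) g'(1)]) auto
  have "fourier g' \<xi> = \<i> * of_real \<xi> * fourier g \<xi>" for \<xi>
    by (rule fourier_by_parts[OF g'(1) Ck_continuous[OF g'(2)] Suc.prems(2) z])
  then have "norm (of_real x ^ Suc k * fourier g x) = norm (of_real x ^ k * fourier g' x)" for x
    by (simp add: norm_mult norm_power)
  then show ?case using Suc.IH[OF g'(2) z] by simp
qed

lemma fourier_uminus: "fourier (\<lambda>x. f (- x)) \<xi> = fourier f (- \<xi>)"
proof -
  have "(CLINT x|lborel. exp (- (\<i> * of_real (- \<xi>) * of_real x)) * f x) =
      \<bar>-1\<bar> *\<^sub>R (CLINT x|lborel. exp (- (\<i> * of_real (- \<xi>) * of_real (0 + -1 * x))) * f (0 + -1 * x))"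
    by (rule lborel_integral_real_affine) simp
  then show ?thesis by (simp add: fourier_def)
qed

text \<open>
  Derivatives of the inverse transform correspond to multiplication of \<open>m\<close> by powers of \<open>\<i>\<xi>\<close>,
  and multiplication by \<open>x\<close> to differentiation of these products, which stay smooth with compact support.
\<close>

lemma schwartz_inverse_fourier:
  assumes m: "\<And>k. Ck k UNIV m" and z: "\<And>x. x \<notin> {-R..R} \<Longrightarrow> m x = 0"
  shows "schwartz (\<lambda>x. fourier m (- x))" "\<And>\<xi>. fourier (\<lambda>x. fourier m (- x)) \<xi> = m \<xi>"
proof -
  define g where "g n \<xi> = (\<i> * of_real \<xi>) ^ n * m \<xi>" for n \<xi>
  have gC: "Ck k UNIV (g n)" for k n
  proof -
    have "Ck k UNIV (\<lambda>\<xi>. (\<i> * of_real \<xi>) ^ n)"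
      by (rule Ck_holomorphic[of "\<lambda>z. (\<i> * z) ^ n" UNIV]) (auto intro!: holomorphic_intros)
    then show ?thesis unfolding g_def by (intro Ck_mult m)
  qed
  have gz: "g n \<xi> = 0" if "\<xi> \<notin> {-R..R}" for n \<xi> using z[OF that] by (simp add: g_def)
  have gr: "rapid (g n)" for n by (rule rapid_compact_support[OF Ck_continuous[OF gC[of 0]] gz])
  define D where "D n x = fourier (g n) (- x)" for n x
  have D0: "D 0 = (\<lambda>x. fourier m (- x))" by (simp add: D_def[abs_def] g_def[abs_def])
  have "(D n has_vector_derivative D (Suc n) x) (at x)" for n x
  proof -
    have "(uminus has_vector_derivative (-1 :: real)) (at x)"
      by (rule has_vector_derivative_minus[OF has_vector_derivative_id])
    from vector_diff_chain_at[OF this fourier_rapid_derivative[OF gr]]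
    have "(fourier (g n) \<circ> uminus has_vector_derivative -1 *\<^sub>R fourier (\<lambda>x. - \<i> * of_real x * g n x) (- x)) (at x)" .
    moreover have "-1 *\<^sub>R fourier (\<lambda>x. - \<i> * of_real x * g n x) (- x) = D (Suc n) x"
      by (simp add: D_def fourier_def g_def mult_ac)
    ultimately show ?thesis by (simp add: D_def[abs_def] o_def)
  qed
  moreover have "bounded (range (\<lambda>x. x ^ k *\<^sub>R D n x))" for k n
  proof -
    obtain C where C: "\<And>x. norm (of_real x ^ k * fourier (g n) x) \<le> C"
      using fourier_compact_decay[OF gC gz] by blast
    have "norm (x ^ k *\<^sub>R D n x) \<le> C" for x
      using C[of "- x"] by (simp add: D_def norm_mult norm_power power_abs)
    then show ?thesis by (auto simp: bounded_iff)
  qed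
  ultimately show S: "schwartz (\<lambda>x. fourier m (- x))"
    unfolding schwartz_def using D0 by blast
  have m0: "continuous_on UNIV m" using m[of 0] by simp
  have "rapid m" by (rule rapid_compact_support[OF m0 z])
  then obtain K where K: "\<And>x. norm (of_real x ^ 0 * m x) \<le> K" by (auto simp only: rapid_def)
  have "fourier (fourier m) (- \<xi>) = m \<xi>" for \<xi>
  proof (rule fourier_inversion)
    show "continuous_on UNIV m" by (rule m0)
    show "integrable lborel m" by (rule integrable_compact_support[OF m0 z])
    show "norm (m x) \<le> K" for x using K[of x] by simp
    have "integrable lborel (\<lambda>x. fourier m (- (0 + -1 * x)))"
      by (rule lborel_integrable_real_affine[OF rapid_integrable[OF rapid_schwartz[OF S]]]) simp
    then show "integrable lborel (fourier m)" by simp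
  qed
  then show "\<And>\<xi>. fourier (\<lambda>x. fourier m (- x)) \<xi> = m \<xi>" by (simp add: fourier_uminus)
qed

text \<open>
  Transforms of Schwartz functions are continuous, so agreement away from \<open>0\<close> extends to \<open>0\<close>; inversion
  does the rest.
\<close>

lemma schwartz_fourier_inject:
  fixes f g :: "real \<Rightarrow> complex"
  assumes f: "schwartz f" and g: "schwartz g" and eq: "\<And>\<xi>. \<xi> \<noteq> 0 \<Longrightarrow> fourier f \<xi> = fourier g \<xi>"
  shows "f = g"
proof
  fix x
  have fi: "integrable lborel f" and gi: "integrable lborel g"
    using f g by (auto intro: rapid_integrable rapid_schwartz)
  define u where "u x = f x - g x" for x
  have Fu: "fourier u \<xi> = fourier f \<xi> - fourier g \<xi>" for \<xi>
    unfolding u_def[abs_def] by (rule fourier_diff[OF fi gi])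
  have cont: "continuous_on UNIV (fourier u)"
    unfolding Fu[abs_def] by (intro continuous_on_diff Ck_continuous[OF Ck_fourier[of _ 0]] rapid_schwartz f g)
  have "((\<lambda>_. 0) \<longlongrightarrow> fourier u 0) (at (0::real))"
  proof (rule Lim_transform_eventually)
    show "(fourier u \<longlongrightarrow> fourier u 0) (at 0)"
      using cont by (simp add: continuous_on_eq_continuous_at isContD)
    show "\<forall>\<^sub>F x in at 0. fourier u x = 0"
      using eq by (auto simp: eventually_at_filter Fu)
  qed
  then have "fourier u 0 = 0" by (simp add: tendsto_const_iff)
  then have z: "fourier u = (\<lambda>_. 0)" using eq by (auto simp: Fu fun_eq_iff) (metis Fu)
  obtain C where C: "quadratic_decay f C" using schwartz_quadratic_decay[OF f] by blast
  obtain C' where C': "quadratic_decay g C'" using schwartz_quadratic_decay[OF g] by blast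
  have bd: "norm (h x) \<le> c" if "quadratic_decay h c" for h :: "real \<Rightarrow> complex" and x c
  proof -
    have "norm (h x) \<le> c / (1 + x\<^sup>2)" by (rule quadratic_decayD[OF that])
    also have "\<dots> \<le> c / 1" using quadratic_decay_nonneg[OF that] by (intro divide_left_mono) auto
    finally show ?thesis by simp
  qed
  have "fourier (fourier u) (- x) = u x"
  proof (rule fourier_inversion)
    show "integrable lborel u" unfolding u_def[abs_def] using fi gi by simp
    show "continuous_on UNIV u" unfolding u_def[abs_def]
      by (intro continuous_on_diff schwartz_continuous f g)
    show "norm (u y) \<le> C + C'" for y
      unfolding u_def using bd[OF C, of y] bd[OF C', of y] norm_triangle_ineq4[of "f y" "g y"] by linarith
    show "integrable lborel (fourier u)" unfolding z by simp
  qed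
  then have "u x = 0" by (simp add: z fourier_def)
  then show "f x = g x" by (simp add: u_def)
qed

section \<open>The fractional scaling function\<close>

text \<open>
  The integral of \<open>exp (- \<i>zx)\<close> over \<open>x \<in> {0..1}\<close>, that is, the Fourier symbol of the moving average over the
  unit interval, with its removable singularity filled in. The case \<open>z = 0\<close> makes it entire.
\<close>

definition qsym :: "complex \<Rightarrow> complex" where
  "qsym z = (if z = 0 then 1 else (1 - exp (- (\<i> * z))) / (\<i> * z))"

lemma qsym_holomorphic: "qsym holomorphic_on UNIV"
proof -
  let ?f = "\<lambda>z. \<i> * exp (- (\<i> * z))"
  have "?f holomorphic_on UNIV" by (intro holomorphic_intros)
  (* qsym is the difference quotient at 0 of the entire function ?f. *)
  then have 1: "(\<lambda>z. if z = 0 then deriv ?f 0 else (?f z - ?f 0) / (z - 0)) holomorphic_on UNIV"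
    by (rule pole_lemma) simp
  have "(?f has_field_derivative 1) (at 0)"
    by (rule derivative_eq_intros refl)+ simp
  then have "deriv ?f 0 = 1" by (rule DERIV_imp_deriv)
  then have "(\<lambda>z. if z = 0 then deriv ?f 0 else (?f z - ?f 0) / (z - 0)) = qsym"
    by (auto simp: fun_eq_iff qsym_def divide_simps algebra_simps)
  with 1 show ?thesis by simp
qed

lemma qsym_continuous: "continuous_on S qsym"
  using holomorphic_on_imp_continuous_on[OF qsym_holomorphic] by (rule continuous_on_subset) simp

lemma cos_less_one:
  assumes "\<xi> \<noteq> 0" "\<bar>\<xi>\<bar> < 2 * pi"
  shows "cos \<xi> < 1"
proof -
  have "cos \<xi> \<noteq> 1"
  proof
    assume "cos \<xi> = 1"
    then obtain n :: nat where n: "\<xi> = real n * 2 * pi \<or> \<xi> = - (real n * 2 * pi)"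
      using cos_one_2pi by auto
    then have "n \<noteq> 0" using assms(1) by auto
    then have "1 \<le> real n" by simp
    then have "1 * (2 * pi) \<le> real n * (2 * pi)" by (intro mult_right_mono) auto
    then have "2 * pi \<le> \<bar>\<xi>\<bar>" using n by (auto simp: abs_mult)
    then show False using assms(2) by simp
  qed
  then show ?thesis using cos_le_one[of \<xi>] by linarith
qed

text \<open>
  A real value of \<open>qsym\<close> makes \<open>1 - exp (- \<i>\<xi>)\<close> purely imaginary, which forces \<open>cos \<xi> = 1\<close>. Hence the
  principal power of \<open>qsym\<close> is holomorphic near the whole interval \<open>{-2\<pi><..<2\<pi>}\<close>.
\<close>

lemma qsym_real_pos:
  assumes "\<bar>\<xi>\<bar> < 2 * pi"
  shows "qsym (of_real \<xi>) \<notin> \<real>\<^sub>\<le>\<^sub>0"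
proof (cases "\<xi> = 0")
  case False
  show ?thesis
  proof
    assume "qsym (of_real \<xi>) \<in> \<real>\<^sub>\<le>\<^sub>0"
    then obtain r where "qsym (of_real \<xi>) = of_real r" by (auto simp: nonpos_Reals_def)
    then have "1 - exp (- (\<i> * of_real \<xi>)) = of_real r * (\<i> * of_real \<xi>)"
      using False by (simp add: qsym_def field_simps)
    then have "Re (1 - exp (- (\<i> * of_real \<xi>))) = 0" by simp
    then have "cos \<xi> = 1" by (simp add: Re_exp)
    then show False using cos_less_one[OF False assms] by simp
  qed
qed (simp add: qsym_def complex_nonpos_Reals_iff)

lemma cnj_qsym: "cnj (qsym (of_real \<xi>)) = qsym (of_real (- \<xi>))"
  by (simp add: qsym_def exp_cnj)

lemma norm_qsym_le_1: "norm (qsym (of_real \<xi>)) \<le> 1"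
proof (cases "\<xi> = 0")
  case False
  have "norm (exp (\<i> * of_real (- \<xi>)) - 1) \<le> \<bar>- \<xi>\<bar>"
    using iexp_approx1[of "- \<xi>" 0] by simp
  then have "norm (1 - exp (- (\<i> * of_real \<xi>))) \<le> \<bar>\<xi>\<bar>" by (simp add: norm_minus_commute)
  then show ?thesis using False by (simp add: qsym_def norm_divide norm_mult)
qed (simp add: qsym_def)

lemma Ck_subset: "Ck n T f \<Longrightarrow> S \<subseteq> T \<Longrightarrow> Ck n S f"
proof (induction n arbitrary: f)
  case 0
  then show ?case by (auto intro: continuous_on_subset)
next
  case (Suc n)
  then obtain f' where "\<forall>x\<in>T. (f has_vector_derivative f' x) (at x)" "Ck n T f'" by auto
  with Suc show ?case by auto
qed

lemma Ck_qsym_powr: "Ck n {- (2 * pi)<..<2 * pi} (\<lambda>\<xi>. qsym (of_real \<xi>) powr of_real \<delta>)"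
proof (rule Ck_holomorphic)
  let ?U = "qsym -` (- \<real>\<^sub>\<le>\<^sub>0)"
  show "open ?U"
    using qsym_continuous[of UNIV] by (intro open_vimage) (auto simp: open_closed)
  show "(\<lambda>z. qsym z powr of_real \<delta>) holomorphic_on ?U"
    by (intro holomorphic_on_powr holomorphic_on_subset[OF qsym_holomorphic] holomorphic_on_const) auto
  show "complex_of_real ` {- (2 * pi)<..<2 * pi} \<subseteq> ?U"
    using qsym_real_pos by (auto simp: abs_less_iff)
qed

text \<open>
  The bound \<open>4\<pi>/3\<close> keeps the spectrum of \<open>\<phi>\<close> inside the interval of length \<open>4\<pi>\<close> on which no power of \<open>qsym\<close> is
  singular; this is why fractional scaling functions are Schwartz functions.
\<close>

locale band_limited_scaling =
  fixes \<phi> :: "real \<Rightarrow> real"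
  assumes schwartz_phi: "schwartz \<phi>"
    and supp_phi: "\<And>\<xi>. \<xi> \<notin> {- (4 * pi / 3) .. 4 * pi / 3} \<Longrightarrow> fourier (\<lambda>x. of_real (\<phi> x)) \<xi> = 0"
begin

definition frac_hat :: "real \<Rightarrow> real \<Rightarrow> complex" where
  "frac_hat \<delta> \<xi> = qsym (of_real \<xi>) powr of_real \<delta> * fourier (\<lambda>x. of_real (\<phi> x)) \<xi>"

lemma frac_hat_supp: "\<xi> \<notin> {- (4 * pi / 3) .. 4 * pi / 3} \<Longrightarrow> frac_hat \<delta> \<xi> = 0"
  using supp_phi[of \<xi>] by (simp add: frac_hat_def del: atLeastAtMost_iff)

lemma Ck_frac_hat: "Ck n UNIV (frac_hat \<delta>)"
proof (rule Ck_zero_extension[where S="{- (2 * pi)<..<2 * pi}" and K="{- (4 * pi / 3) .. 4 * pi / 3}"])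
  show "Ck n {- (2 * pi)<..<2 * pi} (frac_hat \<delta>)"
    unfolding frac_hat_def
    by (intro Ck_mult Ck_qsym_powr Ck_subset[OF Ck_fourier[OF rapid_schwartz_real[OF schwartz_phi]]]) simp
  show "{- (4 * pi / 3)..4 * pi / 3} \<subseteq> {- (2 * pi)<..<2 * pi}"
    using pi_gt_zero unfolding subset_iff atLeastAtMost_iff greaterThanLessThan_iff by (intro allI impI) linarith
qed (auto intro: frac_hat_supp)

lemma frac_scaling_eq: "frac_scaling \<phi> \<delta> = (\<lambda>x. fourier (frac_hat \<delta>) (- x))"
  unfolding frac_scaling_def
proof (rule the_equality)
  have S: "schwartz (\<lambda>x. fourier (frac_hat \<delta>) (- x))" "fourier (\<lambda>x. fourier (frac_hat \<delta>) (- x)) \<xi> = frac_hat \<delta> \<xi>" for \<xi>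
    by (rule schwartz_inverse_fourier[OF Ck_frac_hat frac_hat_supp]; assumption)+
  show 1: "schwartz (\<lambda>x. fourier (frac_hat \<delta>) (- x)) \<and>
     (\<forall>\<xi>. \<xi> \<noteq> 0 \<longrightarrow> fourier (\<lambda>x. fourier (frac_hat \<delta>) (- x)) \<xi> =
        ((1 - exp (- (\<i> * of_real \<xi>))) / (\<i> * of_real \<xi>)) powr of_real \<delta> * fourier (\<lambda>x. of_real (\<phi> x)) \<xi>)"
  proof (intro conjI allI impI S(1))
    fix \<xi> :: real assume "\<xi> \<noteq> 0"
    then have "frac_hat \<delta> \<xi> = ((1 - exp (- (\<i> * of_real \<xi>))) / (\<i> * of_real \<xi>)) powr of_real \<delta> * fourier (\<lambda>x. of_real (\<phi> x)) \<xi>"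
      by (simp add: frac_hat_def qsym_def)
    then show "fourier (\<lambda>x. fourier (frac_hat \<delta>) (- x)) \<xi> =
        ((1 - exp (- (\<i> * of_real \<xi>))) / (\<i> * of_real \<xi>)) powr of_real \<delta> * fourier (\<lambda>x. of_real (\<phi> x)) \<xi>"
      by (simp only: S(2))
  qed
  fix \<Phi> :: "real \<Rightarrow> complex"
  assume "schwartz \<Phi> \<and>
     (\<forall>\<xi>. \<xi> \<noteq> 0 \<longrightarrow> fourier \<Phi> \<xi> =
        ((1 - exp (- (\<i> * of_real \<xi>))) / (\<i> * of_real \<xi>)) powr of_real \<delta> * fourier (\<lambda>x. of_real (\<phi> x)) \<xi>)"
  with 1 show "\<Phi> = (\<lambda>x. fourier (frac_hat \<delta>) (- x))"
    by (intro schwartz_fourier_inject) auto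
qed

lemma schwartz_frac_scaling: "schwartz (frac_scaling \<phi> \<delta>)"
  unfolding frac_scaling_eq
  by (rule schwartz_inverse_fourier[OF Ck_frac_hat frac_hat_supp]; assumption)

lemma fourier_cnj: "cnj (fourier f \<xi>) = fourier (\<lambda>x. cnj (f x)) (- \<xi>)"
proof -
  have "cnj (CLINT x|lborel. exp (- (\<i> * of_real \<xi> * of_real x)) * f x) =
      (CLINT x|lborel. cnj (exp (- (\<i> * of_real \<xi> * of_real x)) * f x))"
    by (rule Bochner_Integration.integral_cnj[symmetric])
  then show ?thesis by (simp add: fourier_def exp_cnj)
qed

lemma frac_scaling_real: "cnj (frac_scaling \<phi> \<delta> x) = frac_scaling \<phi> \<delta> x"
proof -
  have "cnj (frac_hat \<delta> \<xi>) = frac_hat \<delta> (- \<xi>)" for \<xi>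
  proof (cases "\<xi> \<in> {- (4 * pi / 3) .. 4 * pi / 3}")
    case True
    then have "\<bar>\<xi>\<bar> < 2 * pi" using pi_gt_zero unfolding atLeastAtMost_iff by linarith
    then have q: "qsym (of_real \<xi>) \<notin> \<real>\<^sub>\<le>\<^sub>0" by (rule qsym_real_pos)
    have "cnj (qsym (of_real \<xi>) powr of_real \<delta>) = qsym (of_real (- \<xi>)) powr of_real \<delta>"
      using q by (subst cnj_powr) (simp_all add: complex_nonpos_Reals_iff cnj_qsym del: of_real_minus)
    then show ?thesis by (simp add: frac_hat_def fourier_cnj)
  next
    case False
    then have "- \<xi> \<notin> {- (4 * pi / 3) .. 4 * pi / 3}" by auto
    with False show ?thesis by (simp add: frac_hat_supp del: atLeastAtMost_iff)
  qed
  then have "cnj (fourier (frac_hat \<delta>) (- x)) = fourier (\<lambda>\<xi>. frac_hat \<delta> (- \<xi>)) x"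
    by (simp add: fourier_cnj)
  then show ?thesis by (simp add: frac_scaling_eq fourier_uminus)
qed

text \<open>
  The fractional scaling function is real-valued because \<open>\<phi>\<close> is and \<open>qsym\<close> commutes with conjugation; this
  real version replaces it from here on.
\<close>

definition frac_scaling_Re :: "real \<Rightarrow> real \<Rightarrow> real" where
  "frac_scaling_Re \<delta> x = Re (frac_scaling \<phi> \<delta> x)"

lemma frac_scaling_of_real: "frac_scaling \<phi> \<delta> x = of_real (frac_scaling_Re \<delta> x)"
  using frac_scaling_real[of \<delta> x] by (simp add: frac_scaling_Re_def complex_eq_iff)

lemma frac_scaling_Re_continuous: "continuous_on UNIV (frac_scaling_Re \<delta>)"
  unfolding frac_scaling_Re_def by (intro continuous_intros schwartz_continuous schwartz_frac_scaling)

lemma frac_scaling_Re_decay: "\<exists>C. quadratic_decay (frac_scaling_Re \<delta>) C"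
proof -
  obtain C where "quadratic_decay (frac_scaling \<phi> \<delta>) C"
    using schwartz_quadratic_decay[OF schwartz_frac_scaling] by blast
  then have "quadratic_decay (frac_scaling_Re \<delta>) C" by (simp add: quadratic_decay_def frac_scaling_of_real)
  then show ?thesis ..
qed

end


section \<open>FARIMA coefficients and the complex Gamma integral\<close>

lemma farima_coeff_pochhammer:
  assumes "0 < \<delta>"
  shows "farima_coeff \<delta> p = pochhammer \<delta> p / fact p"
proof (cases "p = 0")
  case False
  have "\<delta> \<notin> \<int>\<^sub>\<le>\<^sub>0" using assms by (auto elim!: nonpos_Ints_cases)
  then have "pochhammer \<delta> p = Gamma (\<delta> + real p) / Gamma \<delta>" by (simp add: pochhammer_Gamma)
  moreover have "Gamma (\<delta> + 1) = \<delta> * Gamma \<delta>" using assms by (intro Gamma_plus1) (auto elim!: nonpos_Ints_cases)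
  moreover have "Gamma (real p + 1) = fact p" by (simp add: Gamma_fact add.commute)
  ultimately show ?thesis using False assms by (simp add: farima_coeff_def add.commute)
qed (simp add: farima_coeff_def)

lemma farima_coeff_Suc:
  "0 < \<delta> \<Longrightarrow> farima_coeff \<delta> (Suc p) = farima_coeff \<delta> p * ((\<delta> + real p) / real (Suc p))"
  by (simp add: farima_coeff_pochhammer pochhammer_Suc field_simps)

lemma farima_coeff_pos: "0 < \<delta> \<Longrightarrow> 0 < farima_coeff \<delta> p"
  by (simp add: farima_coeff_pochhammer pochhammer_pos)

text \<open>
  The quotient of consecutive coefficients is \<open>1 - (1 - \<delta>)/(p + 1)\<close>, which is at most the quotient
  \<open>((p + 2)/(p + 1)) powr (\<delta> - 1)\<close> of the bounds, by \<open>1 + x \<le> exp x\<close> and \<open>ln (1 + x) \<le> x\<close>.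
\<close>

lemma farima_coeff_le:
  assumes "0 < \<delta>" "\<delta> < 1"
  shows "farima_coeff \<delta> p \<le> real (Suc p) powr (\<delta> - 1)"
proof (induction p)
  case 0
  then show ?case by (simp add: farima_coeff_def)
next
  case (Suc p)
  define x where "x = 1 / real (Suc p)"
  have x: "0 < x" by (simp add: x_def)
  have "(\<delta> + real p) / real (Suc p) = 1 + (\<delta> - 1) * x" by (simp add: x_def field_simps)
  also have "\<dots> \<le> exp ((\<delta> - 1) * x)" by (rule exp_ge_add_one_self)
  also have "\<dots> \<le> exp ((\<delta> - 1) * ln (1 + x))"
    using assms x ln_add_one_self_le_self[of x] by (simp add: mult_left_mono_neg)
  also have "\<dots> = (1 + x) powr (\<delta> - 1)" using x by (simp add: powr_def)
  finally have "farima_coeff \<delta> (Suc p) \<le> real (Suc p) powr (\<delta> - 1) * (1 + x) powr (\<delta> - 1)"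
    unfolding farima_coeff_Suc[OF assms(1)] using Suc farima_coeff_pos[OF assms(1), of p] assms(1)
    by (intro mult_mono) auto
  also have "\<dots> = (real (Suc p) * (1 + x)) powr (\<delta> - 1)" using x by (simp add: powr_mult)
  also have "real (Suc p) * (1 + x) = real (Suc (Suc p))" by (simp add: x_def field_simps)
  finally show ?case .
qed

lemma farima_coeff_le_1:
  assumes "0 < \<delta>" "\<delta> < 1"
  shows "farima_coeff \<delta> p \<le> 1"
proof -
  have "real (Suc p) powr (\<delta> - 1) \<le> real (Suc p) powr 0" using assms by (intro powr_mono) auto
  then show ?thesis using farima_coeff_le[OF assms, of p] by simp
qed

lemma farima_generating:
  assumes "0 < \<delta>" "norm (z :: complex) < 1"
  shows "(\<lambda>p. of_real (farima_coeff \<delta> p) * z ^ p) sums (1 - z) powr (- of_real \<delta>)"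
proof -
  have "(\<lambda>n. ((- of_real \<delta>) gchoose n) * (- z)^n) sums (1 + (- z)) powr (- of_real \<delta>)"
    by (rule gen_binomial_complex) (use assms in simp)
  moreover have "((- of_real \<delta>) gchoose n) * (- z)^n = of_real (farima_coeff \<delta> n) * z ^ n" for n
  proof -
    have "(- 1 :: complex) ^ n * (- z) ^ n = z ^ n"
      by (simp add: power_mult_distrib[symmetric])
    then have "((- of_real \<delta>) gchoose n) * (- z)^n = pochhammer (of_real \<delta>) n / fact n * z ^ n"
      unfolding gbinomial_pochhammer by (simp add: divide_inverse mult_ac)
    then show ?thesis using assms by (simp add: farima_coeff_pochhammer pochhammer_of_real)
  qed
  ultimately show ?thesis by simp
qed

lemma
  assumes "0 < (a::real)"
  shows gamma_kernel_integrable: "integrable lborel (\<lambda>u. pos_power u (a - 1) * exp (- u))"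
    and gamma_kernel_integral: "(LINT u|lborel. pos_power u (a - 1) * exp (- u)) = Gamma a"
proof -
  have eq: "indicator {0..} t * t powr (a - 1) / exp t = pos_power t (a - 1) * exp (- t)" for t :: real
    by (auto simp: pos_power_def indicator_def exp_minus divide_inverse)
  have m: "(\<lambda>u. pos_power u (a - 1) * exp (- u)) \<in> borel_measurable lborel"
    unfolding pos_power_def by measurable
  have nn: "(\<integral>\<^sup>+u. ennreal (pos_power u (a - 1) * exp (- u)) \<partial>lborel) = ennreal (Gamma a)"
    using Gamma_conv_nn_integral_real[OF assms] by (simp add: eq)
  show "integrable lborel (\<lambda>u. pos_power u (a - 1) * exp (- u))"
    by (rule integrableI_nonneg[OF m]) (simp_all add: nn, simp add: pos_power_def)
  show "(LINT u|lborel. pos_power u (a - 1) * exp (- u)) = Gamma a"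
    by (subst integral_eq_nn_integral[OF m]) (use assms in \<open>simp_all add: nn Gamma_real_pos less_imp_le\<close>, simp add: pos_power_def)
qed

lemma pos_power_mult_power: "pos_power u a * u ^ n = pos_power u (a + real n)"
  by (auto simp: pos_power_def powr_add powr_realpow)

lemma pos_power_nonneg [simp]: "0 \<le> pos_power u a"
  by (simp add: pos_power_def)

lemma pos_power_measurable [measurable]: "(\<lambda>u. pos_power u a) \<in> borel_measurable borel"
  unfolding pos_power_def by measurable

text \<open>
  Expanding \<open>exp (- wu)\<close> in a power series and integrating termwise gives the Gamma values
  \<open>Gamma (\<delta> + n) / n!\<close>, which are \<open>Gamma \<delta>\<close> times the FARIMA coefficients, so that their generating
  function, the binomial series, appears.
\<close>

lemma gamma_integral_near_1:
  fixes w :: complex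
  assumes \<delta>: "0 < \<delta>" "\<delta> < 1" and w: "norm w < 1"
  shows "(CLINT u|lborel. of_real (pos_power u (\<delta> - 1)) * exp (- ((1 + w) * of_real u))) = of_real (Gamma \<delta>) * (1 + w) powr (- of_real \<delta>)"
proof -
  define f where "f n u = of_real (pos_power u (\<delta> - 1) * exp (- u)) * ((- w * of_real u) ^ n /\<^sub>R fact n)" for n and u :: real
  have feq: "f n u = ((- w) ^ n / of_real (fact n)) * of_real (pos_power u (\<delta> + real n - 1) * exp (- u))" for n u
  proof -
    have 1: "(- w * of_real u) ^ n = (- w) ^ n * of_real (u ^ n)" by (simp only: power_mult_distrib of_real_power)
    have 2: "pos_power u (\<delta> + real n - 1) = pos_power u (\<delta> - 1) * u ^ n"
      using pos_power_mult_power[of u "\<delta> - 1" n] by (simp add: add.commute add_diff_eq)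
    show ?thesis unfolding f_def 1 2 scaleR_conv_of_real of_real_mult by (simp add: divide_inverse mult_ac)
  qed
  have G: "Gamma (\<delta> + real n) = Gamma \<delta> * (farima_coeff \<delta> n * fact n)" for n
  proof -
    have "\<delta> \<notin> \<int>\<^sub>\<le>\<^sub>0" using \<delta> by (auto elim!: nonpos_Ints_cases)
    moreover have "Gamma \<delta> \<noteq> 0" using Gamma_real_pos[OF \<delta>(1)] by simp
    ultimately show ?thesis using \<delta> by (simp add: farima_coeff_pochhammer pochhammer_Gamma)
  qed
  have int: "integrable lborel (f n)" for n
    unfolding feq[abs_def] using gamma_kernel_integrable[of "\<delta> + real n"] \<delta> by (intro integrable_mult_right integrable_of_real) auto
  have If: "integral\<^sup>L lborel (f n) = of_real (Gamma \<delta>) * (of_real (farima_coeff \<delta> n) * (- w) ^ n)" for n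
  proof -
    have "integral\<^sup>L lborel (f n) = ((- w) ^ n / of_real (fact n)) * (CLINT u|lborel. of_real (pos_power u (\<delta> + real n - 1) * exp (- u)))"
      unfolding feq[abs_def] by (rule integral_mult_right_zero)
    also have "(CLINT u|lborel. complex_of_real (pos_power u (\<delta> + real n - 1) * exp (- u))) = of_real (Gamma (\<delta> + real n))"
      using gamma_kernel_integral[of "\<delta> + real n"] \<delta> by (subst integral_complex_of_real) simp
    finally have "integral\<^sup>L lborel (f n) = ((- w) ^ n / of_real (fact n)) * of_real (Gamma (\<delta> + real n))" .
    then show ?thesis by (simp add: G)
  qed
  have Inf: "(LINT u|lborel. norm (f n u)) = Gamma \<delta> * (farima_coeff \<delta> n * norm w ^ n)" for n
  proof -
    have "norm (f n u) = (norm w ^ n / fact n) * (pos_power u (\<delta> + real n - 1) * exp (- u))" for u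
      unfolding feq by (simp add: norm_mult norm_divide norm_power)
    then have "(LINT u|lborel. norm (f n u)) = (norm w ^ n / fact n) * Gamma (\<delta> + real n)"
      using gamma_kernel_integral[of "\<delta> + real n"] \<delta> by simp
    then show ?thesis by (simp add: G)
  qed
  have sums: "(\<lambda>n. f n u) sums (of_real (pos_power u (\<delta> - 1)) * exp (- ((1 + w) * of_real u)))" for u
  proof -
    have "(\<lambda>n. of_real (pos_power u (\<delta> - 1) * exp (- u)) * ((- w * of_real u) ^ n /\<^sub>R fact n)) sums
       (of_real (pos_power u (\<delta> - 1) * exp (- u)) * exp (- w * of_real u))"
      by (intro sums_mult exp_converges)
    moreover have "of_real (exp (- u)) * exp (- w * of_real u) = exp (- ((1 + w) * of_real u))"
      by (simp add: exp_of_real[symmetric] exp_add[symmetric] algebra_simps)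
    ultimately show ?thesis by (simp add: f_def mult.assoc)
  qed
  have "(\<lambda>n. integral\<^sup>L lborel (f n)) sums (CLINT u|lborel. (\<Sum>n. f n u))"
  proof (rule sums_integral[OF int])
    show "AE u in lborel. summable (\<lambda>n. norm (f n u))"
    proof (rule AE_I2)
      fix u :: real
      have "norm (f n u) = (pos_power u (\<delta> - 1) * exp (- u)) * ((norm w * \<bar>u\<bar>) ^ n /\<^sub>R fact n)" for n
        by (simp add: f_def norm_mult norm_power)
      then have eq: "(\<lambda>n. norm (f n u)) = (\<lambda>n. (pos_power u (\<delta> - 1) * exp (- u)) * ((norm w * \<bar>u\<bar>) ^ n /\<^sub>R fact n))"
        by (rule ext)
      show "summable (\<lambda>n. norm (f n u))"
        unfolding eq by (intro summable_mult sums_summable[OF exp_converges])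
    qed
    have "summable (\<lambda>n. farima_coeff \<delta> n * norm w ^ n)"
    proof (rule summable_comparison_test')
      show "summable (\<lambda>n. norm w ^ n)" using w by (intro summable_geometric) simp
      show "norm (farima_coeff \<delta> n * norm w ^ n) \<le> norm w ^ n" for n
        using farima_coeff_pos[OF \<delta>(1), of n] farima_coeff_le_1[OF \<delta>, of n]
          mult_right_mono[of "farima_coeff \<delta> n" 1 "norm w ^ n"] by (simp add: abs_mult)
    qed
    then show "summable (\<lambda>n. LINT u|lborel. norm (f n u))"
      unfolding Inf by (rule summable_mult)
  qed
  then have 1: "(\<lambda>n. of_real (Gamma \<delta>) * (of_real (farima_coeff \<delta> n) * (- w) ^ n)) sums
      (CLINT u|lborel. of_real (pos_power u (\<delta> - 1)) * exp (- ((1 + w) * of_real u)))"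
    unfolding If sums_unique[OF sums, symmetric] .
  have 2: "(\<lambda>n. of_real (Gamma \<delta>) * (of_real (farima_coeff \<delta> n) * (- w) ^ n)) sums (of_real (Gamma \<delta>) * (1 - (- w)) powr (- of_real \<delta>))"
    by (intro sums_mult farima_generating \<delta>(1)) (use w in simp)
  from sums_unique2[OF 1 2] show ?thesis by simp
qed

text \<open>
  Every point of the right half-plane lies in a disc about some \<open>R > 0\<close> of radius \<open>R\<close>, and rescaling by
  \<open>R\<close> moves this disc to the one about \<open>1\<close> that the power series covers.
\<close>

lemma gamma_integral_complex:
  fixes s :: complex
  assumes \<delta>: "0 < \<delta>" "\<delta> < 1" and s: "0 < Re s"
  shows "(CLINT u|lborel. of_real (pos_power u (\<delta> - 1)) * exp (- (s * of_real u))) = of_real (Gamma \<delta>) * s powr (- of_real \<delta>)"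
proof -
  (* With this R, norm (s - R)^2 = R^2 - (norm s)^2 < R^2. *)
  define R where "R = (norm s)\<^sup>2 / Re s"
  have s0: "norm s > 0" using s by auto
  have R: "R > 0" using s s0 by (simp add: R_def)
  define w where "w = s / of_real R - 1"
  have sw: "s = of_real R * (1 + w)" using R by (simp add: w_def)
  have "norm (s - of_real R) < R"
  proof -
    have "(norm (s - of_real R))\<^sup>2 = (norm s)\<^sup>2 - 2 * R * Re s + R\<^sup>2"
      unfolding cmod_power2 by (simp add: power2_eq_square algebra_simps)
    also have "2 * R * Re s = 2 * (norm s)\<^sup>2" using s by (simp add: R_def)
    finally have "(norm (s - of_real R))\<^sup>2 < R\<^sup>2" using s0 by simp
    then show ?thesis using R by (simp add: power2_less_imp_less)
  qed
  then have w: "norm w < 1"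
  proof -
    have "w = (s - of_real R) / of_real R" using R by (simp add: w_def diff_divide_distrib)
    then show ?thesis using \<open>norm (s - of_real R) < R\<close> R by (simp add: norm_divide)
  qed
  have pp: "pos_power (0 + v / R) (\<delta> - 1) = R powr (1 - \<delta>) * pos_power v (\<delta> - 1)" for v
    using R by (auto simp: pos_power_def powr_divide powr_diff zero_less_divide_iff divide_simps)
  have "(CLINT u|lborel. of_real (pos_power u (\<delta> - 1)) * exp (- (s * of_real u))) =
     \<bar>1 / R\<bar> *\<^sub>R (CLINT v|lborel. of_real (pos_power (0 + 1 / R * v) (\<delta> - 1)) * exp (- (s * of_real (0 + 1 / R * v))))"
    by (rule lborel_integral_real_affine) (use R in simp)
  also have "\<dots> = (1 / R) *\<^sub>R (CLINT v|lborel. of_real (R powr (1 - \<delta>)) * (of_real (pos_power v (\<delta> - 1)) * exp (- ((1 + w) * of_real v))))"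
  proof -
    have "of_real (pos_power (0 + 1 / R * v) (\<delta> - 1)) * exp (- (s * of_real (0 + 1 / R * v))) =
       of_real (R powr (1 - \<delta>)) * (of_real (pos_power v (\<delta> - 1)) * exp (- ((1 + w) * complex_of_real v)))" for v
      using R pp[of v] by (simp add: sw)
    then show ?thesis using R by simp
  qed
  also have "\<dots> = of_real (R powr (1 - \<delta>) / R) * (of_real (Gamma \<delta>) * (1 + w) powr (- of_real \<delta>))"
    by (simp add: gamma_integral_near_1[OF \<delta> w] scaleR_conv_of_real)
  also have "R powr (1 - \<delta>) / R = R powr (- \<delta>)" using R by (simp add: powr_diff powr_minus divide_simps)
  also have "complex_of_real (R powr (- \<delta>)) = of_real R powr (- of_real \<delta>)"
    using R powr_of_real[of R "- \<delta>"] by simp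
  also have "\<dots> * (of_real (Gamma \<delta>) * (1 + w) powr (- of_real \<delta>)) = of_real (Gamma \<delta>) * (of_real R * (1 + w)) powr (- of_real \<delta>)"
    using R by (subst powr_times_real_left) auto
  finally show ?thesis by (simp add: sw)
qed

section \<open>The fractional integral of the scaling function\<close>

lemma summable_one_plus_sq: "summable (\<lambda>k. 1 / (1 + (real k)\<^sup>2))"
proof (rule summable_comparison_test')
  show "summable (\<lambda>k. inverse (real k ^ 2))" by (rule inverse_power_summable) simp
  show "norm (1 / (1 + (real k)\<^sup>2)) \<le> inverse (real k ^ 2)" if "k \<ge> 1" for k
    using that by (simp add: divide_simps add_pos_nonneg)
qed

lemma quadratic_decay_shift:
  assumes "quadratic_decay f C"
  shows "norm (f (y - k)) \<le> C * (2 * (1 + y\<^sup>2)) / (1 + k\<^sup>2)"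
proof -
  have "1 + k\<^sup>2 \<le> 2 * (1 + y\<^sup>2) * (1 + (y - k)\<^sup>2)"
    using peetre[of k y] by (simp add: power2_commute)
  from mult_left_mono[OF this quadratic_decay_nonneg[OF assms]]
  have "C / (1 + (y - k)\<^sup>2) \<le> C * (2 * (1 + y\<^sup>2)) / (1 + k\<^sup>2)"
    by (simp add: divide_simps mult_ac)
  then show ?thesis using quadratic_decayD[OF assms, of "y - k"] by linarith
qed

text \<open>
  The values \<open>1 - exp (- \<i>\<xi>)\<close> and \<open>\<i>\<xi>\<close> lie in the closed right half-plane, the first in its interior, so
  the difference of their arguments stays below \<open>\<pi>\<close> and the principal logarithm of
  the quotient is the difference of the logarithms.
\<close>

lemma qsym_powr_identity:
  assumes "\<xi> \<noteq> 0" "cos \<xi> < 1"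
  shows "qsym (of_real \<xi>) powr of_real \<delta> * (1 - exp (- (\<i> * of_real \<xi>))) powr (- of_real \<delta>) = (\<i> * of_real \<xi>) powr (- of_real \<delta>)"
proof -
  let ?a = "1 - exp (- (\<i> * complex_of_real \<xi>))" and ?b = "\<i> * complex_of_real \<xi>"
  have a: "0 < Re ?a" using assms(2) by (simp add: Re_exp)
  then have a0: "?a \<noteq> 0" by (metis less_irrefl zero_complex.simps(1))
  have b0: "?b \<noteq> 0" using assms by simp
  have "\<bar>Im (Ln ?a)\<bar> < pi / 2" by (rule Re_Ln_pos_lt_imp[OF a])
  moreover have "\<bar>Im (Ln ?b)\<bar> \<le> pi / 2" using Re_Ln_pos_le[OF b0] by simp
  ultimately have im: "- pi < Im (Ln ?a - Ln ?b)" "Im (Ln ?a - Ln ?b) \<le> pi"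
    unfolding minus_complex.simps by linarith+
  have q: "qsym (of_real \<xi>) = ?a / ?b" using assms by (simp add: qsym_def)
  have q0: "qsym (of_real \<xi>) \<noteq> 0" using a0 b0 by (simp add: q)
  have L: "Ln (qsym (of_real \<xi>)) = Ln ?a - Ln ?b"
  proof (rule Ln_unique[OF _ im])
    show "exp (Ln ?a - Ln ?b) = qsym (of_real \<xi>)" using a0 b0 by (simp add: exp_diff q del: right_minus_eq)
  qed
  have "qsym (of_real \<xi>) powr of_real \<delta> * ?a powr (- of_real \<delta>) =
      exp (of_real \<delta> * Ln (qsym (of_real \<xi>)) + (- of_real \<delta>) * Ln ?a)"
    using a0 q0 unfolding exp_add powr_def by (simp only: if_False)
  also have "of_real \<delta> * Ln (qsym (of_real \<xi>)) + (- of_real \<delta>) * Ln ?a = (- of_real \<delta>) * Ln ?b"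
    unfolding L by (simp add: algebra_simps)
  also have "exp ((- of_real \<delta>) * Ln ?b) = ?b powr (- of_real \<delta>)"
    using b0 unfolding powr_def by (simp only: if_False)
  finally show ?thesis .
qed

text \<open>
  The function \<open>1 - exp (- z)\<close> is \<open>z\<close> times a continuous function that has no zeros on the compact rectangle
  given by \<open>0 \<le> Re z \<le> 1\<close> and \<open>\<bar>Im z\<bar> \<le> 4\<pi>/3\<close>. The bound is uniform in the damping \<open>e\<close>.
\<close>

lemma one_minus_exp_lower:
  "\<exists>c>0. \<forall>e \<xi>. 0 \<le> e \<longrightarrow> e \<le> 1 \<longrightarrow> \<bar>\<xi>\<bar> \<le> 4 * pi / 3 \<longrightarrow> c * \<bar>\<xi>\<bar> \<le> norm (1 - exp (- (complex_of_real e + \<i> * of_real \<xi>)))"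
proof -
  define K where "K = cbox (Complex 0 (- (4 * pi / 3))) (Complex 1 (4 * pi / 3))"
  have K: "z \<in> K \<longleftrightarrow> 0 \<le> Re z \<and> Re z \<le> 1 \<and> \<bar>Im z\<bar> \<le> 4 * pi / 3" for z
    by (auto simp: K_def in_cbox_complex_iff abs_le_iff minus_le_iff)
  have eq: "1 - exp (- z) = qsym (- (\<i> * z)) * z" for z by (simp add: qsym_def)
  have nz: "qsym (- (\<i> * z)) \<noteq> 0" if "z \<in> K" for z
  proof
    assume 0: "qsym (- (\<i> * z)) = 0"
    then have "z \<noteq> 0" by (auto simp: qsym_def)
    have "exp (- z) = 1" using eq[of z] 0 by simp
    then obtain n :: int where n: "Re z = 0" "- Im z = of_int (2 * n) * pi" by (auto simp: exp_eq_1)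
    have "n \<noteq> 0" using \<open>z \<noteq> 0\<close> n by (auto simp: complex_eq_iff)
    then have "1 \<le> \<bar>real_of_int n\<bar>" by linarith
    then have "1 * (2 * pi) \<le> \<bar>real_of_int n\<bar> * (2 * pi)" by (intro mult_right_mono) auto
    moreover have "\<bar>Im z\<bar> = \<bar>real_of_int n\<bar> * (2 * pi)"
      using arg_cong[OF n(2), of abs] by (simp add: abs_mult)
    ultimately show False using that pi_gt_zero unfolding K by linarith
  qed
  have "compact K" by (simp add: K_def)
  moreover have "continuous_on K (\<lambda>z. norm (qsym (- (\<i> * z))))"
    by (intro continuous_on_norm continuous_on_compose2[OF qsym_continuous[of UNIV]] continuous_intros) auto
  moreover have "0 \<in> K" by (simp add: K)
  ultimately obtain z0 where z0: "z0 \<in> K" "\<And>z. z \<in> K \<Longrightarrow> norm (qsym (- (\<i> * z0))) \<le> norm (qsym (- (\<i> * z)))"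
    using continuous_attains_inf[of K "\<lambda>z. norm (qsym (- (\<i> * z)))"] by blast
  show ?thesis
  proof (intro exI[of _ "norm (qsym (- (\<i> * z0)))"] conjI allI impI)
    show "0 < norm (qsym (- (\<i> * z0)))" using nz[OF z0(1)] by simp
    fix e \<xi> :: real assume e: "0 \<le> e" "e \<le> 1" "\<bar>\<xi>\<bar> \<le> 4 * pi / 3"
    let ?z = "complex_of_real e + \<i> * of_real \<xi>"
    have "?z \<in> K" using e by (simp add: K)
    then have "norm (qsym (- (\<i> * z0))) * \<bar>\<xi>\<bar> \<le> norm (qsym (- (\<i> * ?z))) * norm ?z"
      using abs_Im_le_cmod[of ?z] by (intro mult_mono z0(2)) auto
    then show "norm (qsym (- (\<i> * z0))) * \<bar>\<xi>\<bar> \<le> norm (1 - exp (- ?z))"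
      unfolding eq norm_mult .
  qed
qed

lemma integrable_abs_powr:
  assumes "0 < (a::real)"
  shows "integrable lborel (\<lambda>x. \<bar>x\<bar> powr (a - 1) * indicator {-R..R} x)"
proof (rule Bochner_Integration.integrable_bound)
  let ?p = "\<lambda>u. pos_power u (a - 1) * exp (- u)"
  have 1: "integrable lborel ?p" by (rule gamma_kernel_integrable[OF assms])
  have "integrable lborel (\<lambda>x. ?p (0 + -1 * x))" by (rule lborel_integrable_real_affine[OF 1]) simp
  then show "integrable lborel (\<lambda>x. exp R * (?p x + ?p (- x)))"
    using 1 by (intro integrable_mult_right Bochner_Integration.integrable_add) simp_all
  show "AE x in lborel. norm (\<bar>x\<bar> powr (a - 1) * indicator {-R..R} x) \<le> norm (exp R * (?p x + ?p (- x)))"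
  proof (rule AE_I2)
    fix x :: real
    have "\<bar>x\<bar> powr (a - 1) * indicator {-R..R} x \<le> exp R * (?p x + ?p (- x))"
    proof (cases "x \<in> {-R..R} \<and> x \<noteq> 0")
      case True
      then have e: "1 \<le> exp (R - \<bar>x\<bar>)" by auto
      have "\<bar>x\<bar> powr (a - 1) * 1 \<le> \<bar>x\<bar> powr (a - 1) * exp (R - \<bar>x\<bar>)"
        by (intro mult_left_mono e) simp
      also have "\<dots> = exp R * (?p x + ?p (- x))"
        using True by (auto simp: pos_power_def exp_diff exp_minus divide_inverse abs_if)
      finally show ?thesis using True by simp
    next
      case False
      then have "\<bar>x\<bar> powr (a - 1) * indicator {-R..R} x = 0" by auto
      moreover have "0 \<le> exp R * (?p x + ?p (- x))" by (intro mult_nonneg_nonneg add_nonneg_nonneg) auto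
      ultimately show ?thesis by linarith
    qed
    then show "norm (\<bar>x\<bar> powr (a - 1) * indicator {-R..R} x) \<le> norm (exp R * (?p x + ?p (- x)))"
      by (simp add: add_nonneg_nonneg)
  qed
qed measurable

lemma gamma_kernel_scaled_integrable:
  assumes "0 < (a::real)" "0 < e"
  shows "integrable lborel (\<lambda>u. pos_power u (a - 1) * exp (- (e * u)))"
proof -
  have "integrable lborel (\<lambda>u. pos_power (0 + e * u) (a - 1) * exp (- (0 + e * u)))"
    by (rule lborel_integrable_real_affine[OF gamma_kernel_integrable[OF assms(1)]]) (use assms in simp)
  then have "integrable lborel (\<lambda>u. e powr (1 - a) * (pos_power (0 + e * u) (a - 1) * exp (- (0 + e * u))))"
    by (rule integrable_mult_right)
  moreover have "(\<lambda>u. e powr (1 - a) * (pos_power (0 + e * u) (a - 1) * exp (- (0 + e * u)))) = (\<lambda>u. pos_power u (a - 1) * exp (- (e * u)))"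
    using assms by (auto simp: pos_power_def powr_mult powr_diff zero_less_mult_iff)
  ultimately show ?thesis by (simp only:)
qed

text \<open>
  For \<open>u \<le> 1\<close> the factor \<open>exp (1 - u)\<close> is at least \<open>1\<close> and can be inserted; for \<open>u > 1\<close> the power is at most \<open>1\<close>.
  The fractional kernel, which is not integrable at infinity, is thus controlled by the Gamma kernel
  and by \<open>v\<close> itself.
\<close>

lemma pos_power_kernel_bound:
  assumes "a \<le> 1" "\<bar>v\<bar> \<le> C"
  shows "pos_power u (a - 1) * \<bar>v\<bar> \<le> C * exp 1 * (pos_power u (a - 1) * exp (- u)) + \<bar>v\<bar>"
proof (cases "u \<le> 1")
  case True
  have C: "0 \<le> C" using assms(2) by linarith
  have "pos_power u (a - 1) * \<bar>v\<bar> \<le> pos_power u (a - 1) * C * 1"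
    using assms(2) by (simp add: mult_left_mono)
  also have "\<dots> \<le> pos_power u (a - 1) * C * exp (1 - u)"
    using True C by (intro mult_left_mono) auto
  also have "\<dots> = C * exp 1 * (pos_power u (a - 1) * exp (- u))"
    by (simp add: exp_diff exp_minus divide_inverse)
  finally show ?thesis by simp
next
  case False
  then have "u powr (a - 1) \<le> u powr 0" using assms(1) by (intro powr_mono) auto
  then have "pos_power u (a - 1) \<le> 1" using False by (simp add: pos_power_def)
  then have "pos_power u (a - 1) * \<bar>v\<bar> \<le> 1 * \<bar>v\<bar>" by (rule mult_right_mono) simp
  moreover have "0 \<le> C * exp 1 * (pos_power u (a - 1) * exp (- u))" using assms(2) by auto
  ultimately show ?thesis by linarith
qed

context band_limited_scaling
begin

definition phihat :: "real \<Rightarrow> complex" where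
  "phihat = fourier (\<lambda>x. of_real (\<phi> x))"

lemma phihat_supp: "\<xi> \<notin> {- (4 * pi / 3) .. 4 * pi / 3} \<Longrightarrow> phihat \<xi> = 0"
  using supp_phi[of \<xi>] by (simp add: phihat_def del: atLeastAtMost_iff)

lemma phihat_continuous: "continuous_on UNIV phihat"
  unfolding phihat_def by (rule Ck_continuous[OF Ck_fourier[OF rapid_schwartz_real[OF schwartz_phi]]])

lemma phihat_integrable: "integrable lborel phihat"
  by (rule integrable_compact_support[OF phihat_continuous phihat_supp])

lemma phihat_bounded: "\<exists>K. \<forall>\<xi>. norm (phihat \<xi>) \<le> K"
  using fourier_norm_le[OF rapid_integrable[OF rapid_schwartz_real[OF schwartz_phi]]] unfolding phihat_def by blast

lemma phi_continuous: "continuous_on UNIV \<phi>"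
  by (rule schwartz_continuous[OF schwartz_phi])

lemma phi_bounded: "\<exists>C. \<forall>x. \<bar>\<phi> x\<bar> \<le> C"
proof -
  obtain C where C: "\<And>x. norm (of_real x ^ 0 * complex_of_real (\<phi> x)) \<le> C"
    using rapid_schwartz_real[OF schwartz_phi] unfolding rapid_def by blast
  then have "\<bar>\<phi> x\<bar> \<le> C" for x using C[of x] by simp
  then show ?thesis by blast
qed

lemma phi_inversion: "of_real (\<phi> x) = fourier phihat (- x)"
proof -
  obtain C where C: "\<And>x. \<bar>\<phi> x\<bar> \<le> C" using phi_bounded by blast
  show ?thesis unfolding phihat_def
  proof (rule fourier_inversion[symmetric])
    show "integrable lborel (\<lambda>x. complex_of_real (\<phi> x))"
      by (rule rapid_integrable[OF rapid_schwartz_real[OF schwartz_phi]])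
    show "continuous_on UNIV (\<lambda>x. complex_of_real (\<phi> x))" by (intro continuous_intros phi_continuous)
    show "norm (complex_of_real (\<phi> x)) \<le> C" for x using C[of x] by simp
    show "integrable lborel (fourier (\<lambda>x. complex_of_real (\<phi> x)))" using phihat_integrable by (simp add: phihat_def)
  qed
qed

lemma phi_decay: "\<exists>C. quadratic_decay \<phi> C"
  by (rule schwartz_quadratic_decay[OF schwartz_phi])

lemma phi_integrable: "integrable lborel \<phi>"
proof -
  obtain C where "quadratic_decay \<phi> C" using phi_decay by blast
  then show ?thesis by (rule quadratic_decay_integrable[OF _ borel_measurable_continuous_onI[OF phi_continuous]])
qed

lemma phi_shift_integrable: "integrable lborel (\<lambda>u. \<phi> (y - u))"
  using lborel_integrable_real_affine[OF phi_integrable, of "-1" y] by simp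

lemma frac_hat_continuous: "continuous_on UNIV (frac_hat \<delta>)"
  by (rule Ck_continuous[OF Ck_frac_hat])

lemma frac_hat_integrable: "integrable lborel (frac_hat \<delta>)"
  by (rule integrable_compact_support[OF frac_hat_continuous frac_hat_supp])

lemma frac_inversion: "of_real (frac_scaling_Re \<delta> x) = fourier (frac_hat \<delta>) (- x)"
  using frac_scaling_of_real[of \<delta> x] by (simp add: frac_scaling_eq)

lemma frac_kernel_integrable:
  assumes "0 < \<delta>" "\<delta> \<le> 1"
  shows "integrable lborel (\<lambda>u. pos_power u (\<delta> - 1) * \<phi> (y - u))"
proof -
  obtain C where C: "\<And>x. \<bar>\<phi> x\<bar> \<le> C" using phi_bounded by blast
  have [measurable]: "\<phi> \<in> borel_measurable borel" by (rule borel_measurable_continuous_onI[OF phi_continuous])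
  show ?thesis
  proof (rule Bochner_Integration.integrable_bound)
    show "integrable lborel (\<lambda>u. C * exp 1 * (pos_power u (\<delta> - 1) * exp (- u)) + \<bar>\<phi> (y - u)\<bar>)"
      using gamma_kernel_integrable[OF assms(1)] phi_shift_integrable[of y]
      by (intro Bochner_Integration.integrable_add integrable_mult_right integrable_abs)
    show "AE u in lborel. norm (pos_power u (\<delta> - 1) * \<phi> (y - u)) \<le> norm (C * exp 1 * (pos_power u (\<delta> - 1) * exp (- u)) + \<bar>\<phi> (y - u)\<bar>)"
    proof (rule AE_I2)
      fix u
      have "norm (pos_power u (\<delta> - 1) * \<phi> (y - u)) = pos_power u (\<delta> - 1) * \<bar>\<phi> (y - u)\<bar>" by (simp add: abs_mult)
      also have "\<dots> \<le> C * exp 1 * (pos_power u (\<delta> - 1) * exp (- u)) + \<bar>\<phi> (y - u)\<bar>"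
        by (rule pos_power_kernel_bound[OF assms(2) C])
      finally show "norm (pos_power u (\<delta> - 1) * \<phi> (y - u)) \<le> norm (C * exp 1 * (pos_power u (\<delta> - 1) * exp (- u)) + \<bar>\<phi> (y - u)\<bar>)"
        unfolding real_norm_def by linarith
    qed
  qed measurable
qed

lemma frac_series_summable:
  assumes "0 < \<delta>" "\<delta> < 1"
  shows "summable (\<lambda>p. \<bar>farima_coeff \<delta> p * frac_scaling_Re \<delta> (y - real p)\<bar>)"
proof -
  obtain C where C: "quadratic_decay (frac_scaling_Re \<delta>) C" using frac_scaling_Re_decay by blast
  show ?thesis
  proof (rule summable_comparison_test')
    show "summable (\<lambda>p. C * (2 * (1 + y\<^sup>2)) * (1 / (1 + (real p)\<^sup>2)))"
      by (rule summable_mult[OF summable_one_plus_sq])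
    fix p
    have "\<bar>farima_coeff \<delta> p\<bar> * \<bar>frac_scaling_Re \<delta> (y - real p)\<bar> \<le> 1 * (C * (2 * (1 + y\<^sup>2)) / (1 + (real p)\<^sup>2))"
      using quadratic_decay_shift[OF C, of y "real p"] farima_coeff_le_1[OF assms, of p] farima_coeff_pos[OF assms(1), of p]
      by (intro mult_mono) auto
    then show "norm \<bar>farima_coeff \<delta> p * frac_scaling_Re \<delta> (y - real p)\<bar> \<le> C * (2 * (1 + y\<^sup>2)) * (1 / (1 + (real p)\<^sup>2))"
      by (simp add: abs_mult)
  qed
qed

text \<open>
  The undamped kernel is not integrable, so Fubini's theorem applies only after damping by
  \<open>exp (- eu)\<close>. Writing \<open>\<phi>\<close> as an inverse transform and integrating over \<open>u\<close> first yields the complex Gamma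
  integral.
\<close>

lemma damped_fractional_integral:
  assumes \<delta>: "0 < \<delta>" "\<delta> < 1" and e: "0 < e"
  shows "of_real (sqrt (2 * pi)) * (CLINT u|lborel. of_real (pos_power u (\<delta> - 1) * exp (- (e * u)) * \<phi> (y - u))) =
    of_real (Gamma \<delta>) * (CLINT \<xi>|lborel. (of_real e + \<i> * of_real \<xi>) powr (- of_real \<delta>) * (exp (\<i> * of_real \<xi> * of_real y) * phihat \<xi>))"
proof -
  define k where "k u \<xi> = of_real (pos_power u (\<delta> - 1)) * exp (- ((of_real e + \<i> * of_real \<xi>) * of_real u)) * (exp (\<i> * of_real \<xi> * of_real y) * phihat \<xi>)" for u \<xi> :: real
  have [measurable]: "phihat \<in> borel_measurable borel" using borel_measurable_integrable[OF phihat_integrable] by simp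
  have e1: "norm (exp (- ((of_real e + \<i> * of_real \<xi>) * complex_of_real u))) = exp (- (e * u))" for u \<xi>
    by (simp add: norm_exp_eq_Re)
  have e2: "norm (exp (\<i> * of_real \<xi> * complex_of_real y)) = 1" for \<xi> by (simp add: norm_exp_eq_Re)
  have nk: "norm (k u \<xi>) = pos_power u (\<delta> - 1) * exp (- (e * u)) * norm (phihat \<xi>)" for u \<xi>
    by (simp add: k_def norm_mult e1 e2)
  have int: "integrable (lborel \<Otimes>\<^sub>M lborel) (\<lambda>(u, \<xi>). k u \<xi>)"
  proof (rule lborel_pair.Fubini_integrable)
    show km: "(\<lambda>(u, \<xi>). k u \<xi>) \<in> borel_measurable (lborel \<Otimes>\<^sub>M lborel)"
      unfolding k_def by measurable
    have "(\<lambda>u. LINT \<xi>|lborel. norm (k u \<xi>)) = (\<lambda>u. pos_power u (\<delta> - 1) * exp (- (e * u)) * (LINT \<xi>|lborel. norm (phihat \<xi>)))"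
      by (simp add: nk)
    then show "integrable lborel (\<lambda>u. LINT \<xi>|lborel. norm (case (u, \<xi>) of (u, \<xi>) \<Rightarrow> k u \<xi>))"
      using gamma_kernel_scaled_integrable[OF \<delta>(1) e] by simp
    show "AE u in lborel. integrable lborel (\<lambda>\<xi>. case (u, \<xi>) of (u, \<xi>) \<Rightarrow> k u \<xi>)"
    proof (rule AE_I2)
      fix u
      show "integrable lborel (\<lambda>\<xi>. case (u, \<xi>) of (u, \<xi>) \<Rightarrow> k u \<xi>)"
      proof (rule Bochner_Integration.integrable_bound)
        show "integrable lborel (\<lambda>\<xi>. pos_power u (\<delta> - 1) * exp (- (e * u)) * norm (phihat \<xi>))"
          using phihat_integrable by simp
        have "(\<lambda>\<xi>. k u \<xi>) \<in> borel_measurable lborel"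
          unfolding k_def by measurable
        then show "(\<lambda>\<xi>. case (u, \<xi>) of (u, \<xi>) \<Rightarrow> k u \<xi>) \<in> borel_measurable lborel" by simp
      qed (simp add: nk)
    qed
  qed
  have "(CLINT \<xi>|lborel. CLINT u|lborel. k u \<xi>) = (CLINT u|lborel. CLINT \<xi>|lborel. k u \<xi>)"
    by (rule lborel_pair.Fubini_integral[OF int])
  moreover have "(CLINT u|lborel. k u \<xi>) = of_real (Gamma \<delta>) * ((of_real e + \<i> * of_real \<xi>) powr (- of_real \<delta>) * (exp (\<i> * of_real \<xi> * of_real y) * phihat \<xi>))" for \<xi>
    using gamma_integral_complex[OF \<delta>, of "of_real e + \<i> * of_real \<xi>"] e
    unfolding k_def integral_mult_left_zero by simp
  moreover have "(CLINT \<xi>|lborel. k u \<xi>) = of_real (sqrt (2 * pi)) * of_real (pos_power u (\<delta> - 1) * exp (- (e * u)) * \<phi> (y - u))" for u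
  proof -
    have "k u \<xi> = of_real (pos_power u (\<delta> - 1) * exp (- (e * u))) * (exp (- (\<i> * of_real (- (y - u)) * of_real \<xi>)) * phihat \<xi>)" for \<xi>
    proof -
      have "exp (- ((of_real e + \<i> * of_real \<xi>) * of_real u)) * exp (\<i> * of_real \<xi> * of_real y) =
         of_real (exp (- (e * u))) * exp (- (\<i> * of_real (- (y - u)) * complex_of_real \<xi>))"
        unfolding exp_of_real[symmetric] exp_add[symmetric] by (simp add: algebra_simps)
      then show ?thesis by (simp add: k_def mult.assoc)
    qed
    then have "(CLINT \<xi>|lborel. k u \<xi>) = of_real (pos_power u (\<delta> - 1) * exp (- (e * u))) * (CLINT \<xi>|lborel. exp (- (\<i> * of_real (- (y - u)) * of_real \<xi>)) * phihat \<xi>)"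
      by simp
    also have "(CLINT \<xi>|lborel. exp (- (\<i> * of_real (- (y - u)) * of_real \<xi>)) * phihat \<xi>) = of_real (sqrt (2 * pi)) * of_real (\<phi> (y - u))"
      unfolding phi_inversion[of "y - u"] fourier_def by simp
    finally show ?thesis by simp
  qed
  ultimately show ?thesis by simp
qed

text \<open>
  The same damping makes the series of FARIMA coefficients absolutely convergent, and summation under
  the inverse transform yields the binomial series in \<open>exp (- (e + \<i>\<xi>))\<close>.
\<close>

lemma damped_frac_series:
  assumes \<delta>: "0 < \<delta>" "\<delta> < 1" and e: "0 < e"
  shows "of_real (sqrt (2 * pi)) * (\<Sum>p. of_real (farima_coeff \<delta> p * exp (- (e * real p)) * frac_scaling_Re \<delta> (y - real p))) =
    (CLINT \<xi>|lborel. (1 - exp (- (of_real e + \<i> * of_real \<xi>))) powr (- of_real \<delta>) * (exp (\<i> * of_real \<xi> * of_real y) * frac_hat \<delta> \<xi>))"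
proof -
  define f where "f p \<xi> = (of_real (farima_coeff \<delta> p) * exp (- (of_real e + \<i> * of_real \<xi>)) ^ p) * (exp (\<i> * of_real \<xi> * of_real y) * frac_hat \<delta> \<xi>)" for p and \<xi> :: real
  have [measurable]: "frac_hat \<delta> \<in> borel_measurable borel" using borel_measurable_integrable[OF frac_hat_integrable] by simp
  have e1: "norm (exp (- (of_real e + \<i> * complex_of_real \<xi>))) = exp (- e)" for \<xi>
    by (simp add: norm_exp_eq_Re)
  have e2: "norm (exp (\<i> * of_real \<xi> * complex_of_real y)) = 1" for \<xi> by (simp add: norm_exp_eq_Re)
  have nf: "norm (f p \<xi>) = farima_coeff \<delta> p * exp (- e) ^ p * norm (frac_hat \<delta> \<xi>)" for p \<xi>
    using farima_coeff_pos[OF \<delta>(1), of p] by (simp add: f_def norm_mult norm_power e1 e2)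
  have sm: "summable (\<lambda>p. farima_coeff \<delta> p * exp (- e) ^ p)"
  proof (rule summable_comparison_test')
    show "summable (\<lambda>p. exp (- e) ^ p)" using e by (intro summable_geometric) simp
    show "norm (farima_coeff \<delta> p * exp (- e) ^ p) \<le> exp (- e) ^ p" for p
      using mult_right_mono[OF farima_coeff_le_1[OF \<delta>, of p], of "exp (- e) ^ p"] farima_coeff_pos[OF \<delta>(1), of p]
      by (simp add: abs_mult)
  qed
  have "(\<lambda>p. integral\<^sup>L lborel (f p)) sums (CLINT \<xi>|lborel. (\<Sum>p. f p \<xi>))"
  proof (rule sums_integral)
    show "integrable lborel (f p)" for p
    proof (rule Bochner_Integration.integrable_bound)
      show "integrable lborel (\<lambda>\<xi>. farima_coeff \<delta> p * exp (- e) ^ p * norm (frac_hat \<delta> \<xi>))"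
        using frac_hat_integrable by simp
      show "f p \<in> borel_measurable lborel" unfolding f_def by measurable
    qed (use farima_coeff_pos[OF \<delta>(1), of p] in \<open>simp add: nf abs_mult\<close>)
    show "AE \<xi> in lborel. summable (\<lambda>p. norm (f p \<xi>))"
      unfolding nf by (intro AE_I2 summable_mult2 sm)
    show "summable (\<lambda>p. LINT \<xi>|lborel. norm (f p \<xi>))"
      unfolding nf integral_mult_right_zero by (intro summable_mult2 sm)
  qed
  moreover have "(\<Sum>p. f p \<xi>) = (1 - exp (- (of_real e + \<i> * of_real \<xi>))) powr (- of_real \<delta>) * (exp (\<i> * of_real \<xi> * of_real y) * frac_hat \<delta> \<xi>)" for \<xi>
  proof -
    have "norm (exp (- (of_real e + \<i> * complex_of_real \<xi>))) < 1" using e by (simp add: e1)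
    from sums_mult2[OF farima_generating[OF \<delta>(1) this]]
    show ?thesis unfolding f_def by (rule sums_unique[symmetric])
  qed
  moreover have "integral\<^sup>L lborel (f p) = of_real (sqrt (2 * pi)) * of_real (farima_coeff \<delta> p * exp (- (e * real p)) * frac_scaling_Re \<delta> (y - real p))" for p
  proof -
    have "f p \<xi> = of_real (farima_coeff \<delta> p * exp (- (e * real p))) * (exp (- (\<i> * of_real (- (y - real p)) * of_real \<xi>)) * frac_hat \<delta> \<xi>)" for \<xi>
    proof -
      have "exp (- (of_real e + \<i> * of_real \<xi>)) ^ p * exp (\<i> * of_real \<xi> * of_real y) =
         of_real (exp (- (e * real p))) * exp (- (\<i> * of_real (- (y - real p)) * complex_of_real \<xi>))"
        unfolding exp_of_real[symmetric] exp_of_nat_mult[symmetric] exp_add[symmetric] by (simp add: algebra_simps)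
      then show ?thesis by (simp add: f_def mult.assoc)
    qed
    then have eq: "f p = (\<lambda>\<xi>. of_real (farima_coeff \<delta> p * exp (- (e * real p))) * (exp (- (\<i> * of_real (- (y - real p)) * of_real \<xi>)) * frac_hat \<delta> \<xi>))"
      by (rule ext)
    have "integral\<^sup>L lborel (f p) = of_real (farima_coeff \<delta> p * exp (- (e * real p))) * (CLINT \<xi>|lborel. exp (- (\<i> * of_real (- (y - real p)) * of_real \<xi>)) * frac_hat \<delta> \<xi>)"
      unfolding eq by (rule integral_mult_right_zero)
    also have "(CLINT \<xi>|lborel. exp (- (\<i> * of_real (- (y - real p)) * of_real \<xi>)) * frac_hat \<delta> \<xi>) = of_real (sqrt (2 * pi)) * of_real (frac_scaling_Re \<delta> (y - real p))"
      unfolding frac_inversion[of \<delta> "y - real p"] fourier_def by simp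
    finally show ?thesis by simp
  qed
  ultimately have s: "(\<lambda>p. of_real (sqrt (2 * pi)) * complex_of_real (farima_coeff \<delta> p * exp (- (e * real p)) * frac_scaling_Re \<delta> (y - real p))) sums
     (CLINT \<xi>|lborel. (1 - exp (- (of_real e + \<i> * of_real \<xi>))) powr (- of_real \<delta>) * (exp (\<i> * of_real \<xi> * of_real y) * frac_hat \<delta> \<xi>))"
    by simp
  have "summable (\<lambda>p. complex_of_real (farima_coeff \<delta> p * exp (- (e * real p)) * frac_scaling_Re \<delta> (y - real p)))"
    using summable_mult[OF sums_summable[OF s], of "inverse (of_real (sqrt (2 * pi)))"] by simp
  from suminf_mult[OF this, of "of_real (sqrt (2 * pi))"] sums_unique[OF s] show ?thesis by simp
qed

text \<open>
  The fractional integral of order \<open>\<delta>\<close> of \<open>\<phi>\<close> is the FARIMA filter applied to the fractional scaling function: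
  on the Fourier side \<open>(\<i>\<xi>) powr (- \<delta>)\<close> factors as \<open>(1 - exp (- \<i>\<xi>)) powr (- \<delta>)\<close> times
  \<open>qsym \<xi> powr \<delta>\<close>. Both sides are limits of their damped versions as the damping \<open>e n\<close> tends to \<open>0\<close>; the
  integrands over \<open>\<xi>\<close> have the common majorant \<open>\<bar>\<xi>\<bar> powr (- \<delta>)\<close> on a bounded interval.
\<close>

lemma fractional_integral_identity:
  assumes \<delta>: "0 < \<delta>" "\<delta> < 1"
  shows "(LINT u|lborel. pos_power u (\<delta> - 1) * \<phi> (y - u)) = Gamma \<delta> * (\<Sum>p. farima_coeff \<delta> p * frac_scaling_Re \<delta> (y - real p))"
proof -
  define e where "e n = inverse (real (Suc n))" for n
  have e: "0 < e n" "e n \<le> 1" for n by (simp_all add: e_def field_simps)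
  have e_lim: "e \<longlonglongrightarrow> 0" unfolding e_def by (rule LIMSEQ_inverse_real_of_nat)
  define A where "A n = (LINT u|lborel. pos_power u (\<delta> - 1) * exp (- (e n * u)) * \<phi> (y - u))" for n
  define Bs where "Bs n = (\<Sum>p. farima_coeff \<delta> p * exp (- (e n * real p)) * frac_scaling_Re \<delta> (y - real p))" for n
  define a where "a n \<xi> = (of_real (e n) + \<i> * of_real \<xi>) powr (- of_real \<delta>) * (exp (\<i> * of_real \<xi> * of_real y) * phihat \<xi>)" for n \<xi>
  define b where "b n \<xi> = (1 - exp (- (of_real (e n) + \<i> * of_real \<xi>))) powr (- of_real \<delta>) * (exp (\<i> * of_real \<xi> * of_real y) * frac_hat \<delta> \<xi>)" for n \<xi>
  have \<phi>m [measurable]: "\<phi> \<in> borel_measurable borel" by (rule borel_measurable_continuous_onI[OF phi_continuous])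
  have [measurable]: "phihat \<in> borel_measurable borel" using borel_measurable_integrable[OF phihat_integrable] by simp
  have [measurable]: "frac_hat \<delta> \<in> borel_measurable borel" using borel_measurable_integrable[OF frac_hat_integrable] by simp
  have Gpos: "Gamma \<delta> > 0" using \<delta>(1) by (rule Gamma_real_pos)
  have AA: "A \<longlonglongrightarrow> (LINT u|lborel. pos_power u (\<delta> - 1) * \<phi> (y - u))"
    unfolding A_def
  proof (rule integral_dominated_convergence)
    show "integrable lborel (\<lambda>u. norm (pos_power u (\<delta> - 1) * \<phi> (y - u)))"
      using frac_kernel_integrable[of \<delta> y] \<delta> by simp
    show "AE u in lborel. (\<lambda>n. pos_power u (\<delta> - 1) * exp (- (e n * u)) * \<phi> (y - u)) \<longlonglongrightarrow> pos_power u (\<delta> - 1) * \<phi> (y - u)"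
    proof (rule AE_I2)
      fix u
      have "(\<lambda>n. pos_power u (\<delta> - 1) * exp (- (e n * u)) * \<phi> (y - u)) \<longlonglongrightarrow> pos_power u (\<delta> - 1) * exp (- (0 * u)) * \<phi> (y - u)"
        by (intro tendsto_intros e_lim)
      then show "(\<lambda>n. pos_power u (\<delta> - 1) * exp (- (e n * u)) * \<phi> (y - u)) \<longlonglongrightarrow> pos_power u (\<delta> - 1) * \<phi> (y - u)" by simp
    qed
    show "AE u in lborel. norm (pos_power u (\<delta> - 1) * exp (- (e n * u)) * \<phi> (y - u)) \<le> norm (pos_power u (\<delta> - 1) * \<phi> (y - u))" for n
    proof (rule AE_I2)
      fix u
      have "pos_power u (\<delta> - 1) * exp (- (e n * u)) \<le> pos_power u (\<delta> - 1) * 1"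
        using e(1)[of n] by (auto simp: pos_power_def intro!: mult_left_mono)
      from mult_right_mono[OF this, of "\<bar>\<phi> (y - u)\<bar>"]
      show "norm (pos_power u (\<delta> - 1) * exp (- (e n * u)) * \<phi> (y - u)) \<le> norm (pos_power u (\<delta> - 1) * \<phi> (y - u))"
        by (simp add: abs_mult)
    qed
  qed measurable
  have fs: "summable (\<lambda>p. \<bar>farima_coeff \<delta> p * frac_scaling_Re \<delta> (y - real p)\<bar>)" by (rule frac_series_summable[OF \<delta>])
  have bd: "\<bar>farima_coeff \<delta> p * exp (- (e n * real p)) * frac_scaling_Re \<delta> (y - real p)\<bar> \<le> \<bar>farima_coeff \<delta> p * frac_scaling_Re \<delta> (y - real p)\<bar>" for n p
  proof -
    have "exp (- (e n * real p)) \<le> 1" using e(1)[of n] by simp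
    from mult_left_mono[OF this, of "\<bar>farima_coeff \<delta> p * frac_scaling_Re \<delta> (y - real p)\<bar>"]
    show ?thesis by (simp add: abs_mult mult_ac)
  qed
  have BB: "Bs \<longlonglongrightarrow> (\<Sum>p. farima_coeff \<delta> p * frac_scaling_Re \<delta> (y - real p))"
  proof -
    have lim: "((\<lambda>n. farima_coeff \<delta> p * exp (- (e n * real p)) * frac_scaling_Re \<delta> (y - real p)) \<longlongrightarrow> farima_coeff \<delta> p * frac_scaling_Re \<delta> (y - real p)) sequentially" for p
    proof -
      have "(\<lambda>n. farima_coeff \<delta> p * exp (- (e n * real p)) * frac_scaling_Re \<delta> (y - real p)) \<longlonglongrightarrow> farima_coeff \<delta> p * exp (- (0 * real p)) * frac_scaling_Re \<delta> (y - real p)"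
        by (intro tendsto_intros e_lim)
      then show ?thesis by simp
    qed
    have "eventually (\<lambda>(k, n). norm (farima_coeff \<delta> k * exp (- (e n * real k)) * frac_scaling_Re \<delta> (y - real k)) \<le> \<bar>farima_coeff \<delta> k * frac_scaling_Re \<delta> (y - real k)\<bar>) (at_top \<times>\<^sub>F sequentially)"
      using bd by (intro always_eventually) auto
    from tannerys_theorem[OF lim this fs] show ?thesis by (simp add: Bs_def[abs_def])
  qed
  have Asum: "of_real (sqrt (2 * pi)) * of_real (A n) = of_real (Gamma \<delta>) * (CLINT \<xi>|lborel. a n \<xi>)" for n
    using damped_fractional_integral[OF \<delta> e(1)[of n], of y] unfolding a_def A_def integral_complex_of_real .
  have Bsum: "of_real (sqrt (2 * pi)) * of_real (Bs n) = (CLINT \<xi>|lborel. b n \<xi>)" for n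
  proof -
    have "summable (\<lambda>p. farima_coeff \<delta> p * exp (- (e n * real p)) * frac_scaling_Re \<delta> (y - real p))"
      using bd[of _ n] by (intro summable_comparison_test'[OF fs, of 0]) simp
    from suminf_of_real[OF this, where ?'a=complex] show ?thesis
      using damped_frac_series[OF \<delta> e(1)[of n], of y] unfolding b_def Bs_def by simp
  qed
  obtain c where c: "c > 0" "\<And>e \<xi>. 0 \<le> e \<Longrightarrow> e \<le> 1 \<Longrightarrow> \<bar>\<xi>\<bar> \<le> 4 * pi / 3 \<Longrightarrow> c * \<bar>\<xi>\<bar> \<le> norm (1 - exp (- (complex_of_real e + \<i> * of_real \<xi>)))"
    using one_minus_exp_lower by blast
  obtain K where K: "\<And>\<xi>. norm (phihat \<xi>) \<le> K" using phihat_bounded by blast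
  let ?R = "4 * pi / 3"
  have nexp: "norm (exp (\<i> * of_real \<xi> * complex_of_real y)) = 1" for \<xi> by (simp add: norm_exp_eq_Re)
  have out: "a n \<xi> = 0" "b n \<xi> = 0" if "\<xi> \<notin> {- ?R..?R}" for n \<xi>
    using phihat_supp[OF that] frac_hat_supp[OF that, of \<delta>] by (simp_all add: a_def b_def)
  have npow: "norm (z powr (- of_real \<delta>)) = norm z powr (- \<delta>)" for z :: complex
    using norm_powr_real_powr'[of "- of_real \<delta>" z] by simp
  have abd: "norm (a n \<xi>) \<le> K * (\<bar>\<xi>\<bar> powr (- \<delta>) * indicator {- ?R..?R} \<xi>)" if "\<xi> \<noteq> 0" for n \<xi>
  proof (cases "\<xi> \<in> {- ?R..?R}")
    case True
    have "norm (of_real (e n) + \<i> * complex_of_real \<xi>) powr (- \<delta>) \<le> \<bar>\<xi>\<bar> powr (- \<delta>)"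
      using abs_Im_le_cmod[of "of_real (e n) + \<i> * complex_of_real \<xi>"] that \<delta>(1) by (intro powr_mono2') auto
    then have "norm (of_real (e n) + \<i> * complex_of_real \<xi>) powr (- \<delta>) * norm (phihat \<xi>) \<le> \<bar>\<xi>\<bar> powr (- \<delta>) * K"
      using K[of \<xi>] by (intro mult_mono) auto
    then show ?thesis using True by (simp add: a_def norm_mult npow nexp mult.commute)
  next
    case False
    then show ?thesis by (simp add: out(1)[OF False])
  qed
  have bbd: "norm (b n \<xi>) \<le> c powr (- \<delta>) * K * (\<bar>\<xi>\<bar> powr (- \<delta>) * indicator {- ?R..?R} \<xi>)" if "\<xi> \<noteq> 0" for n \<xi>
  proof (cases "\<xi> \<in> {- ?R..?R}")
    case True
    then have R: "\<bar>\<xi>\<bar> \<le> ?R" unfolding atLeastAtMost_iff by linarith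
    have "norm (1 - exp (- (complex_of_real (e n) + \<i> * of_real \<xi>))) powr (- \<delta>) \<le> (c * \<bar>\<xi>\<bar>) powr (- \<delta>)"
      using c(2)[OF less_imp_le[OF e(1)] e(2) R, of n] c(1) that \<delta>(1) by (intro powr_mono2') auto
    also have "\<dots> = c powr (- \<delta>) * \<bar>\<xi>\<bar> powr (- \<delta>)" using c(1) by (simp add: powr_mult)
    finally have 1: "norm (1 - exp (- (complex_of_real (e n) + \<i> * of_real \<xi>))) powr (- \<delta>) \<le> c powr (- \<delta>) * \<bar>\<xi>\<bar> powr (- \<delta>)" .
    have "norm (frac_hat \<delta> \<xi>) = norm (qsym (of_real \<xi>)) powr \<delta> * norm (phihat \<xi>)"
      using norm_powr_real_powr'[of "of_real \<delta>" "qsym (of_real \<xi>)"] by (simp add: frac_hat_def phihat_def norm_mult)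
    also have "\<dots> \<le> 1 * K"
    proof (intro mult_mono K)
      show "norm (qsym (of_real \<xi>)) powr \<delta> \<le> 1"
        using powr_mono2[of \<delta> "norm (qsym (of_real \<xi>))" 1] norm_qsym_le_1[of \<xi>] \<delta>(1) by simp
    qed auto
    finally have 2: "norm (frac_hat \<delta> \<xi>) \<le> K" by simp
    have "norm (b n \<xi>) = norm (1 - exp (- (complex_of_real (e n) + \<i> * of_real \<xi>))) powr (- \<delta>) * norm (frac_hat \<delta> \<xi>)"
      by (simp only: b_def norm_mult npow nexp mult_1)
    also have "\<dots> \<le> (c powr (- \<delta>) * \<bar>\<xi>\<bar> powr (- \<delta>)) * K"
      by (intro mult_mono 1 2) auto
    finally show ?thesis using True by (simp add: mult_ac)
  next
    case False
    then show ?thesis by (simp add: out(2)[OF False])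
  qed
  have hint: "integrable lborel (\<lambda>\<xi>. \<bar>\<xi>\<bar> powr (- \<delta>) * indicator {- ?R..?R} \<xi>)"
    using integrable_abs_powr[of "1 - \<delta>" ?R] \<delta>(2) by simp
  have ne0: "AE \<xi> in lborel. \<xi> \<noteq> (0::real)" by (rule AE_lborel_singleton)
  have aint: "integrable lborel (a n)" for n
  proof (rule Bochner_Integration.integrable_bound)
    show "integrable lborel (\<lambda>\<xi>. K * (\<bar>\<xi>\<bar> powr (- \<delta>) * indicator {- ?R..?R} \<xi>))" by (rule integrable_mult_right[OF hint])
    show "a n \<in> borel_measurable lborel" unfolding a_def by measurable
    show "AE \<xi> in lborel. norm (a n \<xi>) \<le> norm (K * (\<bar>\<xi>\<bar> powr (- \<delta>) * indicator {- ?R..?R} \<xi>))"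
      using ne0 by eventually_elim (rule order_trans[OF abd], auto)
  qed
  have bint: "integrable lborel (b n)" for n
  proof (rule Bochner_Integration.integrable_bound)
    show "integrable lborel (\<lambda>\<xi>. c powr (- \<delta>) * K * (\<bar>\<xi>\<bar> powr (- \<delta>) * indicator {- ?R..?R} \<xi>))" by (rule integrable_mult_right[OF hint])
    show "b n \<in> borel_measurable lborel" unfolding b_def by measurable
    show "AE \<xi> in lborel. norm (b n \<xi>) \<le> norm (c powr (- \<delta>) * K * (\<bar>\<xi>\<bar> powr (- \<delta>) * indicator {- ?R..?R} \<xi>))"
      using ne0 by eventually_elim (rule order_trans[OF bbd], auto)
  qed
  have "(\<lambda>n. CLINT \<xi>|lborel. a n \<xi> - b n \<xi>) \<longlonglongrightarrow> (CLINT \<xi>|(lborel :: real measure). 0)"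
  proof (rule integral_dominated_convergence)
    show "(\<lambda>\<xi>. a n \<xi> - b n \<xi>) \<in> borel_measurable lborel" for n
      using borel_measurable_integrable[OF aint] borel_measurable_integrable[OF bint] by measurable
    show "integrable lborel (\<lambda>\<xi>. (K + c powr (- \<delta>) * K) * (\<bar>\<xi>\<bar> powr (- \<delta>) * indicator {- ?R..?R} \<xi>))" by (rule integrable_mult_right[OF hint])
    show "AE \<xi> in lborel. norm (a n \<xi> - b n \<xi>) \<le> (K + c powr (- \<delta>) * K) * (\<bar>\<xi>\<bar> powr (- \<delta>) * indicator {- ?R..?R} \<xi>)" for n
      using ne0
    proof eventually_elim
      case (elim \<xi>)
      then show ?case
        using norm_triangle_ineq4[of "a n \<xi>" "b n \<xi>"] abd[of \<xi> n] bbd[of \<xi> n] unfolding distrib_right[of K] by linarith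
    qed
    show "AE \<xi> in lborel. (\<lambda>n. a n \<xi> - b n \<xi>) \<longlonglongrightarrow> 0"
      using ne0
    proof eventually_elim
      case (elim \<xi>)
      show ?case
      proof (cases "\<xi> \<in> {- ?R..?R}")
        case False
        then show ?thesis by (simp add: out[OF False])
      next
        case True
        then have R: "\<bar>\<xi>\<bar> \<le> ?R" unfolding atLeastAtMost_iff by linarith
        have "\<bar>\<xi>\<bar> < 2 * pi" using R pi_gt_zero by linarith
        then have cos: "cos \<xi> < 1" by (rule cos_less_one[OF elim])
        have n1: "of_real 0 + \<i> * complex_of_real \<xi> \<notin> \<real>\<^sub>\<le>\<^sub>0" using elim by (simp add: complex_nonpos_Reals_iff)
        have n2: "1 - exp (- (of_real 0 + \<i> * complex_of_real \<xi>)) \<notin> \<real>\<^sub>\<le>\<^sub>0" using cos by (simp add: complex_nonpos_Reals_iff Re_exp)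
        have la: "(\<lambda>n. a n \<xi>) \<longlonglongrightarrow> (of_real 0 + \<i> * of_real \<xi>) powr (- of_real \<delta>) * (exp (\<i> * of_real \<xi> * of_real y) * phihat \<xi>)"
          unfolding a_def by (intro tendsto_mult tendsto_const tendsto_powr_complex n1 tendsto_add tendsto_of_real e_lim)
        have lb: "(\<lambda>n. b n \<xi>) \<longlonglongrightarrow> (1 - exp (- (of_real 0 + \<i> * of_real \<xi>))) powr (- of_real \<delta>) * (exp (\<i> * of_real \<xi> * of_real y) * frac_hat \<delta> \<xi>)"
          unfolding b_def by (intro tendsto_mult tendsto_const tendsto_powr_complex n2 tendsto_diff tendsto_exp tendsto_minus tendsto_add tendsto_of_real e_lim)
        have eq: "(of_real 0 + \<i> * of_real \<xi>) powr (- of_real \<delta>) * (exp (\<i> * of_real \<xi> * of_real y) * phihat \<xi>) =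
            (1 - exp (- (of_real 0 + \<i> * of_real \<xi>))) powr (- of_real \<delta>) * (exp (\<i> * of_real \<xi> * of_real y) * frac_hat \<delta> \<xi>)"
          using qsym_powr_identity[OF elim cos, of \<delta>] by (simp add: frac_hat_def phihat_def[symmetric] mult.commute)
        show ?thesis using tendsto_diff[OF la lb] unfolding eq by simp
      qed
    qed
  qed measurable
  then have d0: "(\<lambda>n. (CLINT \<xi>|lborel. a n \<xi>) - (CLINT \<xi>|lborel. b n \<xi>)) \<longlonglongrightarrow> 0"
    using aint bint by simp
  have "(CLINT \<xi>|lborel. a n \<xi>) - (CLINT \<xi>|lborel. b n \<xi>) = of_real (sqrt (2 * pi) * (A n / Gamma \<delta> - Bs n))" for n
  proof -
    have "(CLINT \<xi>|lborel. a n \<xi>) = of_real (sqrt (2 * pi)) * of_real (A n) / of_real (Gamma \<delta>)"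
      using Asum[of n] Gpos by (simp add: field_simps)
    then show ?thesis using Bsum[of n] by (simp add: right_diff_distrib)
  qed
  then have "(\<lambda>n. complex_of_real (sqrt (2 * pi) * (A n / Gamma \<delta> - Bs n))) \<longlonglongrightarrow> of_real 0" using d0 by simp
  then have z: "(\<lambda>n. sqrt (2 * pi) * (A n / Gamma \<delta> - Bs n)) \<longlonglongrightarrow> 0" by (simp only: tendsto_of_real_iff)
  have "(\<lambda>n. sqrt (2 * pi) * (A n / Gamma \<delta> - Bs n)) \<longlonglongrightarrow>
     sqrt (2 * pi) * ((LINT u|lborel. pos_power u (\<delta> - 1) * \<phi> (y - u)) / Gamma \<delta> - (\<Sum>p. farima_coeff \<delta> p * frac_scaling_Re \<delta> (y - real p)))"
    by (intro tendsto_intros AA BB) (use Gpos in simp)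
  from LIMSEQ_unique[OF this z]
  have "(LINT u|lborel. pos_power u (\<delta> - 1) * \<phi> (y - u)) / Gamma \<delta> = (\<Sum>p. farima_coeff \<delta> p * frac_scaling_Re \<delta> (y - real p))" by simp
  then show ?thesis using Gpos by (simp add: field_simps)
qed

end

section \<open>Sums over boxes of multi-indices\<close>

lemma vec_box_eq_image: "{v :: 'i^'d::finite. \<forall>l. v $ l \<in> S l} = vec_lambda ` (PiE UNIV S)"
proof (intro set_eqI iffI)
  fix v :: "'i^'d" assume "v \<in> {v. \<forall>l. v $ l \<in> S l}"
  then show "v \<in> vec_lambda ` (PiE UNIV S)"
    by (intro image_eqI[of _ _ "\<lambda>l. v $ l"]) (auto simp: PiE_UNIV_domain vec_eq_iff)
qed (auto simp: PiE_UNIV_domain)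

lemma finite_vec_box: "(\<And>l. finite (S l)) \<Longrightarrow> finite {v :: 'i^'d::finite. \<forall>l. v $ l \<in> S l}"
  unfolding vec_box_eq_image by (intro finite_imageI finite_PiE) auto

lemma sum_prod_vec_box:
  fixes f :: "'d::finite \<Rightarrow> 'i \<Rightarrow> 'a::comm_semiring_1"
  assumes "\<And>l. finite (S l)"
  shows "(\<Sum>v\<in>{v :: 'i^'d. \<forall>l. v $ l \<in> S l}. \<Prod>l\<in>UNIV. f l (v $ l)) = (\<Prod>l\<in>UNIV. \<Sum>i\<in>S l. f l i)"
proof -
  have inj: "inj_on vec_lambda (PiE (UNIV :: 'd set) S)" by (auto simp: inj_on_def vec_lambda_inject)
  show ?thesis
    unfolding vec_box_eq_image by (simp add: sum.reindex[OF inj] prod_sum_PiE assms)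
qed

definition nat_box :: "nat \<Rightarrow> (nat^'d) set" where "nat_box n = {p. \<forall>l. p $ l \<le> n}"

definition int_box :: "nat \<Rightarrow> (int^'d) set" where "int_box n = {m. \<forall>l. \<bar>m $ l\<bar> \<le> int n}"

lemma finite_nat_box [simp]: "finite (nat_box n :: (nat^'d) set)"
  using finite_vec_box[of "\<lambda>_. {..n}"] by (simp add: nat_box_def)

lemma int_box_alt: "int_box n = {m. \<forall>l. m $ l \<in> {- int n..int n}}"
  by (auto simp: int_box_def abs_le_iff minus_le_iff)

lemma finite_int_box [simp]: "finite (int_box n :: (int^'d) set)"
  unfolding int_box_alt by (rule finite_vec_box) simp

lemma sum_prod_nat_box: "(\<Sum>p\<in>nat_box n. \<Prod>l\<in>UNIV. f l (p $ l)) = (\<Prod>l\<in>UNIV. \<Sum>i\<le>n. f l i :: 'a::comm_semiring_1)"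
  using sum_prod_vec_box[of "\<lambda>_. {..n}" f] by (simp add: nat_box_def)

lemma int_box_mono: "n \<le> n' \<Longrightarrow> int_box n \<subseteq> int_box n'"
  unfolding int_box_def by (auto intro: order_trans)

lemma nat_box_mono: "n \<le> n' \<Longrightarrow> nat_box n \<subseteq> nat_box n'"
  unfolding nat_box_def by (auto intro: order_trans)

lemma mem_int_box: "\<exists>n. m \<in> int_box n"
proof -
  have "\<bar>m $ l\<bar> \<le> int (nat (\<Sum>l\<in>UNIV. \<bar>m $ l\<bar>))" for l
    using member_le_sum[of l UNIV "\<lambda>l. \<bar>m $ l\<bar>"] by (simp add: sum_nonneg)
  then show ?thesis unfolding int_box_def by blast
qed

lemma finite_subset_int_box: "finite F \<Longrightarrow> \<exists>n. F \<subseteq> int_box n"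
proof (induction F rule: finite_induct)
  case (insert x X)
  then obtain N n where "X \<subseteq> int_box N" "x \<in> int_box n" using mem_int_box by blast
  then show ?case using int_box_mono[of N "max N n"] int_box_mono[of n "max N n"] by (intro exI[of _ "max N n"]) auto
qed auto

lemma mem_nat_box: "\<exists>n. p \<in> nat_box n"
proof -
  have "p $ l \<le> (\<Sum>l\<in>UNIV. p $ l)" for l by (rule member_le_sum) auto
  then show ?thesis unfolding nat_box_def by blast
qed

lemma exhaustion_tendsto:
  fixes f :: "'i \<Rightarrow> 'a::{comm_monoid_add,t2_space}"
  assumes f: "f summable_on A" and fin: "\<And>n. finite (F n)" and sub: "\<And>n. F n \<subseteq> A"
    and mono: "\<And>n n'. n \<le> n' \<Longrightarrow> F n \<subseteq> F n'" and ex: "\<And>x. x \<in> A \<Longrightarrow> \<exists>n::nat. x \<in> F n"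
  shows "(\<lambda>n. sum f (F n)) \<longlonglongrightarrow> infsum f A"
proof -
  have "filterlim F (finite_subsets_at_top A) sequentially"
    unfolding filterlim_finite_subsets_at_top
  proof (intro allI impI)
    fix X assume X: "finite X \<and> X \<subseteq> A"
    then have "finite X" "X \<subseteq> A" by auto
    then have "\<exists>N. X \<subseteq> F N"
    proof (induction X rule: finite_induct)
      case (insert x X)
      then obtain N n where "X \<subseteq> F N" "x \<in> F n" using ex by blast
      then show ?case using mono[of N "max N n"] mono[of n "max N n"] by (intro exI[of _ "max N n"]) auto
    qed auto
    then obtain N where N: "X \<subseteq> F N" by blast
    show "\<forall>\<^sub>F n in sequentially. finite (F n) \<and> X \<subseteq> F n \<and> F n \<subseteq> A"
      by (rule eventually_mono[OF eventually_ge_at_top[of N]]) (use fin sub mono N in blast)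
  qed
  then show ?thesis
    using filterlim_compose[OF infsum_tendsto[OF f]] by (simp add: o_def)
qed

text \<open>
  A summable weight on the integer lattice that dominates the translates of products of functions of
  quadratic decay.
\<close>

definition decay_weight :: "int^'d \<Rightarrow> real" where
  "decay_weight m = (\<Prod>l\<in>UNIV. 1 / (1 + (of_int (m $ l))\<^sup>2))"

lemma decay_weight_pos: "0 < decay_weight m"
  unfolding decay_weight_def by (intro prod_pos) simp

lemma decay_weight_summable: "(decay_weight :: int^'d \<Rightarrow> real) summable_on UNIV"
proof (rule nonneg_bdd_above_summable_on)
  define S where "S = (\<Sum>k. 1 / (1 + (real k)\<^sup>2))"
  have part: "(\<Sum>i\<in>{- int n..int n}. 1 / (1 + (of_int i :: real)\<^sup>2)) \<le> 2 * S" for n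
  proof -
    have "{- int n..int n} \<subseteq> int ` {..n} \<union> (\<lambda>k. - int k) ` {..n}"
    proof
      fix i assume "i \<in> {- int n..int n}"
      then show "i \<in> int ` {..n} \<union> (\<lambda>k. - int k) ` {..n}"
        by (cases i rule: int_cases2) auto
    qed
    then have "(\<Sum>i\<in>{- int n..int n}. 1 / (1 + (of_int i :: real)\<^sup>2)) \<le>
        (\<Sum>i\<in>int ` {..n} \<union> (\<lambda>k. - int k) ` {..n}. 1 / (1 + (of_int i :: real)\<^sup>2))"
      by (intro sum_mono2) auto
    also have "\<dots> \<le> (\<Sum>i\<in>int ` {..n}. 1 / (1 + (of_int i :: real)\<^sup>2)) + (\<Sum>i\<in>(\<lambda>k. - int k) ` {..n}. 1 / (1 + (of_int i :: real)\<^sup>2))"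
      by (subst sum.union_inter[symmetric]) (auto intro!: sum_nonneg)
    also have "\<dots> = (\<Sum>k\<le>n. 1 / (1 + (real k)\<^sup>2)) + (\<Sum>k\<le>n. 1 / (1 + (real k)\<^sup>2))"
      by (simp add: sum.reindex inj_on_def)
    also have "(\<Sum>k\<le>n. 1 / (1 + (real k)\<^sup>2)) \<le> S"
      unfolding S_def by (rule sum_le_suminf[OF summable_one_plus_sq]) auto
    finally show ?thesis by simp
  qed
  show "0 \<le> decay_weight m" for m :: "int^'d" by (rule less_imp_le[OF decay_weight_pos])
  show "bdd_above (sum (decay_weight :: int^'d \<Rightarrow> real) ` {F. F \<subseteq> UNIV \<and> finite F})"
  proof (rule bdd_aboveI2)
    fix F :: "(int^'d) set" assume "F \<in> {F. F \<subseteq> UNIV \<and> finite F}"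
    then have "finite F" by simp
    then obtain n where n: "F \<subseteq> int_box n" using finite_subset_int_box by blast
    have "sum decay_weight F \<le> sum decay_weight (int_box n :: (int^'d) set)"
      by (rule sum_mono2[OF _ n]) (auto intro: less_imp_le[OF decay_weight_pos])
    also have "\<dots> = (\<Prod>l\<in>(UNIV :: 'd set). \<Sum>i\<in>{- int n..int n}. 1 / (1 + (of_int i :: real)\<^sup>2))"
      unfolding decay_weight_def int_box_alt by (rule sum_prod_vec_box) simp
    also have "\<dots> \<le> (\<Prod>l\<in>(UNIV :: 'd set). 2 * S)"
      by (intro prod_mono conjI part sum_nonneg) auto
    finally show "sum decay_weight F \<le> (\<Prod>l\<in>(UNIV :: 'd set). 2 * S)" .
  qed
qed


section \<open>Spans, closed spans and projections\<close>

lemma fun_span_lincomb: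
  assumes "finite I" "\<And>i. i \<in> I \<Longrightarrow> g i \<in> S"
  shows "(\<lambda>x. \<Sum>i\<in>I. c i * g i x) \<in> fun_span S"
proof -
  have "(\<Sum>i\<in>I. c i * g i x) = (\<Sum>s\<in>g ` I. (\<Sum>i\<in>{i\<in>I. g i = s}. c i) * s x)" for x
  proof -
    have "(\<Sum>i\<in>I. c i * g i x) = (\<Sum>s\<in>g ` I. \<Sum>i\<in>{i\<in>I. g i = s}. c i * g i x)"
      by (rule sum.image_gen[OF assms(1)])
    also have "\<dots> = (\<Sum>s\<in>g ` I. (\<Sum>i\<in>{i\<in>I. g i = s}. c i) * s x)"
      by (intro sum.cong refl) (simp add: sum_distrib_right)
    finally show ?thesis .
  qed
  then show ?thesis
    unfolding fun_span_def using assms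
    by (intro CollectI exI[of _ "g ` I"] exI[of _ "\<lambda>s. \<Sum>i\<in>{i\<in>I. g i = s}. c i"]) (auto simp: fun_eq_iff)
qed

lemma fun_span_L2: "S \<subseteq> L2 N \<Longrightarrow> fun_span S \<subseteq> L2 N"
  unfolding fun_span_def by (auto intro!: L2_lincomb)

lemma fun_span_closed_span: "S \<subseteq> L2 N \<Longrightarrow> fun_span S \<subseteq> L2_closed_span N S"
  using fun_span_L2[of S N] by (force simp: L2_closed_span_def L2_dist_def)

lemma closed_span_limit:
  assumes S: "S \<subseteq> L2 N" and f: "\<And>n. f n \<in> L2_closed_span N S" and g: "g \<in> L2 N"
    and lim: "(\<lambda>n. L2_dist N (f n) g) \<longlonglongrightarrow> 0"
  shows "g \<in> L2_closed_span N S"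
  unfolding L2_closed_span_def
proof (intro CollectI conjI g allI impI)
  fix e :: real assume e: "0 < e"
  then obtain n where n: "L2_dist N (f n) g < e / 2"
    using order_tendstoD(2)[OF lim, of "e / 2"] eventually_happens[of _ sequentially] by fastforce
  have fn: "f n \<in> L2 N" using f[of n] by (simp add: L2_closed_span_def)
  obtain w where w: "w \<in> fun_span S" "L2_dist N (f n) w < e / 2"
  proof -
    have "\<forall>e>0. \<exists>w\<in>fun_span S. L2_dist N (f n) w < e" using f[of n] by (simp add: L2_closed_span_def)
    then show ?thesis using e that by (meson half_gt_zero)
  qed
  have "w \<in> L2 N" using w(1) fun_span_L2[OF S] by blast
  from L2_dist_triangle[OF g fn this] n w(2) show "\<exists>w\<in>fun_span S. L2_dist N g w < e"
    using w(1) by (intro bexI[of _ w]) (simp_all add: L2_dist_commute)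
qed

lemma orthogonal_closed_span:
  assumes S: "S \<subseteq> L2 N" and r: "r \<in> L2 N" and z: "\<And>s. s \<in> S \<Longrightarrow> L2_inner N r s = 0"
    and v: "v \<in> L2_closed_span N S"
  shows "L2_inner N r v = 0"
proof (rule ccontr)
  assume ne: "L2_inner N r v \<noteq> 0"
  define e where "e = \<bar>L2_inner N r v\<bar> / (L2_norm N r + 1)"
  have pos: "0 < L2_norm N r + 1" by (rule add_nonneg_pos) simp_all
  then have e: "0 < e" using ne by (simp add: e_def)
  obtain w where w: "w \<in> fun_span S" "L2_dist N v w < e" and vL: "v \<in> L2 N"
    using v e unfolding L2_closed_span_def by auto
  have wL: "w \<in> L2 N" using w(1) fun_span_L2[OF S] by blast
  obtain F c where F: "finite F" "F \<subseteq> S" "w = (\<lambda>x. \<Sum>s\<in>F. c s * s x)" using w(1) by (auto simp: fun_span_def)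
  have "L2_inner N w r = (\<Sum>s\<in>F. c s * L2_inner N s r)"
    unfolding F(3) using F(2) S r by (intro L2_inner_sum_left) auto
  also have "\<dots> = 0" using F(2) z by (intro sum.neutral) (auto simp: L2_inner_commute)
  finally have 0: "L2_inner N w r = 0" .
  have "L2_inner N r v = L2_inner N (\<lambda>x. v x - w x) r"
    unfolding L2_inner_diff_left[OF vL wL r] 0 by (simp add: L2_inner_commute[of N r v])
  then have "\<bar>L2_inner N r v\<bar> \<le> L2_dist N v w * L2_norm N r"
    using L2_inner_CS[OF L2_diff[OF vL wL] r] by (simp add: L2_dist_norm)
  also have "\<dots> \<le> e * L2_norm N r" using w(2) by (intro mult_right_mono) auto
  also have "\<dots> < e * (L2_norm N r + 1)" using e by simp
  also have "\<dots> = \<bar>L2_inner N r v\<bar>" using pos by (simp add: e_def)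
  finally show False by simp
qed

text \<open>
  The projection is a choice among all functions with its defining properties. Exhibiting one
  such function therefore determines it up to null sets: the difference of two candidates lies in the closed span and is
  orthogonal to it.
\<close>

lemma L2_projection_unique:
  assumes S: "S \<subseteq> L2 N" and f: "f \<in> L2 N" and g: "g \<in> L2_closed_span N S"
    and orth: "\<And>v. v \<in> L2_closed_span N S \<Longrightarrow> L2_inner N (\<lambda>x. f x - g x) v = 0"
  shows "L2_projection N (L2_closed_span N S) f \<in> L2 N"
    and "AE x in N. L2_projection N (L2_closed_span N S) f x = g x"
proof -
  let ?V = "L2_closed_span N S"
  define p where "p = L2_projection N ?V f"
  have p: "p \<in> ?V \<and> (\<forall>v\<in>?V. L2_inner N (\<lambda>x. f x - p x) v = 0)"
    unfolding p_def L2_projection_def by (rule someI[of _ g]) (use g orth in auto)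
  have VL: "v \<in> L2 N" if "v \<in> ?V" for v using that by (simp add: L2_closed_span_def)
  have pL: "p \<in> L2 N" and gL: "g \<in> L2 N" using p g VL by auto
  have z: "L2_inner N (\<lambda>x. p x - g x) v = 0" if "v \<in> ?V" for v
  proof -
    have "L2_inner N f v = L2_inner N p v" "L2_inner N f v = L2_inner N g v"
      using p orth[OF that] that by (simp_all add: L2_inner_diff_left f pL gL VL)
    then show ?thesis by (simp add: L2_inner_diff_left pL gL VL that)
  qed
  have "L2_inner N (\<lambda>x. p x - g x) (\<lambda>x. p x - g x) = 0"
    unfolding L2_inner_diff_left[OF pL gL L2_diff[OF pL gL]]
    using z[of p] z[of g] p g by (simp add: L2_inner_commute[of N p] L2_inner_commute[of N g])
  then have "L2_norm N (\<lambda>x. p x - g x) = 0" by (simp add: L2_norm_def L2_inner_def power2_eq_square)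
  then have "AE x in N. p x - g x = 0" using L2_norm_zero_iff[OF L2_diff[OF pL gL]] by simp
  then show "AE x in N. L2_projection N ?V f x = g x" "L2_projection N ?V f \<in> L2 N"
    using pL by (simp_all add: p_def)
qed

lemma orthonormal_norm_sq:
  assumes e: "\<And>i. e i \<in> L2 N" and o: "\<And>i j. L2_inner N (e i) (e j) = (if i = j then 1 else 0)" and "finite F"
  shows "(L2_norm N (\<lambda>x. \<Sum>i\<in>F. c i * e i x))\<^sup>2 = (\<Sum>i\<in>F. (c i)\<^sup>2)"
proof -
  let ?s = "\<lambda>x. \<Sum>i\<in>F. c i * e i x"
  have sL: "?s \<in> L2 N" by (intro L2_lincomb e)
  have "L2_inner N ?s (e j) = c j" if "j \<in> F" for j
    using assms(3) that by (simp add: L2_inner_sum_left e o if_distrib sum.delta' cong: if_cong)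
  then have "L2_inner N (e j) ?s = c j" if "j \<in> F" for j
    using that by (subst L2_inner_commute)
  then have "L2_inner N ?s ?s = (\<Sum>i\<in>F. c i * c i)"
    using L2_inner_sum_left[where I=F and f=e and c=c and v="?s", OF e sL] by simp
  then show ?thesis unfolding L2_norm_sq by (simp add: L2_inner_def power2_eq_square)
qed

section \<open>The orthonormal basis of the approximation space\<close>

locale meyer_scaling = band_limited_scaling +
  assumes orthonormal_phi: "\<And>i j :: int. L2_inner lborel (\<lambda>x. \<phi> (x - of_int i)) (\<lambda>x. \<phi> (x - of_int j)) = (if i = j then 1 else 0)"
begin

definition scaled :: "nat \<Rightarrow> int \<Rightarrow> real \<Rightarrow> real" where
  "scaled J k x = 2 powr (real J / 2) * \<phi> (2 ^ J * x - of_int k)"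

lemma scaled_continuous: "continuous_on UNIV (scaled J k)"
  unfolding scaled_def
  by (intro continuous_intros continuous_on_compose2[OF phi_continuous]) auto

lemma dilate_decay: "\<exists>C. quadratic_decay (\<lambda>x. \<phi> (2 ^ J * x - of_int k)) C"
proof -
  obtain C where "quadratic_decay \<phi> C" using phi_decay by blast
  from quadratic_decay_affine[OF this, of "2 ^ J" "of_int k"] show ?thesis by auto
qed

lemma quadratic_decay_scale: "quadratic_decay f C \<Longrightarrow> quadratic_decay (\<lambda>x. a * f x :: real) (\<bar>a\<bar> * C)"
  unfolding quadratic_decay_def
proof
  fix x assume "\<forall>x. norm (f x) \<le> C / (1 + x\<^sup>2)"
  then have "\<bar>a\<bar> * norm (f x) \<le> \<bar>a\<bar> * (C / (1 + x\<^sup>2))" by (intro mult_left_mono) auto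
  then show "norm (a * f x) \<le> \<bar>a\<bar> * C / (1 + x\<^sup>2)" by (simp add: abs_mult)
qed

lemma scaled_decay: "\<exists>C. quadratic_decay (scaled J k) C"
  using dilate_decay[of J k] quadratic_decay_scale unfolding scaled_def[abs_def] by blast

lemma scaled_measurable [measurable]: "scaled J k \<in> borel_measurable borel"
  by (rule borel_measurable_continuous_onI[OF scaled_continuous])

lemma scaled_L2: "scaled J k \<in> L2 lborel"
  using scaled_decay[of J k] quadratic_decay_L2 scaled_measurable by blast

lemma scaled_orthonormal: "L2_inner lborel (scaled J i) (scaled J j) = (if i = j then 1 else 0)"
proof -
  have "(2::real) powr (real J / 2) * 2 powr (real J / 2) = 2 ^ J"
    by (simp add: powr_add[symmetric] powr_realpow)
  moreover have "scaled J i x * scaled J j x = (2 powr (real J / 2) * 2 powr (real J / 2)) *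
      (\<phi> (0 + 2 ^ J * x - of_int i) * \<phi> (0 + 2 ^ J * x - of_int j))" for x
    unfolding scaled_def by (simp only: add_0 mult_ac)
  ultimately have e: "scaled J i x * scaled J j x = 2 ^ J * (\<phi> (0 + 2 ^ J * x - of_int i) * \<phi> (0 + 2 ^ J * x - of_int j))" for x
    by simp
  have "L2_inner lborel (scaled J i) (scaled J j) = \<bar>2 ^ J\<bar> *\<^sub>R (LINT x|lborel. \<phi> (0 + 2 ^ J * x - of_int i) * \<phi> (0 + 2 ^ J * x - of_int j))"
    unfolding L2_inner_def e integral_mult_right_zero real_scaleR_def by simp
  also have "\<dots> = (LINT y|lborel. \<phi> (y - of_int i) * \<phi> (y - of_int j))"
    by (rule lborel_integral_real_affine[symmetric]) simp
  finally show ?thesis using orthonormal_phi[of i j] by (simp add: L2_inner_def)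
qed

definition basis_fn :: "nat \<Rightarrow> int^'d \<Rightarrow> real^'d \<Rightarrow> real" where
  "basis_fn J k x = (\<Prod>l\<in>UNIV. scaled J (k $ l) (x $ l))"

lemma basis_fn_eq:
  "basis_fn J k x = 2 powr (real J * real CARD('d) / 2) * (\<Prod>l\<in>UNIV. \<phi> (2 ^ J * x $ l - of_int (k $ l)))"
  for x :: "real^'d"
proof -
  have "(2 powr (real J / 2)) ^ CARD('d) = (2::real) powr (real J * real CARD('d) / 2)"
    by (simp add: powr_realpow[symmetric] powr_powr)
  then show ?thesis by (simp add: basis_fn_def scaled_def prod.distrib)
qed

lemma basis_fn_L2: "basis_fn J k \<in> L2 lborel"
  unfolding basis_fn_def[abs_def] by (rule L2_prod_vec[OF scaled_L2])

lemma basis_fn_orthonormal: "L2_inner lborel (basis_fn J k) (basis_fn J k') = (if k = k' then 1 else 0)" for k k' :: "int^'d"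
proof -
  have "L2_inner lborel (basis_fn J k) (basis_fn J k') = (\<Prod>l\<in>UNIV. if k $ l = k' $ l then 1 else 0)"
    unfolding basis_fn_def[abs_def] by (simp add: L2_inner_prod_vec[OF scaled_L2 scaled_L2] scaled_orthonormal)
  also have "\<dots> = (if k = k' then 1 else 0)"
  proof (cases "k = k'")
    case False
    then obtain l where "k $ l \<noteq> k' $ l" by (auto simp: vec_eq_iff)
    then show ?thesis using False by (auto intro!: prod_zero bexI[of _ l])
  qed simp
  finally show ?thesis .
qed

definition V1_gen :: "nat \<Rightarrow> (real \<Rightarrow> real) set" where
  "V1_gen J = {\<lambda>x. \<phi> (2 powi int J * x - of_int k) | k. True}"

lemma V1_gen: "V1 \<phi> (int J) = L2_closed_span lborel (V1_gen J)"
  by (simp add: V1_def V1_gen_def)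

lemma V1_gen_scaled:
  assumes "s \<in> V1_gen J"
  obtains k where "s = (\<lambda>x. 2 powr (- (real J / 2)) * scaled J k x)"
proof -
  obtain k where "s = (\<lambda>x. \<phi> (2 ^ J * x - of_int k))" using assms by (auto simp: V1_gen_def)
  then have "s = (\<lambda>x. 2 powr (- (real J / 2)) * scaled J k x)"
    by (simp add: scaled_def fun_eq_iff mult.assoc[symmetric] powr_add[symmetric])
  then show ?thesis by (rule that)
qed

lemma V1_gen_L2: "V1_gen J \<subseteq> L2 lborel"
  by (auto elim!: V1_gen_scaled intro!: L2_scale scaled_L2)

lemma scaled_V1: "scaled J k \<in> V1 \<phi> (int J)"
proof -
  have "(\<lambda>x. \<Sum>i\<in>{k}. 2 powr (real J / 2) * \<phi> (2 powi int J * x - of_int i)) \<in> fun_span (V1_gen J)"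
    by (rule fun_span_lincomb) (auto simp: V1_gen_def)
  then have "scaled J k \<in> fun_span (V1_gen J)" by (simp add: scaled_def[abs_def])
  then show ?thesis unfolding V1_gen using fun_span_closed_span[OF V1_gen_L2] by blast
qed

lemma V1_L2: "f \<in> V1 \<phi> (int J) \<Longrightarrow> f \<in> L2 lborel"
  by (simp add: V1_gen L2_closed_span_def)

definition Vd_gen :: "nat \<Rightarrow> (real^'d \<Rightarrow> real) set" where
  "Vd_gen J = {\<lambda>x. \<Prod>l\<in>UNIV. f l (x $ l) | f. \<forall>l::'d. f l \<in> V1 \<phi> (int J)}"

lemma Vd_gen: "(Vd \<phi> (int J) :: (real^'d \<Rightarrow> real) set) = L2_closed_span lborel (Vd_gen J)"
  by (simp add: Vd_def Vd_gen_def)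

lemma Vd_gen_L2: "Vd_gen J \<subseteq> L2 lborel"
  unfolding Vd_gen_def by (auto intro!: L2_prod_vec V1_L2)

lemma basis_fn_Vd_gen: "basis_fn J k \<in> Vd_gen J"
  unfolding Vd_gen_def basis_fn_def[abs_def]
  by (intro CollectI exI[of _ "\<lambda>l. scaled J (k $ l)"]) (simp add: scaled_V1)

text \<open>
  Coordinates are released one at a time: \<open>A\<close> is the set of coordinates in which the factor is an arbitrary
  element of \<open>V1\<close>, while in all others it is still a basis function. With the other factors fixed, the
  inner product with \<open>r\<close> is linear and continuous in the new factor.
\<close>

lemma orthogonal_products:
  fixes f :: "'d::finite \<Rightarrow> real \<Rightarrow> real"
  assumes r: "r \<in> L2 lborel" and z: "\<And>k :: int^'d. L2_inner lborel r (basis_fn J k) = 0"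
    and "finite A" "\<And>l. l \<in> A \<Longrightarrow> f l \<in> V1 \<phi> (int J)" "\<And>l. l \<notin> A \<Longrightarrow> \<exists>k. f l = scaled J k"
  shows "L2_inner lborel r (\<lambda>x. \<Prod>l\<in>UNIV. f l (x $ l)) = 0"
  using assms(3-5)
proof (induction A arbitrary: f rule: finite_induct)
  case empty
  then have "\<forall>l. \<exists>k. f l = scaled J k" by simp
  then obtain k where "\<And>l. f l = scaled J (k l)" by metis
  then have "(\<lambda>x. \<Prod>l\<in>UNIV. f l (x $ l)) = basis_fn J (\<chi> l. k l)" by (simp add: basis_fn_def[abs_def])
  then show ?case using z by simp
next
  case (insert a A)
  define P where "P u x = (\<Prod>l\<in>UNIV. (f(a := u)) l (x $ l))" for u and x :: "real^'d"
  define R where "R x = (\<Prod>l\<in>UNIV - {a}. f l (x $ l))" for x :: "real^'d"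
  have PR: "P u x = u (x $ a) * R x" for u x
    unfolding P_def R_def by (subst prod.remove[of _ a]) auto
  have fL: "f l \<in> L2 lborel" for l
  proof (cases "l \<in> insert a A")
    case False then show ?thesis using insert.prems(2)[of l] scaled_L2 by auto
  qed (use insert.prems(1) V1_L2 in blast)
  have PL: "P u \<in> L2 lborel" if "u \<in> L2 lborel" for u
    unfolding P_def[abs_def] using that fL by (intro L2_prod_vec) auto
  define c where "c = (\<Prod>l\<in>UNIV - {a}. L2_norm lborel (f l))"
  have c0: "0 \<le> c" unfolding c_def by (intro prod_nonneg) auto
  have Pn: "L2_norm lborel (P u) = L2_norm lborel u * c" if "u \<in> L2 lborel" for u
  proof -
    have "L2_norm lborel (P u) = (\<Prod>l\<in>UNIV. L2_norm lborel ((f(a := u)) l))"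
      unfolding P_def[abs_def] using that fL by (intro L2_norm_prod_vec) auto
    then show ?thesis unfolding c_def by (simp add: prod.remove[of UNIV a])
  qed
  have Ps: "L2_inner lborel r (P (scaled J k)) = 0" for k
    unfolding P_def[abs_def] using insert.prems insert.hyps by (intro insert.IH) auto
  have Pg: "L2_inner lborel r (P s) = 0" if "s \<in> V1_gen J" for s
  proof -
    obtain k where s: "s = (\<lambda>x. 2 powr (- (real J / 2)) * scaled J k x)" using V1_gen_scaled[OF \<open>s \<in> V1_gen J\<close>] by blast
    have "P s = (\<lambda>x. 2 powr (- (real J / 2)) * P (scaled J k) x)" by (simp add: PR s fun_eq_iff)
    then have "L2_inner lborel r (P s) = 2 powr (- (real J / 2)) * L2_inner lborel r (P (scaled J k))"
      by (simp only: L2_inner_scale_right)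
    then show ?thesis by (simp add: Ps)
  qed
  have fa: "f a \<in> L2_closed_span lborel (V1_gen J)" using insert.prems(1)[of a] by (simp add: V1_gen)
  have "L2_inner lborel r (P (f a)) = 0"
  proof (rule ccontr)
    assume ne: "L2_inner lborel r (P (f a)) \<noteq> 0"
    define b where "b = L2_norm lborel r * c + 1"
    have b: "0 < b" unfolding b_def using c0 by (intro add_nonneg_pos mult_nonneg_nonneg) auto
    define e where "e = \<bar>L2_inner lborel r (P (f a))\<bar> / b"
    have e: "0 < e" using ne b by (simp add: e_def)
    obtain w where w: "w \<in> fun_span (V1_gen J)" "L2_dist lborel (f a) w < e"
      using fa e unfolding L2_closed_span_def by auto
    have wL: "w \<in> L2 lborel" using w(1) fun_span_L2[OF V1_gen_L2] by blast
    obtain F q where F: "finite F" "F \<subseteq> V1_gen J" "w = (\<lambda>x. \<Sum>s\<in>F. q s * s x)" using w(1) by (auto simp: fun_span_def)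
    have Pw: "P w = (\<lambda>x. \<Sum>s\<in>F. q s * P s x)" by (simp add: PR F(3) sum_distrib_right mult.assoc fun_eq_iff)
    have "L2_inner lborel (P w) r = (\<Sum>s\<in>F. q s * L2_inner lborel (P s) r)"
      unfolding Pw using F(2) V1_gen_L2 r PL by (intro L2_inner_sum_left) auto
    also have "\<dots> = 0"
    proof (intro sum.neutral ballI)
      fix s assume "s \<in> F"
      then show "q s * L2_inner lborel (P s) r = 0"
        using Pg[of s] F(2) by (subst L2_inner_commute) auto
    qed
    finally have 0: "L2_inner lborel (P w) r = 0" .
    have Pd: "(\<lambda>x. P (f a) x - P w x) = P (\<lambda>y. f a y - w y)" by (simp add: PR fun_eq_iff left_diff_distrib)
    have "L2_inner lborel (P (f a)) r = L2_inner lborel (P (\<lambda>y. f a y - w y)) r"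
      using L2_inner_diff_left[OF PL[OF fL] PL[OF wL] r, of a] 0 unfolding Pd by simp
    then have "\<bar>L2_inner lborel r (P (f a))\<bar> \<le> L2_norm lborel (P (\<lambda>y. f a y - w y)) * L2_norm lborel r"
      using L2_inner_CS[OF PL[OF L2_diff[OF fL[of a] wL]] r] by (subst L2_inner_commute) simp
    also have "\<dots> = L2_dist lborel (f a) w * c * L2_norm lborel r"
      using Pn[OF L2_diff[OF fL[of a] wL]] by (simp add: L2_dist_norm)
    also have "\<dots> \<le> e * c * L2_norm lborel r" using w(2) c0 by (intro mult_right_mono) auto
    also have "\<dots> < e * b" using e by (simp add: b_def algebra_simps)
    also have "\<dots> = \<bar>L2_inner lborel r (P (f a))\<bar>" using b by (simp add: e_def)
    finally show False by simp
  qed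
  then show ?case unfolding P_def[abs_def] fun_upd_triv .
qed

lemma orthogonal_Vd:
  fixes r :: "real^'d \<Rightarrow> real"
  assumes r: "r \<in> L2 lborel" and z: "\<And>k :: int^'d. L2_inner lborel r (basis_fn J k) = 0"
    and v: "v \<in> Vd \<phi> (int J)"
  shows "L2_inner lborel r v = 0"
proof (rule orthogonal_closed_span[OF Vd_gen_L2 r])
  show "v \<in> L2_closed_span lborel (Vd_gen J)" using v by (simp add: Vd_gen)
  fix s :: "real^'d \<Rightarrow> real" assume "s \<in> Vd_gen J"
  then obtain f where "s = (\<lambda>x. \<Prod>l\<in>UNIV. f l (x $ l))" "\<And>l. f l \<in> V1 \<phi> (int J)" by (auto simp: Vd_gen_def)
  then show "L2_inner lborel r s = 0" using orthogonal_products[OF r z, of UNIV f] by simp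
qed

end


section \<open>Square sums of the FARIMA coefficients over boxes\<close>

text \<open>
  Telescoping: the factors are changed from \<open>a\<close> to \<open>b\<close> one after the other, the remaining ones being at most \<open>K\<close>.
\<close>

lemma prod_diff_le:
  fixes a b :: "'i \<Rightarrow> real"
  assumes "finite I" "\<And>i. i \<in> I \<Longrightarrow> 0 \<le> a i \<and> a i \<le> b i \<and> b i \<le> K" "1 \<le> K"
  shows "(\<Prod>i\<in>I. b i) - (\<Prod>i\<in>I. a i) \<le> K ^ card I * (\<Sum>i\<in>I. b i - a i)"
  using assms(1,2)
proof (induction I rule: finite_induct)
  case (insert x I)
  have x: "0 \<le> a x" "a x \<le> b x" "b x \<le> K" using insert.prems by auto
  have IH: "(\<Prod>i\<in>I. b i) - (\<Prod>i\<in>I. a i) \<le> K ^ card I * (\<Sum>i\<in>I. b i - a i)" using insert by auto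
  have s0: "0 \<le> (\<Sum>i\<in>I. b i - a i)" using insert.prems by (intro sum_nonneg) auto
  have pa: "(\<Prod>i\<in>I. a i) \<le> K ^ card I"
    using insert.prems by (intro prod_le_power) (auto intro: order_trans assms(3))
  have "b x * (\<Prod>i\<in>I. b i) - a x * (\<Prod>i\<in>I. a i) = b x * ((\<Prod>i\<in>I. b i) - (\<Prod>i\<in>I. a i)) + (b x - a x) * (\<Prod>i\<in>I. a i)"
    by (simp add: algebra_simps)
  also have "\<dots> \<le> K * (K ^ card I * (\<Sum>i\<in>I. b i - a i)) + (b x - a x) * (K ^ card I)"
  proof (intro add_mono mult_left_mono pa)
    have "b x * ((\<Prod>i\<in>I. b i) - (\<Prod>i\<in>I. a i)) \<le> b x * (K ^ card I * (\<Sum>i\<in>I. b i - a i))"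
      using x by (intro mult_left_mono IH) auto
    also have "\<dots> \<le> K * (K ^ card I * (\<Sum>i\<in>I. b i - a i))"
      using x s0 assms(3) by (intro mult_right_mono) auto
    finally show "b x * ((\<Prod>i\<in>I. b i) - (\<Prod>i\<in>I. a i)) \<le> K * (K ^ card I * (\<Sum>i\<in>I. b i - a i))" .
  qed (use x in auto)
  also have "\<dots> \<le> K * (K ^ card I * (\<Sum>i\<in>I. b i - a i)) + (b x - a x) * (K * K ^ card I)"
    using x assms(3) by (intro add_left_mono mult_left_mono) (auto simp: mult_le_cancel_right1)
  also have "\<dots> = K ^ card (insert x I) * (\<Sum>i\<in>insert x I. b i - a i)"
    using insert.hyps by (simp add: algebra_simps)
  finally show ?case using insert.hyps by simp
qed simp

lemma farima_sq_le:
  assumes "0 < \<delta>" "\<delta> < 1"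
  shows "(farima_coeff \<delta> p)\<^sup>2 \<le> real (Suc p) powr (2 * \<delta> - 2)"
proof -
  have "(farima_coeff \<delta> p)\<^sup>2 \<le> (real (Suc p) powr (\<delta> - 1))\<^sup>2"
    using farima_coeff_le[OF assms] farima_coeff_pos[OF assms(1), of p] by (intro power_mono) auto
  also have "\<dots> = real (Suc p) powr (2 * \<delta> - 2)"
    by (simp add: powr_power algebra_simps)
  finally show ?thesis .
qed

lemma farima_sq_summable:
  assumes "0 < \<delta>" "\<delta> < 1/2"
  shows "summable (\<lambda>p. (farima_coeff \<delta> p)\<^sup>2)"
proof (rule summable_comparison_test')
  have "summable (\<lambda>p. real p powr (2 * \<delta> - 2))" using assms by (simp add: summable_real_powr_iff)
  then show "summable (\<lambda>p. real (Suc p) powr (2 * \<delta> - 2))" by (subst summable_Suc_iff)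
  show "norm ((farima_coeff \<delta> p)\<^sup>2) \<le> real (Suc p) powr (2 * \<delta> - 2)" for p
    using farima_sq_le[of \<delta> p] assms by simp
qed

text \<open>
  The block has \<open>2^k\<close> terms, each at most \<open>(2^k) powr (2\<delta> - 2)\<close>. The decay is geometric because
  \<open>\<delta> < 1/2\<close>.
\<close>

lemma farima_sq_block:
  assumes "0 < \<delta>" "\<delta> < 1/2"
  shows "(\<Sum>p\<le>2 ^ Suc k. (farima_coeff \<delta> p)\<^sup>2) - (\<Sum>p\<le>2 ^ k. (farima_coeff \<delta> p)\<^sup>2) \<le> (2 powr (2 * \<delta> - 1)) ^ k"
proof -
  have sp: "{..(2::nat) ^ Suc k} = {..2 ^ k} \<union> {2 ^ k<..2 ^ Suc k}" by auto
  have "(\<Sum>p\<le>2 ^ Suc k. (farima_coeff \<delta> p)\<^sup>2) - (\<Sum>p\<le>2 ^ k. (farima_coeff \<delta> p)\<^sup>2) =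
      (\<Sum>p\<in>{2 ^ k<..2 ^ Suc k}. (farima_coeff \<delta> p)\<^sup>2)"
    unfolding sp by (subst sum.union_disjoint) auto
  also have "\<dots> \<le> (\<Sum>p\<in>{(2::nat) ^ k<..2 ^ Suc k}. (2 ^ k) powr (2 * \<delta> - 2))"
  proof (rule sum_mono)
    fix p :: nat assume p: "p \<in> {2 ^ k<..2 ^ Suc k}"
    have "real (2 ^ k) \<le> real p" using p by (intro of_nat_mono) auto
    then have "2 ^ k \<le> real (Suc p)" unfolding of_nat_power of_nat_numeral of_nat_Suc by linarith
    then have "real (Suc p) powr (2 * \<delta> - 2) \<le> (2 ^ k) powr (2 * \<delta> - 2)"
      using assms by (intro powr_mono2') auto
    then show "(farima_coeff \<delta> p)\<^sup>2 \<le> (2 ^ k) powr (2 * \<delta> - 2)" using farima_sq_le[of \<delta> p] assms by linarith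
  qed
  also have "\<dots> = 2 ^ k * (2 ^ k) powr (2 * \<delta> - 2)" by simp
  also have "\<dots> = (2 ^ k) powr 1 * (2 ^ k) powr (2 * \<delta> - 2)" by simp
  also have "\<dots> = (2 ^ k) powr (2 * \<delta> - 1)" by (subst powr_add[symmetric]) simp
  also have "\<dots> = (2 powr (2 * \<delta> - 1)) ^ k" by (simp add: powr_realpow[symmetric] powr_powr mult.commute)
  finally show ?thesis .
qed

section \<open>Almost sure convergence by dyadic chaining\<close>

text \<open>
  The sum of the squared increments of \<open>S\<close> over the left halves of all dyadic subintervals of \<open>{a..a + 2^k}\<close>,
  together with those over the unit steps.
\<close>

fun chain_sq :: "(nat \<Rightarrow> 'w \<Rightarrow> real) \<Rightarrow> nat \<Rightarrow> nat \<Rightarrow> 'w \<Rightarrow> real" where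
  "chain_sq S a 0 \<omega> = (S (Suc a) \<omega> - S a \<omega>)\<^sup>2"
| "chain_sq S a (Suc k) \<omega> = (S (a + 2 ^ k) \<omega> - S a \<omega>)\<^sup>2 + chain_sq S a k \<omega> + chain_sq S (a + 2 ^ k) k \<omega>"

lemma chain_sq_nonneg: "0 \<le> chain_sq S a k \<omega>"
  by (induction k arbitrary: a) (auto intro!: add_nonneg_nonneg)

text \<open>
  The point \<open>n\<close> is reached from \<open>a\<close> through at most one of these increments at each of the \<open>k + 1\<close> levels,
  and the square of a sum of \<open>k + 1\<close> terms is at most \<open>k + 1\<close> times the sum of the squares.
\<close>

lemma chain_sq_bound:
  "a \<le> n \<Longrightarrow> n \<le> a + 2 ^ k \<Longrightarrow> (S n \<omega> - S a \<omega>)\<^sup>2 \<le> real (Suc k) * chain_sq S a k \<omega>"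
proof (induction k arbitrary: a)
  case 0
  then have "n = a \<or> n = Suc a" by auto
  then show ?case by auto
next
  case (Suc k)
  define U where "U = (S (a + 2 ^ k) \<omega> - S a \<omega>)\<^sup>2"
  define Q1 where "Q1 = chain_sq S a k \<omega>"
  define Q2 where "Q2 = chain_sq S (a + 2 ^ k) k \<omega>"
  have nn: "0 \<le> U" "0 \<le> Q1" "0 \<le> Q2" by (simp_all add: U_def Q1_def Q2_def chain_sq_nonneg)
  have "(S n \<omega> - S a \<omega>)\<^sup>2 \<le> real (Suc (Suc k)) * (U + Q1 + Q2)"
  proof (cases "n \<le> a + 2 ^ k")
    case True
    then have "(S n \<omega> - S a \<omega>)\<^sup>2 \<le> real (Suc k) * Q1" using Suc by (simp add: Q1_def)
    also have "\<dots> \<le> real (Suc (Suc k)) * (U + Q1 + Q2)" using nn by (intro mult_mono) auto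
    finally show ?thesis .
  next
    case False
    define v where "v = S n \<omega> - S (a + 2 ^ k) \<omega>"
    define u where "u = S (a + 2 ^ k) \<omega> - S a \<omega>"
    have v: "v\<^sup>2 \<le> real (Suc k) * Q2" unfolding v_def Q2_def using False Suc.prems by (intro Suc.IH) auto
    define c where "c = real (Suc k)"
    have c: "c > 0" by (simp add: c_def)
    (* The weighted inequality (u + v)^2 <= (c + 1) * (u^2 + v^2 / c) adds one level to the chain. *)
    have "0 \<le> (c * u - v)\<^sup>2" by simp
    then have "2 * u * v * c \<le> c\<^sup>2 * u\<^sup>2 + v\<^sup>2" by (simp add: power2_eq_square algebra_simps)
    then have "c * (u + v)\<^sup>2 \<le> c * ((c + 1) * u\<^sup>2) + (c + 1) * v\<^sup>2" by (simp add: power2_eq_square algebra_simps)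
    also have "\<dots> \<le> c * ((c + 1) * u\<^sup>2) + (c + 1) * (c * Q2)"
      using v c by (intro add_left_mono mult_left_mono) (auto simp: c_def)
    finally have "c * (u + v)\<^sup>2 \<le> c * ((c + 1) * (u\<^sup>2 + Q2))" by (simp add: algebra_simps)
    then have "(u + v)\<^sup>2 \<le> (c + 1) * (u\<^sup>2 + Q2)" using c by simp
    also have "\<dots> \<le> (c + 1) * (U + Q1 + Q2)" using nn c by (intro mult_left_mono) (auto simp: U_def u_def)
    finally show ?thesis by (simp add: u_def v_def c_def)
  qed
  then show ?case by (simp add: U_def Q1_def Q2_def)
qed

lemma (in prob_space)
  assumes f: "f \<in> L2 M"
  shows L2_integrable: "integrable M f"
    and expectation_le_L2_norm: "expectation f \<le> L2_norm M f"
proof -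
  have one: "(\<lambda>_. 1) \<in> L2 M" by (simp add: L2_def)
  show "integrable M f" using L2_mult_integrable[OF f one] by simp
  show "expectation f \<le> L2_norm M f"
    using L2_inner_CS[OF f one] by (simp add: L2_inner_def L2_norm_def prob_space)
qed

text \<open>
  The chain bounds the oscillation of \<open>S\<close> over the block from \<open>2^k\<close> to \<open>2^(k+1)\<close> in mean by the \<open>k\<close>-th term of the
  assumed series: each of the \<open>k + 1\<close> levels contributes at most the increment of \<open>G\<close> over the block. Hence
  the oscillations are summable almost surely, and the whole sequence, not only the dyadic subsequence, is Cauchy. Only
  second moments enter, so the terms may be dependent.
\<close>

lemma (in prob_space) rademacher_menshov_dyadic:
  fixes S :: "nat \<Rightarrow> 'a \<Rightarrow> real"
  assumes S: "\<And>n. S n \<in> L2 M"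
    and inc: "\<And>m n. m \<le> n \<Longrightarrow> (L2_norm M (\<lambda>\<omega>. S n \<omega> - S m \<omega>))\<^sup>2 \<le> G n - G m"
    and sm: "summable (\<lambda>k. real (Suc k) * sqrt (G (2 ^ Suc k) - G (2 ^ k)))"
  shows "AE \<omega> in M. convergent (\<lambda>n. S n \<omega>)"
proof -
  have Gmono: "0 \<le> G n - G m" if "m \<le> n" for m n using inc[OF that] by (meson order_trans zero_le_power2)
  have sqint: "integrable M (\<lambda>\<omega>. (S n \<omega> - S m \<omega>)\<^sup>2)" for m n
    by (rule L2_square_integrable[OF L2_diff[OF S S]])
  have Qint: "integrable M (chain_sq S a k)" for a k
  proof (induction k arbitrary: a)
    case 0
    have "chain_sq S a 0 = (\<lambda>\<omega>. (S (Suc a) \<omega> - S a \<omega>)\<^sup>2)" by (rule ext) simp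
    then show ?case by (simp add: sqint)
  next
    case (Suc k)
    have "chain_sq S a (Suc k) = (\<lambda>\<omega>. (S (a + 2 ^ k) \<omega> - S a \<omega>)\<^sup>2 + chain_sq S a k \<omega> + chain_sq S (a + 2 ^ k) k \<omega>)"
      by (rule ext) simp
    then show ?case by (simp add: sqint Suc)
  qed
  have QE: "(LINT \<omega>|M. chain_sq S a k \<omega>) \<le> real (Suc k) * (G (a + 2 ^ k) - G a)" for a k
  proof (induction k arbitrary: a)
    case 0
    then show ?case using inc[of a "Suc a"] by (simp add: L2_norm_sq)
  next
    case (Suc k)
    have "(LINT \<omega>|M. chain_sq S a (Suc k) \<omega>) = (LINT \<omega>|M. (S (a + 2 ^ k) \<omega> - S a \<omega>)\<^sup>2) + (LINT \<omega>|M. chain_sq S a k \<omega>) + (LINT \<omega>|M. chain_sq S (a + 2 ^ k) k \<omega>)"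
      by (simp add: sqint Qint)
    also have "\<dots> \<le> (G (a + 2 ^ k) - G a) + real (Suc k) * (G (a + 2 ^ k) - G a) + real (Suc k) * (G (a + 2 ^ k + 2 ^ k) - G (a + 2 ^ k))"
      using inc[of a "a + 2 ^ k"] by (intro add_mono Suc) (simp_all add: L2_norm_sq)
    also have "\<dots> \<le> (G (a + 2 ^ Suc k) - G a) + real (Suc k) * (G (a + 2 ^ Suc k) - G a)"
    proof -
      have e: "a + 2 ^ k + 2 ^ k = a + 2 ^ Suc k" by simp
      show ?thesis
        unfolding e using Gmono[of "a + 2 ^ k" "a + 2 ^ Suc k"] by (simp add: algebra_simps del: power_Suc)
    qed
    also have "\<dots> = real (Suc (Suc k)) * (G (a + 2 ^ Suc k) - G a)" by (simp add: algebra_simps)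
    finally show ?case .
  qed
  (* An upper bound for the oscillation of S over the k-th dyadic block, measured from its left end. *)
  define osc where "osc k \<omega> = sqrt (real (Suc k) * chain_sq S (2 ^ k) k \<omega>)" for k \<omega>
  have osc0: "0 \<le> osc k \<omega>" for k \<omega> by (simp add: osc_def chain_sq_nonneg)
  have osc_sq: "(osc k \<omega>)\<^sup>2 = real (Suc k) * chain_sq S (2 ^ k) k \<omega>" for k \<omega>
    by (simp add: osc_def chain_sq_nonneg)
  have oscL: "osc k \<in> L2 M" for k
  proof -
    have "osc k \<in> borel_measurable M"
      unfolding osc_def[abs_def] using borel_measurable_integrable[OF Qint] by measurable
    then show ?thesis by (simp add: L2_def osc_sq Qint del: of_nat_Suc)
  qed
  have oscint: "integrable M (osc k)" for k by (rule L2_integrable[OF oscL])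
  have oscE: "(LINT \<omega>|M. osc k \<omega>) \<le> real (Suc k) * sqrt (G (2 ^ Suc k) - G (2 ^ k))" for k
  proof -
    have "(LINT \<omega>|M. osc k \<omega>) \<le> L2_norm M (osc k)" by (rule expectation_le_L2_norm[OF oscL])
    also have "\<dots> = sqrt (real (Suc k) * (LINT \<omega>|M. chain_sq S (2 ^ k) k \<omega>))"
      by (simp add: L2_norm_def osc_sq del: of_nat_Suc)
    also have "\<dots> \<le> sqrt (real (Suc k) * (real (Suc k) * (G (2 ^ k + 2 ^ k) - G (2 ^ k))))"
      by (intro real_sqrt_le_mono mult_left_mono QE) simp
    also have "\<dots> = real (Suc k) * sqrt (G (2 ^ Suc k) - G (2 ^ k))"
      by (simp add: real_sqrt_mult mult_2 mult.assoc[symmetric] del: of_nat_Suc)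
    finally show ?thesis .
  qed
  have "(\<integral>\<^sup>+\<omega>. (\<Sum>k. ennreal (osc k \<omega>)) \<partial>M) = (\<Sum>k. \<integral>\<^sup>+\<omega>. ennreal (osc k \<omega>) \<partial>M)"
    using oscL[THEN L2_measurable] by (intro nn_integral_suminf) auto
  also have "\<dots> \<le> (\<Sum>k. ennreal (real (Suc k) * sqrt (G (2 ^ Suc k) - G (2 ^ k))))"
  proof (intro suminf_le)
    fix k show "(\<integral>\<^sup>+\<omega>. ennreal (osc k \<omega>) \<partial>M) \<le> ennreal (real (Suc k) * sqrt (G (2 ^ Suc k) - G (2 ^ k)))"
      using oscint osc0 oscE by (subst nn_integral_eq_integral) (auto intro!: ennreal_leI simp del: of_nat_Suc)
  qed auto
  also have "\<dots> < \<infinity>"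
    using sm Gmono by (subst suminf_ennreal2) (auto simp del: of_nat_Suc power_Suc)
  finally have "(\<integral>\<^sup>+\<omega>. (\<Sum>k. ennreal (osc k \<omega>)) \<partial>M) \<noteq> \<infinity>" by simp
  then have "AE \<omega> in M. (\<Sum>k. ennreal (osc k \<omega>)) \<noteq> \<infinity>"
    using oscL[THEN L2_measurable] by (intro nn_integral_noteq_infinite) auto
  then show ?thesis
  proof eventually_elim
    case (elim \<omega>)
    then have so: "summable (\<lambda>k. osc k \<omega>)" using osc0 by (intro summable_suminf_not_top) auto
    have step: "\<bar>S n \<omega> - S (2 ^ k) \<omega>\<bar> \<le> osc k \<omega>" if "2 ^ k \<le> n" "n \<le> 2 ^ Suc k" for n k
    proof -
      have "(S n \<omega> - S (2 ^ k) \<omega>)\<^sup>2 \<le> (osc k \<omega>)\<^sup>2"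
        unfolding osc_sq using that by (intro chain_sq_bound) auto
      then show ?thesis using osc0[of k \<omega>] by (simp add: abs_le_square_iff[symmetric])
    qed
    have dy: "\<bar>S (2 ^ (j + i)) \<omega> - S (2 ^ j) \<omega>\<bar> \<le> (\<Sum>k\<in>{j..<j + i}. osc k \<omega>)" for i j
    proof (induction i)
      case (Suc i)
      have "\<bar>S (2 ^ (j + Suc i)) \<omega> - S (2 ^ (j + i)) \<omega>\<bar> \<le> osc (j + i) \<omega>" by (rule step) auto
      with Suc show ?case by simp
    qed simp
    have "Cauchy (\<lambda>n. S n \<omega>)"
    proof (rule metric_CauchyI)
      fix r :: real assume r: "r > 0"
      then obtain j where j: "\<And>i n. j \<le> i \<Longrightarrow> norm (\<Sum>k\<in>{i..<n}. osc k \<omega>) < r / 2"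
        using so[unfolded summable_Cauchy] by (meson half_gt_zero)
      have near: "\<bar>S n \<omega> - S (2 ^ j) \<omega>\<bar> < r / 2" if n: "n \<ge> 2 ^ j" for n
      proof -
        obtain k where k: "2 ^ k \<le> n" "n < 2 ^ Suc k"
          using ex_power_ivl1[of 2 n] n by (metis Suc_eq_plus1 le_trans numeral_le_iff one_le_numeral one_le_power order_refl semiring_norm(69))
        have "j < Suc k"
        proof (rule ccontr)
          assume "\<not> j < Suc k"
          then have "(2::nat) ^ Suc k \<le> 2 ^ j" by (intro power_increasing) auto
          then show False using k n by linarith
        qed
        then obtain i where i: "k = j + i" using less_Suc_eq_le le_Suc_ex by blast
        have "\<bar>S n \<omega> - S (2 ^ j) \<omega>\<bar> \<le> \<bar>S n \<omega> - S (2 ^ k) \<omega>\<bar> + \<bar>S (2 ^ k) \<omega> - S (2 ^ j) \<omega>\<bar>" by linarith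
        also have "\<dots> \<le> osc k \<omega> + (\<Sum>k\<in>{j..<j + i}. osc k \<omega>)"
          using step[of k n] k dy[of j i] i by (intro add_mono) auto
        also have "\<dots> = (\<Sum>k\<in>{j..<Suc k}. osc k \<omega>)" by (simp add: i)
        also have "\<dots> < r / 2" using j[of j "Suc k"] by simp
        finally show ?thesis .
      qed
      show "\<exists>N. \<forall>m\<ge>N. \<forall>n\<ge>N. dist (S m \<omega>) (S n \<omega>) < r"
      proof (intro exI[of _ "2 ^ j"] allI impI)
        fix m n :: nat assume mn: "m \<ge> 2 ^ j" "n \<ge> 2 ^ j"
        show "dist (S m \<omega>) (S n \<omega>) < r"
          unfolding dist_real_def using near[OF mn(1)] near[OF mn(2)] by linarith
      qed
    qed
    then show ?case by (simp add: Cauchy_convergent_iff)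
  qed
qed


section \<open>The FARIMA random variables as Wiener integrals\<close>

definition farima_weight :: "('d::finite \<Rightarrow> real) \<Rightarrow> nat^'d \<Rightarrow> real" where
  "farima_weight \<delta> p = (\<Prod>l\<in>UNIV. farima_coeff (\<delta> l) (p $ l))"

definition box_energy :: "('d::finite \<Rightarrow> real) \<Rightarrow> nat \<Rightarrow> real" where
  "box_energy \<delta> n = (\<Sum>p\<in>nat_box n. (farima_weight \<delta> p)\<^sup>2)"

lemma box_energy_prod: "box_energy \<delta> n = (\<Prod>l\<in>UNIV. \<Sum>j\<le>n. (farima_coeff (\<delta> l) j)\<^sup>2)"
  unfolding box_energy_def farima_weight_def prod_power_distrib
  using sum_prod_nat_box[of "\<lambda>l j. (farima_coeff (\<delta> l) j)\<^sup>2" n] by simp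

context
  fixes \<delta> :: "'d::finite \<Rightarrow> real"
  assumes \<delta>: "\<And>l. 0 < \<delta> l" "\<And>l. \<delta> l < 1/2"
begin

lemma box_energy_mono: "m \<le> n \<Longrightarrow> box_energy \<delta> m \<le> box_energy \<delta> n"
  unfolding box_energy_def by (intro sum_mono2 nat_box_mono) auto

lemma box_energy_bounded: "\<exists>E\<ge>0. \<forall>n. box_energy \<delta> n \<le> E"
proof (intro exI conjI allI)
  show "box_energy \<delta> n \<le> (\<Prod>l\<in>UNIV. \<Sum>j. (farima_coeff (\<delta> l) j)\<^sup>2)" for n
    unfolding box_energy_prod
    by (intro prod_mono conjI sum_nonneg sum_le_suminf farima_sq_summable \<delta>) auto
  show "0 \<le> (\<Prod>l\<in>UNIV. \<Sum>j. (farima_coeff (\<delta> l) j)\<^sup>2)"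
    by (intro prod_nonneg suminf_nonneg farima_sq_summable \<delta>) auto
qed

lemma box_energy_convergent: "convergent (box_energy \<delta>)"
proof -
  obtain E where "\<And>n. box_energy \<delta> n \<le> E" using box_energy_bounded by blast
  then have "Bseq (box_energy \<delta>)"
    by (intro BseqI'[of _ E]) (simp add: box_energy_def sum_nonneg)
  then show ?thesis by (rule Bseq_mono_convergent) (auto intro: box_energy_mono)
qed

text \<open>
  The box sums are products of one-dimensional sums, which are bounded and grow geometrically little from one
  dyadic block to the next; the slowest rate belongs to the largest exponent \<open>D\<close>.
\<close>

lemma box_energy_dyadic: "\<exists>C q. 0 \<le> C \<and> 0 \<le> q \<and> q < 1 \<and> (\<forall>k. box_energy \<delta> (2 ^ Suc k) - box_energy \<delta> (2 ^ k) \<le> C * q ^ k)"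
proof -
  define T where "T l = (\<Sum>j. (farima_coeff (\<delta> l) j)\<^sup>2)" for l
  have T0: "0 \<le> T l" for l unfolding T_def by (intro suminf_nonneg farima_sq_summable \<delta>) auto
  define K where "K = 1 + (\<Sum>l\<in>UNIV. T l)"
  have TK: "T l \<le> K" for l
    unfolding K_def using member_le_sum[of l UNIV T] T0 by simp
  have K1: "1 \<le> K" unfolding K_def using T0 by (simp add: sum_nonneg)
  define D where "D = Max (range \<delta>)"
  have D: "\<delta> l \<le> D" for l unfolding D_def by (intro Max_ge) auto
  have D2: "D < 1/2" unfolding D_def using \<delta>(2) by (subst Max_less_iff) auto
  define q where "q = 2 powr (2 * D - 1)"
  have q: "0 \<le> q" "q < 1"
  proof -
    have "q < 2 powr 0" unfolding q_def using D2 by (intro powr_less_mono) auto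
    then show "q < 1" by simp
  qed (simp add: q_def)
  define s where "s l n = (\<Sum>j\<le>n. (farima_coeff (\<delta> l) j)\<^sup>2)" for l n
  have "box_energy \<delta> (2 ^ Suc k) - box_energy \<delta> (2 ^ k) \<le> (K ^ CARD('d) * real CARD('d)) * q ^ k" for k
  proof -
    have "box_energy \<delta> (2 ^ Suc k) - box_energy \<delta> (2 ^ k) \<le> K ^ CARD('d) * (\<Sum>l\<in>UNIV. s l (2 ^ Suc k) - s l (2 ^ k))"
      unfolding box_energy_prod s_def[symmetric]
    proof (rule prod_diff_le)
      fix l
      have "s l (2 ^ Suc k) \<le> T l"
        unfolding s_def T_def by (intro sum_le_suminf farima_sq_summable \<delta>) auto
      moreover have "s l (2 ^ k) \<le> s l (2 ^ Suc k)" unfolding s_def by (intro sum_mono2) auto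
      moreover have "0 \<le> s l (2 ^ k)" unfolding s_def by (intro sum_nonneg) auto
      ultimately show "0 \<le> s l (2 ^ k) \<and> s l (2 ^ k) \<le> s l (2 ^ Suc k) \<and> s l (2 ^ Suc k) \<le> K" using TK[of l] by linarith
    qed (use K1 in auto)
    also have "\<dots> \<le> K ^ CARD('d) * (\<Sum>l\<in>(UNIV :: 'd set). q ^ k)"
    proof (intro mult_left_mono sum_mono)
      fix l
      have "s l (2 ^ Suc k) - s l (2 ^ k) \<le> (2 powr (2 * \<delta> l - 1)) ^ k"
        unfolding s_def by (rule farima_sq_block[OF \<delta>])
      also have "\<dots> \<le> q ^ k" unfolding q_def using D[of l] by (intro power_mono powr_mono) auto
      finally show "s l (2 ^ Suc k) - s l (2 ^ k) \<le> q ^ k" .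
    qed (use K1 in auto)
    finally show ?thesis by (simp add: mult.assoc)
  qed
  moreover have "0 \<le> K ^ CARD('d) * real CARD('d)" using K1 by simp
  ultimately show ?thesis using q by blast
qed

lemma box_energy_chaining_summable:
  assumes "0 \<le> c"
  shows "summable (\<lambda>k. real (Suc k) * sqrt (c * box_energy \<delta> (2 ^ Suc k) - c * box_energy \<delta> (2 ^ k)))"
proof -
  obtain C q where q: "0 \<le> C" "0 \<le> q" "q < 1" "\<And>k. box_energy \<delta> (2 ^ Suc k) - box_energy \<delta> (2 ^ k) \<le> C * q ^ k"
    using box_energy_dyadic by blast
  show ?thesis
  proof (rule summable_comparison_test')
    have "norm (sqrt q) < 1" using q by simp
    from sums_summable[OF geometric_deriv_sums[OF this]]
    show "summable (\<lambda>k. sqrt (c * C) * (real (Suc k) * sqrt q ^ k))" by (rule summable_mult)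
    fix k :: nat
    have "c * box_energy \<delta> (2 ^ Suc k) - c * box_energy \<delta> (2 ^ k) \<le> c * (C * q ^ k)"
      using mult_left_mono[OF q(4) assms, of k] by (simp add: right_diff_distrib)
    then have "sqrt (c * box_energy \<delta> (2 ^ Suc k) - c * box_energy \<delta> (2 ^ k)) \<le> sqrt (c * (C * q ^ k))"
      by (rule real_sqrt_le_mono)
    also have "\<dots> = sqrt (c * C) * sqrt q ^ k" by (simp add: real_sqrt_mult real_sqrt_power)
    finally have "real (Suc k) * sqrt (c * box_energy \<delta> (2 ^ Suc k) - c * box_energy \<delta> (2 ^ k)) \<le> real (Suc k) * (sqrt (c * C) * sqrt q ^ k)"
      by (rule mult_left_mono) simp
    moreover have "0 \<le> c * box_energy \<delta> (2 ^ Suc k) - c * box_energy \<delta> (2 ^ k)"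
      using mult_left_mono[OF box_energy_mono[of "2 ^ k" "2 ^ Suc k"] assms] by simp
    ultimately show "norm (real (Suc k) * sqrt (c * box_energy \<delta> (2 ^ Suc k) - c * box_energy \<delta> (2 ^ k))) \<le> sqrt (c * C) * (real (Suc k) * sqrt q ^ k)"
      by (simp add: abs_mult mult.left_commute del: of_nat_Suc power_Suc)
  qed
qed

end

definition shift_index :: "int^'d \<Rightarrow> nat^'d \<Rightarrow> int^'d" where
  "shift_index m p = (\<chi> l. m $ l - int (p $ l))"

lemma shift_index_inject: "shift_index m p = shift_index m p' \<longleftrightarrow> p = p'"
  by (auto simp: shift_index_def vec_eq_iff)

text \<open>
  The weights extended by \<open>0\<close> to the integer lattice, so that convolutions with them can be written as
  sums over all indices.
\<close>

definition farima_weight_at :: "('d::finite \<Rightarrow> real) \<Rightarrow> int^'d \<Rightarrow> real" where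
  "farima_weight_at \<delta> j = (if \<forall>l. 0 \<le> j $ l then farima_weight \<delta> (\<chi> l. nat (j $ l)) else 0)"

lemma farima_weight_at_shift: "farima_weight_at \<delta> (m - k) = farima_weight \<delta> p" if "shift_index m p = k"
proof -
  have "m $ l - k $ l = int (p $ l)" for l using that by (auto simp: shift_index_def)
  then show ?thesis by (simp add: farima_weight_at_def vec_lambda_eta)
qed

lemma farima_weight_at_no_shift: "farima_weight_at \<delta> (m - k) = 0" if "\<And>p. shift_index m p \<noteq> k"
proof (rule ccontr)
  assume "farima_weight_at \<delta> (m - k) \<noteq> 0"
  then have "\<forall>l. 0 \<le> m $ l - k $ l" by (auto simp: farima_weight_at_def split: if_splits)
  then have "shift_index m (\<chi> l. nat (m $ l - k $ l)) = k" by (auto simp: shift_index_def vec_eq_iff)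
  with that show False by blast
qed

context meyer_scaling
begin

context
  fixes M :: "'w measure" and B :: "real \<Rightarrow> 'w \<Rightarrow> real" and \<delta> :: "'d::finite \<Rightarrow> real" and J :: nat
  assumes bm: "standard_brownian_motion M B"
    and \<delta>: "\<And>l. 0 < \<delta> l" "\<And>l. \<delta> l < 1/2"
begin

lemma wiener_coeff_is_wiener:
  "is_wiener_integral M B (basis_fn J k) (wiener_coeff M B \<phi> J k)" for k :: "int^'d"
proof -
  obtain C where C: "\<And>l. quadratic_decay (\<lambda>x. \<phi> (2 ^ J * x - of_int (k $ l))) C"
    using quadratic_decay_uniform[of "\<lambda>l x. \<phi> (2 ^ J * x - of_int (k $ l))"] dilate_decay by blast
  have "\<exists>X. is_wiener_integral M B (\<lambda>x::real^'d. \<Prod>l\<in>UNIV. (\<lambda>y. \<phi> (2 ^ J * y - of_int (k $ l))) (x $ l)) X"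
  proof (rule is_wiener_integral_product[OF bm _ C])
    show "continuous_on UNIV (\<lambda>y. \<phi> (2 ^ J * y - of_int (k $ l)))" for l
      by (intro continuous_intros continuous_on_compose2[OF phi_continuous]) auto
  qed
  from is_wiener_integral_some[OF bm this]
  have w: "is_wiener_integral M B (\<lambda>x::real^'d. \<Prod>l\<in>UNIV. \<phi> (2 ^ J * x $ l - of_int (k $ l)))
      (wiener_integral M B (\<lambda>x::real^'d. \<Prod>l\<in>UNIV. \<phi> (2 ^ J * x $ l - of_int (k $ l))))" .
  from is_wiener_integral_lincomb[OF bm w w, of "2 powr (real J * real CARD('d) / 2)" 0]
  show ?thesis by (simp add: basis_fn_eq[abs_def] wiener_coeff_def[abs_def])
qed

definition partial_kernel :: "int^'d \<Rightarrow> nat \<Rightarrow> real^'d \<Rightarrow> real" where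
  "partial_kernel m n x = (\<Sum>p\<in>nat_box n. farima_weight \<delta> p * basis_fn J (shift_index m p) x)"

definition partial_farima :: "int^'d \<Rightarrow> nat \<Rightarrow> 'w \<Rightarrow> real" where
  "partial_farima m n \<omega> = (\<Sum>p\<in>nat_box n. farima_weight \<delta> p * wiener_coeff M B \<phi> J (shift_index m p) \<omega>)"

lemma shifted_orthonormal:
  "L2_inner lborel (basis_fn J (shift_index m p)) (basis_fn J (shift_index m p')) = (if p = p' then 1 else 0)" for m :: "int^'d"
  by (simp add: basis_fn_orthonormal shift_index_inject)

lemma partial_wiener: "is_wiener_integral M B (partial_kernel m n) (partial_farima m n)"
  unfolding partial_kernel_def[abs_def] partial_farima_def[abs_def]
  by (intro is_wiener_integral_sum[OF bm] wiener_coeff_is_wiener)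

lemma partial_kernel_L2: "partial_kernel m n \<in> L2 lborel"
  unfolding partial_kernel_def[abs_def] by (intro L2_lincomb basis_fn_L2)

lemma partial_kernel_norm: "(L2_norm lborel (partial_kernel m n))\<^sup>2 = box_energy \<delta> n"
  unfolding partial_kernel_def[abs_def] box_energy_def
  by (rule orthonormal_norm_sq[OF basis_fn_L2 shifted_orthonormal]) simp

lemma partial_kernel_diff_norm:
  assumes "n' \<le> n"
  shows "(L2_norm lborel (\<lambda>x. partial_kernel m n x - partial_kernel m n' x))\<^sup>2 = box_energy \<delta> n - box_energy \<delta> n'"
proof -
  have "partial_kernel m n x - partial_kernel m n' x = (\<Sum>p\<in>nat_box n - nat_box n'. farima_weight \<delta> p * basis_fn J (shift_index m p) x)" for x
    unfolding partial_kernel_def by (simp add: sum_diff nat_box_mono[OF assms])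
  then have "(L2_norm lborel (\<lambda>x. partial_kernel m n x - partial_kernel m n' x))\<^sup>2 = (\<Sum>p\<in>nat_box n - nat_box n'. (farima_weight \<delta> p)\<^sup>2)"
    using orthonormal_norm_sq[where F="nat_box n - nat_box n'" and c="farima_weight \<delta>" and e="\<lambda>p. basis_fn J (shift_index m p)",
        OF basis_fn_L2 shifted_orthonormal] by simp
  then show ?thesis unfolding box_energy_def by (simp add: sum_diff nat_box_mono[OF assms])
qed

lemma partial_farima_diff_norm:
  assumes "n' \<le> n"
  shows "(L2_norm M (\<lambda>\<omega>. partial_farima m n \<omega> - partial_farima m n' \<omega>))\<^sup>2 \<le>
    (wiener_const TYPE('d))\<^sup>2 * box_energy \<delta> n - (wiener_const TYPE('d))\<^sup>2 * box_energy \<delta> n'"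
proof -
  have w: "is_wiener_integral M B (\<lambda>x. partial_kernel m n x - partial_kernel m n' x) (\<lambda>\<omega>. partial_farima m n \<omega> - partial_farima m n' \<omega>)"
    using is_wiener_integral_lincomb[OF bm partial_wiener partial_wiener, of 1 m n "-1" m n'] by simp
  have "(L2_norm M (\<lambda>\<omega>. partial_farima m n \<omega> - partial_farima m n' \<omega>))\<^sup>2 \<le>
      (wiener_const TYPE('d) * L2_norm lborel (\<lambda>x. partial_kernel m n x - partial_kernel m n' x))\<^sup>2"
    by (intro power_mono is_wiener_integral_norm_le[OF bm w]) simp
  then show ?thesis by (simp add: power_mult_distrib partial_kernel_diff_norm[OF assms] right_diff_distrib)
qed

text \<open>
  Almost sure convergence over cubes does not follow from convergence of the squared weights, since for \<open>d > 1\<close> the variables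
  need be neither independent nor orthogonal; the geometric growth of the box sums over dyadic
  blocks supplies what chaining needs.
\<close>

lemma partial_farima_convergent: "AE \<omega> in M. convergent (\<lambda>n. partial_farima m n \<omega>)"
proof -
  interpret prob_space M by (rule bm_prob_space[OF bm])
  show ?thesis
  proof (rule rademacher_menshov_dyadic)
    show "partial_farima m n \<in> L2 M" for n using partial_wiener by (rule is_wiener_integral_L2[OF bm])
    show "summable (\<lambda>k. real (Suc k) * sqrt ((wiener_const TYPE('d))\<^sup>2 * box_energy \<delta> (2 ^ Suc k) - (wiener_const TYPE('d))\<^sup>2 * box_energy \<delta> (2 ^ k)))"
      by (rule box_energy_chaining_summable[where \<delta>=\<delta>, OF \<delta>]) simp
  qed (rule partial_farima_diff_norm)
qed

lemma partial_kernel_limit: "\<exists>f\<in>L2 lborel. (\<lambda>n. L2_dist lborel (partial_kernel m n) f) \<longlonglongrightarrow> 0"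
proof (rule L2_complete[OF partial_kernel_L2])
  fix e :: real assume e: "e > 0"
  have "Cauchy (box_energy \<delta>)" using box_energy_convergent[where \<delta>=\<delta>, OF \<delta>] by (rule convergent_Cauchy)
  then obtain N where N: "\<And>m n. m \<ge> N \<Longrightarrow> n \<ge> N \<Longrightarrow> \<bar>box_energy \<delta> m - box_energy \<delta> n\<bar> < e\<^sup>2"
    using e unfolding Cauchy_def dist_real_def by (meson zero_less_power)
  have le: "L2_dist lborel (partial_kernel m i) (partial_kernel m j) \<le> e" if "i \<ge> N" "j \<ge> N" "j \<le> i" for i j
  proof -
    have "(L2_dist lborel (partial_kernel m i) (partial_kernel m j))\<^sup>2 \<le> e\<^sup>2"
      using partial_kernel_diff_norm[OF that(3), of m] N[OF that(1,2)] by (simp add: L2_dist_norm)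
    then show ?thesis by (rule power2_le_imp_le) (use e in simp)
  qed
  have "L2_dist lborel (partial_kernel m i) (partial_kernel m j) \<le> e" if "i \<ge> N" "j \<ge> N" for i j
    using le[of i j] le[of j i] that L2_dist_commute[of lborel "partial_kernel m i" "partial_kernel m j"] by (cases "j \<le> i") auto
  then show "\<exists>K. \<forall>i\<ge>K. \<forall>j\<ge>K. L2_dist lborel (partial_kernel m i) (partial_kernel m j) \<le> e" by blast
qed

text \<open>
  The kernel whose Wiener integral is the FARIMA variable with index \<open>m\<close>; any \<open>L\<^sup>2\<close> limit of the
  partial kernels will do.
\<close>

definition farima_kernel :: "int^'d \<Rightarrow> real^'d \<Rightarrow> real" where
  "farima_kernel m = (SOME f. f \<in> L2 lborel \<and> (\<lambda>n. L2_dist lborel (partial_kernel m n) f) \<longlonglongrightarrow> 0)"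

lemma farima_kernel: "farima_kernel m \<in> L2 lborel" "(\<lambda>n. L2_dist lborel (partial_kernel m n) (farima_kernel m)) \<longlonglongrightarrow> 0"
  using someI_ex[of "\<lambda>f. f \<in> L2 lborel \<and> (\<lambda>n. L2_dist lborel (partial_kernel m n) f) \<longlonglongrightarrow> 0"] partial_kernel_limit[of m]
  unfolding farima_kernel_def by blast+

lemma farima_kernel_bounded: "\<exists>E. \<forall>m. L2_norm lborel (farima_kernel m) \<le> E"
proof -
  obtain E where E: "\<And>n. box_energy \<delta> n \<le> E" using box_energy_bounded[where \<delta>=\<delta>, OF \<delta>] by blast
  have "L2_norm lborel (farima_kernel m) \<le> sqrt E" for m
  proof (rule LIMSEQ_le_const2[OF L2_norm_tendsto[OF partial_kernel_L2 farima_kernel]], intro exI[of _ 0] allI impI)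
    fix n
    have "sqrt ((L2_norm lborel (partial_kernel m n))\<^sup>2) \<le> sqrt E" unfolding partial_kernel_norm by (rule real_sqrt_le_mono[OF E])
    then show "L2_norm lborel (partial_kernel m n) \<le> sqrt E" by simp
  qed
  then show ?thesis by blast
qed

lemma farima_kernel_coeff: "L2_inner lborel (farima_kernel m) (basis_fn J k) = farima_weight_at \<delta> (m - k)"
proof -
  have part: "L2_inner lborel (partial_kernel m n) (basis_fn J k) = (\<Sum>p\<in>nat_box n. if shift_index m p = k then farima_weight \<delta> p else 0)" for n
    unfolding partial_kernel_def[abs_def]
    by (subst L2_inner_sum_left) (auto simp: basis_fn_L2 basis_fn_orthonormal intro!: sum.cong)
  have "\<forall>\<^sub>F n in sequentially. L2_inner lborel (partial_kernel m n) (basis_fn J k) = farima_weight_at \<delta> (m - k)"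
  proof (cases "\<exists>p. shift_index m p = k")
    case True
    then obtain p where p: "shift_index m p = k" by blast
    obtain N where N: "p \<in> nat_box N" using mem_nat_box by blast
    show ?thesis using eventually_ge_at_top[of N]
    proof eventually_elim
      case (elim n)
      then have pn: "p \<in> nat_box n" using N nat_box_mono by blast
      have "shift_index m p' = k \<longleftrightarrow> p' = p" for p' using p shift_index_inject[of m p' p] by auto
      then have "L2_inner lborel (partial_kernel m n) (basis_fn J k) = farima_weight \<delta> p" using pn by (simp add: part sum.delta)
      then show ?case by (simp add: farima_weight_at_shift[OF p])
    qed
  next
    case False
    then show ?thesis by (simp add: part farima_weight_at_no_shift)
  qed
  then have "(\<lambda>n. L2_inner lborel (partial_kernel m n) (basis_fn J k)) \<longlonglongrightarrow> farima_weight_at \<delta> (m - k)" by (rule tendsto_eventually)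
  then show ?thesis
    using LIMSEQ_unique[OF L2_inner_tendsto[OF partial_kernel_L2 farima_kernel(1) basis_fn_L2 farima_kernel(2)]] by blast
qed

lemma farima_eq_lim:
  assumes "\<And>l. h $ l - 1/2 = \<delta> l"
  shows "farima M B \<phi> h J m \<omega> = lim (\<lambda>n. partial_farima m n \<omega>)"
  unfolding farima_def partial_farima_def farima_weight_def nat_box_def shift_index_def assms ..

text \<open>
  The partial sums converge in \<open>L\<^sup>2\<close> to the Wiener integral of the limit kernel and almost surely to the
  FARIMA variable.
\<close>

lemma farima_wiener:
  assumes h: "\<And>l. h $ l - 1/2 = \<delta> l"
  shows "\<exists>Y. is_wiener_integral M B (farima_kernel m) Y \<and> (AE \<omega> in M. Y \<omega> = farima M B \<phi> h J m \<omega>)"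
proof -
  obtain Y where Y: "is_wiener_integral M B (farima_kernel m) Y" "(\<lambda>n. L2_dist M (partial_farima m n) Y) \<longlonglongrightarrow> 0"
    using is_wiener_integral_limit[OF bm partial_wiener farima_kernel] by blast
  have pL: "partial_farima m n \<in> L2 M" for n using partial_wiener by (rule is_wiener_integral_L2[OF bm])
  have YL: "Y \<in> L2 M" using Y(1) by (rule is_wiener_integral_L2[OF bm])
  have "AE \<omega> in M. (\<lambda>n. partial_farima m n \<omega>) \<longlonglongrightarrow> farima M B \<phi> h J m \<omega>"
    using partial_farima_convergent[of m] unfolding farima_eq_lim[OF h]
    by eventually_elim (simp add: convergent_LIMSEQ_iff)
  from L2_limit_AE_eq[OF pL YL Y(2) this] Y(1) show ?thesis by blast
qed

end

end

section \<open>The Hermite kernel is square integrable\<close>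

text \<open>
  For \<open>u \<le> r\<close> the second factor is at most \<open>r powr (a - 1)\<close>, and beyond \<open>r\<close> both are at most
  \<open>u powr (a - 1)\<close>; these bounds are integrated exactly, the second because \<open>a < 1/2\<close>.
\<close>

lemma kernel_correlation_pos:
  fixes a r :: real
  assumes a: "0 < a" "a < 1/2" and r: "0 < r"
  shows "(\<integral>\<^sup>+u. ennreal (pos_power u (a - 1) * pos_power (r + u) (a - 1)) \<partial>lborel) \<le> ennreal ((1 / a + 1 / (1 - 2 * a)) * r powr (2 * a - 1))"
proof -
  have 1: "(\<integral>\<^sup>+u. ennreal (indicator {0..r} u * u powr (a - 1)) \<partial>lborel) = ennreal (r powr (a - 1 + 1) / (a - 1 + 1))"
    by (rule nn_integral_has_integral_lebesgue[OF _ has_integral_powr_from_0]) (use a r in auto)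
  have 2: "(\<integral>\<^sup>+u. ennreal (indicator {r..} u * u powr (2 * a - 2)) \<partial>lborel) = ennreal (- (r powr (2 * a - 2 + 1)) / (2 * a - 2 + 1))"
    by (rule nn_integral_has_integral_lebesgue[OF _ has_integral_powr_to_inf]) (use a r in auto)
  have "pos_power u (a - 1) * pos_power (r + u) (a - 1) \<le>
      r powr (a - 1) * (indicator {0..r} u * u powr (a - 1)) + indicator {r..} u * u powr (2 * a - 2)" for u
  proof (cases "u \<le> 0")
    case True
    then show ?thesis by (simp add: pos_power_def)
  next
    case False
    then have u: "u > 0" by simp
    show ?thesis
    proof (cases "u \<le> r")
      case True
      have "(r + u) powr (a - 1) \<le> r powr (a - 1)" using u r a by (intro powr_mono2') auto
      then have "u powr (a - 1) * (r + u) powr (a - 1) \<le> u powr (a - 1) * r powr (a - 1)" by (rule mult_left_mono) simp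
      moreover have "0 \<le> indicator {r..} u * u powr (2 * a - 2)" by simp
      moreover have "pos_power u (a - 1) * pos_power (r + u) (a - 1) = u powr (a - 1) * (r + u) powr (a - 1)"
        using u r by (simp add: pos_power_def)
      moreover have "r powr (a - 1) * (indicator {0..r} u * u powr (a - 1)) = u powr (a - 1) * r powr (a - 1)"
        using u True by simp
      ultimately show ?thesis by linarith
    next
      case False
      have "(r + u) powr (a - 1) \<le> u powr (a - 1)" using u r a by (intro powr_mono2') auto
      then have "u powr (a - 1) * (r + u) powr (a - 1) \<le> u powr (a - 1) * u powr (a - 1)" by (rule mult_left_mono) simp
      also have "\<dots> = u powr (2 * a - 2)" by (simp add: powr_add[symmetric])
      finally show ?thesis using u r False by (simp add: pos_power_def)
    qed
  qed
  then have "(\<integral>\<^sup>+u. ennreal (pos_power u (a - 1) * pos_power (r + u) (a - 1)) \<partial>lborel) \<le>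
     (\<integral>\<^sup>+u. ennreal (r powr (a - 1)) * ennreal (indicator {0..r} u * u powr (a - 1)) + ennreal (indicator {r..} u * u powr (2 * a - 2)) \<partial>lborel)"
    by (intro nn_integral_mono) (simp add: ennreal_mult[symmetric] ennreal_plus[symmetric] del: ennreal_plus)
  also have "\<dots> = ennreal (r powr (a - 1)) * ennreal (r powr (a - 1 + 1) / (a - 1 + 1)) + ennreal (- (r powr (2 * a - 2 + 1)) / (2 * a - 2 + 1))"
    by (subst nn_integral_add) (auto simp: nn_integral_cmult 1 2)
  also have "\<dots> = ennreal (r powr (a - 1) * (r powr (a - 1 + 1) / (a - 1 + 1)) + - (r powr (2 * a - 2 + 1)) / (2 * a - 2 + 1))"
    using a by (simp add: ennreal_mult[symmetric] ennreal_plus[symmetric] divide_nonneg_neg divide_nonpos_neg del: ennreal_plus)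
  also have "r powr (a - 1) * (r powr (a - 1 + 1) / (a - 1 + 1)) + - (r powr (2 * a - 2 + 1)) / (2 * a - 2 + 1) = (1 / a + 1 / (1 - 2 * a)) * r powr (2 * a - 1)"
  proof -
    have "r powr (a - 1) * r powr a = r powr (2 * a - 1)" by (simp add: powr_add[symmetric])
    moreover have "- (r powr (2 * a - 1)) / (2 * a - 1) = r powr (2 * a - 1) / (1 - 2 * a)"
      using minus_divide_divide[of "r powr (2 * a - 1)" "1 - 2 * a"] by simp
    ultimately show ?thesis by (simp add: algebra_simps)
  qed
  finally show ?thesis .
qed

lemma kernel_correlation:
  fixes a s s' :: real
  assumes a: "0 < a" "a < 1/2" and ne: "s \<noteq> s'"
  shows "(\<integral>\<^sup>+y. ennreal (pos_power (s - y) (a - 1) * pos_power (s' - y) (a - 1)) \<partial>lborel) \<le> ennreal ((1 / a + 1 / (1 - 2 * a)) * \<bar>s - s'\<bar> powr (2 * a - 1))"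
proof -
  have main: "(\<integral>\<^sup>+y. ennreal (pos_power (s - y) (a - 1) * pos_power (s' - y) (a - 1)) \<partial>lborel) \<le> ennreal ((1 / a + 1 / (1 - 2 * a)) * \<bar>s - s'\<bar> powr (2 * a - 1))"
    if "s < s'" for s s' :: real
  proof -
    have "(\<integral>\<^sup>+y. ennreal (pos_power (s - y) (a - 1) * pos_power (s' - y) (a - 1)) \<partial>lborel) =
        ennreal \<bar>-1\<bar> * (\<integral>\<^sup>+u. ennreal (pos_power (s - (s + -1 * u)) (a - 1) * pos_power (s' - (s + -1 * u)) (a - 1)) \<partial>lborel)"
      by (rule nn_integral_real_affine) auto
    also have "\<dots> = (\<integral>\<^sup>+u. ennreal (pos_power u (a - 1) * pos_power ((s' - s) + u) (a - 1)) \<partial>lborel)"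
    proof -
      have "s - (s + -1 * u) = u" "s' - (s + -1 * u) = (s' - s) + u" for u by simp_all
      then show ?thesis by (simp only: abs_minus_cancel abs_one ennreal_1 mult_1)
    qed
    also have "\<dots> \<le> ennreal ((1 / a + 1 / (1 - 2 * a)) * (s' - s) powr (2 * a - 1))"
      by (rule kernel_correlation_pos[OF a]) (use that in simp)
    finally show ?thesis using that by simp
  qed
  show ?thesis
  proof (cases "s < s'")
    case False
    then have "s' < s" using ne by simp
    from main[OF this] show ?thesis by (simp add: mult.commute abs_minus_commute)
  qed (rule main)
qed

text \<open>
  The integrand of the Hermite kernel, with the range of integration included and the Gamma factors left out.
\<close>

definition prod_kernel :: "('d::finite \<Rightarrow> real) \<Rightarrow> real \<Rightarrow> real \<Rightarrow> real^'d \<Rightarrow> real" where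
  "prod_kernel \<delta> t s x = indicator {0..t} s * (\<Prod>l\<in>UNIV. pos_power (s - x $ l) (\<delta> l - 1))"

lemma fst_nth_measurable [measurable]: "(\<lambda>p. fst p $ l :: real) \<in> borel_measurable (borel \<Otimes>\<^sub>M N)" for l :: "'d::finite"
  by (rule measurable_compose[OF measurable_fst, where g="\<lambda>x :: real^'d. x $ l"]) measurable

lemma snd_nth_measurable [measurable]: "(\<lambda>p. snd p $ l :: real) \<in> borel_measurable (N \<Otimes>\<^sub>M borel)" for l :: "'d::finite"
  by (rule measurable_compose[OF measurable_snd, where g="\<lambda>x :: real^'d. x $ l"]) measurable

context
  fixes \<delta> :: "'d::finite \<Rightarrow> real" and t :: real
  assumes \<delta>: "\<And>l. 0 < \<delta> l" "\<And>l. \<delta> l < 1/2" and sum: "(\<Sum>l\<in>UNIV. 2 * \<delta> l - 1) > - 1"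
begin

lemma prod_kernel_nonneg: "0 \<le> prod_kernel \<delta> t s x"
  by (auto simp: prod_kernel_def intro!: mult_nonneg_nonneg prod_nonneg)

lemma prod_kernel_measurable [measurable]:
  "(\<lambda>p. prod_kernel \<delta> t (fst p) (snd p)) \<in> borel_measurable (lborel \<Otimes>\<^sub>M lborel)"
  unfolding prod_kernel_def by measurable

text \<open>
  The integral over \<open>x\<close> is a product of one-dimensional correlations, hence at most a multiple of \<open>\<bar>s - s'\<bar>\<close> to the
  power \<open>\<beta>\<close>, the sum of \<open>2 \<delta> l - 1\<close>. The hypothesis on the Hurst parameters says \<open>\<beta> > - 1\<close>, which is local
  integrability of this power.
\<close>

lemma prod_kernel_correlation:
  "(\<integral>\<^sup>+s. \<integral>\<^sup>+s'. \<integral>\<^sup>+x. ennreal (prod_kernel \<delta> t s x) * ennreal (prod_kernel \<delta> t s' x) \<partial>lborel \<partial>lborel \<partial>lborel) < \<infinity>"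
proof -
  define \<beta> where "\<beta> = (\<Sum>l\<in>UNIV. 2 * \<delta> l - 1)"
  define C where "C = (\<Prod>l\<in>UNIV. 1 / \<delta> l + 1 / (1 - 2 * \<delta> l))"
  have c0: "0 \<le> 1 / \<delta> l + 1 / (1 - 2 * \<delta> l)" for l
    using \<delta>(1)[of l] \<delta>(2)[of l] by (intro add_nonneg_nonneg) auto
  have C0: "0 \<le> C" unfolding C_def by (intro prod_nonneg ballI c0)
  have inner: "(\<integral>\<^sup>+x. ennreal (prod_kernel \<delta> t s x) * ennreal (prod_kernel \<delta> t s' x) \<partial>lborel) \<le>
      indicator {0..t} s * (ennreal C * ennreal (\<bar>s - s'\<bar> powr \<beta> * indicator {- t..t} (s - s')))" if "s' \<noteq> s" for s s'
  proof (cases "s \<in> {0..t} \<and> s' \<in> {0..t}")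
    case True
    then have ss: "s - s' \<in> {- t..t}" by auto
    have "(\<integral>\<^sup>+x. ennreal (prod_kernel \<delta> t s x) * ennreal (prod_kernel \<delta> t s' x) \<partial>lborel) =
        (\<integral>\<^sup>+x. (\<Prod>l\<in>UNIV. ennreal (pos_power (s - x $ l) (\<delta> l - 1) * pos_power (s' - x $ l) (\<delta> l - 1))) \<partial>(lborel :: (real^'d) measure))"
      using True by (intro nn_integral_cong)
        (simp add: prod_kernel_def prod_ennreal prod_nonneg ennreal_mult[symmetric] prod.distrib)
    also have "\<dots> = (\<Prod>l\<in>UNIV. \<integral>\<^sup>+y. ennreal (pos_power (s - y) (\<delta> l - 1) * pos_power (s' - y) (\<delta> l - 1)) \<partial>lborel)"
      by (rule nn_integral_prod_vec) measurable
    also have "\<dots> \<le> (\<Prod>l\<in>UNIV. ennreal ((1 / \<delta> l + 1 / (1 - 2 * \<delta> l)) * \<bar>s - s'\<bar> powr (2 * \<delta> l - 1)))"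
      using that by (intro prod_mono_ennreal kernel_correlation \<delta>) auto
    also have "\<dots> = ennreal (\<Prod>l\<in>UNIV. (1 / \<delta> l + 1 / (1 - 2 * \<delta> l)) * \<bar>s - s'\<bar> powr (2 * \<delta> l - 1))"
      by (intro prod_ennreal mult_nonneg_nonneg c0) auto
    also have "(\<Prod>l\<in>UNIV. (1 / \<delta> l + 1 / (1 - 2 * \<delta> l)) * \<bar>s - s'\<bar> powr (2 * \<delta> l - 1)) = C * \<bar>s - s'\<bar> powr \<beta>"
      using that by (simp add: prod.distrib C_def \<beta>_def powr_sum)
    finally show ?thesis using True ss C0 by (simp add: ennreal_mult)
  next
    case False
    then have "prod_kernel \<delta> t s x = 0 \<or> prod_kernel \<delta> t s' x = 0" for x by (auto simp: prod_kernel_def)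
    then have "ennreal (prod_kernel \<delta> t s x) * ennreal (prod_kernel \<delta> t s' x) = 0" for x by (metis ennreal_0 mult_zero_left mult_zero_right)
    then have "(\<lambda>x. ennreal (prod_kernel \<delta> t s x) * ennreal (prod_kernel \<delta> t s' x)) = (\<lambda>_. 0)" by (rule ext)
    then show ?thesis by (simp only: nn_integral_const mult_zero_left zero_le)
  qed
  define D where "D = (\<integral>\<^sup>+v. ennreal (\<bar>v\<bar> powr \<beta> * indicator {- t..t} v) \<partial>lborel)"
  have Dfin: "D < \<infinity>"
  proof -
    have "integrable lborel (\<lambda>v. \<bar>v\<bar> powr (\<beta> + 1 - 1) * indicator {- t..t} v)"
      by (rule integrable_abs_powr) (use sum in \<open>simp add: \<beta>_def\<close>)
    then have "integrable lborel (\<lambda>v. \<bar>v\<bar> powr \<beta> * indicator {- t..t} v)" by simp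
    then show ?thesis unfolding D_def by (subst nn_integral_eq_integral) auto
  qed
  have mid: "(\<integral>\<^sup>+s'. \<integral>\<^sup>+x. ennreal (prod_kernel \<delta> t s x) * ennreal (prod_kernel \<delta> t s' x) \<partial>lborel \<partial>lborel) \<le> indicator {0..t} s * (ennreal C * D)" for s
  proof -
    have "(\<integral>\<^sup>+s'. \<integral>\<^sup>+x. ennreal (prod_kernel \<delta> t s x) * ennreal (prod_kernel \<delta> t s' x) \<partial>lborel \<partial>lborel) \<le>
       (\<integral>\<^sup>+s'. indicator {0..t} s * (ennreal C * ennreal (\<bar>s - s'\<bar> powr \<beta> * indicator {- t..t} (s - s'))) \<partial>lborel)"
      using AE_lborel_singleton[of s] by (intro nn_integral_mono_AE) (auto intro: inner)
    also have "\<dots> = indicator {0..t} s * (ennreal C * (\<integral>\<^sup>+s'. ennreal (\<bar>s - s'\<bar> powr \<beta> * indicator {- t..t} (s - s')) \<partial>lborel))"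
      by (simp add: nn_integral_cmult)
    also have "(\<integral>\<^sup>+s'. ennreal (\<bar>s - s'\<bar> powr \<beta> * indicator {- t..t} (s - s')) \<partial>lborel) =
       ennreal \<bar>-1\<bar> * (\<integral>\<^sup>+v. ennreal (\<bar>s - (s + -1 * v)\<bar> powr \<beta> * indicator {- t..t} (s - (s + -1 * v))) \<partial>lborel)"
      by (rule nn_integral_real_affine) auto
    also have "\<dots> = D" by (simp add: D_def)
    finally show ?thesis .
  qed
  have "(\<integral>\<^sup>+s. \<integral>\<^sup>+s'. \<integral>\<^sup>+x. ennreal (prod_kernel \<delta> t s x) * ennreal (prod_kernel \<delta> t s' x) \<partial>lborel \<partial>lborel \<partial>lborel) \<le>
     (\<integral>\<^sup>+s. indicator {0..t} s * (ennreal C * D) \<partial>lborel)"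
    by (intro nn_integral_mono mid)
  also have "\<dots> = emeasure lborel {0..t} * (ennreal C * D)"
    by (subst nn_integral_multc) auto
  also have "\<dots> < \<infinity>" using Dfin by (simp add: ennreal_mult_less_top emeasure_lborel_Icc_eq)
  finally show ?thesis .
qed

text \<open>
  The square of the integral over \<open>s\<close> is a double integral over \<open>s\<close> and \<open>s'\<close>; exchanging the order leaves the
  correlation of the kernel. The extended integral \<open>E\<close> dominates the Bochner integral also where
  it is infinite and the latter is \<open>0\<close> by convention.
\<close>

lemma int_prod_kernel_L2: "(\<lambda>x. LINT s|lborel. prod_kernel \<delta> t s x) \<in> L2 lborel"
proof -
  have [measurable]: "(\<lambda>s. prod_kernel \<delta> t s x) \<in> borel_measurable lborel" for x
    unfolding prod_kernel_def by measurable
  have m2 [measurable]: "(\<lambda>(x, s). prod_kernel \<delta> t s x) \<in> borel_measurable (lborel \<Otimes>\<^sub>M lborel)"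
    unfolding prod_kernel_def by measurable
  have m3: "(\<lambda>x. LINT s|lborel. prod_kernel \<delta> t s x) \<in> borel_measurable lborel"
    by (rule lborel.borel_measurable_lebesgue_integral) (rule m2)
  define E where "E x = (\<integral>\<^sup>+s. ennreal (prod_kernel \<delta> t s x) \<partial>lborel)" for x
  have [measurable]: "E \<in> borel_measurable lborel"
    unfolding E_def by (rule lborel.borel_measurable_nn_integral) measurable
  have EE: "E x * E x = (\<integral>\<^sup>+s. \<integral>\<^sup>+s'. ennreal (prod_kernel \<delta> t s x) * ennreal (prod_kernel \<delta> t s' x) \<partial>lborel \<partial>lborel)" for x
    unfolding E_def by (simp add: nn_integral_cmult nn_integral_multc)
  have "(\<integral>\<^sup>+x. E x * E x \<partial>lborel) = (\<integral>\<^sup>+s. \<integral>\<^sup>+x. \<integral>\<^sup>+s'. ennreal (prod_kernel \<delta> t s x) * ennreal (prod_kernel \<delta> t s' x) \<partial>lborel \<partial>lborel \<partial>lborel)"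
    unfolding EE by (rule lborel_pair.Fubini'[symmetric]) (simp add: split_beta' nn_integral_cmult E_def[symmetric])
  also have "\<dots> = (\<integral>\<^sup>+s. \<integral>\<^sup>+s'. \<integral>\<^sup>+x. ennreal (prod_kernel \<delta> t s x) * ennreal (prod_kernel \<delta> t s' x) \<partial>lborel \<partial>lborel \<partial>lborel)"
  proof (rule nn_integral_cong)
    fix s
    have [measurable]: "(\<lambda>x. prod_kernel \<delta> t s x) \<in> borel_measurable lborel" unfolding prod_kernel_def by measurable
    show "(\<integral>\<^sup>+x. \<integral>\<^sup>+s'. ennreal (prod_kernel \<delta> t s x) * ennreal (prod_kernel \<delta> t s' x) \<partial>lborel \<partial>lborel) =
        (\<integral>\<^sup>+s'. \<integral>\<^sup>+x. ennreal (prod_kernel \<delta> t s x) * ennreal (prod_kernel \<delta> t s' x) \<partial>lborel \<partial>lborel)"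
      by (rule lborel_pair.Fubini'[symmetric]) (simp add: split_beta')
  qed
  also have "\<dots> < \<infinity>" by (rule prod_kernel_correlation)
  finally have fin: "(\<integral>\<^sup>+x. E x * E x \<partial>lborel) < \<infinity>" .
  have le: "ennreal ((LINT s|lborel. prod_kernel \<delta> t s x)\<^sup>2) \<le> E x * E x" for x
  proof (cases "E x = \<infinity>")
    case True
    then show ?thesis by (simp add: ennreal_top_mult)
  next
    case False
    have "(LINT s|lborel. prod_kernel \<delta> t s x) = enn2real (E x)"
      unfolding E_def by (rule integral_eq_nn_integral) (auto simp: prod_kernel_nonneg)
    then have "ennreal ((LINT s|lborel. prod_kernel \<delta> t s x)\<^sup>2) = ennreal (enn2real (E x)) * ennreal (enn2real (E x))"
      by (simp add: power2_eq_square ennreal_mult)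
    also have "\<dots> = E x * E x" using False by (simp add: ennreal_enn2real_if)
    finally show ?thesis by simp
  qed
  have "(\<integral>\<^sup>+x. ennreal ((LINT s|lborel. prod_kernel \<delta> t s x)\<^sup>2) \<partial>lborel) < \<infinity>"
    by (rule le_less_trans[OF nn_integral_mono[OF le] fin])
  then have "integrable lborel (\<lambda>x. (LINT s|lborel. prod_kernel \<delta> t s x)\<^sup>2)"
    using m3 by (intro integrableI_bounded) auto
  then show ?thesis using m3 by (simp add: L2_def)
qed

end

lemma hermite_kernel_eq:
  assumes "\<And>l. h $ l - 1/2 = \<delta> l"
  shows "hermite_kernel h t x = 1 / (\<Prod>l\<in>UNIV. Gamma (\<delta> l)) * (LINT s|lborel. prod_kernel \<delta> t s x)"
proof -
  have "h $ l - 3/2 = \<delta> l - 1" for l using assms[of l] by simp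
  then show ?thesis
    unfolding hermite_kernel_def prod_kernel_def set_lebesgue_integral_def assms by simp
qed

lemma hermite_kernel_L2:
  assumes "\<And>l. h $ l - 1/2 = \<delta> l" "\<And>l. 0 < \<delta> l" "\<And>l. \<delta> l < 1/2" "(\<Sum>l\<in>UNIV. 2 * \<delta> l - 1) > - 1"
  shows "hermite_kernel h t \<in> L2 lborel"
  unfolding hermite_kernel_eq[OF assms(1), abs_def] by (intro L2_scale int_prod_kernel_L2 assms)

section \<open>The coefficients of the Hermite kernel\<close>

context meyer_scaling
begin

text \<open>
  The bound is uniform in \<open>y\<close>, which makes the Hermite kernel absolutely integrable against basis functions.
\<close>

lemma phi_abs_conv_bound:
  assumes a: "0 < a" "a \<le> 1"
  shows "\<exists>b. \<forall>y. (LINT u|lborel. \<bar>pos_power u (a - 1) * \<phi> (y - u)\<bar>) \<le> b"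
proof -
  obtain C where C: "\<And>x. \<bar>\<phi> x\<bar> \<le> C" using phi_bounded by blast
  have "(LINT u|lborel. \<bar>pos_power u (a - 1) * \<phi> (y - u)\<bar>) \<le> C * exp 1 * Gamma a + (LINT x|lborel. \<bar>\<phi> x\<bar>)" for y
  proof -
    have tr: "(LINT u|lborel. \<bar>\<phi> (y - u)\<bar>) = (LINT x|lborel. \<bar>\<phi> x\<bar>)"
      using lborel_integral_real_affine[of "-1" "\<lambda>x. \<bar>\<phi> x\<bar>" y] by simp
    have i: "integrable lborel (\<lambda>u. C * exp 1 * (pos_power u (a - 1) * exp (- u)))"
      using gamma_kernel_integrable[OF a(1)] by (rule integrable_mult_right)
    have j: "integrable lborel (\<lambda>u. \<bar>\<phi> (y - u)\<bar>)" using phi_shift_integrable by (rule integrable_abs)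
    have "(LINT u|lborel. \<bar>pos_power u (a - 1) * \<phi> (y - u)\<bar>) \<le> (LINT u|lborel. C * exp 1 * (pos_power u (a - 1) * exp (- u)) + \<bar>\<phi> (y - u)\<bar>)"
    proof (rule integral_mono)
      show "integrable lborel (\<lambda>u. \<bar>pos_power u (a - 1) * \<phi> (y - u)\<bar>)" using frac_kernel_integrable[OF a] by (rule integrable_abs)
      show "integrable lborel (\<lambda>u. C * exp 1 * (pos_power u (a - 1) * exp (- u)) + \<bar>\<phi> (y - u)\<bar>)"
        using i j by (rule Bochner_Integration.integrable_add)
      show "\<bar>pos_power u (a - 1) * \<phi> (y - u)\<bar> \<le> C * exp 1 * (pos_power u (a - 1) * exp (- u)) + \<bar>\<phi> (y - u)\<bar>" for u
        using pos_power_kernel_bound[OF a(2) C, of u "y - u"] by (simp add: abs_mult)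
    qed
    also have "\<dots> = C * exp 1 * Gamma a + (LINT x|lborel. \<bar>\<phi> x\<bar>)"
      unfolding Bochner_Integration.integral_add[OF i j] tr integral_mult_right_zero gamma_kernel_integral[OF a(1)] ..
    finally show ?thesis .
  qed
  then show ?thesis by blast
qed

lemma scaled_kernel_affine:
  "pos_power (2 ^ J * s + - (2 ^ J) * y) (a - 1) * \<phi> ((2 ^ J * s - of_int \<kappa>) - (2 ^ J * s + - (2 ^ J) * y)) =
    2 powr (real J * (a - 1) - real J / 2) * (pos_power (s - y) (a - 1) * scaled J \<kappa> y)"
proof -
  have e: "2 ^ J * s + - (2 ^ J) * y = 2 ^ J * (s - y)" by (simp add: algebra_simps)
  have p: "pos_power (2 ^ J * (s - y)) (a - 1) = 2 powr (real J * (a - 1)) * pos_power (s - y) (a - 1)"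
    by (auto simp: pos_power_def powr_mult zero_less_mult_iff powr_powr powr_realpow[symmetric])
  have q: "(2 ^ J * s - of_int \<kappa>) - 2 ^ J * (s - y) = 2 ^ J * y - of_int \<kappa>" by (simp add: algebra_simps)
  show ?thesis
    unfolding e p q scaled_def powr_diff by simp
qed

lemma
  assumes a: "0 < a" "a < 1"
  shows scaled_conv_integrable: "integrable lborel (\<lambda>y. pos_power (s - y) (a - 1) * scaled J \<kappa> y)"
    and scaled_conv: "(LINT y|lborel. pos_power (s - y) (a - 1) * scaled J \<kappa> y) =
      2 powr (real J / 2 - real J * a) * Gamma a * (\<Sum>p. farima_coeff a p * frac_scaling_Re a (2 ^ J * s - of_int \<kappa> - real p))"
    and scaled_conv_abs: "(LINT y|lborel. \<bar>pos_power (s - y) (a - 1) * scaled J \<kappa> y\<bar>) =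
      2 powr (real J / 2 - real J * a) * (LINT u|lborel. \<bar>pos_power u (a - 1) * \<phi> ((2 ^ J * s - of_int \<kappa>) - u)\<bar>)"
proof -
  define Y where "Y = 2 ^ J * s - of_int \<kappa>"
  define c where "c = 2 powr (real J * (a - 1) - real J / 2)"
  have c: "c > 0" by (simp add: c_def)
  have fi: "integrable lborel (\<lambda>u. pos_power u (a - 1) * \<phi> (Y - u))" using a by (intro frac_kernel_integrable) auto
  have aff: "pos_power (2 ^ J * s + - (2 ^ J) * y) (a - 1) * \<phi> (Y - (2 ^ J * s + - (2 ^ J) * y)) = c * (pos_power (s - y) (a - 1) * scaled J \<kappa> y)" for y
    unfolding Y_def c_def by (rule scaled_kernel_affine)
  have "integrable lborel (\<lambda>y. c * (pos_power (s - y) (a - 1) * scaled J \<kappa> y))"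
    using lborel_integrable_real_affine[OF fi, of "- (2 ^ J)" "2 ^ J * s"] unfolding aff by simp
  then show int: "integrable lborel (\<lambda>y. pos_power (s - y) (a - 1) * scaled J \<kappa> y)" using c by simp
  have "2 powr (real J / 2 - real J * a) * (\<bar>- (2 ^ J)\<bar> * c) = 1"
    by (simp add: c_def powr_realpow[symmetric] powr_add[symmetric] algebra_simps)
  then have k: "2 powr (real J / 2 - real J * a) * (\<bar>- (2 ^ J)\<bar> * (c * z)) = z" for z by (simp add: mult.assoc[symmetric])
  have "(LINT u|lborel. pos_power u (a - 1) * \<phi> (Y - u)) = \<bar>- (2 ^ J)\<bar> *\<^sub>R (LINT y|lborel. c * (pos_power (s - y) (a - 1) * scaled J \<kappa> y))"
    unfolding aff[symmetric] by (rule lborel_integral_real_affine) simp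
  also have "\<dots> = \<bar>- (2 ^ J)\<bar> * (c * (LINT y|lborel. pos_power (s - y) (a - 1) * scaled J \<kappa> y))" by simp
  finally have "(LINT y|lborel. pos_power (s - y) (a - 1) * scaled J \<kappa> y) = 2 powr (real J / 2 - real J * a) * (LINT u|lborel. pos_power u (a - 1) * \<phi> (Y - u))"
    by (simp only: k)
  then show "(LINT y|lborel. pos_power (s - y) (a - 1) * scaled J \<kappa> y) =
      2 powr (real J / 2 - real J * a) * Gamma a * (\<Sum>p. farima_coeff a p * frac_scaling_Re a (2 ^ J * s - of_int \<kappa> - real p))"
    by (simp add: fractional_integral_identity[OF a] Y_def)
  have aff': "\<bar>pos_power (2 ^ J * s + - (2 ^ J) * y) (a - 1) * \<phi> (Y - (2 ^ J * s + - (2 ^ J) * y))\<bar> = c * \<bar>pos_power (s - y) (a - 1) * scaled J \<kappa> y\<bar>" for y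
    unfolding aff using c by (simp add: abs_mult)
  have "(LINT u|lborel. \<bar>pos_power u (a - 1) * \<phi> (Y - u)\<bar>) = \<bar>- (2 ^ J)\<bar> *\<^sub>R (LINT y|lborel. c * \<bar>pos_power (s - y) (a - 1) * scaled J \<kappa> y\<bar>)"
    unfolding aff'[symmetric] by (rule lborel_integral_real_affine) simp
  also have "\<dots> = \<bar>- (2 ^ J)\<bar> * (c * (LINT y|lborel. \<bar>pos_power (s - y) (a - 1) * scaled J \<kappa> y\<bar>))" by simp
  finally show "(LINT y|lborel. \<bar>pos_power (s - y) (a - 1) * scaled J \<kappa> y\<bar>) =
      2 powr (real J / 2 - real J * a) * (LINT u|lborel. \<bar>pos_power u (a - 1) * \<phi> ((2 ^ J * s - of_int \<kappa>) - u)\<bar>)"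
    unfolding Y_def[symmetric] by (simp only: k)
qed

context
  fixes \<delta> :: "'d::finite \<Rightarrow> real" and J :: nat
  assumes \<delta>: "\<And>l. 0 < \<delta> l" "\<And>l. \<delta> l < 1/2"
begin

text \<open>
  The time-dependent coefficient of the FARIMA variable with index \<open>m\<close> in the expansion of the
  approximation process, up to the power of two that depends on the level only.
\<close>

definition time_coeff :: "real \<Rightarrow> int^'d \<Rightarrow> real" where
  "time_coeff t m = (LINT s:{0..t}|lborel. (\<Prod>l\<in>UNIV. frac_scaling_Re (\<delta> l) (2 ^ J * s - of_int (m $ l))))"

lemma prod_frac_continuous: "continuous_on S (\<lambda>s. \<Prod>l\<in>UNIV. frac_scaling_Re (\<delta> l) (2 ^ J * s - of_int (m $ l)))"
  by (intro continuous_intros continuous_on_compose2[OF frac_scaling_Re_continuous]) auto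

lemma prod_frac_integrable: "set_integrable lborel {0..t} (\<lambda>s. \<Prod>l\<in>UNIV. frac_scaling_Re (\<delta> l) (2 ^ J * s - of_int (m $ l)))"
  by (intro borel_integrable_atLeastAtMost' prod_frac_continuous)

lemma frac_decay_const: "\<exists>C. 0 \<le> C \<and> (\<forall>l. quadratic_decay (frac_scaling_Re (\<delta> l)) C)"
  using quadratic_decay_uniform[of "\<lambda>l. frac_scaling_Re (\<delta> l)"] frac_scaling_Re_decay quadratic_decay_nonneg by blast

text \<open>
  Quadratic decay in each coordinate, with \<open>2^J * s\<close> in a bounded set; the constant is uniform in
  \<open>t \<le> T\<close>, which is the source of uniform convergence.
\<close>

lemma time_coeff_bound: "\<exists>C. 0 \<le> C \<and> (\<forall>t m. 0 \<le> t \<longrightarrow> t \<le> T \<longrightarrow> \<bar>time_coeff t m\<bar> \<le> C * decay_weight m)"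
proof (cases "0 \<le> T")
  case False
  then show ?thesis by (intro exI[of _ 0]) auto
next
  case True
  obtain C where C: "0 \<le> C" "\<And>l. quadratic_decay (frac_scaling_Re (\<delta> l)) C" using frac_decay_const by blast
  define c where "c = C * (2 * (1 + (2 ^ J * T)\<^sup>2))"
  have c: "0 \<le> c" using C(1) by (simp add: c_def)
  have pt: "\<bar>\<Prod>l\<in>UNIV. frac_scaling_Re (\<delta> l) (2 ^ J * s - of_int (m $ l))\<bar> \<le> c ^ CARD('d) * decay_weight m" if "0 \<le> s" "s \<le> T" for s m
  proof -
    have "\<bar>\<Prod>l\<in>UNIV. frac_scaling_Re (\<delta> l) (2 ^ J * s - of_int (m $ l))\<bar> \<le> (\<Prod>l\<in>UNIV. c * (1 / (1 + (of_int (m $ l))\<^sup>2)))"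
      unfolding abs_prod
    proof (intro prod_mono conjI)
      fix l
      have "\<bar>frac_scaling_Re (\<delta> l) (2 ^ J * s - of_int (m $ l))\<bar> \<le> C * (2 * (1 + (2 ^ J * s)\<^sup>2)) / (1 + (of_int (m $ l))\<^sup>2)"
        using quadratic_decay_shift[OF C(2), of l "2 ^ J * s" "of_int (m $ l)"] by simp
      also have "\<dots> \<le> c / (1 + (of_int (m $ l))\<^sup>2)"
        unfolding c_def using that C(1) by (intro divide_right_mono mult_left_mono add_left_mono power_mono) auto
      finally show "\<bar>frac_scaling_Re (\<delta> l) (2 ^ J * s - of_int (m $ l))\<bar> \<le> c * (1 / (1 + (of_int (m $ l))\<^sup>2))" by simp
    qed auto
    also have "\<dots> = c ^ CARD('d) * decay_weight m" by (simp add: prod.distrib decay_weight_def del: times_divide_eq_right mult_1_right)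
    finally show ?thesis .
  qed
  have "\<bar>time_coeff t m\<bar> \<le> (T * c ^ CARD('d)) * decay_weight m" if t: "0 \<le> t" "t \<le> T" for t m
  proof -
    have b: "\<bar>indicator {0..t} s *\<^sub>R (\<Prod>l\<in>UNIV. frac_scaling_Re (\<delta> l) (2 ^ J * s - of_int (m $ l)))\<bar> \<le> indicator {0..t} s * (c ^ CARD('d) * decay_weight m)" for s
      using pt[of s m] t by (auto simp: indicator_def)
    have "\<bar>time_coeff t m\<bar> \<le> (LINT s|lborel. indicator {0..t} s * (c ^ CARD('d) * decay_weight m))"
      unfolding time_coeff_def set_lebesgue_integral_def
    proof (rule order_trans[OF integral_abs_bound], rule integral_mono)
      show "integrable lborel (\<lambda>s. \<bar>indicator {0..t} s *\<^sub>R (\<Prod>l\<in>UNIV. frac_scaling_Re (\<delta> l) (2 ^ J * s - of_int (m $ l)))\<bar>)"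
        using prod_frac_integrable unfolding set_integrable_def by (rule integrable_abs)
    qed (use t b in auto)
    also have "\<dots> = t * (c ^ CARD('d) * decay_weight m)" using t by simp
    also have "\<dots> \<le> T * (c ^ CARD('d) * decay_weight m)"
      using t c decay_weight_pos[of m] by (intro mult_right_mono) (auto simp: less_imp_le)
    finally show ?thesis by (simp add: mult.assoc)
  qed
  moreover have "0 \<le> T * c ^ CARD('d)" using True c by simp
  ultimately show ?thesis by blast
qed

lemma farima_weight_bounds: "0 \<le> farima_weight \<delta> p" "farima_weight \<delta> p \<le> 1"
proof -
  have "\<delta> l < 1" for l using \<delta>(2)[of l] by simp
  then show "0 \<le> farima_weight \<delta> p" "farima_weight \<delta> p \<le> 1"
    unfolding farima_weight_def using \<delta>(1)
    by (auto intro!: prod_nonneg prod_le_1 farima_coeff_le_1 less_imp_le[OF farima_coeff_pos])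
qed

lemma farima_weight_at_bounds: "0 \<le> farima_weight_at \<delta> j" "farima_weight_at \<delta> j \<le> 1"
  by (auto simp: farima_weight_at_def farima_weight_bounds)

lemma coeff_series_summable:
  assumes "0 \<le> t"
  shows "(\<lambda>m. farima_weight_at \<delta> (m - k) * time_coeff t m) summable_on UNIV"
proof -
  obtain C where C: "0 \<le> C" "\<And>m. \<bar>time_coeff t m\<bar> \<le> C * decay_weight m" using time_coeff_bound[of t] assms by blast
  have "(\<lambda>m. C * decay_weight m) summable_on (UNIV :: (int^'d) set)" by (rule summable_on_cmult_right[OF decay_weight_summable])
  then have "(\<lambda>m. norm (farima_weight_at \<delta> (m - k) * time_coeff t m)) summable_on UNIV"
  proof (rule Infinite_Sum.abs_summable_on_comparison_test')
    fix m
    have "\<bar>farima_weight_at \<delta> (m - k)\<bar> * \<bar>time_coeff t m\<bar> \<le> 1 * (C * decay_weight m)"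
      using farima_weight_at_bounds[of "m - k"] C(2) by (intro mult_mono) auto
    then show "norm (farima_weight_at \<delta> (m - k) * time_coeff t m) \<le> C * decay_weight m" by (simp add: abs_mult)
  qed
  then show ?thesis by (rule Infinite_Sum.abs_summable_summable)
qed

definition add_index :: "int^'d \<Rightarrow> nat^'d \<Rightarrow> int^'d" where
  "add_index k p = (\<chi> l. k $ l + int (p $ l))"

text \<open>
  The weights vanish outside the cone \<open>k + \<nat>\<^sub>0\<^sup>d\<close>, which the images of the cubes exhaust.
\<close>

lemma coeff_series_limit:
  assumes "0 \<le> t"
  shows "(\<lambda>n. \<Sum>p\<in>nat_box n. farima_weight \<delta> p * time_coeff t (add_index k p)) \<longlonglongrightarrow> (\<Sum>\<^sub>\<infinity>m. farima_weight_at \<delta> (m - k) * time_coeff t m)"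
proof -
  let ?f = "\<lambda>m. farima_weight_at \<delta> (m - k) * time_coeff t m"
  define A where "A = range (add_index k)"
  have inj: "inj (add_index k)" by (auto simp: inj_on_def add_index_def vec_eq_iff)
  have ga: "farima_weight_at \<delta> (add_index k p - k) = farima_weight \<delta> p" for p
    by (rule farima_weight_at_shift) (simp add: shift_index_def add_index_def vec_eq_iff)
  have "(\<lambda>n. sum ?f (add_index k ` nat_box n)) \<longlonglongrightarrow> infsum ?f A"
  proof (rule exhaustion_tendsto)
    show "?f summable_on A" by (rule summable_on_subset_banach[OF coeff_series_summable[OF assms]]) simp
    show "\<exists>n. x \<in> add_index k ` nat_box n" if "x \<in> A" for x
    proof -
      obtain p where "x = add_index k p" using \<open>x \<in> A\<close> unfolding A_def by blast
      then show ?thesis using mem_nat_box[of p] by blast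
    qed
  qed (auto simp: A_def intro!: image_mono nat_box_mono)
  moreover have "infsum ?f A = infsum ?f UNIV"
  proof (rule infsum_cong_neutral)
    fix m assume "m \<in> UNIV - A"
    then have "add_index k p \<noteq> m" for p by (auto simp: A_def)
    moreover have "shift_index m p = k \<longleftrightarrow> add_index k p = m" for p
    proof -
      have "m $ l - int (p $ l) = k $ l \<longleftrightarrow> k $ l + int (p $ l) = m $ l" for l by linarith
      then show ?thesis by (simp add: add_index_def shift_index_def vec_eq_iff)
    qed
    ultimately have "shift_index m p \<noteq> k" for p by simp
    then show "?f m = 0" by (simp add: farima_weight_at_no_shift)
  qed auto
  moreover have "sum ?f (add_index k ` nat_box n) = (\<Sum>p\<in>nat_box n. farima_weight \<delta> p * time_coeff t (add_index k p))" for n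
    using inj by (subst sum.reindex) (auto simp: ga inj_on_def)
  ultimately show ?thesis by simp
qed

text \<open>
  Truncating all series at the same length turns the product into a finite sum over a cube, which can be
  integrated termwise; the truncated products are bounded uniformly on \<open>{0..t}\<close>.
\<close>

lemma prod_series_integral:
  assumes t: "0 \<le> t"
  shows "(LINT s|lborel. indicator {0..t} s * (\<Prod>l\<in>UNIV. \<Sum>p. farima_coeff (\<delta> l) p * frac_scaling_Re (\<delta> l) (2 ^ J * s - of_int (k $ l) - real p))) =
    (\<Sum>\<^sub>\<infinity>m. farima_weight_at \<delta> (m - k) * time_coeff t m)"
proof -
  have d1: "\<delta> l < 1" for l using \<delta>(2)[of l] by simp
  define g where "g l s p = farima_coeff (\<delta> l) p * frac_scaling_Re (\<delta> l) (2 ^ J * s - of_int (k $ l) - real p)" for l s p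
  define Z where "Z n s = indicator {0..t} s * (\<Prod>l\<in>UNIV. \<Sum>p\<le>n. g l s p)" for n s
  have gs: "summable (\<lambda>p. \<bar>g l s p\<bar>)" for l s unfolding g_def by (rule frac_series_summable[OF \<delta>(1) d1])
  obtain C where C: "0 \<le> C" "\<And>l. quadratic_decay (frac_scaling_Re (\<delta> l)) C" using frac_decay_const by blast
  define S where "S = (\<Sum>p. 1 / (1 + (real p)\<^sup>2))"
  have S0: "0 \<le> S" unfolding S_def by (rule suminf_nonneg[OF summable_one_plus_sq]) auto
  define b where "b l = C * (2 * (1 + (2 ^ J * t + \<bar>of_int (k $ l)\<bar>)\<^sup>2)) * S" for l
  have gb: "\<bar>\<Sum>p\<le>n. g l s p\<bar> \<le> b l" if s: "s \<in> {0..t}" for l s n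
  proof -
    define Y where "Y = 2 ^ J * s - of_int (k $ l)"
    have Y: "\<bar>Y\<bar> \<le> 2 ^ J * t + \<bar>of_int (k $ l)\<bar>"
    proof -
      have "\<bar>2 ^ J * s\<bar> \<le> 2 ^ J * t" using s by (simp add: abs_mult)
      then show ?thesis unfolding Y_def by linarith
    qed
    have "Y\<^sup>2 \<le> (2 ^ J * t + \<bar>of_int (k $ l)\<bar>)\<^sup>2"
      using power_mono[OF Y, of 2] by simp
    then have cY: "C * (2 * (1 + Y\<^sup>2)) \<le> C * (2 * (1 + (2 ^ J * t + \<bar>of_int (k $ l)\<bar>)\<^sup>2))" using C(1) by (intro mult_left_mono) auto
    have "\<bar>\<Sum>p\<le>n. g l s p\<bar> \<le> (\<Sum>p\<le>n. \<bar>g l s p\<bar>)" by (rule sum_abs)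
    also have "\<dots> \<le> (\<Sum>p\<le>n. C * (2 * (1 + Y\<^sup>2)) * (1 / (1 + (real p)\<^sup>2)))"
    proof (rule sum_mono)
      fix p
      have "\<bar>farima_coeff (\<delta> l) p\<bar> * \<bar>frac_scaling_Re (\<delta> l) (Y - real p)\<bar> \<le> 1 * (C * (2 * (1 + Y\<^sup>2)) / (1 + (real p)\<^sup>2))"
        using quadratic_decay_shift[OF C(2), of l Y "real p"] farima_coeff_le_1[OF \<delta>(1) d1, of l p] farima_coeff_pos[OF \<delta>(1), of l p]
        by (intro mult_mono) auto
      then show "\<bar>g l s p\<bar> \<le> C * (2 * (1 + Y\<^sup>2)) * (1 / (1 + (real p)\<^sup>2))" by (simp add: g_def Y_def abs_mult)
    qed
    also have "\<dots> = C * (2 * (1 + Y\<^sup>2)) * (\<Sum>p\<le>n. 1 / (1 + (real p)\<^sup>2))" by (rule sum_distrib_left[symmetric])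
    also have "\<dots> \<le> C * (2 * (1 + Y\<^sup>2)) * S"
      unfolding S_def using C(1) by (intro mult_left_mono sum_le_suminf summable_one_plus_sq) auto
    also have "\<dots> \<le> b l" unfolding b_def using cY S0 by (rule mult_right_mono)
    finally show ?thesis .
  qed
  have gcont: "continuous_on UNIV (\<lambda>s. g l s p)" for l p
    unfolding g_def by (intro continuous_intros continuous_on_compose2[OF frac_scaling_Re_continuous]) auto
  have [measurable]: "(\<lambda>s. g l s p) \<in> borel_measurable borel" for l p
    by (rule borel_measurable_continuous_onI[OF gcont])
  have "(\<lambda>n. LINT s|lborel. Z n s) \<longlonglongrightarrow> (LINT s|lborel. indicator {0..t} s * (\<Prod>l\<in>UNIV. \<Sum>p. g l s p))"
  proof (rule integral_dominated_convergence)
    show "integrable lborel (\<lambda>s. indicator {0..t} s * (\<Prod>l\<in>UNIV. b l))" using t by simp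
    show "AE s in lborel. (\<lambda>n. Z n s) \<longlonglongrightarrow> indicator {0..t} s * (\<Prod>l\<in>UNIV. \<Sum>p. g l s p)"
    proof (rule AE_I2)
      fix s
      have "(\<lambda>n. \<Sum>p\<le>n. g l s p) \<longlonglongrightarrow> (\<Sum>p. g l s p)" for l
        using summable_LIMSEQ'[OF summable_rabs_cancel[OF gs]] .
      then show "(\<lambda>n. Z n s) \<longlonglongrightarrow> indicator {0..t} s * (\<Prod>l\<in>UNIV. \<Sum>p. g l s p)"
        unfolding Z_def by (intro tendsto_intros)
    qed
    show "AE s in lborel. norm (Z n s) \<le> indicator {0..t} s * (\<Prod>l\<in>UNIV. b l)" for n
    proof (rule AE_I2)
      fix s
      show "norm (Z n s) \<le> indicator {0..t} s * (\<Prod>l\<in>UNIV. b l)"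
        by (cases "s \<in> {0..t}") (auto simp: Z_def abs_prod intro!: prod_mono gb)
    qed
    show "(\<lambda>s. indicator {0..t} s * (\<Prod>l\<in>UNIV. \<Sum>p. g l s p)) \<in> borel_measurable lborel" by measurable
    show "Z n \<in> borel_measurable lborel" for n unfolding Z_def[abs_def] by measurable
  qed
  moreover have "(LINT s|lborel. Z n s) = (\<Sum>p\<in>nat_box n. farima_weight \<delta> p * time_coeff t (add_index k p))" for n
  proof -
    have "Z n s = (\<Sum>p\<in>nat_box n. farima_weight \<delta> p * (indicator {0..t} s *\<^sub>R (\<Prod>l\<in>UNIV. frac_scaling_Re (\<delta> l) (2 ^ J * s - of_int (add_index k p $ l)))))" for s
    proof -
      have "(\<Prod>l\<in>UNIV. \<Sum>p\<le>n. g l s p) = (\<Sum>p\<in>nat_box n. \<Prod>l\<in>UNIV. g l s (p $ l))" by (rule sum_prod_nat_box[symmetric])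
      then show ?thesis
        by (simp add: Z_def g_def farima_weight_def prod.distrib sum_distrib_left add_index_def mult.left_commute diff_diff_eq)
    qed
    then have "(LINT s|lborel. Z n s) = (LINT s|lborel. (\<Sum>p\<in>nat_box n. farima_weight \<delta> p * (indicator {0..t} s *\<^sub>R (\<Prod>l\<in>UNIV. frac_scaling_Re (\<delta> l) (2 ^ J * s - of_int (add_index k p $ l))))))"
      by (simp only:)
    also have "\<dots> = (\<Sum>p\<in>nat_box n. farima_weight \<delta> p * time_coeff t (add_index k p))"
      unfolding time_coeff_def set_lebesgue_integral_def
      using prod_frac_integrable[unfolded set_integrable_def] by (subst Bochner_Integration.integral_sum) auto
    finally show ?thesis .
  qed
  ultimately have "(\<lambda>n. \<Sum>p\<in>nat_box n. farima_weight \<delta> p * time_coeff t (add_index k p)) \<longlonglongrightarrow> (LINT s|lborel. indicator {0..t} s * (\<Prod>l\<in>UNIV. \<Sum>p. g l s p))"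
    by simp
  from LIMSEQ_unique[OF this coeff_series_limit[OF t]] show ?thesis by (simp add: g_def)
qed

text \<open>
  By Fubini's theorem the coefficient is an integral over \<open>s\<close> of a product of fractional integrals of dilates of
  \<open>\<phi>\<close>. Each is a FARIMA series of fractional scaling functions times \<open>2 powr (J/2 - J \<delta> l)\<close>, and
  these factors combine to the prefactor since \<open>h $ l = \<delta> l + 1/2\<close>.
\<close>

lemma hermite_kernel_coeff:
  assumes h: "\<And>l. h $ l - 1/2 = \<delta> l" and t: "0 \<le> t"
  shows "L2_inner lborel (hermite_kernel h t) (basis_fn J k) =
    2 powr (- (real J * ((\<Sum>l\<in>UNIV. h $ l) - real CARD('d)))) * (\<Sum>\<^sub>\<infinity>m. farima_weight_at \<delta> (m - k) * time_coeff t m)"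
proof -
  have d1: "\<delta> l < 1" "\<delta> l \<le> 1" for l using \<delta>(2)[of l] by auto
  define F where "F s x = prod_kernel \<delta> t s x * basis_fn J k x" for s and x :: "real^'d"
  define c where "c l = 2 powr (real J / 2 - real J * \<delta> l)" for l
  define z where "z l s = (\<Sum>p. farima_coeff (\<delta> l) p * frac_scaling_Re (\<delta> l) (2 ^ J * s - of_int (k $ l) - real p))" for l s
  have Feq: "F s x = indicator {0..t} s * (\<Prod>l\<in>UNIV. pos_power (s - x $ l) (\<delta> l - 1) * scaled J (k $ l) (x $ l))" for s x
    by (simp add: F_def prod_kernel_def basis_fn_def prod.distrib mult.assoc)
  have Fm: "(\<lambda>(s, x). F s x) \<in> borel_measurable (lborel \<Otimes>\<^sub>M lborel)"
    unfolding Feq by measurable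
  note ci = scaled_conv_integrable[OF \<delta>(1) d1(1)]
  have Fx: "integrable lborel (F s)" for s
    unfolding Feq[abs_def] using integrable_prod_vec[of "\<lambda>l y. pos_power (s - y) (\<delta> l - 1) * scaled J (k $ l) y", OF ci]
    by (rule integrable_mult_right)
  have Fxi: "(LINT x|lborel. F s x) = indicator {0..t} s * (\<Prod>l\<in>UNIV. c l * Gamma (\<delta> l) * z l s)" for s
    unfolding Feq integral_mult_right_zero
    using integral_prod_vec[of "\<lambda>l y. pos_power (s - y) (\<delta> l - 1) * scaled J (k $ l) y", OF ci]
    by (simp add: scaled_conv[OF \<delta>(1) d1(1)] c_def z_def)
  have "\<forall>l. \<exists>b. \<forall>y. (LINT u|lborel. \<bar>pos_power u (\<delta> l - 1) * \<phi> (y - u)\<bar>) \<le> b"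
    using phi_abs_conv_bound[OF \<delta>(1) d1(2)] by blast
  then obtain b where b: "\<And>l y. (LINT u|lborel. \<bar>pos_power u (\<delta> l - 1) * \<phi> (y - u)\<bar>) \<le> b l" by metis
  have Fint: "integrable (lborel \<Otimes>\<^sub>M lborel) (\<lambda>(s, x). F s x)"
  proof (rule lborel_pair.Fubini_integrable[OF Fm])
    have Fa: "(LINT x|lborel. norm (F s x)) = indicator {0..t} s * (\<Prod>l\<in>UNIV. LINT y|lborel. \<bar>pos_power (s - y) (\<delta> l - 1) * scaled J (k $ l) y\<bar>)" for s
    proof -
      have "norm (F s x) = indicator {0..t} s * (\<Prod>l\<in>UNIV. \<bar>pos_power (s - x $ l) (\<delta> l - 1) * scaled J (k $ l) (x $ l)\<bar>)" for x
        unfolding Feq by (simp add: abs_mult abs_prod)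
      then have "(LINT x|lborel. norm (F s x)) = indicator {0..t} s * (LINT x|lborel. (\<Prod>l\<in>UNIV. \<bar>pos_power (s - (x::real^'d) $ l) (\<delta> l - 1) * scaled J (k $ l) (x $ l)\<bar>))"
        by simp
      then show ?thesis
        using integral_prod_vec[of "\<lambda>l y. \<bar>pos_power (s - y) (\<delta> l - 1) * scaled J (k $ l) y\<bar>", OF integrable_abs[OF ci]]
        by simp
    qed
    have "integrable lborel (\<lambda>s. LINT x|lborel. norm (F s x))"
    proof (rule Bochner_Integration.integrable_bound)
      show "integrable lborel (\<lambda>s. indicator {0..t} s * (\<Prod>l\<in>UNIV. c l * b l))" using t by simp
      show "(\<lambda>s. LINT x|lborel. norm (F s x)) \<in> borel_measurable lborel"
        by (rule lborel.borel_measurable_lebesgue_integral) (use Fm in measurable)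
      show "AE s in lborel. norm (LINT x|lborel. norm (F s x)) \<le> norm (indicator {0..t} s * (\<Prod>l\<in>UNIV. c l * b l))"
      proof (rule AE_I2)
        fix s
        have "(\<Prod>l\<in>UNIV. LINT y|lborel. \<bar>pos_power (s - y) (\<delta> l - 1) * scaled J (k $ l) y\<bar>) \<le> (\<Prod>l\<in>UNIV. c l * b l)"
          unfolding scaled_conv_abs[OF \<delta>(1) d1(1)] c_def[symmetric]
          by (intro prod_mono conjI mult_left_mono b mult_nonneg_nonneg) (auto simp: c_def)
        moreover have "0 \<le> (\<Prod>l\<in>UNIV. LINT y|lborel. \<bar>pos_power (s - y) (\<delta> l - 1) * scaled J (k $ l) y\<bar>)"
          by (intro prod_nonneg) auto
        ultimately show "norm (LINT x|lborel. norm (F s x)) \<le> norm (indicator {0..t} s * (\<Prod>l\<in>UNIV. c l * b l))"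
          unfolding Fa by (cases "s \<in> {0..t}") auto
      qed
    qed
    then show "integrable lborel (\<lambda>s. LINT x|lborel. norm (case (s, x) of (s, x) \<Rightarrow> F s x))" by simp
    show "AE s in lborel. integrable lborel (\<lambda>x. case (s, x) of (s, x) \<Rightarrow> F s x)" using Fx by simp
  qed
  define G where "G = (\<Prod>l\<in>UNIV. Gamma (\<delta> l))"
  have G: "G > 0" unfolding G_def using \<delta>(1) by (intro prod_pos) (auto intro: Gamma_real_pos)
  have "L2_inner lborel (hermite_kernel h t) (basis_fn J k) = (LINT x|lborel. 1 / G * (LINT s|lborel. F s x))"
    unfolding L2_inner_def hermite_kernel_eq[OF h] G_def F_def by simp
  also have "\<dots> = 1 / G * (LINT x|lborel. LINT s|lborel. F s x)" by (rule integral_mult_right_zero)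
  also have "(LINT x|lborel. LINT s|lborel. F s x) = (LINT s|lborel. LINT x|lborel. F s x)"
    by (rule lborel_pair.Fubini_integral[OF Fint])
  also have "\<dots> = (LINT s|lborel. ((\<Prod>l\<in>UNIV. c l) * G) * (indicator {0..t} s * (\<Prod>l\<in>UNIV. z l s)))"
    unfolding Fxi G_def by (intro Bochner_Integration.integral_cong refl) (simp add: prod.distrib)
  also have "\<dots> = ((\<Prod>l\<in>UNIV. c l) * G) * (LINT s|lborel. indicator {0..t} s * (\<Prod>l\<in>UNIV. z l s))"
    by (rule integral_mult_right_zero)
  also have "(LINT s|lborel. indicator {0..t} s * (\<Prod>l\<in>UNIV. z l s)) = (\<Sum>\<^sub>\<infinity>m. farima_weight_at \<delta> (m - k) * time_coeff t m)"
    unfolding z_def by (rule prod_series_integral[OF t])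
  also have "(\<Prod>l\<in>UNIV. c l) = 2 powr (- (real J * ((\<Sum>l\<in>UNIV. h $ l) - real CARD('d))))"
  proof -
    have "c l = 2 powr (real J * (1 - h $ l))" for l
      unfolding c_def h[symmetric] by (intro arg_cong2[where f="(powr)"] refl) (simp add: field_simps)
    then have "(\<Prod>l\<in>UNIV. c l) = 2 powr (\<Sum>l\<in>UNIV. real J * (1 - h $ l))" by (simp add: powr_sum)
    also have "(\<Sum>l\<in>UNIV. real J * (1 - h $ l)) = - (real J * ((\<Sum>l\<in>UNIV. h $ l) - real CARD('d)))"
      by (simp add: sum_distrib_left[symmetric] sum_subtractf algebra_simps)
    finally show ?thesis .
  qed
  finally show ?thesis using G by simp
qed

end

end

section \<open>The expansion of the approximation process\<close>

lemma is_wiener_integral_cong_fn: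
  fixes f g :: "real^'d \<Rightarrow> real"
  assumes w: "is_wiener_integral M B f X" and eq: "AE x in lborel. f x = g x" and g: "g \<in> L2 lborel"
  shows "is_wiener_integral M B g X"
proof -
  have fL: "f \<in> L2 lborel" using w by (simp add: is_wiener_integral_def)
  have "L2_dist lborel g (step_kernel n t a) = L2_dist lborel f (step_kernel n t a)" if "strict_mono_on {..n} t" for n t a
    unfolding L2_dist_norm using eq L2_measurable[OF fL] L2_measurable[OF g] L2_measurable[OF step_kernel_L2[OF that, of a]]
    by (intro L2_norm_cong_AE borel_measurable_diff) auto
  then show ?thesis using w g unfolding is_wiener_integral_def by metis
qed

context meyer_scaling
begin

context
  fixes M :: "'w measure" and B :: "real \<Rightarrow> 'w \<Rightarrow> real" and \<delta> :: "'d::finite \<Rightarrow> real" and h :: "real^'d" and J :: nat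
  assumes bm: "standard_brownian_motion M B"
    and \<delta>: "\<And>l. 0 < \<delta> l" "\<And>l. \<delta> l < 1/2"
    and h: "\<And>l. h $ l - 1/2 = \<delta> l"
    and sum_\<delta>: "(\<Sum>l\<in>UNIV. 2 * \<delta> l - 1) > - 1"
begin

abbreviation "\<sigma> \<equiv> farima M B \<phi> h J"
abbreviation "\<kappa> \<equiv> farima_kernel \<delta> J"
abbreviation "\<tau> \<equiv> time_coeff \<delta> J"
definition "level_scale = 2 powr (- (real J * ((\<Sum>l\<in>UNIV. h $ l) - real CARD('d))))"

lemmas \<kappa>_L2 = farima_kernel(1)[OF bm \<delta>]

text \<open>
  Versions of the FARIMA variables that are themselves Wiener integrals; the pointwise limits agree with them only
  almost surely.
\<close>

definition farima_version :: "int^'d \<Rightarrow> 'w \<Rightarrow> real" where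
  "farima_version m = (SOME Y. is_wiener_integral M B (\<kappa> m) Y \<and> (AE \<omega> in M. Y \<omega> = \<sigma> m \<omega>))"

lemma farima_version: "is_wiener_integral M B (\<kappa> m) (farima_version m)" "AE \<omega> in M. farima_version m \<omega> = \<sigma> m \<omega>"
  using someI_ex[OF farima_wiener[OF bm \<delta> h, of J m]] unfolding farima_version_def by blast+

lemma farima_version_L2: "farima_version m \<in> L2 M"
  using farima_version(1) by (rule is_wiener_integral_L2[OF bm])

lemma farima_version_abs_integrable: "integrable M (\<lambda>\<omega>. \<bar>farima_version m \<omega>\<bar>)"
proof -
  interpret prob_space M by (rule bm_prob_space[OF bm])
  show ?thesis by (intro integrable_abs L2_integrable farima_version_L2)
qed

lemma farima_version_mean_bounded: "\<exists>E\<ge>0. \<forall>m. (LINT \<omega>|M. \<bar>farima_version m \<omega>\<bar>) \<le> E"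
proof -
  interpret prob_space M by (rule bm_prob_space[OF bm])
  obtain E where E: "\<And>m. L2_norm lborel (\<kappa> m) \<le> E" using farima_kernel_bounded[where \<delta>=\<delta> and J=J, OF bm \<delta>] by blast
  let ?K = "wiener_const TYPE('d)"
  have "(LINT \<omega>|M. \<bar>farima_version m \<omega>\<bar>) \<le> ?K * E" for m
  proof -
    have aL: "(\<lambda>\<omega>. \<bar>farima_version m \<omega>\<bar>) \<in> L2 M" using farima_version_L2[of m] by (auto simp: L2_def)
    have "(LINT \<omega>|M. \<bar>farima_version m \<omega>\<bar>) \<le> L2_norm M (\<lambda>\<omega>. \<bar>farima_version m \<omega>\<bar>)"
      by (rule expectation_le_L2_norm[OF aL])
    also have "\<dots> = L2_norm M (farima_version m)" by (simp add: L2_norm_def)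
    also have "\<dots> \<le> ?K * L2_norm lborel (\<kappa> m)" by (rule is_wiener_integral_norm_le[OF bm farima_version(1)])
    also have "\<dots> \<le> ?K * E" using E wiener_const_pos[OF bm, where 'd='d] by (intro mult_left_mono) auto
    finally show ?thesis .
  qed
  moreover have "0 \<le> ?K * E"
    using E[of 0] wiener_const_pos[OF bm, where 'd='d] L2_norm_nonneg[of lborel "\<kappa> 0"] by (intro mult_nonneg_nonneg) linarith+
  ultimately show ?thesis by blast
qed

text \<open>
  The kernels of the FARIMA variables have bounded norms, so these variables have bounded first absolute moments. The
  weighted sum then has finite expectation. A single null set serves all times, which the uniform statement
  requires.
\<close>

lemma weighted_summable_AE: "AE \<omega> in M. (\<lambda>m. decay_weight m * \<bar>\<sigma> m \<omega>\<bar>) summable_on UNIV"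
proof -
  define u where "u n \<omega> = (\<Sum>m\<in>int_box n. decay_weight m * \<bar>farima_version m \<omega>\<bar>)" for n \<omega>
  have w0: "0 \<le> decay_weight m" for m :: "int^'d" by (rule less_imp_le[OF decay_weight_pos])
  obtain E where E: "0 \<le> E" "\<And>m. (LINT \<omega>|M. \<bar>farima_version m \<omega>\<bar>) \<le> E" using farima_version_mean_bounded by blast
  have um: "u n \<in> borel_measurable M" for n
    unfolding u_def[abs_def] using L2_measurable[OF farima_version_L2] by measurable
  have ui: "integrable M (u n)" for n
    unfolding u_def[abs_def] by (intro Bochner_Integration.integrable_sum integrable_mult_right farima_version_abs_integrable)
  have u0: "0 \<le> u n \<omega>" for n \<omega> unfolding u_def by (intro sum_nonneg mult_nonneg_nonneg w0) auto
  have uE: "(LINT \<omega>|M. u n \<omega>) \<le> infsum decay_weight (UNIV :: (int^'d) set) * E" for n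
  proof -
    have "(LINT \<omega>|M. u n \<omega>) = (\<Sum>m\<in>int_box n. decay_weight m * (LINT \<omega>|M. \<bar>farima_version m \<omega>\<bar>))"
      unfolding u_def by (simp add: farima_version_abs_integrable)
    also have "\<dots> \<le> (\<Sum>m\<in>(int_box n :: (int^'d) set). decay_weight m * E)"
      by (intro sum_mono mult_left_mono E w0)
    also have "\<dots> = (\<Sum>m\<in>(int_box n :: (int^'d) set). decay_weight m) * E" by (simp add: sum_distrib_right)
    also have "\<dots> \<le> infsum decay_weight (UNIV :: (int^'d) set) * E"
      by (intro mult_right_mono finite_sum_le_infsum decay_weight_summable E(1)) (auto simp: w0)
    finally show ?thesis .
  qed
  have inc: "incseq (\<lambda>n \<omega>. ennreal (u n \<omega>))"
    unfolding incseq_def le_fun_def u_def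
    by (intro allI impI ennreal_leI sum_mono2 int_box_mono) (auto simp: w0)
  have "(\<integral>\<^sup>+\<omega>. (SUP n. ennreal (u n \<omega>)) \<partial>M) = (SUP n. \<integral>\<^sup>+\<omega>. ennreal (u n \<omega>) \<partial>M)"
    by (rule nn_integral_monotone_convergence_SUP[OF inc]) (use um in auto)
  also have "\<dots> \<le> ennreal (infsum decay_weight (UNIV :: (int^'d) set) * E)"
    using ui u0 uE by (intro SUP_least) (simp add: nn_integral_eq_integral ennreal_leI)
  also have "\<dots> < \<infinity>" by simp
  finally have "(\<integral>\<^sup>+\<omega>. (SUP n. ennreal (u n \<omega>)) \<partial>M) \<noteq> \<infinity>" by simp
  then have "AE \<omega> in M. (SUP n. ennreal (u n \<omega>)) \<noteq> \<infinity>"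
    by (intro nn_integral_noteq_infinite borel_measurable_SUP) (use um in auto)
  moreover have "AE \<omega> in M. \<forall>m. farima_version m \<omega> = \<sigma> m \<omega>"
    unfolding AE_all_countable using farima_version(2) by blast
  ultimately show ?thesis
  proof eventually_elim
    case (elim \<omega>)
    then obtain r where r: "0 \<le> r" "(SUP n. ennreal (u n \<omega>)) = ennreal r" by (cases "SUP n. ennreal (u n \<omega>)") auto
    show ?case
    proof (rule nonneg_bdd_above_summable_on)
      show "bdd_above (sum (\<lambda>m. decay_weight m * \<bar>\<sigma> m \<omega>\<bar>) ` {F. F \<subseteq> UNIV \<and> finite F})"
      proof (rule bdd_aboveI2)
        fix F :: "(int^'d) set" assume "F \<in> {F. F \<subseteq> UNIV \<and> finite F}"
        then have "finite F" by simp
        then obtain n where n: "F \<subseteq> int_box n" using finite_subset_int_box by blast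
        have "(\<Sum>m\<in>F. decay_weight m * \<bar>\<sigma> m \<omega>\<bar>) \<le> (\<Sum>m\<in>int_box n. decay_weight m * \<bar>\<sigma> m \<omega>\<bar>)"
          by (rule sum_mono2[OF _ n]) (auto simp: w0)
        also have "\<dots> = u n \<omega>" using elim(2) by (simp add: u_def)
        also have "\<dots> \<le> r"
        proof -
          have "ennreal (u n \<omega>) \<le> ennreal r" unfolding r(2)[symmetric] by (rule SUP_upper) simp
          then show ?thesis using r(1) by (simp add: ennreal_le_iff)
        qed
        finally show "(\<Sum>m\<in>F. decay_weight m * \<bar>\<sigma> m \<omega>\<bar>) \<le> r" .
      qed
    qed (auto simp: w0)
  qed
qed

text \<open>
  The finite expansions in the kernels \<open>\<kappa> m\<close> converge in \<open>L\<^sup>2\<close> since these have bounded norms and summable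
  coefficients. The limit lies in \<open>Vd\<close> and has the same coefficients in the orthonormal basis as the
  Hermite kernel, so it is the projection.
\<close>

lemma kernel_expansion:
  assumes t: "0 \<le> t"
  shows "\<exists>g\<in>L2 lborel. (\<lambda>n. L2_dist lborel (\<lambda>x. \<Sum>m\<in>int_box n. (level_scale * \<tau> t m) * \<kappa> m x) g) \<longlonglongrightarrow> 0 \<and>
    (AE x in lborel. L2_projection lborel (Vd \<phi> (int J)) (hermite_kernel h t) x = g x) \<and>
    L2_projection lborel (Vd \<phi> (int J)) (hermite_kernel h t) \<in> L2 lborel"
proof -
  define P where "P n x = (\<Sum>m\<in>int_box n. (level_scale * \<tau> t m) * \<kappa> m x)" for n x
  obtain C where C: "0 \<le> C" "\<And>m. \<bar>\<tau> t m\<bar> \<le> C * decay_weight m" using time_coeff_bound[where \<delta>=\<delta> and J=J, OF \<delta>, of t] t by blast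
  obtain E where E: "\<And>m. L2_norm lborel (\<kappa> m) \<le> E" using farima_kernel_bounded[where \<delta>=\<delta> and J=J, OF bm \<delta>] by blast
  have w0: "0 \<le> decay_weight m" for m :: "int^'d" by (rule less_imp_le[OF decay_weight_pos])
  have PL: "P n \<in> L2 lborel" for n unfolding P_def[abs_def] by (intro L2_lincomb \<kappa>_L2)
  have scl0: "0 < level_scale" by (simp add: level_scale_def)
  define W where "W n = (\<Sum>m\<in>(int_box n :: (int^'d) set). decay_weight m)" for n
  define q where "q = level_scale * C * max E 0"
  have q0: "0 \<le> q" using scl0 C(1) by (simp add: q_def)
  have Pdiff: "L2_dist lborel (P n) (P n') \<le> q * (W n - W n')" if "n' \<le> n" for n n'
  proof -
    have "P n x - P n' x = (\<Sum>m\<in>int_box n - int_box n'. (level_scale * \<tau> t m) * \<kappa> m x)" for x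
      unfolding P_def by (simp add: sum_diff int_box_mono[OF that])
    then have "L2_dist lborel (P n) (P n') = L2_norm lborel (\<lambda>x. \<Sum>m\<in>int_box n - int_box n'. (level_scale * \<tau> t m) * \<kappa> m x)"
      by (simp add: L2_dist_norm)
    also have "\<dots> \<le> (\<Sum>m\<in>int_box n - int_box n'. L2_norm lborel (\<lambda>x. (level_scale * \<tau> t m) * \<kappa> m x))"
      by (intro L2_norm_sum_le L2_scale \<kappa>_L2)
    also have "\<dots> \<le> (\<Sum>m\<in>(int_box n - int_box n' :: (int^'d) set). q * decay_weight m)"
    proof (rule sum_mono)
      fix m
      have "\<bar>\<tau> t m\<bar> * L2_norm lborel (\<kappa> m) \<le> (C * decay_weight m) * max E 0"
        using C(2)[of m] E[of m] C(1) w0[of m] by (intro mult_mono) auto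
      from mult_left_mono[OF this, of level_scale] scl0
      show "L2_norm lborel (\<lambda>x. (level_scale * \<tau> t m) * \<kappa> m x) \<le> q * decay_weight m"
        unfolding L2_norm_scale by (simp add: q_def abs_mult mult_ac)
    qed
    also have "\<dots> = q * (W n - W n')"
      unfolding W_def sum_distrib_left[symmetric] by (simp add: sum_diff int_box_mono[OF that])
    finally show ?thesis .
  qed
  have "W \<longlonglongrightarrow> infsum decay_weight (UNIV :: (int^'d) set)"
    unfolding W_def by (rule exhaustion_tendsto[OF decay_weight_summable]) (auto simp: mem_int_box intro: subsetD[OF int_box_mono])
  then have WC: "Cauchy W" by (rule LIMSEQ_imp_Cauchy)
  have "\<exists>g\<in>L2 lborel. (\<lambda>n. L2_dist lborel (P n) g) \<longlonglongrightarrow> 0"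
  proof (rule L2_complete[OF PL])
    fix e :: real assume e: "e > 0"
    have q1: "0 < q + 1" using q0 by simp
    then obtain N where N: "\<And>i j. i \<ge> N \<Longrightarrow> j \<ge> N \<Longrightarrow> \<bar>W i - W j\<bar> < e / (q + 1)"
      using WC e unfolding Cauchy_def dist_real_def by (meson divide_pos_pos)
    have le: "L2_dist lborel (P i) (P j) \<le> e" if "i \<ge> N" "j \<ge> N" "j \<le> i" for i j
    proof -
      have "q * (W i - W j) \<le> q * (e / (q + 1))" using N[OF that(1,2)] q0 by (intro mult_left_mono) auto
      also have "\<dots> \<le> (q + 1) * (e / (q + 1))" using e q1 by (intro mult_right_mono) auto
      also have "\<dots> = e" using q1 by simp
      finally show ?thesis using Pdiff[OF that(3)] by linarith
    qed
    have "L2_dist lborel (P i) (P j) \<le> e" if "i \<ge> N" "j \<ge> N" for i j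
      using le[of i j] le[of j i] that L2_dist_commute[of lborel "P i" "P j"] by (cases "j \<le> i") auto
    then show "\<exists>K. \<forall>i\<ge>K. \<forall>j\<ge>K. L2_dist lborel (P i) (P j) \<le> e" by blast
  qed
  then obtain g where g: "g \<in> L2 lborel" "(\<lambda>n. L2_dist lborel (P n) g) \<longlonglongrightarrow> 0" by blast
  have PV: "P n \<in> L2_closed_span lborel (Vd_gen J)" for n
  proof (rule closed_span_limit[OF Vd_gen_L2 _ PL])
    define Q where "Q N x = (\<Sum>m\<in>int_box n. (level_scale * \<tau> t m) * partial_kernel \<delta> J m N x)" for N x
    show "Q N \<in> L2_closed_span lborel (Vd_gen J)" for N
    proof -
      have "Q N = (\<lambda>x. \<Sum>i\<in>int_box n \<times> nat_box N. (level_scale * \<tau> t (fst i) * farima_weight \<delta> (snd i)) * basis_fn J (shift_index (fst i) (snd i)) x)"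
      proof
        fix x
        have "Q N x = (\<Sum>m\<in>int_box n. \<Sum>p\<in>nat_box N. (level_scale * \<tau> t m * farima_weight \<delta> p) * basis_fn J (shift_index m p) x)"
          unfolding Q_def partial_kernel_def[where \<delta>=\<delta> and J=J, OF bm \<delta>] sum_distrib_left by (simp only: mult.assoc)
        then show "Q N x = (\<Sum>i\<in>int_box n \<times> nat_box N. (level_scale * \<tau> t (fst i) * farima_weight \<delta> (snd i)) * basis_fn J (shift_index (fst i) (snd i)) x)"
          by (simp only: sum.cartesian_product split_beta')
      qed
      also have "\<dots> \<in> fun_span (Vd_gen J)"
        by (intro fun_span_lincomb basis_fn_Vd_gen) auto
      finally show ?thesis using fun_span_closed_span[OF Vd_gen_L2] by blast
    qed
    have le: "L2_dist lborel (Q N) (P n) \<le> (\<Sum>m\<in>int_box n. \<bar>level_scale * \<tau> t m\<bar> * L2_dist lborel (partial_kernel \<delta> J m N) (\<kappa> m))" for N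
    proof -
      have "Q N x - P n x = (\<Sum>m\<in>int_box n. (level_scale * \<tau> t m) * (partial_kernel \<delta> J m N x - \<kappa> m x))" for x
        by (simp add: Q_def P_def right_diff_distrib sum_subtractf)
      then have "L2_dist lborel (Q N) (P n) = L2_norm lborel (\<lambda>x. \<Sum>m\<in>int_box n. (level_scale * \<tau> t m) * (partial_kernel \<delta> J m N x - \<kappa> m x))"
        by (simp add: L2_dist_norm)
      also have "\<dots> \<le> (\<Sum>m\<in>int_box n. L2_norm lborel (\<lambda>x. (level_scale * \<tau> t m) * (partial_kernel \<delta> J m N x - \<kappa> m x)))"
        by (intro L2_norm_sum_le L2_scale L2_diff \<kappa>_L2 partial_kernel_L2[where \<delta>=\<delta> and J=J, OF bm \<delta>])
      finally show ?thesis by (simp add: L2_norm_scale L2_dist_norm)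
    qed
    have "(\<lambda>N. \<Sum>m\<in>int_box n. \<bar>level_scale * \<tau> t m\<bar> * L2_dist lborel (partial_kernel \<delta> J m N) (\<kappa> m)) \<longlonglongrightarrow> (\<Sum>m\<in>int_box n. \<bar>level_scale * \<tau> t m\<bar> * 0)"
      by (intro tendsto_sum tendsto_mult tendsto_const farima_kernel(2)[where \<delta>=\<delta> and J=J, OF bm \<delta>])
    then have tz: "(\<lambda>N. \<Sum>m\<in>int_box n. \<bar>level_scale * \<tau> t m\<bar> * L2_dist lborel (partial_kernel \<delta> J m N) (\<kappa> m)) \<longlonglongrightarrow> 0" by simp
    show "(\<lambda>N. L2_dist lborel (Q N) (P n)) \<longlonglongrightarrow> 0"
      by (rule Lim_null_comparison[OF _ tz]) (simp add: le)
  qed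
  have gV: "g \<in> L2_closed_span lborel (Vd_gen J)" by (rule closed_span_limit[OF Vd_gen_L2 PV g])
  have KL: "hermite_kernel h t \<in> L2 lborel" by (rule hermite_kernel_L2[where \<delta>=\<delta>, OF h \<delta> sum_\<delta>])
  have coeff: "L2_inner lborel (\<lambda>x. hermite_kernel h t x - g x) (basis_fn J k) = 0" for k
  proof -
    have Pk: "L2_inner lborel (P n) (basis_fn J k) = level_scale * (\<Sum>m\<in>int_box n. farima_weight_at \<delta> (m - k) * \<tau> t m)" for n
      unfolding P_def[abs_def]
      by (subst L2_inner_sum_left[OF \<kappa>_L2 basis_fn_L2]) (simp_all add: farima_kernel_coeff[where \<delta>=\<delta> and J=J, OF bm \<delta>] sum_distrib_left mult_ac)
    have "(\<lambda>n. \<Sum>m\<in>int_box n. farima_weight_at \<delta> (m - k) * \<tau> t m) \<longlonglongrightarrow> (\<Sum>\<^sub>\<infinity>m. farima_weight_at \<delta> (m - k) * \<tau> t m)"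
      by (rule exhaustion_tendsto[OF coeff_series_summable[where \<delta>=\<delta> and J=J, OF \<delta> t]]) (auto simp: mem_int_box intro: subsetD[OF int_box_mono])
    then have "(\<lambda>n. L2_inner lborel (P n) (basis_fn J k)) \<longlonglongrightarrow> level_scale * (\<Sum>\<^sub>\<infinity>m. farima_weight_at \<delta> (m - k) * \<tau> t m)"
      unfolding Pk by (rule tendsto_mult_left)
    moreover have "(\<lambda>n. L2_inner lborel (P n) (basis_fn J k)) \<longlonglongrightarrow> L2_inner lborel g (basis_fn J k)"
      by (rule L2_inner_tendsto[OF PL g(1) basis_fn_L2 g(2)])
    ultimately have "L2_inner lborel g (basis_fn J k) = level_scale * (\<Sum>\<^sub>\<infinity>m. farima_weight_at \<delta> (m - k) * \<tau> t m)"
      using LIMSEQ_unique by blast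
    then show ?thesis
      using hermite_kernel_coeff[where \<delta>=\<delta>, OF \<delta> h t, of J k] by (simp add: L2_inner_diff_left[OF KL g(1) basis_fn_L2] level_scale_def)
  qed
  have orth: "L2_inner lborel (\<lambda>x. hermite_kernel h t x - g x) v = 0" if "v \<in> L2_closed_span lborel (Vd_gen J)" for v
    by (rule orthogonal_Vd[OF L2_diff[OF KL g(1)] coeff]) (use that in \<open>simp add: Vd_gen\<close>)
  have "AE x in lborel. L2_projection lborel (Vd \<phi> (int J)) (hermite_kernel h t) x = g x"
     "L2_projection lborel (Vd \<phi> (int J)) (hermite_kernel h t) \<in> L2 lborel"
    using L2_projection_unique[OF Vd_gen_L2 KL gV orth] by (simp_all add: Vd_gen)
  then show ?thesis using g unfolding P_def[abs_def] by blast
qed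

text \<open>
  Continuity of the Wiener integral carries the expansion of the projected kernel over to random variables; the
  pointwise sum of the series, which converges absolutely almost surely, must be the same limit.
\<close>

lemma approx_process_series:
  assumes t: "0 \<le> t"
  shows "AE \<omega> in M. hermite_approx_process M B \<phi> h J t \<omega> = level_scale * (\<Sum>\<^sub>\<infinity>m. \<sigma> m \<omega> * \<tau> t m)"
proof -
  obtain g where g: "g \<in> L2 lborel" "(\<lambda>n. L2_dist lborel (\<lambda>x. \<Sum>m\<in>int_box n. (level_scale * \<tau> t m) * \<kappa> m x) g) \<longlonglongrightarrow> 0"
    and pr: "AE x in lborel. L2_projection lborel (Vd \<phi> (int J)) (hermite_kernel h t) x = g x"
      "L2_projection lborel (Vd \<phi> (int J)) (hermite_kernel h t) \<in> L2 lborel"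
    using kernel_expansion[OF t] by blast
  obtain C where C: "0 \<le> C" "\<And>m. \<bar>\<tau> t m\<bar> \<le> C * decay_weight m" using time_coeff_bound[where \<delta>=\<delta> and J=J, OF \<delta>, of t] t by blast
  have w: "is_wiener_integral M B (\<lambda>x. \<Sum>m\<in>int_box n. (level_scale * \<tau> t m) * \<kappa> m x) (\<lambda>\<omega>. \<Sum>m\<in>int_box n. (level_scale * \<tau> t m) * farima_version m \<omega>)" for n
    by (intro is_wiener_integral_sum[OF bm] farima_version(1))
  obtain X where X: "is_wiener_integral M B g X" "(\<lambda>n. L2_dist M (\<lambda>\<omega>. \<Sum>m\<in>int_box n. (level_scale * \<tau> t m) * farima_version m \<omega>) X) \<longlonglongrightarrow> 0"
    using is_wiener_integral_limit[OF bm w g] by blast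
  have "AE x in lborel. g x = L2_projection lborel (Vd \<phi> (int J)) (hermite_kernel h t) x" using pr(1) by eventually_elim simp
  from is_wiener_integral_cong_fn[OF X(1) this pr(2)]
  have wp: "is_wiener_integral M B (L2_projection lborel (Vd \<phi> (int J)) (hermite_kernel h t)) (hermite_approx_process M B \<phi> h J t)"
    unfolding hermite_approx_process_def by (intro is_wiener_integral_some[OF bm] exI)
  have 1: "AE \<omega> in M. hermite_approx_process M B \<phi> h J t \<omega> = X \<omega>"
    by (rule is_wiener_integral_unique[OF bm wp X(1) pr(1)])
  have eqm: "AE \<omega> in M. \<forall>m. farima_version m \<omega> = \<sigma> m \<omega>" unfolding AE_all_countable using farima_version(2) by blast
  have lim: "AE \<omega> in M. (\<lambda>n. \<Sum>m\<in>int_box n. (level_scale * \<tau> t m) * farima_version m \<omega>) \<longlonglongrightarrow> level_scale * (\<Sum>\<^sub>\<infinity>m. \<sigma> m \<omega> * \<tau> t m)"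
    using weighted_summable_AE eqm
  proof eventually_elim
    case (elim \<omega>)
    have "(\<lambda>m. C * (decay_weight m * \<bar>\<sigma> m \<omega>\<bar>)) summable_on UNIV" by (rule summable_on_cmult_right[OF elim(1)])
    then have "(\<lambda>m. norm (\<sigma> m \<omega> * \<tau> t m)) summable_on UNIV"
    proof (rule Infinite_Sum.abs_summable_on_comparison_test')
      fix m
      show "norm (\<sigma> m \<omega> * \<tau> t m) \<le> C * (decay_weight m * \<bar>\<sigma> m \<omega>\<bar>)"
        using mult_left_mono[OF C(2)[of m], of "\<bar>\<sigma> m \<omega>\<bar>"] by (simp add: abs_mult mult_ac)
    qed
    then have s: "(\<lambda>m. \<sigma> m \<omega> * \<tau> t m) summable_on UNIV" by (rule Infinite_Sum.abs_summable_summable)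
    have "(\<lambda>n. \<Sum>m\<in>int_box n. \<sigma> m \<omega> * \<tau> t m) \<longlonglongrightarrow> (\<Sum>\<^sub>\<infinity>m. \<sigma> m \<omega> * \<tau> t m)"
      by (rule exhaustion_tendsto[OF s]) (auto simp: mem_int_box intro: subsetD[OF int_box_mono])
    then have "(\<lambda>n. level_scale * (\<Sum>m\<in>int_box n. \<sigma> m \<omega> * \<tau> t m)) \<longlonglongrightarrow> level_scale * (\<Sum>\<^sub>\<infinity>m. \<sigma> m \<omega> * \<tau> t m)" by (rule tendsto_mult_left)
    then show ?case using elim(2) by (simp add: sum_distrib_left mult_ac)
  qed
  have "AE \<omega> in M. X \<omega> = level_scale * (\<Sum>\<^sub>\<infinity>m. \<sigma> m \<omega> * \<tau> t m)"
  proof (rule L2_limit_AE_eq[OF _ _ X(2) lim])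
    show "(\<lambda>\<omega>. \<Sum>m\<in>int_box n. (level_scale * \<tau> t m) * farima_version m \<omega>) \<in> L2 M" for n by (intro L2_lincomb farima_version_L2)
    show "X \<in> L2 M" using X(1) by (rule is_wiener_integral_L2[OF bm])
  qed
  with 1 show ?thesis by eventually_elim simp
qed

lemma complex_time_coeff:
  "(CLINT u:{0..t}|lborel. \<Prod>l\<in>UNIV. frac_scaling \<phi> (h $ l - 1/2) (2 ^ J * u - of_int (k $ l))) = of_real (\<tau> t k)"
proof -
  have "indicator {0..t} u *\<^sub>R (\<Prod>l\<in>UNIV. frac_scaling \<phi> (h $ l - 1/2) (2 ^ J * u - of_int (k $ l))) =
     complex_of_real (indicator {0..t} u *\<^sub>R (\<Prod>l\<in>UNIV. frac_scaling_Re (\<delta> l) (2 ^ J * u - of_int (k $ l))))" for u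
    unfolding h by (simp add: frac_scaling_of_real scaleR_conv_of_real)
  then show ?thesis
    unfolding set_lebesgue_integral_def time_coeff_def[where \<delta>=\<delta>, OF \<delta>] by (simp only: integral_complex_of_real)
qed

text \<open>
  Weierstrass M-test on the almost sure event where the weighted sum is finite.
\<close>

lemma series_uniform:
  "AE \<omega> in M. \<forall>a b. 0 \<le> a \<and> a \<le> b \<longrightarrow>
     uniform_limit {a..b} (\<lambda>F t. \<Sum>k\<in>F. complex_of_real (\<sigma> k \<omega>) * of_real (\<tau> t k))
       (\<lambda>t. \<Sum>\<^sub>\<infinity>k. complex_of_real (\<sigma> k \<omega>) * of_real (\<tau> t k)) (finite_subsets_at_top UNIV)"
  using weighted_summable_AE
proof eventually_elim
  case (elim \<omega>)
  show ?case
  proof (intro allI impI)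
    fix a b :: real assume ab: "0 \<le> a \<and> a \<le> b"
    obtain C where C: "0 \<le> C" "\<And>t m. 0 \<le> t \<Longrightarrow> t \<le> b \<Longrightarrow> \<bar>\<tau> t m\<bar> \<le> C * decay_weight m"
      using time_coeff_bound[where \<delta>=\<delta> and J=J, OF \<delta>, of b] by blast
    show "uniform_limit {a..b} (\<lambda>F t. \<Sum>k\<in>F. complex_of_real (\<sigma> k \<omega>) * of_real (\<tau> t k))
       (\<lambda>t. \<Sum>\<^sub>\<infinity>k. complex_of_real (\<sigma> k \<omega>) * of_real (\<tau> t k)) (finite_subsets_at_top UNIV)"
    proof (rule Weierstrass_m_test_general)
      show "(\<lambda>m. C * (decay_weight m * \<bar>\<sigma> m \<omega>\<bar>)) summable_on UNIV" by (rule summable_on_cmult_right[OF elim])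
      fix m :: "int^'d" and t assume "t \<in> {a..b}"
      then have "\<bar>\<tau> t m\<bar> \<le> C * decay_weight m" using ab by (intro C(2)) auto
      from mult_left_mono[OF this, of "\<bar>\<sigma> m \<omega>\<bar>"]
      show "norm (complex_of_real (\<sigma> m \<omega>) * of_real (\<tau> t m)) \<le> C * (decay_weight m * \<bar>\<sigma> m \<omega>\<bar>)"
        by (simp add: norm_mult mult_ac)
    qed
  qed
qed

end

end

theorem theorem2p8:
  fixes M :: "'w measure" and B :: "real \<Rightarrow> 'w \<Rightarrow> real"
    and \<phi> \<psi> :: "real \<Rightarrow> real"
    and h :: "real ^ 'd" and J :: nat
  assumes "standard_brownian_motion M B"
    and "meyer_wavelet \<phi> \<psi>"
    and "\<forall>l. 1/2 < h $ l \<and> h $ l < 1"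
    and "(\<Sum>l\<in>UNIV. h $ l) > real CARD('d) - 1/2"
    and "J \<ge> 1"
  shows "(\<forall>t\<ge>0. AE \<omega> in M.
            complex_of_real (hermite_approx_process M B \<phi> h J t \<omega>) =
              of_real (2 powr (- (real J * ((\<Sum>l\<in>UNIV. h $ l) - real CARD('d))))) *
              (\<Sum>\<^sub>\<infinity>k::int ^ 'd. of_real (farima M B \<phi> h J k \<omega>) *
                 (CLINT u:{0..t}|lborel.
                    \<Prod>l\<in>UNIV. frac_scaling \<phi> (h $ l - 1/2) (2 ^ J * u - of_int (k $ l))))) \<and>
         (AE \<omega> in M. \<forall>a b. 0 \<le> a \<and> a \<le> b \<longrightarrow>
            uniform_limit {a..b}
              (\<lambda>F t. \<Sum>k\<in>F. of_real (farima M B \<phi> h J k \<omega>) *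
                 (CLINT u:{0..t}|lborel.
                    \<Prod>l\<in>UNIV. frac_scaling \<phi> (h $ l - 1/2) (2 ^ J * u - of_int (k $ l))))
              (\<lambda>t. \<Sum>\<^sub>\<infinity>k::int ^ 'd. of_real (farima M B \<phi> h J k \<omega>) *
                 (CLINT u:{0..t}|lborel.
                    \<Prod>l\<in>UNIV. frac_scaling \<phi> (h $ l - 1/2) (2 ^ J * u - of_int (k $ l))))
              (finite_subsets_at_top UNIV))"
proof -
  have mw: "schwartz \<phi>"
    "closure {\<xi>. fourier (\<lambda>x. of_real (\<phi> x)) \<xi> \<noteq> 0} \<subseteq> {- (4 * pi / 3) .. 4 * pi / 3}"
    "L2_orthonormal_basis lborel (\<lambda>(k::int) x. \<phi> (x - of_int k)) (V1 \<phi> 0)"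
    using assms(2) by (simp_all add: meyer_wavelet_def)
  interpret meyer_scaling \<phi>
  proof
    show "schwartz \<phi>" by (rule mw)
    show "fourier (\<lambda>x. of_real (\<phi> x)) \<xi> = 0" if "\<xi> \<notin> {- (4 * pi / 3) .. 4 * pi / 3}" for \<xi>
      using that mw(2) closure_subset[of "{\<xi>. fourier (\<lambda>x. of_real (\<phi> x)) \<xi> \<noteq> 0}"] by blast
    show "L2_inner lborel (\<lambda>x. \<phi> (x - of_int i)) (\<lambda>x. \<phi> (x - of_int j)) = (if i = j then 1 else 0)" for i j :: int
      using mw(3) by (simp add: L2_orthonormal_basis_def)
  qed
  define \<delta> where "\<delta> l = h $ l - 1/2" for l
  have \<delta>: "\<And>l. 0 < \<delta> l" "\<And>l. \<delta> l < 1/2" and h: "\<And>l. h $ l - 1/2 = \<delta> l"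
    using assms(3) by (auto simp: \<delta>_def)
  have "(\<Sum>l\<in>UNIV. 2 * \<delta> l - 1) = 2 * (\<Sum>l\<in>UNIV. h $ l) - 2 * real CARD('d)"
    by (simp add: \<delta>_def sum_subtractf sum_distrib_left[symmetric])
  then have s: "(\<Sum>l\<in>UNIV. 2 * \<delta> l - 1) > - 1" using assms(4) by linarith
  note ctx = assms(1) \<delta> h s
  show ?thesis
    unfolding complex_time_coeff[OF ctx]
  proof (intro conjI allI impI)
    fix t :: real assume "0 \<le> t"
    from approx_process_series[OF ctx this, of J]
    show "AE \<omega> in M. complex_of_real (hermite_approx_process M B \<phi> h J t \<omega>) =
        of_real (2 powr (- (real J * ((\<Sum>l\<in>UNIV. h $ l) - real CARD('d))))) *
        (\<Sum>\<^sub>\<infinity>k. of_real (farima M B \<phi> h J k \<omega>) * of_real (time_coeff \<delta> J t k))"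
    proof eventually_elim
      case (elim \<omega>)
      have "(\<Sum>\<^sub>\<infinity>k. complex_of_real (farima M B \<phi> h J k \<omega>) * of_real (time_coeff \<delta> J t k)) =
          of_real (\<Sum>\<^sub>\<infinity>k. farima M B \<phi> h J k \<omega> * time_coeff \<delta> J t k)"
        unfolding of_real_mult[symmetric]
        by (intro infsum_bounded_linear_strong bounded_linear_of_real
              summable_on_bounded_linear_iff[OF bounded_linear_of_real bounded_linear_Re Re_complex_of_real])
      then show ?case unfolding elim level_scale_def[OF ctx] by simp
    qed
  qed (rule series_uniform[OF ctx])
qed

end
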